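(* Let $0\le\beta\le\alpha\le1$ with $\beta<1$, and let $(\chi,(\psi_i)_{i\in I_\ast})$ be a wave-packet scattering bank subordinate to the covering $\mathcal Q^{(\alpha,\beta)}$ which satisfies the multiplier regularity conditions (C1) and (C2). For every $\kappa\in(0,1)$ there exists $C>0$ such that, whenever $\tau\in W^{1,\infty}(\mathbb R^2;\mathbb R^2)$ satisfies $\|D\tau\|_{L^\infty}\le\kappa$, one has for every $f\in H^{1-\beta}(\mathbb R^2)$ $$\|\mathsf S_\chi(L_\tau f)-\mathsf S_\chi f\|_{\ell^2(L^2)}\le C\bigl(\|\tau\|_{L^\infty}+\|D\tau\|_{L^\infty}\bigr)\,\mathfrak E_{1-\beta}(f).$$
   Context: Notation: $\mathbb N=\{1,2,\dots\}$, $\mathbb N_0=\{0,1,2,\dots\}$; $\widehat f(\xi)=\int_{\mathbb R^2}e^{-2\pi \mathrm i x\cdot\xi}f(x)\,dx$; $\|f\|_{H^s}=\|(1+|\xi|^2)^{s/2}\widehat f\|_{L^2}$; $B_r(x_0)$ is the open ball. $L_\tau f(x)=f(x-\tau(x))$, and $\|D\tau\|_{L^\infty}$ is the essential supremum of the operator norm of $D\tau(x)$. For a countable family $q=(q_p)_p$, $\|q\|_{\ell^2(L^2)}=(\sum_p\|q_p\|_{L^2}^2)^{1/2}$ and $\|q\|_{\ell^2(H^s)}=(\sum_p\|q_p\|_{H^s}^2)^{1/2}$. Covering. Fix $0\le\beta\le\alpha\le1$ and $\varepsilon_0\in(0,1/32)$. Let $Q=(-\varepsilon_0,1+\varepsilon_0)\times(-1-\varepsilon_0,1+\varepsilon_0)$.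 For $j\in\mathbb N$ let $m_j^{\max}=\lceil 2^{(1-\alpha)j-1}\rceil$, $\ell_j^{\max}=\lceil 10\cdot2^{(1-\beta)j}\rceil$, $A_j=\mathrm{diag}(2^{\alpha j},2^{\beta j})$, $c_{j,m}=(2^{j-1}+m2^{\alpha j},0)^\top$, and let $R_{j,\ell}$ be the rotation matrix by the angle $\theta_{j,\ell}=2\ell\cdot\frac{\pi}{10}2^{(\beta-1)j}$. Put $I_\ast=\{(j,m,\ell)\in\mathbb N\times\mathbb N_0\times\mathbb N_0: m\le m_j^{\max},\ \ell\le\ell_j^{\max}\}$, $I_{\ast,j}$ = the set of elements of $I_\ast$ with first entry $j$, $I=\{0\}\cup I_\ast$, $Q_i=R_{j,\ell}(A_jQ+c_{j,m})$ for $i=(j,m,\ell)\in I_\ast$, and $Q_0=B_4(0)$. The covering is $\mathcal Q^{(\alpha,\beta)}=(Q_i)_{i\in I}$. Filter bank. A wave-packet scattering bank subordinate to $\mathcal Q^{(\alpha,\beta)}$ consists of $\chi\in L^1\cap L^2(\mathbb R^2)$ and $\psi_i\in L^1\cap L^2(\mathbb R^2)$, $i\in I_\ast$, with $m_i:=\widehat\psi_i$, such that $|\widehat\chi(\xi)|^2+\sum_{i\in I_\ast}|m_i(\xi)|^2=1$ for a.e. $\xi$, $\operatorname{supp}\widehat\chi\subset Q_0$ and $\operatorname{supp}m_i\subset Q_i$ for all $i\in I_\ast$. Scattering. $U[e]f=f$ for the empty path $e$, and for $p=(i_1,\dots,i_n)\in I_\ast^n$, $U[p]f=U[i_n]\cdots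 U[i_1]f$ with $U[i]g=|g*\psi_i|$. $U_nf=(U[p]f)_{p\in I_\ast^n}$ (with $I_\ast^0=\{e\}$), and $\mathsf S_\chi f=(U[p]f*\chi)_{p\in\bigcup_{n\ge0}I_\ast^n}$. For $0\le s\le1$, $\mathfrak E_s(f)=\sum_{n=0}^\infty\|U_nf\|_{\ell^2(H^s)}\in[0,\infty]$ (the estimate is regarded as trivially true when $\mathfrak E_{1-\beta}(f)=\infty$). Multiplier regularity (the $m_i$ being understood to have derivatives up to order $4$): there is $j_{\rm reg}\in\mathbb N$ such that (C1) all $m_i$ with $i\in\bigcup_{1\le j<j_{\rm reg}}I_{\ast,j}$ have compact support and bounded derivatives up to order $4$; (C2) for every multi-index $\nu$ with $1\le|\nu|\le4$, $\sup_{j\ge j_{\rm reg}}\sup_{\xi\in\mathbb R^2}2^{\beta j|\nu|}\bigl(\sum_{i\in I_{\ast,j}}|\partial^\nu m_i(\xi)|^2\bigr)^{1/2}<\infty$. *)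

theory Defs
  imports "HOL-Analysis.Analysis" "HOL-Probability.Essential_Supremum"
begin

text \<open>
  Elements of the Lebesgue spaces are represented by Borel functions on \<open>real^2\<close> with
  Lebesgue measure; norms take values in \<open>ennreal\<close>.
\<close>

section \<open>Norms\<close>

definition ennreal_sqrt :: "ennreal \<Rightarrow> ennreal" where
  "ennreal_sqrt x = (if x = \<infinity> then \<infinity> else ennreal (sqrt (enn2real x)))"

definition L2_norm :: "(real^2 \<Rightarrow> complex) \<Rightarrow> ennreal" where
  "L2_norm f = ennreal_sqrt (\<integral>\<^sup>+ x. ennreal ((cmod (f x))\<^sup>2) \<partial>lborel)"

definition in_L2 :: "(real^2 \<Rightarrow> complex) \<Rightarrow> bool" where
  "in_L2 f \<longleftrightarrow> f \<in> borel_measurable lborel \<and> L2_norm f < \<infinity>"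

definition fourier :: "(real^2 \<Rightarrow> complex) \<Rightarrow> real^2 \<Rightarrow> complex" where
  "fourier f \<xi> = (\<integral> x. cis (- (2 * pi * (x \<bullet> \<xi>))) * f x \<partial>lborel)"

text \<open>
  The Fourier transform on L2: the L2-limit (unique almost everywhere) of the integrals over
  growing balls.
\<close>

definition fourier_L2 :: "(real^2 \<Rightarrow> complex) \<Rightarrow> real^2 \<Rightarrow> complex" where
  "fourier_L2 f = (SOME g. in_L2 g \<and>
     (\<lambda>n::nat. L2_norm (\<lambda>\<xi>. g \<xi> - fourier (\<lambda>x. indicator (cball 0 (real n)) x * f x) \<xi>))
       \<longlonglongrightarrow> 0)"

definition H_norm :: "real \<Rightarrow> (real^2 \<Rightarrow> complex) \<Rightarrow> ennreal" where
  "H_norm s f = L2_norm (\<lambda>\<xi>. ((1 + (norm \<xi>)\<^sup>2) powr (s / 2)) *\<^sub>R fourier_L2 f \<xi>)"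

definition in_H :: "real \<Rightarrow> (real^2 \<Rightarrow> complex) \<Rightarrow> bool" where
  "in_H s f \<longleftrightarrow> in_L2 f \<and> H_norm s f < \<infinity>"

definition ell2_norm :: "('f \<Rightarrow> ennreal) \<Rightarrow> 'p set \<Rightarrow> ('p \<Rightarrow> 'f) \<Rightarrow> ennreal" where
  "ell2_norm N P q = ennreal_sqrt (\<Sum>\<^sub>\<infinity>p\<in>P. (N (q p))\<^sup>2)"

section \<open>Derivatives\<close>

definition partial_deriv ::
    "2 \<Rightarrow> (real^2 \<Rightarrow> 'b::real_normed_vector) \<Rightarrow> real^2 \<Rightarrow> 'b" where
  "partial_deriv k f x = frechet_derivative f (at x) (axis k 1)"

definition multi_deriv ::
    "nat \<times> nat \<Rightarrow> (real^2 \<Rightarrow> 'b::real_normed_vector) \<Rightarrow> real^2 \<Rightarrow> 'b" where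
  "multi_deriv \<nu> f = (partial_deriv 1 ^^ fst \<nu>) ((partial_deriv 2 ^^ snd \<nu>) f)"

text \<open>
  All iterated partial derivatives of order below \<open>n\<close> are Frechet differentiable everywhere, so
  that the partial derivatives of order \<open>n\<close> exist (they need not be continuous).
\<close>

definition times_differentiable :: "nat \<Rightarrow> (real^2 \<Rightarrow> 'b::real_normed_vector) \<Rightarrow> bool" where
  "times_differentiable n f \<longleftrightarrow>
     (\<forall>ks x. length ks < n \<longrightarrow> fold partial_deriv ks f differentiable (at x))"

definition test_function :: "(real^2 \<Rightarrow> real) \<Rightarrow> bool" where
  "test_function \<phi> \<longleftrightarrow> (\<forall>n. times_differentiable n \<phi>) \<and> compact (closure {x. \<phi> x \<noteq> 0})"

definition Linf_norm :: "(real^2 \<Rightarrow> real^2) \<Rightarrow> ennreal" where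
  "Linf_norm \<tau> = esssup lborel (\<lambda>x. ennreal (norm (\<tau> x)))"

definition Linf_opnorm :: "(real^2 \<Rightarrow> real^2^2) \<Rightarrow> ennreal" where
  "Linf_opnorm D = esssup lborel (\<lambda>x. ennreal (onorm ((*v) (D x))))"

text \<open>
  \<open>W1inf \<tau> D\<close>: the vector field \<open>\<tau>\<close> belongs to the Sobolev space of bounded functions with
  bounded first-order weak derivatives, and \<open>D\<close> (unique almost everywhere) is its weak
  Jacobian matrix.
\<close>

definition W1inf :: "(real^2 \<Rightarrow> real^2) \<Rightarrow> (real^2 \<Rightarrow> real^2^2) \<Rightarrow> bool" where
  "W1inf \<tau> D \<longleftrightarrow>
     \<tau> \<in> borel_measurable lborel \<and> Linf_norm \<tau> < \<infinity> \<and>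
     D \<in> borel_measurable lborel \<and> Linf_opnorm D < \<infinity> \<and>
     (\<forall>k l \<phi>. test_function \<phi> \<longrightarrow>
        (\<integral> x. \<tau> x $ k * partial_deriv l \<phi> x \<partial>lborel) = - (\<integral> x. D x $ k $ l * \<phi> x \<partial>lborel))"

section \<open>The covering\<close>

definition m_max :: "real \<Rightarrow> nat \<Rightarrow> nat" where
  "m_max \<alpha> j = nat \<lceil>2 powr ((1 - \<alpha>) * j - 1)\<rceil>"

definition l_max :: "real \<Rightarrow> nat \<Rightarrow> nat" where
  "l_max \<beta> j = nat \<lceil>10 * 2 powr ((1 - \<beta>) * j)\<rceil>"

definition I_star :: "real \<Rightarrow> real \<Rightarrow> (nat \<times> nat \<times> nat) set" where
  "I_star \<alpha> \<beta> = {(j, m, l). 1 \<le> j \<and> m \<le> m_max \<alpha> j \<and> l \<le> l_max \<beta> j}"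

definition I_level :: "real \<Rightarrow> real \<Rightarrow> nat \<Rightarrow> (nat \<times> nat \<times> nat) set" where
  "I_level \<alpha> \<beta> j = {i \<in> I_star \<alpha> \<beta>. fst i = j}"

definition Q_ref :: "real \<Rightarrow> (real^2) set" where
  "Q_ref \<epsilon> = {x. x $ 1 \<in> {- \<epsilon> <..< 1 + \<epsilon>} \<and> x $ 2 \<in> {- 1 - \<epsilon> <..< 1 + \<epsilon>}}"

definition A_mat :: "real \<Rightarrow> real \<Rightarrow> nat \<Rightarrow> real^2^2" where
  "A_mat \<alpha> \<beta> j = vector [vector [2 powr (\<alpha> * j), 0], vector [0, 2 powr (\<beta> * j)]]"

definition c_vec :: "real \<Rightarrow> nat \<Rightarrow> nat \<Rightarrow> real^2" where
  "c_vec \<alpha> j m = vector [2 powr (real j - 1) + m * 2 powr (\<alpha> * j), 0]"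

definition rotation :: "real \<Rightarrow> real^2^2" where
  "rotation \<theta> = vector [vector [cos \<theta>, - sin \<theta>], vector [sin \<theta>, cos \<theta>]]"

definition angle :: "real \<Rightarrow> nat \<Rightarrow> nat \<Rightarrow> real" where
  "angle \<beta> j l = 2 * l * (pi / 10) * 2 powr ((\<beta> - 1) * j)"

definition Q_zero :: "(real^2) set" where
  "Q_zero = ball 0 4"

fun Q_set :: "real \<Rightarrow> real \<Rightarrow> real \<Rightarrow> nat \<times> nat \<times> nat \<Rightarrow> (real^2) set" where
  "Q_set \<alpha> \<beta> \<epsilon> (j, m, l) =
     (\<lambda>x. rotation (angle \<beta> j l) *v (A_mat \<alpha> \<beta> j *v x + c_vec \<alpha> j m)) ` Q_ref \<epsilon>"

section \<open>Filter banks and scattering\<close>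

definition wave_packet_bank ::
    "real \<Rightarrow> real \<Rightarrow> real \<Rightarrow> (real^2 \<Rightarrow> complex) \<Rightarrow> (nat \<times> nat \<times> nat \<Rightarrow> real^2 \<Rightarrow> complex) \<Rightarrow> bool"
  where
  "wave_packet_bank \<alpha> \<beta> \<epsilon> chi \<psi> \<longleftrightarrow>
     integrable lborel chi \<and> in_L2 chi \<and>
     (\<forall>i\<in>I_star \<alpha> \<beta>. integrable lborel (\<psi> i) \<and> in_L2 (\<psi> i)) \<and>
     (AE \<xi> in lborel. ennreal ((cmod (fourier chi \<xi>))\<^sup>2)
        + (\<Sum>\<^sub>\<infinity>i\<in>I_star \<alpha> \<beta>. ennreal ((cmod (fourier (\<psi> i) \<xi>))\<^sup>2)) = 1) \<and>
     closure {\<xi>. fourier chi \<xi> \<noteq> 0} \<subseteq> Q_zero \<and>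
     (\<forall>i\<in>I_star \<alpha> \<beta>. closure {\<xi>. fourier (\<psi> i) \<xi> \<noteq> 0} \<subseteq> Q_set \<alpha> \<beta> \<epsilon> i)"

text \<open>
  The Fourier integrals of the integrable filters are continuous functions, so supports and
  classical derivatives refer to them pointwise.
\<close>

definition multiplier_regularity ::
    "real \<Rightarrow> real \<Rightarrow> (nat \<times> nat \<times> nat \<Rightarrow> real^2 \<Rightarrow> complex) \<Rightarrow> bool"
  where
  "multiplier_regularity \<alpha> \<beta> \<psi> \<longleftrightarrow>
     (\<forall>i\<in>I_star \<alpha> \<beta>. times_differentiable 4 (fourier (\<psi> i))) \<and>
     (\<exists>j_reg\<ge>1.
        (\<forall>i\<in>(\<Union>j\<in>{1..<j_reg}. I_level \<alpha> \<beta> j).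
           compact (closure {\<xi>. fourier (\<psi> i) \<xi> \<noteq> 0}) \<and>
           (\<forall>\<nu>. fst \<nu> + snd \<nu> \<le> 4 \<longrightarrow> bounded (range (multi_deriv \<nu> (fourier (\<psi> i)))))) \<and>
        (\<forall>\<nu>. 1 \<le> fst \<nu> + snd \<nu> \<and> fst \<nu> + snd \<nu> \<le> 4 \<longrightarrow>
           (SUP j\<in>{j_reg..}. SUP \<xi>. ennreal (2 powr (\<beta> * j * (fst \<nu> + snd \<nu>)) *
              sqrt (\<Sum>i\<in>I_level \<alpha> \<beta> j. (cmod (multi_deriv \<nu> (fourier (\<psi> i)) \<xi>))\<^sup>2))) < \<infinity>))"

definition convolution :: "(real^2 \<Rightarrow> complex) \<Rightarrow> (real^2 \<Rightarrow> complex) \<Rightarrow> real^2 \<Rightarrow> complex" where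
  "convolution g h x = (\<integral> y. g y * h (x - y) \<partial>lborel)"

definition scat_U ::
    "('i \<Rightarrow> real^2 \<Rightarrow> complex) \<Rightarrow> 'i list \<Rightarrow> (real^2 \<Rightarrow> complex) \<Rightarrow> real^2 \<Rightarrow> complex" where
  "scat_U \<psi> p f = fold (\<lambda>i g x. complex_of_real (cmod (convolution g (\<psi> i) x))) p f"

definition scat_S ::
    "(real^2 \<Rightarrow> complex) \<Rightarrow> ('i \<Rightarrow> real^2 \<Rightarrow> complex) \<Rightarrow> (real^2 \<Rightarrow> complex) \<Rightarrow>
     'i list \<Rightarrow> real^2 \<Rightarrow> complex" where
  "scat_S chi \<psi> f p = convolution (scat_U \<psi> p f) chi"

definition scat_energy ::
    "'i set \<Rightarrow> ('i \<Rightarrow> real^2 \<Rightarrow> complex) \<Rightarrow> real \<Rightarrow> (real^2 \<Rightarrow> complex) \<Rightarrow> ennreal" where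
  "scat_energy J \<psi> s f =
     (\<Sum>n. ell2_norm (H_norm s) {p \<in> lists J. length p = n} (\<lambda>p. scat_U \<psi> p f))"

definition deform :: "(real^2 \<Rightarrow> real^2) \<Rightarrow> (real^2 \<Rightarrow> complex) \<Rightarrow> real^2 \<Rightarrow> complex" where
  "deform \<tau> f x = f (x - \<tau> x)"

end

theory Submission
 imports "HOL-Probability.Characteristic_Functions" Defs
begin

text \<open>
Let \<open>L\<close> denote the deformation and \<open>U\<^sub>i\<close> the step \<open>g \<mapsto> |g * \<psi>\<^sub>i|\<close>. Since the modulus is a contraction and
commutes with \<open>L\<close>, and since the filters form a Parseval frame, the deformation can be pushed through
the network layer by layer: the difference of the two scattering transforms is at most the sum over all
layers of the output term \<open>(L g - g) * chi\<close> and of the commutators of \<open>L\<close> with the filters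
(\<open>scat_dist_deform\<close>). Errors made in one layer are not amplified by the following ones. Thus it
suffices to bound both terms, for one function \<open>g\<close>, by \<open>\<kappa> + T\<close> times the norm of \<open>g\<close> in the Sobolev space
of order \<open>1 - \<beta>\<close>; here \<open>\<kappa>\<close> is the Lipschitz constant and \<open>T\<close> the supremum of a Lipschitz representative of
the displacement field (\<open>W1inf_lipschitz\<close>). For \<open>\<kappa> > 1/8\<close> the trivial bound of \<open>L g - g\<close> is enough.

The commutator is bounded level by level. The filters of level \<open>j\<close> live at frequencies below \<open>8 * 2 ^ j\<close>, and
the derivatives of their symbols show that, as a family, they are localized in space at scale
\<open>\<delta> = 2 powr (- \<beta> * j)\<close>. (i) On frequencies below \<open>24 * 2 ^ j\<close> the commutator compares \<open>g (y - \<tau> y)\<close> with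
\<open>g (y - \<tau> x)\<close> for \<open>x\<close>, \<open>y\<close> at distance about \<open>\<delta>\<close>. The plane is cut into cells of side \<open>\<delta>\<close>; the four moments
controlled by the regularity condition give the decay of the interaction of two cells
(\<open>block_decay_conv\<close>), and the result is \<open>\<kappa> \<delta>\<close> times the norm of the gradient (\<open>low_commutator\<close>).
(ii) Frequencies above \<open>24 * 2 ^ j\<close> are not seen by the filters, and after the deformation they contribute
only \<open>O(\<kappa>)\<close> to the frequencies below \<open>8 * 2 ^ j\<close> (\<open>lowpass_of_high\<close>). Summed over the levels, (i) gives
a geometric series above the frequency considered and (ii) counts the levels below it; both are
dominated by the power \<open>2 - 2 * \<beta>\<close> of the frequency (\<open>level_weight_sum\<close>). When \<open>\<beta> = 0\<close> the series in (i)
diverges, but then the whole gradient is available and the displacement itself is small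
(\<open>displacement_le_gradient\<close>).

The constants in (i), (ii) and in the bound of the output term must be linear in \<open>\<kappa>\<close>, although \<open>\<tau>\<close> is only
Lipschitz. This rests on the fact that a map \<open>\<kappa>\<close>-close to the identity in the Lipschitz sense distorts
measure by a factor \<open>1 + O(\<kappa>)\<close>, and on integrating increments of smooth functions along the segments
from \<open>x\<close> to \<open>x - \<tau> x\<close> (\<open>path_estimate\<close>). The Fourier transform on square integrable functions enters through the
relation \<open>ft f g\<close>, which says that \<open>g\<close> is a transform of \<open>f\<close>.
\<close>

text \<open>Short notation for integrals with respect to Lebesgue measure, for limits of sequences, and for other
 frequent phrases. Throughout, \<open>om\<close> is a frequency, \<open>ga\<close> a band-limited symbol, \<open>de\<close> a spatial scale, \<open>ta\<close> a
 displacement with Lipschitz constant \<open>ka\<close>, \<open>Ph\<close> the map \<open>x - ta x\<close> and \<open>Ps\<close> its inverse.\<close>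

abbreviation lebesgue_nn :: "('a::euclidean_space => ennreal) => ennreal" (binder "NN " 10) where
 "lebesgue_nn f \<equiv> integral\<^sup>N lborel f"

abbreviation lebesgue_int :: "('a::euclidean_space => 'b::{banach,second_countable_topology}) => 'b" (binder "LB " 10) where
 "lebesgue_int f \<equiv> integral\<^sup>L lborel f"

abbreviation seq_lim :: "(nat => 'a::topological_space) => 'a => bool" (infixr "~~>" 60) where
 "seq_lim X l \<equiv> (X \<longlongrightarrow> l) sequentially"

abbreviation lebesgue_ae :: "('a::euclidean_space => bool) => bool" (binder "AEL " 10) where
 "lebesgue_ae P \<equiv> almost_everywhere lborel P"

abbreviation cor :: "real => complex" where "cor \<equiv> of_real"

abbreviation bm :: "('a::topological_space => 'b::topological_space) set" where
 "bm \<equiv> borel_measurable borel"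

lemmas bcong = Bochner_Integration.integral_cong

section \<open>Square integrable functions\<close>

lemma ennreal_sqrt_sq [simp]: "(ennreal_sqrt x)^2 = x"
 by (cases x) (auto simp: ennreal_sqrt_def ennreal_power top_power_ennreal)

lemma ennreal_sq_le_iff: "(x::ennreal)^2 <= y^2 \<longleftrightarrow> x <= y"
proof -
 have "x <= y" if "x^2 <= y^2"
 proof (cases x; cases y)
  fix r s assume "0 <= r" "x = ennreal r" "0 <= s" "y = ennreal s"
  with that show ?thesis
  by (auto simp: ennreal_power intro!: ennreal_leI power2_le_imp_le)
 qed (use that in \<open>auto simp: ennreal_power top_power_ennreal top_unique\<close>)
 then show ?thesis by (auto intro: power_mono)
qed

lemma ennreal_sq_eq_iff: "(x::ennreal)^2 = y^2 \<longleftrightarrow> x = y"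
 by (metis antisym ennreal_sq_le_iff order_refl)

lemma ennreal_sqrt_of_sq [simp]: "ennreal_sqrt (x^2) = x"
 by (metis ennreal_sqrt_sq ennreal_sq_eq_iff)

lemma ennreal_sqrt_le_iff: "ennreal_sqrt x <= y \<longleftrightarrow> x <= y^2"
 by (metis ennreal_sqrt_sq ennreal_sq_le_iff)

lemma ennreal_sqrt_mono: "x <= y ==> ennreal_sqrt x <= ennreal_sqrt y"
 by (simp add: ennreal_sqrt_le_iff)

lemma ennreal_sqrt_mult: "ennreal_sqrt (x * y) = ennreal_sqrt x * ennreal_sqrt y"
 by (metis ennreal_sqrt_of_sq ennreal_sqrt_sq power_mult_distrib)

lemma ennreal_sqrt_less_top_iff: "ennreal_sqrt x < \<infinity> \<longleftrightarrow> x < \<infinity>"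
 by (cases x) (auto simp: ennreal_sqrt_def)

definition l2n :: "'a measure => ('a => ennreal) => ennreal" where
 "l2n M u = ennreal_sqrt (\<integral>\<^sup>+ x. (u x)^2 \<partial>M)"

lemma l2n_sq: "(l2n M u)^2 = (\<integral>\<^sup>+ x. (u x)^2 \<partial>M)"
 by (simp add: l2n_def)

lemma l2n_mono: "(\<And>x. x \<in> space M ==> u x <= v x) ==> l2n M u <= l2n M v"
 unfolding l2n_def by (intro ennreal_sqrt_mono nn_integral_mono power_mono) auto

lemma l2n_cmult:
 assumes [measurable]: "u \<in> borel_measurable M"
 shows "l2n M (%x. c * u x) = c * l2n M u"
 unfolding l2n_def
 by (simp add: power_mult_distrib nn_integral_cmult ennreal_sqrt_mult)

lemma l2n_holder:
 assumes [measurable]: "u \<in> borel_measurable M" "v \<in> borel_measurable M"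
 shows "(\<integral>\<^sup>+ x. u x * v x \<partial>M) <= l2n M u * l2n M v"
proof -
 have "(\<integral>\<^sup>+ x. u x * v x \<partial>M)^2 <= (l2n M u * l2n M v)^2"
  using Cauchy_Schwarz_nn_integral[OF assms] by (simp add: power_mult_distrib l2n_sq)
 then show ?thesis by (simp add: ennreal_sq_le_iff)
qed

lemma l2n_triangle:
 assumes [measurable]: "u \<in> borel_measurable M" "v \<in> borel_measurable M"
 shows "l2n M (%x. u x + v x) <= l2n M u + l2n M v"
proof -
 have sq: "(a + b)^2 = a^2 + 2 * (a * b) + b^2" for a b :: ennreal
  unfolding power2_eq_square distrib_left distrib_right mult_2 by (simp add: mult.commute add.assoc)
 have "(l2n M (%x. u x + v x))^2 = (l2n M u)^2 + 2 * (\<integral>\<^sup>+ x. u x * v x \<partial>M) + (l2n M v)^2"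
  by (simp add: l2n_sq sq nn_integral_add nn_integral_cmult)
 also have "... <= (l2n M u)^2 + 2 * (l2n M u * l2n M v) + (l2n M v)^2"
  by (intro add_mono mult_left_mono l2n_holder assms) auto
 also have "... = (l2n M u + l2n M v)^2" by (simp add: sq)
 finally show ?thesis by (simp add: ennreal_sq_le_iff)
qed

lemma l2n_sum:
 assumes "finite F" "\<And>k. k \<in> F ==> u k \<in> borel_measurable M"
 shows "l2n M (%x. \<Sum>k\<in>F. u k x) <= (\<Sum>k\<in>F. l2n M (u k))"
 using assms
proof (induction F rule: finite_induct)
 case empty
 then show ?case by (simp add: l2n_def ennreal_sqrt_def)
next
 case (insert k F)
 have "l2n M (%x. \<Sum>k\<in>insert k F. u k x) = l2n M (%x. u k x + (\<Sum>k\<in>F. u k x))"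
  using insert by simp
 also have "... <= l2n M (u k) + l2n M (%x. \<Sum>k\<in>F. u k x)"
  using insert.prems by (intro l2n_triangle borel_measurable_sum) auto
 also have "... <= l2n M (u k) + (\<Sum>k\<in>F. l2n M (u k))"
  using insert by (intro add_left_mono) auto
 finally show ?case using insert by simp
qed

subsection \<open>The norm on complex valued functions\<close>

lemma L2_norm_sq: "(L2_norm f)^2 = (NN x. ennreal ((cmod (f x))^2))"
 by (simp add: L2_norm_def)

lemma L2_norm_l2n: "L2_norm f = l2n lborel (%x. ennreal (cmod (f x)))"
 by (simp add: L2_norm_def l2n_def ennreal_power)

lemma L2_norm_mono_AE:
 assumes "AEL x. cmod (f x) <= cmod (g x)"
 shows "L2_norm f <= L2_norm g"
 unfolding L2_norm_def
 by (intro ennreal_sqrt_mono nn_integral_mono_AE) (use assms in eventually_elim, auto intro: ennreal_leI power_mono)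

lemma L2_norm_mono:
 assumes "\<And>x. cmod (f x) <= cmod (g x)"
 shows "L2_norm f <= L2_norm g"
 by (intro L2_norm_mono_AE) (use assms in auto)

lemma L2_norm_cong_AE:
 assumes "AEL x. cmod (f x) = cmod (g x)"
 shows "L2_norm f = L2_norm g"
 by (intro antisym L2_norm_mono_AE; use assms in eventually_elim) auto

lemma L2_norm_cmult:
 assumes "f \<in> borel_measurable lborel"
 shows "L2_norm (%x. c * f x) = ennreal (cmod c) * L2_norm f"
proof -
 have "L2_norm (%x. c * f x) = l2n lborel (%x. ennreal (cmod c) * ennreal (cmod (f x)))"
  by (simp add: L2_norm_l2n norm_mult ennreal_mult)
 then show ?thesis using assms by (simp add: l2n_cmult L2_norm_l2n)
qed

lemma L2_norm_add:
 assumes [measurable]: "f \<in> borel_measurable lborel" "g \<in> borel_measurable lborel"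
 shows "L2_norm (%x. f x + g x) <= L2_norm f + L2_norm g"
proof -
 have "L2_norm (%x. f x + g x) <= l2n lborel (%x. ennreal (cmod (f x)) + ennreal (cmod (g x)))"
  unfolding L2_norm_l2n
  by (intro l2n_mono) (auto simp flip: ennreal_plus intro!: ennreal_leI norm_triangle_ineq)
 also have "... <= L2_norm f + L2_norm g"
  unfolding L2_norm_l2n by (intro l2n_triangle) auto
 finally show ?thesis .
qed

lemma L2_norm_minus: "L2_norm (%x. - f x) = L2_norm f"
 by (simp add: L2_norm_def)

lemma L2_norm_commute: "L2_norm (%x. f x - g x) = L2_norm (%x. g x - f x)"
 by (simp add: L2_norm_def norm_minus_commute)

lemma L2_norm_diff:
 assumes [measurable]: "f \<in> borel_measurable lborel" "g \<in> borel_measurable lborel"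
 shows "L2_norm (%x. f x - g x) <= L2_norm f + L2_norm g"
 using L2_norm_add[of f "%x. - g x"] by (simp add: L2_norm_minus)

lemma L2_norm_diff_trans:
 assumes [measurable]: "f \<in> borel_measurable lborel" "g \<in> borel_measurable lborel"
  "h \<in> borel_measurable lborel"
 shows "L2_norm (%x. f x - h x) <= L2_norm (%x. f x - g x) + L2_norm (%x. g x - h x)"
 using L2_norm_add[of "%x. f x - g x" "%x. g x - h x"] by simp

lemma L2_norm_zero [simp]: "L2_norm (%x. 0) = 0"
 by (simp add: L2_norm_def ennreal_sqrt_def)

lemma L2_norm_eq_0_iff:
 assumes [measurable]: "f \<in> borel_measurable lborel"
 shows "L2_norm f = 0 \<longleftrightarrow> (AEL x. f x = 0)"
proof -
 have "L2_norm f = 0 \<longleftrightarrow> (L2_norm f)\<^sup>2 = 0" by simp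
 also have "... \<longleftrightarrow> (AEL x. f x = 0)"
  unfolding L2_norm_sq by (subst nn_integral_0_iff_AE) auto
 finally show ?thesis .
qed

lemma in_L2_measurable [measurable_dest]: "in_L2 f ==> f \<in> borel_measurable lborel"
 by (simp add: in_L2_def)

lemma in_L2_measurable' [measurable_dest]: "in_L2 f ==> f \<in> bm"
 by (simp add: in_L2_def)

lemma in_L2_finite: "in_L2 f ==> L2_norm f < \<infinity>"
 by (simp add: in_L2_def)

lemma in_L2_sq_finite: "in_L2 f ==> (L2_norm f)\<^sup>2 < \<infinity>"
 using in_L2_finite[of f] by (simp add: power2_eq_square ennreal_mult_less_top)

lemma cball_borel [measurable]: "cball (x::'a::metric_space) r \<in> sets borel"
 by (rule borel_closed) simp

lemma in_L2_add: "in_L2 f ==> in_L2 g ==> in_L2 (%x. f x + g x)"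
 using L2_norm_add[of f g] by (auto simp: in_L2_def less_top[symmetric] top_unique)

lemma in_L2_cmult: "in_L2 f ==> in_L2 (%x. c * f x)"
 by (auto simp: in_L2_def L2_norm_cmult ennreal_mult_less_top)

lemma in_L2_minus: "in_L2 f ==> in_L2 (%x. - f x)"
 using in_L2_cmult[of f "-1"] by simp

lemma in_L2_diff: "in_L2 f ==> in_L2 g ==> in_L2 (%x. f x - g x)"
 using in_L2_add[OF _ in_L2_minus, of f g] by simp

lemma in_L2_zero [simp]: "in_L2 (%x. 0)"
 by (simp add: in_L2_def)

lemma in_L2_bound:
 assumes "in_L2 g" "f \<in> borel_measurable lborel" "AEL x. cmod (f x) <= B * cmod (g x)" "0 <= B"
 shows "in_L2 f" "L2_norm f <= ennreal B * L2_norm g"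
proof -
 have "L2_norm f <= L2_norm (%x. of_real B * g x)"
  by (intro L2_norm_mono_AE) (use assms(3,4) in \<open>auto simp: norm_mult\<close>)
 also have "... = ennreal B * L2_norm g"
  using assms by (subst L2_norm_cmult) (auto dest: in_L2_measurable)
 finally show *: "L2_norm f <= ennreal B * L2_norm g" .
 have "ennreal B * L2_norm g < \<infinity>"
  using assms by (auto simp: in_L2_def ennreal_mult_less_top)
 with * show "in_L2 f" using assms(2) by (auto simp: in_L2_def)
qed

lemma in_L2_mult_bounded:
 assumes "in_L2 g" "b \<in> borel_measurable lborel" "AEL x. cmod (b x) <= B"
 shows "in_L2 (%x. b x * g x)"
proof (rule in_L2_bound(1)[OF assms(1), of _ "max B 0"])
 show "(%x. b x * g x) \<in> borel_measurable lborel"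
  using assms by (auto dest: in_L2_measurable)
 show "AEL x. cmod (b x * g x) <= max B 0 * cmod (g x)"
  using assms(3) by eventually_elim (auto simp: norm_mult intro!: mult_right_mono)
qed auto

lemma in_L2_indicator_mult:
 assumes "in_L2 g" "A \<in> sets borel"
 shows "in_L2 (%x. indicator A x * g x)"
 by (rule in_L2_mult_bounded[OF assms(1), of _ 1]) (use assms(2) in \<open>auto split: split_indicator\<close>)

lemma in_L2_cnj: "in_L2 f ==> in_L2 (%x. cnj (f x))"
 using borel_measurable_continuous_onI[OF continuous_on_cnj[OF continuous_on_id]]
 by (auto simp: in_L2_def L2_norm_def intro: measurable_compose)

lemma in_L2_integrable_sq:
 assumes "in_L2 f" shows "integrable lborel (%x. (cmod (f x))^2)"
proof (rule integrableI_bounded)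
 show "(%x. (cmod (f x))^2) \<in> borel_measurable lborel" using assms by measurable
 have "(NN x. ennreal (norm ((cmod (f x))^2))) = (L2_norm f)^2"
  by (simp add: L2_norm_sq)
 also have "... < \<infinity>" using in_L2_finite[OF assms]
  by (simp add: power2_eq_square ennreal_mult_less_top)
 finally show "(NN x. ennreal (norm ((cmod (f x))^2))) < \<infinity>" .
qed

lemma in_L2I_integrable:
 assumes "f \<in> borel_measurable lborel" "integrable lborel (%x. (cmod (f x))^2)"
 shows "in_L2 f"
 using assms unfolding in_L2_def L2_norm_def ennreal_sqrt_less_top_iff
 by (auto simp: integrable_iff_bounded)

definition nrm :: "(real^2 => complex) => real" where
 "nrm f = enn2real (L2_norm f)"

definition ip :: "(real^2 => complex) => (real^2 => complex) => complex" where
 "ip f g = (LB x. f x * cnj (g x))"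

lemma nrm_nonneg [simp]: "0 <= nrm f" by (simp add: nrm_def)

lemma L2_norm_eq_nrm: "in_L2 f ==> L2_norm f = ennreal (nrm f)"
 by (simp add: nrm_def in_L2_def)

lemma nrm_le_iff: "in_L2 f ==> 0 <= c ==> nrm f <= c \<longleftrightarrow> L2_norm f <= ennreal c"
 by (simp add: L2_norm_eq_nrm)

lemma nrm_sq: "in_L2 f ==> (nrm f)\<^sup>2 = (LB x. (cmod (f x))^2)"
proof -
 assume "in_L2 f"
 then have "ennreal ((nrm f)^2) = ennreal (LB x. (cmod (f x))^2)"
  using L2_norm_sq[of f] in_L2_integrable_sq[of f]
  by (simp add: L2_norm_eq_nrm ennreal_power nn_integral_eq_integral)
 then show ?thesis by (subst (asm) ennreal_inj) auto
qed

lemma nrm_diff: "in_L2 f ==> in_L2 g ==> nrm (%x. f x - g x) <= nrm f + nrm g"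
 using L2_norm_diff[of f g]
 by (auto simp: L2_norm_eq_nrm in_L2_diff in_L2_measurable' simp flip: ennreal_plus)

lemma ip_integrable:
 assumes "in_L2 f" "in_L2 g"
 shows "integrable lborel (%x. f x * g x)"
proof (rule integrableI_bounded)
 note [measurable] = in_L2_measurable[OF assms(1)] in_L2_measurable[OF assms(2)]
 show "(%x. f x * g x) \<in> borel_measurable lborel" by measurable
 have "(NN x. ennreal (norm (f x * g x)))
  = (NN x. ennreal (cmod (f x)) * ennreal (cmod (g x)))"
  by (simp add: norm_mult ennreal_mult)
 also have "... <= L2_norm f * L2_norm g"
  unfolding L2_norm_l2n by (rule l2n_holder) auto
 also have "... < \<infinity>" using assms by (auto simp: in_L2_def ennreal_mult_less_top)
 finally show "(NN x. ennreal (norm (f x * g x))) < \<infinity>" .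
qed

lemma ip_bound:
 assumes "in_L2 f" "in_L2 g"
 shows "cmod (LB x. f x * g x) <= nrm f * nrm g"
proof -
 note [measurable] = in_L2_measurable[OF assms(1)] in_L2_measurable[OF assms(2)]
 have "ennreal (cmod (LB x. f x * g x)) <= (NN x. ennreal (norm (f x * g x)))"
  by (intro integral_norm_bound_ennreal ip_integrable assms)
 also have "... = (NN x. ennreal (cmod (f x)) * ennreal (cmod (g x)))"
  by (simp add: norm_mult ennreal_mult)
 also have "... <= L2_norm f * L2_norm g"
  unfolding L2_norm_l2n by (rule l2n_holder) auto
 also have "... = ennreal (nrm f * nrm g)"
  using assms by (simp add: L2_norm_eq_nrm ennreal_mult)
 finally show ?thesis by (subst (asm) ennreal_le_iff) auto
qed

lemma nrm_cnj: "nrm (%x. cnj (f x)) = nrm f"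
 by (simp add: nrm_def L2_norm_def)

lemma ip_cauchy: "in_L2 f ==> in_L2 g ==> cmod (ip f g) <= nrm f * nrm g"
 unfolding ip_def using ip_bound[of f "%x. cnj (g x)"] by (simp add: in_L2_cnj nrm_cnj)

lemma ip_self: "in_L2 f ==> ip f f = of_real ((nrm f)^2)"
 by (simp add: ip_def nrm_sq complex_norm_square[symmetric] del: of_real_power)

lemma ip_diff_left: "in_L2 f ==> in_L2 g ==> in_L2 h ==> ip (%x. f x - g x) h = ip f h - ip g h"
 unfolding ip_def by (simp add: ring_distribs ip_integrable in_L2_cnj)

lemma ip_diff_right: "in_L2 f ==> in_L2 g ==> in_L2 h ==> ip f (%x. g x - h x) = ip f g - ip f h"
 unfolding ip_def by (simp add: ring_distribs ip_integrable in_L2_cnj)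

lemma ip_cnj: "ip f g = cnj (ip g f)"
proof -
 have "cnj (ip g f) = (LB x. cnj (g x * cnj (f x)))"
  unfolding ip_def by (rule Bochner_Integration.integral_cnj[symmetric])
 then show ?thesis by (simp add: ip_def mult.commute)
qed

lemma nrm_diff_sq:
 assumes "in_L2 f" "in_L2 g"
 shows "(nrm (%x. f x - g x))^2 = (nrm f)^2 - 2 * Re (ip f g) + (nrm g)^2"
proof -
 have "cor ((nrm (%x. f x - g x))^2) = ip (%x. f x - g x) (%x. f x - g x)"
  using assms by (simp add: ip_self in_L2_diff)
 also have "... = ip f f - ip f g - (ip g f - ip g g)"
  using assms by (simp add: ip_diff_left ip_diff_right in_L2_diff)
 also have "ip g f = cnj (ip f g)" by (rule ip_cnj)
 finally have "Re (cor ((nrm (%x. f x - g x))^2)) = Re (ip f f - ip f g - (cnj (ip f g) - ip g g))"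
  by simp
 then show ?thesis using assms by (simp add: ip_self)
qed

subsection \<open>Convergence\<close>

lemma L2_fatou:
 assumes meas: "\<And>n::nat. f n \<in> borel_measurable lborel" and "g \<in> borel_measurable lborel"
  and lim: "AEL x. (%n. f n x) ~~> g x" and bd: "\<forall>\<^sub>F n in sequentially. L2_norm (f n) <= B"
 shows "L2_norm g <= B"
proof -
 note [measurable] = assms(1,2)
 have "(L2_norm g)^2 = (NN x. liminf (%n. ennreal ((cmod (f n x))^2)))"
  unfolding L2_norm_sq
 proof (intro nn_integral_cong_AE, use lim in eventually_elim)
  fix x assume "(%n. f n x) ~~> g x"
  then have "(%n. ennreal ((cmod (f n x))^2)) ~~> ennreal ((cmod (g x))^2)"
  by (intro tendsto_ennrealI tendsto_intros)
  from lim_imp_Liminf[OF _ this] show "ennreal ((cmod (g x))^2) = liminf (%n. ennreal ((cmod (f n x))^2))"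
  by simp
 qed
 also have "... <= liminf (%n. (L2_norm (f n))^2)"
  unfolding L2_norm_sq by (intro nn_integral_liminf) measurable
 also have "... <= B^2"
 proof (rule Liminf_le)
  show "\<forall>\<^sub>F n in sequentially. (L2_norm (f n))^2 <= B^2"
  using bd by eventually_elim (simp add: ennreal_sq_le_iff)
 qed auto
 finally show ?thesis by (simp add: ennreal_sq_le_iff)
qed

lemma tendsto_0_le_ennreal:
 fixes u :: "'a => ennreal"
 assumes "\<And>e::real. 0 < e ==> \<forall>\<^sub>F n in F. u n <= ennreal e"
 shows "(u \<longlongrightarrow> 0) F"
proof (rule order_tendstoI)
 fix a :: ennreal assume "0 < a"
 then obtain r :: real where r: "0 < ennreal r" "ennreal r < a"
  by (metis ennreal_cases dense less_top_ennreal order_less_trans)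
 then have "0 < r" by (simp add: ennreal_less_zero_iff)
 from assms[OF this] show "\<forall>\<^sub>F n in F. u n < a"
  by eventually_elim (use r in auto)
qed auto

lemma ennreal_tendsto_0_sq:
 assumes "((%n. (u n)^2) \<longlongrightarrow> (0::ennreal)) F"
 shows "(u \<longlongrightarrow> 0) F"
proof (rule order_tendstoI)
 fix a :: ennreal assume "0 < a"
 then have "0 < a\<^sup>2" using ennreal_sq_le_iff[of a 0] by (auto simp: not_le[symmetric])
 then have "\<forall>\<^sub>F n in F. (u n)^2 < a\<^sup>2" using assms by (rule order_tendstoD(2)[rotated])
 then show "\<forall>\<^sub>F n in F. u n < a"
  by eventually_elim (metis ennreal_sq_le_iff linorder_not_le)
qed auto

lemma L2_dominated:
 assumes meas: "\<And>n::nat. f n \<in> borel_measurable lborel" and "g \<in> borel_measurable lborel"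
  and w: "in_L2 w"
  and lim: "AEL x. (%n. f n x) ~~> g x"
  and dom: "\<And>n. AEL x. cmod (f n x - g x) <= cmod (w x)"
 shows "(%n. L2_norm (%x. f n x - g x)) ~~> 0"
proof (rule ennreal_tendsto_0_sq)
 note [measurable] = assms(1,2) in_L2_measurable[OF w]
 have "(%n. (NN x. ennreal ((cmod (f n x - g x))^2))) ~~> (NN (x::real^2). 0)"
 proof (rule nn_integral_dominated_convergence[where w="%x. ennreal ((cmod (w x))^2)"])
  show "AEL x. ennreal ((cmod (f n x - g x))^2) <= ennreal ((cmod (w x))^2)" for n
  using dom[of n] by eventually_elim (auto intro!: ennreal_leI power_mono)
  show "(NN x. ennreal ((cmod (w x))^2)) < \<infinity>"
  using in_L2_sq_finite[OF w] by (simp add: L2_norm_sq)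
  show "AEL x. (%n. ennreal ((cmod (f n x - g x))^2)) ~~> 0"
  using lim
  proof eventually_elim
  fix x assume "(%n. f n x) ~~> g x"
  then have "(%n. ennreal ((cmod (f n x - g x))^2)) ~~> ennreal ((cmod (g x - g x))^2)"
  by (intro tendsto_intros)
  then show "(%n. ennreal ((cmod (f n x - g x))^2)) ~~> 0" by simp
  qed
 qed measurable
 then show "(%n. (L2_norm (%x. f n x - g x))^2) ~~> 0"
  by (simp add: L2_norm_sq)
qed

lemma L2_truncation:
 assumes "in_L2 f"
 shows "(%n. L2_norm (%x. indicator (cball 0 (real n)) x * f x - f x)) ~~> 0"
proof (rule L2_dominated[OF _ _ assms])
 note [measurable] = in_L2_measurable[OF assms]
 show "(%x. indicator (cball 0 (real n)) x * f x) \<in> borel_measurable lborel" for n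
  by (intro borel_measurable_times borel_measurable_indicator in_L2_measurable assms) auto
 show "f \<in> borel_measurable lborel" using assms by (rule in_L2_measurable)
 show "AEL x. (%n. indicator (cball 0 (real n)) x * f x) ~~> f x"
 proof (rule AE_I2)
  fix x :: "real^2"
  obtain N :: nat where "norm x <= real N" using real_arch_simple by blast
  then have "\<forall>\<^sub>F n in sequentially. indicator (cball 0 (real n)) x * f x = f x"
  by (intro eventually_sequentiallyI[of N]) (auto simp: indicator_def)
  then show "(%n. indicator (cball 0 (real n)) x * f x) ~~> f x"
  by (rule tendsto_eventually)
 qed
qed (auto split: split_indicator)

lemma L2_truncation_integrable:
 assumes "in_L2 f"
 shows "integrable lborel (%x. indicator (cball 0 r) x * f x)"
proof -
 have "in_L2 (indicator (cball 0 r) :: real^2 => complex)"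
 proof (rule in_L2I_integrable)
  have "integrable lborel (indicator (cball (0::real^2) r) :: _ => real)"
  by (intro integrable_real_indicator) (use emeasure_bounded_finite[of "cball (0::real^2) r"] in auto)
  then show "integrable lborel (%x. (cmod (indicator (cball (0::real^2) r) x))^2)"
  by (rule Bochner_Integration.integrable_cong[THEN iffD1, rotated 2]) (auto split: split_indicator)
 qed auto
 then show ?thesis using assms by (rule ip_integrable)
qed

lemma L2_complete:
 assumes L2: "\<And>n::nat. in_L2 (f n)"
  and cauchy: "\<And>e. 0 < e ==> \<exists>N. \<forall>m\<ge>N. \<forall>n\<ge>N. L2_norm (%x. f m x - f n x) <= ennreal e"
 shows "\<exists>g. in_L2 g \<and> (%n. L2_norm (%x. g x - f n x)) ~~> 0"
proof -
 note [measurable] = in_L2_measurable[OF L2]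
 have "\<forall>k::nat. \<exists>N. \<forall>m\<ge>N. \<forall>n\<ge>N. L2_norm (%x. f m x - f n x) <= ennreal ((1/2)^k)"
  using cauchy by simp
 then obtain N where N: "\<And>k m n. m \<ge> N k ==> n \<ge> N k ==> L2_norm (%x. f m x - f n x) <= ennreal ((1/2)^k)"
  by metis
 define r where "r k = k + (\<Sum>i\<le>k. N i)" for k
 have rN: "N k <= r k" for k unfolding r_def by (intro trans_le_add2 member_le_sum) auto
 have rS: "r k <= r (Suc k)" for k by (simp add: r_def)
 define h where "h k = f (r k)" for k
 have h[measurable]: "h k \<in> borel_measurable lborel" for k by (simp add: h_def)
 have hstep: "L2_norm (%x. h (Suc k) x - h k x) <= ennreal ((1/2)^k)" for k
  unfolding h_def by (rule N) (use rN[of k] rS[of k] in auto)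
 define u where "u x = (\<Sum>k. ennreal (cmod (h (Suc k) x - h k x)))" for x
 have u[measurable]: "u \<in> borel_measurable lborel" unfolding u_def by measurable
 have part: "l2n lborel (%x. \<Sum>k<n. ennreal (cmod (h (Suc k) x - h k x))) <= 2" for n
 proof -
  have "l2n lborel (%x. \<Sum>k<n. ennreal (cmod (h (Suc k) x - h k x)))
  <= (\<Sum>k<n. l2n lborel (%x. ennreal (cmod (h (Suc k) x - h k x))))"
  by (rule l2n_sum) auto
  also have "... <= (\<Sum>k<n. ennreal ((1/2)^k))"
  by (intro sum_mono) (use hstep in \<open>simp add: L2_norm_l2n\<close>)
  also have "... = ennreal (\<Sum>k<n. (1/2)^k)" by (rule sum_ennreal) auto
  also have "... <= ennreal 2"
  by (rule ennreal_leI) (simp add: sum_gp_strict)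
  also have "ennreal 2 = 2" by simp
  finally show ?thesis .
 qed
 have "(NN x. (u x)^2) = (NN x. (SUP n. (\<Sum>k<n. ennreal (cmod (h (Suc k) x - h k x)))^2))"
 proof (rule nn_integral_cong)
  fix x
  have mon: "mono (%n. \<Sum>k<n. ennreal (cmod (h (Suc k) x - h k x)))"
  by (intro monoI sum_mono2) auto
  have "(%n. (\<Sum>k<n. ennreal (cmod (h (Suc k) x - h k x)))^2) ~~> (u x)\<^sup>2"
  unfolding power2_eq_square u_def using summable_LIMSEQ[OF summableI]
  by (intro tendsto_mult_ennreal) (auto simp del: sum_ennreal)
  moreover have "(%n. (\<Sum>k<n. ennreal (cmod (h (Suc k) x - h k x)))^2)
  ~~> (SUP n. (\<Sum>k<n. ennreal (cmod (h (Suc k) x - h k x)))^2)"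
  by (intro LIMSEQ_SUP monoI power_mono monoD[OF mon]) auto
  ultimately show "(u x)^2 = (SUP n. (\<Sum>k<n. ennreal (cmod (h (Suc k) x - h k x)))^2)"
  by (rule LIMSEQ_unique)
 qed
 also have "... = (SUP n. (NN x. (\<Sum>k<n. ennreal (cmod (h (Suc k) x - h k x)))^2))"
  by (rule nn_integral_monotone_convergence_SUP)
  (auto simp: incseq_def le_fun_def simp del: sum_ennreal intro!: power_mono sum_mono2)
 also have "... <= 2^2"
  by (intro SUP_least) (use part in \<open>simp add: l2n_def ennreal_sqrt_le_iff\<close>)
 finally have "(NN x. (u x)^2) \<noteq> \<infinity>"
  by (auto simp: top_unique)
 then have "AEL x. (u x)^2 \<noteq> \<infinity>"
  by (intro nn_integral_PInf_AE) auto
 then have conv: "AEL x. convergent (%k. h k x)"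
 proof eventually_elim
  fix x assume "(u x)^2 \<noteq> \<infinity>"
  then have "u x \<noteq> \<infinity>" by (auto simp: top_power_ennreal)
  then have "summable (%k. cmod (h (Suc k) x - h k x))"
  unfolding u_def by (intro summable_suminf_not_top) auto
  then have "summable (%k. h (Suc k) x - h k x)" by (rule summable_norm_cancel)
  then have "convergent (%n. h 0 x + (\<Sum>k<n. h (Suc k) x - h k x))"
  by (intro convergent_add convergent_const) (simp add: summable_iff_convergent)
  also have "(%n. h 0 x + (\<Sum>k<n. h (Suc k) x - h k x)) = (%k. h k x)"
  by (rule ext, subst sum_lessThan_telescope) simp
  finally show "convergent (%k. h k x)" .
 qed
 define g where "g x = lim (%k. h k x)" for x
 have g[measurable]: "g \<in> borel_measurable lborel"
  unfolding g_def using borel_measurable_lim_metric[of h lborel] by simp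
 have lim: "AEL x. (%k. h k x) ~~> g x"
  using conv by eventually_elim (simp add: g_def convergent_LIMSEQ_iff)
 have close: "L2_norm (%x. g x - f n x) <= ennreal e"
  if n: "\<forall>m\<ge>M. \<forall>n\<ge>M. L2_norm (%x. f m x - f n x) <= ennreal e" "n \<ge> M" for e M n
 proof (rule L2_fatou[where f="%k x. h k x - f n x"])
  show "AEL x. (%k. h k x - f n x) ~~> g x - f n x"
  using lim by eventually_elim (intro tendsto_intros)
  have "r k \<ge> k" for k by (simp add: r_def)
  then show "\<forall>\<^sub>F k in sequentially. L2_norm (%x. h k x - f n x) <= ennreal e"
  unfolding h_def using n by (intro eventually_sequentiallyI[of M]) (meson order_trans)
 qed auto
 obtain M where "\<forall>m\<ge>M. \<forall>n\<ge>M. L2_norm (%x. f m x - f n x) <= ennreal 1" using cauchy[of 1] by auto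
 then have "L2_norm (%x. g x - f M x) <= ennreal 1" by (intro close[of M]) auto
 then have "in_L2 (%x. g x - f M x)"
  unfolding in_L2_def by (auto simp: less_top[symmetric] top_unique)
 from in_L2_add[OF this L2[of M]] have "in_L2 g" by simp
 moreover have "(%n. L2_norm (%x. g x - f n x)) ~~> 0"
 proof (rule tendsto_0_le_ennreal)
  fix e :: real assume "0 < e"
  then obtain M where "\<forall>m\<ge>M. \<forall>n\<ge>M. L2_norm (%x. f m x - f n x) <= ennreal e" using cauchy by blast
  then show "\<forall>\<^sub>F n in sequentially. L2_norm (%x. g x - f n x) <= ennreal e"
  by (intro eventually_sequentiallyI[of M] close[of M]) auto
 qed
 ultimately show ?thesis by blast
qed

section \<open>Translations and Gaussians\<close>

lemma nn_integral_shift: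
 fixes z :: "real^2"
 assumes [measurable]: "f \<in> bm"
 shows "(NN x. f (x + z)) = (NN x. f x)"
proof -
 have "(NN x. f x) = (\<integral>\<^sup>+ x. f x \<partial>distr lborel borel ((+) z))"
  by (simp add: lborel_distr_plus)
 also have "... = (NN x. f (x + z))"
  by (subst nn_integral_distr) (auto simp: add.commute)
 finally show ?thesis ..
qed

lemma nn_integral_reflect:
 fixes z :: "real^2"
 assumes [measurable]: "f \<in> bm"
 shows "(NN x. f (z - x)) = (NN x. f x)"
proof -
 have "(lborel :: (real^2) measure) = distr lborel borel (%x. z - x)"
  using lborel_affine[of "-1" z] by (simp add: density_1)
 then have "(NN x. f x) = (\<integral>\<^sup>+ x. f x \<partial>distr lborel borel (%x. z - x))"
  by simp
 also have "... = (NN x. f (z - x))"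
  by (subst nn_integral_distr) auto
 finally show ?thesis ..
qed

lemma integral_reflect_shift:
 fixes z :: "real^2" and f :: "real^2 => 'b::{banach, second_countable_topology}"
 shows "(LB x. f (z - x)) = (LB x. f x)"
  and "integrable lborel f ==> integrable lborel (%x. f (z - x))"
proof -
 have *: "(lborel :: (real^2) measure) = distr lborel lborel (%x. z - x)"
  using lborel_affine[of "-1" z] by (simp add: density_1 cong: distr_cong)
 have eq: "f (z - x) = (%x. f (z - x)) x" for x by simp
 have inv: "(%x. f (z - (z - x))) = f" by auto
 show 1: "integrable lborel f ==> integrable lborel (%x. f (z - x))" for f :: "real^2 => 'b"
  by (subst (asm) *, erule integrable_distr[rotated]) auto
 show "(LB x. f (z - x)) = (LB x. f x)"
 proof (cases "integrable lborel f")
  case True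
  then have "(\<integral> x. f x \<partial>distr lborel lborel (%x. z - x)) = (LB x. f (z - x))"
  by (subst integral_distr) auto
  then show ?thesis by (subst (asm) *[symmetric]) simp
 next
  case False
  then have "\<not> integrable lborel (%x. f (z - x))" using 1[of "%x. f (z - x)"] by auto
  with False show ?thesis by (simp add: not_integrable_integral_eq)
 qed
qed

lemma integral_shift:
 fixes z :: "real^2" and f :: "real^2 => 'b::{banach, second_countable_topology}"
 shows "(LB x. f (x + z)) = (LB x. f x)"
  and "integrable lborel f ==> integrable lborel (%x. f (x + z))"
 using integral_reflect_shift[of "%x. f (- x)" "-z"] integral_reflect_shift[of f 0]
 by (simp_all add: add.commute)

lemma L2_norm_shift:
 assumes "f \<in> bm"
 shows "L2_norm (%x. f (x + z)) = L2_norm f"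
 unfolding L2_norm_def
 using nn_integral_shift[of "%x. ennreal ((cmod (f x))^2)" z] assms by simp

lemma in_L2_shift: "in_L2 f ==> in_L2 (%x. f (x + z))"
 using L2_norm_shift[of f z] by (auto simp: in_L2_def)

lemma L2_norm_reflect:
 assumes "f \<in> bm"
 shows "L2_norm (%x. f (z - x)) = L2_norm f"
 unfolding L2_norm_def
 using nn_integral_reflect[of "%x. ennreal ((cmod (f x))^2)" z] assms by simp

lemma in_L2_reflect: "in_L2 f ==> in_L2 (%x. f (z - x))"
 using L2_norm_reflect[of f z] by (auto simp: in_L2_def)

subsection \<open>Continuity of translations\<close>

definition trans_cont :: "(real^2 => complex) => bool" where
 "trans_cont f \<longleftrightarrow> in_L2 f \<and>
  (\<forall>z. z ~~> 0 --> (%n. L2_norm (%x. f (x + z n) - f x)) ~~> 0)"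

lemma trans_cont_limit:
 assumes f: "in_L2 f" and "\<And>e. 0 < e ==> \<exists>g. trans_cont g \<and> L2_norm (%x. f x - g x) <= ennreal e"
 shows "trans_cont f"
 unfolding trans_cont_def
proof (intro conjI allI impI f)
 fix z :: "nat => real^2" assume z: "z ~~> 0"
 show "(%n. L2_norm (%x. f (x + z n) - f x)) ~~> 0"
 proof (rule tendsto_0_le_ennreal)
  fix e :: real assume "0 < e"
  then obtain g where g: "trans_cont g" "L2_norm (%x. f x - g x) <= ennreal (e/3)"
  using assms(2)[of "e/3"] by auto
  note [measurable] = in_L2_measurable'[OF f] 
  have gL2: "in_L2 g" using g by (simp add: trans_cont_def)
  note [measurable] = in_L2_measurable'[OF gL2] 
  have "(%n. L2_norm (%x. g (x + z n) - g x)) ~~> 0" using g z by (simp add: trans_cont_def)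
  then have "\<forall>\<^sub>F n in sequentially. L2_norm (%x. g (x + z n) - g x) < ennreal (e/3)"
  by (rule order_tendstoD) (use \<open>0 < e\<close> in auto)
  then show "\<forall>\<^sub>F n in sequentially. L2_norm (%x. f (x + z n) - f x) <= ennreal e"
  proof eventually_elim
  case (elim n)
  have "L2_norm (%x. f (x + z n) - f x) <= L2_norm (%x. f (x + z n) - g (x + z n)) + L2_norm (%x. g (x + z n) - f x)"
  by (rule L2_norm_diff_trans) auto
  also have "L2_norm (%x. g (x + z n) - f x) <= L2_norm (%x. g (x + z n) - g x) + L2_norm (%x. g x - f x)"
  by (rule L2_norm_diff_trans) auto
  also have "L2_norm (%x. f (x + z n) - g (x + z n)) = L2_norm (%x. f x - g x)"
  by (rule L2_norm_shift[of "%x. f x - g x"]) auto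
  finally have "L2_norm (%x. f (x + z n) - f x) <=
  L2_norm (%x. f x - g x) + (L2_norm (%x. g (x + z n) - g x) + L2_norm (%x. g x - f x))"
  by (simp add: add_left_mono)
  also have "... <= ennreal (e/3) + (ennreal (e/3) + ennreal (e/3))"
  using g elim by (intro add_mono) (auto simp: L2_norm_commute[of g f])
  also have "... = ennreal e"
  using \<open>0 < e\<close> by (simp flip: ennreal_plus)
  finally show ?case .
  qed
 qed
qed

lemma trans_cont_add:
 assumes "trans_cont f" "trans_cont g"
 shows "trans_cont (%x. f x + g x)"
 unfolding trans_cont_def
proof (intro conjI allI impI)
 note fg = assms[unfolded trans_cont_def]
 show "in_L2 (%x. f x + g x)" using fg by (simp add: in_L2_add)
 fix z :: "nat => real^2" assume z: "z ~~> 0"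
 have [measurable]: "f \<in> bm" "g \<in> bm"
  using fg by (auto dest: in_L2_measurable')
 show "(%n. L2_norm (%x. f (x + z n) + g (x + z n) - (f x + g x))) ~~> 0"
 proof (rule tendsto_sandwich[OF _ _ tendsto_const])
  have "(%n. L2_norm (%x. f (x + z n) - f x) + L2_norm (%x. g (x + z n) - g x)) ~~> 0 + 0"
  using fg z by (intro tendsto_add) auto
  then show "(%n. L2_norm (%x. f (x + z n) - f x) + L2_norm (%x. g (x + z n) - g x)) ~~> 0"
  by simp
  show "\<forall>\<^sub>F n in sequentially. L2_norm (%x. f (x + z n) + g (x + z n) - (f x + g x))
  <= L2_norm (%x. f (x + z n) - f x) + L2_norm (%x. g (x + z n) - g x)"
  using L2_norm_add[of "%x. f (x + z n) - f x" "%x. g (x + z n) - g x" for n]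
  by (intro always_eventually allI) (auto simp: algebra_simps)
 qed auto
qed

lemma trans_cont_cmult:
 assumes "trans_cont f"
 shows "trans_cont (%x. c * f x)"
 unfolding trans_cont_def
proof (intro conjI allI impI)
 note f = assms[unfolded trans_cont_def]
 show "in_L2 (%x. c * f x)" using f by (simp add: in_L2_cmult)
 fix z :: "nat => real^2" assume z: "z ~~> 0"
 have [measurable]: "f \<in> bm"
  using f by (auto dest: in_L2_measurable')
 have "L2_norm (%x. c * f (x + z n) - c * f x) = ennreal (cmod c) * L2_norm (%x. f (x + z n) - f x)" for n
  by (subst L2_norm_cmult[symmetric]) (auto simp: algebra_simps)
 moreover have "(%n. ennreal (cmod c) * L2_norm (%x. f (x + z n) - f x)) ~~> ennreal (cmod c) * 0"
  using f z by (intro tendsto_mult_ennreal) auto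
 ultimately show "(%n. L2_norm (%x. c * f (x + z n) - c * f x)) ~~> 0" by simp
qed

lemma L2_norm_indicator:
 assumes "A \<in> sets borel"
 shows "(L2_norm (%x. indicator A x))^2 = emeasure lborel A"
proof -
 have "(L2_norm (%x. indicator A x))^2 = (NN x. indicator A x)"
  unfolding L2_norm_sq by (intro nn_integral_cong) (auto split: split_indicator)
 then show ?thesis using assms by simp
qed

lemma in_L2_indicator:
 assumes "A \<in> sets borel" "emeasure lborel A < \<infinity>"
 shows "in_L2 (%x. indicator A x)"
 unfolding in_L2_def
proof
 have "(L2_norm (%x. indicator A x))^2 < \<infinity>" using assms by (simp add: L2_norm_indicator)
 then show "L2_norm (%x. indicator A x) < \<infinity>"
  by (cases "L2_norm (%x. indicator A x)") (auto simp: top_power_ennreal)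
qed (use assms in auto)

lemma emeasure_lborel_shift:
 fixes z :: "real^2"
 assumes "A \<in> sets borel"
 shows "(NN x. indicator A (x + z)) = emeasure lborel A"
 using nn_integral_shift[of "indicator A" z] assms by simp

text \<open>For an open set \<open>U\<close> the overlap \<open>U \<inter> (U - z)\<close> tends to all of \<open>U\<close> in measure, because
 every point of \<open>U\<close> keeps its small translates inside \<open>U\<close>.\<close>

lemma trans_cont_open:
 assumes U: "open U" "emeasure lborel U < \<infinity>"
 shows "trans_cont (%x. indicator U x)"
 unfolding trans_cont_def
proof (intro conjI allI impI)
 have [measurable]: "U \<in> sets borel" using U by auto
 show "in_L2 (%x. indicator U x)" by (rule in_L2_indicator) (use U in auto)
 fix z :: "nat => real^2" assume z: "z ~~> 0"
 let ?I = "%n. (NN x. indicator U x * indicator U (x + z n))"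
 have "?I ~~> (NN x. indicator U x)"
 proof (rule nn_integral_dominated_convergence[where w="indicator U"])
  show "AEL x. (%n. indicator U x * indicator U (x + z n)) ~~> (indicator U x::ennreal)"
  proof (rule AE_I2)
  fix x :: "real^2"
  show "(%n. indicator U x * indicator U (x + z n)) ~~> (indicator U x::ennreal)"
  proof (cases "x \<in> U")
  case True
  have "(%n. x + z n) ~~> x + 0" using z by (intro tendsto_intros)
  then have "\<forall>\<^sub>F n in sequentially. x + z n \<in> U"
  using U(1) True by (auto dest: topological_tendstoD)
  then have "\<forall>\<^sub>F n in sequentially. indicator U x * indicator U (x + z n) = (indicator U x::ennreal)"
  by eventually_elim (use True in auto)
  then show ?thesis by (rule tendsto_eventually)
  qed auto
  qed
  show "(NN x. indicator U x) < \<infinity>" using U by simp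
 qed (auto split: split_indicator)
 then have lim: "?I ~~> emeasure lborel U" by simp
 have eq: "(L2_norm (%x. indicator U (x + z n) - indicator U x))^2 + 2 * ?I n = 2 * emeasure lborel U" for n
 proof -
  have "(L2_norm (%x. indicator U (x + z n) - indicator U x))^2 + 2 * ?I n
  = (NN x. ennreal ((cmod (indicator U (x + z n) - indicator U x))^2) + 2 * (indicator U x * indicator U (x + z n)))"
  unfolding L2_norm_sq by (subst nn_integral_add) (auto simp: nn_integral_cmult)
  also have "... = (NN x. indicator U (x + z n) + indicator U x)"
  by (intro nn_integral_cong) (auto split: split_indicator)
  also have "... = 2 * emeasure lborel U"
  by (subst nn_integral_add) (auto simp: emeasure_lborel_shift mult_2)
  finally show ?thesis .
 qed
 have fin: "?I n <= emeasure lborel U" for n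
 proof -
  have "?I n <= (NN x. indicator U x)"
  by (intro nn_integral_mono) (auto split: split_indicator)
  then show ?thesis by simp
 qed
 have Itop: "2 * ?I n \<noteq> top" for n
  using fin[of n] U(2) by (auto simp: ennreal_mult_eq_top_iff top_unique)
 have Utop: "2 * emeasure lborel U \<noteq> top"
  using U(2) by (auto simp: ennreal_mult_eq_top_iff)
 have sq: "(L2_norm (%x. indicator U (x + z n) - indicator U x))^2 = 2 * emeasure lborel U - 2 * ?I n" for n
  unfolding eq[of n, symmetric] using Itop by (rule ennreal_add_diff_cancel_right[symmetric])
 have "(%n. 2 * emeasure lborel U - 2 * ?I n) ~~> 2 * emeasure lborel U - 2 * emeasure lborel U"
  by (intro tendsto_diff_ennreal tendsto_const tendsto_mult_ennreal lim Utop) auto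
 also have "2 * emeasure lborel U - 2 * emeasure lborel U = 0"
  using Utop by (intro diff_eq_0_ennreal) (auto simp: less_top[symmetric])
 finally show "(%n. L2_norm (%x. indicator U (x + z n) - indicator U x)) ~~> 0"
  unfolding sq[symmetric] by (rule ennreal_tendsto_0_sq)
qed

lemma trans_cont_borel:
 assumes A: "A \<in> sets borel" "emeasure lborel A < \<infinity>"
 shows "trans_cont (%x. indicator A x)"
proof (rule trans_cont_limit)
 show "in_L2 (%x. indicator A x)" by (rule in_L2_indicator[OF A])
 fix e :: real assume "0 < e"
 then obtain U where U: "open U" "A \<subseteq> U" "emeasure lborel (U - A) < ennreal (e^2)"
  using outer_regular_lborel[OF A(1), of "e^2"] by (metis zero_less_power)
 have [measurable]: "U \<in> sets borel" "A \<in> sets borel" using U A by auto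
 have "emeasure lborel U = emeasure lborel A + emeasure lborel (U - A)"
  using U(2) by (subst plus_emeasure) (auto intro!: arg_cong[where f="emeasure lborel"])
 also have "... < \<infinity>" using A U by (auto simp: less_top[symmetric])
 finally have "trans_cont (%x. indicator U x)" by (intro trans_cont_open U)
 moreover have "(L2_norm (%x. indicator A x - indicator U x))^2 = (L2_norm (%x. indicator (U - A) x))^2"
  using U(2) by (auto simp: L2_norm_sq intro!: nn_integral_cong split: split_indicator)
 then have "(L2_norm (%x. indicator A x - indicator U x))^2 <= (ennreal e)^2"
  using U \<open>0 < e\<close> by (simp add: L2_norm_indicator ennreal_power)
 then have "L2_norm (%x. indicator A x - indicator U x) <= ennreal e"
  by (simp add: ennreal_sq_le_iff)
 ultimately show "\<exists>g. trans_cont g \<and> L2_norm (%x. indicator A x - g x) <= ennreal e" by blast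
qed

lemma trans_cont_L2:
 assumes f: "in_L2 f"
 shows "trans_cont f"
proof -
 note [measurable] = in_L2_measurable'[OF f]
 obtain F where F: "\<And>i::nat. simple_function lborel (F i)" "\<And>x. (%i. F i x) ~~> f x"
  "\<And>i x. cmod (F i x) <= 2 * cmod (f x)"
  using borel_measurable_implies_sequence_metric[of f lborel 0] by auto
 have Fm[measurable]: "F i \<in> borel_measurable lborel" for i
  using F(1) by (rule borel_measurable_simple_function)
 have FL2: "in_L2 (F i)" for i
  by (rule in_L2_bound(1)[OF f, of _ 2]) (use F in auto)
 have "trans_cont (F i)" for i
 proof -
  have fin: "finite (range (F i))" using F(1)[of i] by (simp add: simple_function_def)
  have rep: "F i = (%x. \<Sum>c\<in>range (F i) - {0}. c * indicator {x. F i x = c} x)"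
  proof
  fix x
  have "(\<Sum>c\<in>range (F i) - {0}. c * indicator {x. F i x = c} x)
  = (\<Sum>c\<in>range (F i) - {0}. if c = F i x then F i x else 0)"
  by (intro sum.cong) auto
  also have "... = F i x" using fin by (subst sum.delta) auto
  finally show "F i x = (\<Sum>c\<in>range (F i) - {0}. c * indicator {x. F i x = c} x)" ..
  qed
  have "trans_cont (%x. \<Sum>c\<in>C. c * indicator {x. F i x = c} x)" if "finite C" "0 \<notin> C" for C
  using that
  proof (induction C rule: finite_induct)
  case empty
  then show ?case by (simp add: trans_cont_def)
  next
  case (insert c C)
  have [measurable]: "{x. F i x = c} \<in> sets borel"
  using Fm[of i] by measurable
  have "in_L2 (%x. indicator {x. F i x = c} x)"
  proof (rule in_L2_bound(1)[OF FL2[of i], of _ "1 / cmod c"])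
  show "AEL x. cmod (indicator {x. F i x = c} x) <= 1 / cmod c * cmod (F i x)"
  using insert by (auto split: split_indicator)
  qed auto
  then have "(L2_norm (%x. indicator {x. F i x = c} x))^2 < \<infinity>" by (rule in_L2_sq_finite)
  then have "trans_cont (%x. indicator {x. F i x = c} x)"
  by (intro trans_cont_borel) (simp_all add: L2_norm_indicator)
  then show ?case
  unfolding sum.insert[OF insert.hyps]
  using insert.IH insert.prems by (intro trans_cont_add trans_cont_cmult) auto
  qed
  from this[of "range (F i) - {0}"] fin rep show ?thesis by simp
 qed
 moreover have "(%i. L2_norm (%x. F i x - f x)) ~~> 0"
 proof (rule L2_dominated)
  show "in_L2 (%x. 3 * f x)" using f by (rule in_L2_cmult)
  show "AEL x. cmod (F n x - f x) <= cmod (3 * f x)" for n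
  proof (rule AE_I2)
  fix x
  show "cmod (F n x - f x) <= cmod (3 * f x)"
  using F(3)[of n x] norm_triangle_ineq4[of "F n x" "f x"] by (simp add: norm_mult)
  qed
 qed (use F in auto)
 ultimately show ?thesis
 proof (intro trans_cont_limit[OF f])
  fix e :: real assume "0 < e" and T: "\<And>i. trans_cont (F i)" and L: "(%i. L2_norm (%x. F i x - f x)) ~~> 0"
  then have "\<forall>\<^sub>F i in sequentially. L2_norm (%x. F i x - f x) < ennreal e"
  by (intro order_tendstoD[OF L]) auto
  then obtain i where "L2_norm (%x. F i x - f x) < ennreal e" by (auto simp: eventually_sequentially)
  then show "\<exists>g. trans_cont g \<and> L2_norm (%x. f x - g x) <= ennreal e"
  using T by (intro exI[of _ "F i"]) (simp add: L2_norm_commute)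
 qed
qed

lemma L2_translation:
 assumes f: "in_L2 f" and e: "0 < e"
 shows "\<exists>d>0. \<forall>z. norm z < d --> nrm (%x. f (x + z) - f x) <= e"
proof (rule ccontr)
 assume "\<not> ?thesis"
 then have "\<forall>n. \<exists>z. norm z < 1 / real (Suc n) \<and> \<not> nrm (%x. f (x + z) - f x) <= e"
  by (metis of_nat_0_less_iff zero_less_Suc zero_less_divide_1_iff)
 then obtain z where z: "\<And>n. norm (z n) < 1 / real (Suc n)" "\<And>n. \<not> nrm (%x. f (x + z n) - f x) <= e"
  by metis
 have "(%n. norm (z n)) ~~> 0"
 proof (rule tendsto_sandwich[OF _ _ tendsto_const LIMSEQ_inverse_real_of_nat])
  show "\<forall>\<^sub>F n in sequentially. norm (z n) <= inverse (real (Suc n))"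
  using z(1) by (intro always_eventually allI) (simp add: inverse_eq_divide less_imp_le)
 qed simp
 then have "z ~~> 0" by (rule tendsto_norm_zero_cancel)
 then have "(%n. L2_norm (%x. f (x + z n) - f x)) ~~> 0"
  using trans_cont_L2[OF f] by (simp add: trans_cont_def)
 then have "\<forall>\<^sub>F n in sequentially. L2_norm (%x. f (x + z n) - f x) < ennreal e"
  by (rule order_tendstoD) (use e in auto)
 then obtain n where "L2_norm (%x. f (x + z n) - f x) < ennreal e" by (auto simp: eventually_sequentially)
 then have "nrm (%x. f (x + z n) - f x) <= e"
  using e f by (subst nrm_le_iff) (auto intro!: in_L2_diff in_L2_shift)
 with z(2)[of n] show False by simp
qed

section \<open>Plancherel's theorem in the plane\<close>

subsection \<open>Gaussians\<close>

lemma borel_measurable_cis [measurable]: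
 "f \<in> borel_measurable M ==> (%x. cis (f x)) \<in> borel_measurable M"
 by (rule measurable_compose[OF _ borel_measurable_continuous_onI]) (auto intro!: continuous_intros)

lemma borel_measurable_cnj [measurable]:
 "f \<in> borel_measurable M ==> (%x. cnj (f x)) \<in> borel_measurable M"
 by (rule measurable_compose[OF _ borel_measurable_continuous_onI]) (auto intro!: continuous_intros)

lemma gauss_integrable_real:
 assumes "0 < a"
 shows "integrable lborel (%t::real. exp (- pi * a * t^2))"
proof -
 define c where "c = sqrt (2 * pi * a)"
 have c: "c > 0" "c^2 = 2 * pi * a" using assms by (auto simp: c_def)
 have "integrable lborel (%t. sqrt (2 * pi) * std_normal_density (0 + c * t))"
  using c integrable_std_normal_moment[of 0]
  by (intro integrable_mult_right lborel_integrable_real_affine) auto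
 then show ?thesis
  using c by (simp add: std_normal_density_def power_mult_distrib mult.assoc)
qed

lemma gauss_fourier_real:
 assumes "0 < a"
 shows "(LB (t::real). cor (exp (- pi * a * t^2)) * cis (2 * pi * (y * t)))
  = cor (exp (- pi * y^2 / a) / sqrt a)"
proof -
 define c where "c = sqrt (2 * pi * a)"
 have c: "c > 0" "c^2 = 2 * pi * a" using assms by (auto simp: c_def)
 define s where "s = 2 * pi * y / c"
 have "cor (exp (- (s^2) / 2)) = char std_normal_distribution s"
  by (simp add: char_std_normal_distribution)
 also have "... = (LB u. std_normal_density u *\<^sub>R iexp (s * u))"
  unfolding char_def by (subst integral_density) (auto simp: normal_density_nonneg)
 also have "... = \<bar>c\<bar> *\<^sub>R (LB t. std_normal_density (0 + c * t) *\<^sub>R iexp (s * (0 + c * t)))"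
  by (rule lborel_integral_real_affine) (use c in auto)
 also have "(%t. std_normal_density (0 + c * t) *\<^sub>R iexp (s * (0 + c * t)))
  = (%t. (1 / sqrt (2 * pi)) *\<^sub>R (cor (exp (- pi * a * t^2)) * cis (2 * pi * (y * t))))"
  using c by (auto simp: fun_eq_iff std_normal_density_def power_mult_distrib s_def cis_conv_exp
  scaleR_conv_of_real algebra_simps)
 finally have *: "cor (exp (- (s^2) / 2))
  = (c / sqrt (2 * pi)) *\<^sub>R (LB t. cor (exp (- pi * a * t^2)) * cis (2 * pi * (y * t)))"
  using c by (simp add: scaleR_conv_of_real)
 have "c / sqrt (2 * pi) = sqrt a" by (simp add: c_def real_sqrt_mult)
 moreover have "- (s^2) / 2 = - pi * y^2 / a"
  using c assms by (simp add: s_def power_divide power_mult_distrib power2_eq_square field_simps)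
 ultimately have "cor (exp (- pi * y^2 / a))
  = cor (sqrt a) * (LB (t::real). cor (exp (- pi * a * t^2)) * cis (2 * pi * (y * t)))"
  using * by (simp only: scaleR_conv_of_real)
 moreover have "cor (sqrt a) \<noteq> 0" using assms by simp
 ultimately show ?thesis by (simp only: of_real_divide nonzero_mult_div_cancel_left not_False_eq_True)
qed

lemma prod_Basis_2: "(\<Prod>b\<in>Basis. F b) = F (axis (1::2) (1::real)) * F (axis 2 1)"
proof -
 have "(Basis::(real^2) set) = {axis 1 1, axis 2 1}"
  by (auto simp: Basis_vec_def UNIV_2)
 then have "prod F Basis = prod F {axis 1 1, axis 2 1}" by (rule arg_cong)
 then show ?thesis by (simp add: axis_eq_axis)
qed

lemma lborel_integral_product:
 fixes f g :: "real => complex"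
 assumes f: "integrable lborel f" and g: "integrable lborel g"
 shows "integrable lborel (%x::real^2. f (x$1) * g (x$2))"
  and "(LB (x::real^2). f (x$1) * g (x$2)) = (LB x. f x) * (LB x. g x)"
proof -
 interpret product_sigma_finite "%_::real^2. lborel :: real measure" by standard
 define F where "F b = (if b = (axis 1 1 :: real^2) then f else g)" for b
 have neq: "axis 2 1 \<noteq> (axis 1 1 :: real^2)" by (simp add: axis_eq_axis)
 have F: "integrable lborel (F b)" for b using f g by (auto simp: F_def)
 have [measurable]: "f \<in> bm" "g \<in> bm" using f g by auto
 have rep: "(%x::real^2 => real. f ((\<Sum>b\<in>Basis. x b *\<^sub>R b)$1) * g ((\<Sum>b\<in>Basis. x b *\<^sub>R b)$2))
  = (%x. \<Prod>b\<in>Basis. F b (x b))"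
 proof
  fix x :: "real^2 => real"
  have "(\<Sum>b\<in>Basis. x b *\<^sub>R b) $ i = x (axis i 1)" for i
  proof -
  have "(\<Sum>b\<in>Basis. x b *\<^sub>R b) $ i = (\<Sum>b\<in>Basis. x b *\<^sub>R b) \<bullet> axis i 1"
  by (simp add: inner_axis)
  also have "... = x (axis i 1)"
  by (rule inner_sum_left_Basis) (auto simp: axis_in_Basis_iff)
  finally show ?thesis .
  qed
  then show "f ((\<Sum>b\<in>Basis. x b *\<^sub>R b)$1) * g ((\<Sum>b\<in>Basis. x b *\<^sub>R b)$2) = (\<Prod>b\<in>Basis. F b (x b))"
  by (simp add: prod_Basis_2 F_def neq)
 qed
 show "integrable lborel (%x::real^2. f (x$1) * g (x$2))"
  unfolding lborel_eq[where 'a="real^2"]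
 proof (rule integrable_distr_eq[THEN iffD2])
  show "integrable (\<Pi>\<^sub>M b\<in>Basis. lborel) (%x::real^2 => real. f ((\<Sum>b\<in>Basis. x b *\<^sub>R b)$1) * g ((\<Sum>b\<in>Basis. x b *\<^sub>R b)$2))"
  unfolding rep by (intro product_integrable_prod F) auto
 qed measurable
 have "(LB (x::real^2). f (x$1) * g (x$2))
  = (\<integral>x. (\<Prod>b\<in>Basis. F b (x b)) \<partial>(\<Pi>\<^sub>M b\<in>Basis. lborel))"
  unfolding lborel_eq[where 'a="real^2"]
  by (subst integral_distr) (measurable, simp only: rep)
 also have "... = (\<Prod>b\<in>Basis. integral\<^sup>L lborel (F b))"
  by (rule product_integral_prod) (auto intro: F)
 also have "... = (LB x. f x) * (LB x. g x)"
  by (simp add: prod_Basis_2 F_def neq)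
 finally show "(LB (x::real^2). f (x$1) * g (x$2)) = (LB x. f x) * (LB x. g x)" .
qed

lemma norm_sq_2: "(norm (x::real^2))^2 = (x$1)^2 + (x$2)^2"
 by (simp add: norm_vec_def L2_set_def sum_2)

lemma inner_2: "(x::real^2) \<bullet> y = x$1 * y$1 + x$2 * y$2"
 by (simp add: inner_vec_def sum_2)

lemma gauss_fourier:
 assumes "0 < a"
 shows "integrable lborel (%om::real^2. cor (exp (- pi * a * (norm om)^2)) * cis (2 * pi * (x \<bullet> om)))"
  and "(LB (om::real^2). cor (exp (- pi * a * (norm om)^2)) * cis (2 * pi * (x \<bullet> om)))
  = cor (exp (- pi * (norm x)^2 / a) / a)"
proof -
 define F where "F y t = cor (exp (- pi * a * t^2)) * cis (2 * pi * (y * t))" for y t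
 have F: "integrable lborel (F y)" for y
 proof (rule Bochner_Integration.integrable_bound[OF gauss_integrable_real[OF assms]])
  show "F y \<in> borel_measurable lborel" unfolding F_def by measurable
 qed (auto simp: F_def norm_mult)
 have eq: "(%om::real^2. cor (exp (- pi * a * (norm om)^2)) * cis (2 * pi * (x \<bullet> om)))
  = (%om. F (x$1) (om$1) * F (x$2) (om$2))"
  by (auto simp: fun_eq_iff F_def norm_sq_2 inner_2 exp_add[symmetric] cis_mult[symmetric] distrib_left
  simp flip: of_real_mult)
 show "integrable lborel (%om::real^2. cor (exp (- pi * a * (norm om)^2)) * cis (2 * pi * (x \<bullet> om)))"
  unfolding eq by (rule lborel_integral_product F)+
 have "(LB (om::real^2). F (x$1) (om$1) * F (x$2) (om$2))
  = cor (exp (- pi * (x$1)^2 / a) / sqrt a) * cor (exp (- pi * (x$2)^2 / a) / sqrt a)"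
  unfolding lborel_integral_product(2)[OF F F] unfolding F_def gauss_fourier_real[OF assms] ..
 also have "... = cor (exp (- pi * (norm x)^2 / a) / a)"
 proof -
  have "exp (- pi * (norm x)^2 / a) = exp (- pi * (x$1)^2 / a) * exp (- pi * (x$2)^2 / a)"
  by (simp add: norm_sq_2 distrib_left add_divide_distrib diff_divide_distrib flip: exp_add)
  moreover have "sqrt a * sqrt a = a" using assms by simp
  ultimately show ?thesis by (simp only: of_real_mult[symmetric] times_divide_times_eq)
 qed
 finally show "(LB (om::real^2). cor (exp (- pi * a * (norm om)^2)) * cis (2 * pi * (x \<bullet> om)))
  = cor (exp (- pi * (norm x)^2 / a) / a)"
  unfolding eq .
qed

text \<open>The Gaussian of total mass 1 at scale \<open>a powr (-1/2)\<close>.\<close>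

definition gauss :: "real => real^2 => real" where
 "gauss a x = a * exp (- pi * a * (norm x)^2)"

lemma gauss_measurable [measurable]: "gauss a \<in> bm"
 unfolding gauss_def by measurable

lemma gauss_nonneg: "0 < a ==> 0 <= gauss a x"
 by (simp add: gauss_def)

lemma gauss_le: "0 < a ==> gauss a x <= a"
 by (simp add: gauss_def)

lemma gauss_minus: "gauss a (- x) = gauss a x"
 by (simp add: gauss_def)

lemma gauss_integral:
 assumes "0 < a"
 shows "integrable lborel (gauss a)" "(LB x. gauss a x) = 1"
proof -
 have 1: "integrable lborel (%x. cor (exp (- pi * a * (norm (x::real^2))^2)))"
  using gauss_fourier(1)[OF assms, of 0] by simp
 then have "integrable lborel (%x. exp (- pi * a * (norm (x::real^2))^2))"
  by (simp only: complex_of_real_integrable_eq)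
 then show "integrable lborel (gauss a)" unfolding gauss_def by simp
 have "cor (LB (x::real^2). exp (- pi * a * (norm x)^2)) = cor (1 / a)"
  using gauss_fourier(2)[OF assms, of 0] by (simp flip: integral_complex_of_real)
 then have "(LB (x::real^2). exp (- pi * a * (norm x)^2)) = 1 / a"
  by (simp only: of_real_eq_iff)
 then show "(LB x. gauss a x) = 1" using assms unfolding gauss_def by simp
qed

lemma gauss_second_moment:
 assumes "0 < a"
 shows "integrable lborel (%x. gauss a x * (norm x)^2)"
  and "(LB x. gauss a x * (norm x)^2) <= 4 / (pi * a)"
proof -
 have le: "gauss a x * (norm x)^2 <= 4 / (pi * a) * gauss (a/2) x" for x
 proof -
  define u where "u = pi * (a/2) * (norm x)^2"
  have "u <= exp u" using exp_ge_add_one_self[of u] by linarith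
  then have "exp (-u) * (u * exp (-u)) <= exp (-u) * 1"
  by (intro mult_left_mono) (auto simp: exp_minus field_simps)
  moreover have "gauss a x * (norm x)^2 = (2 / pi) * (exp (-u) * (u * exp (-u)))"
  using assms by (simp add: gauss_def u_def field_simps flip: exp_add)
  moreover have "4 / (pi * a) * gauss (a/2) x = (2/pi) * exp (-u)"
  using assms by (simp add: gauss_def u_def field_simps)
  ultimately show ?thesis by (simp only: mult_le_cancel_left) (simp add: mult_left_mono)
 qed
 have g: "integrable lborel (%x. 4 / (pi * a) * gauss (a/2) x)"
  using assms by (intro integrable_mult_right gauss_integral) auto
 show i: "integrable lborel (%x. gauss a x * (norm x)^2)"
  by (rule Bochner_Integration.integrable_bound[OF g]) (use le assms gauss_nonneg in \<open>auto simp: abs_mult\<close>)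
 have "(LB x. gauss a x * (norm x)^2) <= (LB x. 4 / (pi * a) * gauss (a/2) x)"
  by (rule integral_mono[OF i g le])
 also have "... = 4 / (pi * a)" using assms by (simp add: gauss_integral)
 finally show "(LB x. gauss a x * (norm x)^2) <= 4 / (pi * a)" .
qed

subsection \<open>Fourier integrals\<close>

lemma integrable_product_pair:
 fixes f g :: "real^2 => complex"
 assumes f: "integrable lborel f" and g: "integrable lborel g"
  and k[measurable]: "k \<in> borel_measurable (lborel \<Otimes>\<^sub>M lborel)" and bd: "\<And>p. cmod (k p) <= B"
 shows "integrable (lborel \<Otimes>\<^sub>M lborel) (%(x, y). f x * (k (x, y) * g y))"
proof -
 have [measurable]: "f \<in> bm" "g \<in> bm" using f g by auto
 have 1: "integrable (lborel \<Otimes>\<^sub>M lborel) (%(x, y). f x * g y)"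
 proof (rule lborel_pair.Fubini_integrable)
  show "(%(x, y). f x * g y) \<in> borel_measurable (lborel \<Otimes>\<^sub>M lborel)" by measurable
  show "integrable lborel (%x. (LB y. norm (case (x, y) of (x, y) => f x * g y)))"
  using f by (simp add: norm_mult)
  show "AEL x. integrable lborel (%y. case (x, y) of (x, y) => f x * g y)"
  using g by simp
 qed
 have B: "0 <= B" using bd[of undefined] norm_ge_zero order_trans by blast
 show ?thesis
 proof (rule Bochner_Integration.integrable_bound)
  show "integrable (lborel \<Otimes>\<^sub>M lborel) (%p. of_real B * (case p of (x, y) => f x * g y))"
  using 1 by (rule integrable_mult_right)
  show "(%(x, y). f x * (k (x, y) * g y)) \<in> borel_measurable (lborel \<Otimes>\<^sub>M lborel)" by measurable
  have "cmod (f x) * (cmod (k (x, y)) * cmod (g y)) <= B * (cmod (f x) * cmod (g y))" for x y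
  using mult_right_mono[OF bd[of "(x, y)"], of "cmod (f x) * cmod (g y)"] by (simp add: algebra_simps)
  then show "AE p in lborel \<Otimes>\<^sub>M lborel. norm (case p of (x, y) => f x * (k (x, y) * g y))
  <= norm (of_real B * (case p of (x, y) => f x * g y))"
  using B by (auto simp: norm_mult)
 qed
qed

lemma fubini_kernel:
 fixes f g :: "real^2 => complex"
 assumes f: "integrable lborel f" and g: "integrable lborel g"
  and k[measurable]: "k \<in> borel_measurable (lborel \<Otimes>\<^sub>M lborel)" and bd: "\<And>p. cmod (k p) <= B"
 shows "(LB x. f x * (LB y. k (x, y) * g y))
  = (LB y. (LB x. f x * k (x, y)) * g y)"
proof -
 have [measurable]: "f \<in> bm" "g \<in> bm" using f g by auto
 have B: "0 <= B" using bd[of undefined] norm_ge_zero order_trans by blast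
 have i1: "integrable lborel (%y. k (x, y) * g y)" for x
 proof (rule Bochner_Integration.integrable_bound)
  show "integrable lborel (%y. B *\<^sub>R g y)" using g by simp
  show "AEL y. norm (k (x, y) * g y) <= norm (B *\<^sub>R g y)"
  using bd B by (auto simp: norm_mult intro!: mult_right_mono)
 qed measurable
 have i2: "integrable lborel (%x. f x * k (x, y))" for y
 proof (rule Bochner_Integration.integrable_bound)
  show "integrable lborel (%y. B *\<^sub>R f y)" using f by simp
  show "AEL x. norm (f x * k (x, y)) <= norm (B *\<^sub>R f x)"
  using bd B by (auto simp: norm_mult mult.commute[of B] intro!: mult_left_mono)
 qed measurable
 have "(LB x. f x * (LB y. k (x, y) * g y)) = (LB x. (LB y. f x * (k (x, y) * g y)))"
  using i1 by simp
 also have "... = (LB y. (LB x. f x * (k (x, y) * g y)))"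
  using lborel_pair.Fubini_integral[OF integrable_product_pair[OF f g k bd]] by simp
 also have "... = (LB y. (LB x. f x * k (x, y)) * g y)"
  using i2 by (simp add: mult.assoc[symmetric])
 finally show ?thesis .
qed

lemma fourier_integrable: "integrable lborel f ==> integrable lborel (%x. cis (- (2 * pi * (x \<bullet> om))) * f x)"
 by (frule borel_measurable_integrable, erule Bochner_Integration.integrable_bound) (auto simp: norm_mult)

lemma fourier_measurable [measurable]:
 assumes [measurable]: "f \<in> bm"
 shows "fourier f \<in> bm"
 unfolding fourier_def[abs_def] by measurable

lemma fourier_bound: "integrable lborel f ==> cmod (fourier f om) <= (LB x. cmod (f x))"
 unfolding fourier_def by (rule order_trans[OF integral_norm_bound]) (simp add: norm_mult)

lemma fourier_diff:
 "integrable lborel f ==> integrable lborel g ==> fourier (%x. f x - g x) om = fourier f om - fourier g om"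
 unfolding fourier_def
 by (subst Bochner_Integration.integral_diff[symmetric]) (auto simp: right_diff_distrib intro: fourier_integrable)

lemma cnj_fourier: "cnj (fourier f om) = (LB x. cis (2 * pi * (x \<bullet> om)) * cnj (f x))"
 unfolding fourier_def by (subst Bochner_Integration.integral_cnj[symmetric]) (simp add: cis_cnj)

text \<open>Damping the Fourier integral by a Gaussian turns \<open>\<integral> |fourier f|\<^sup>2\<close> into an average of the
 autocorrelation of \<open>f\<close> over a small neighbourhood of the origin.\<close>

lemma plancherel_damped:
 assumes f: "integrable lborel f" "in_L2 f" and a: "0 < a"
 shows "(LB om. cor (exp (- pi * (norm om)^2 / a)) * (fourier f om * cnj (fourier f om)))
  = (LB z. cor (gauss a z) * ip (%y. f (y - z)) f)"
proof -
 note [measurable] = in_L2_measurable'[OF f(2)]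
 define h where "h om = cor (exp (- pi * (norm (om::real^2))^2 / a))" for om
 have [measurable]: "h \<in> bm" unfolding h_def by measurable
 have hg: "integrable lborel (%om. h om * cis (2 * pi * (x \<bullet> om)))"
  "(LB om. h om * cis (2 * pi * (x \<bullet> om))) = cor (gauss a x)" for x
  using gauss_fourier[of "1/a" x] a by (simp_all add: h_def gauss_def mult.commute[of a])
 have h: "integrable lborel h" using hg(1)[of 0] by simp
 have hf: "integrable lborel (%om. h om * fourier f om)"
 proof (rule Bochner_Integration.integrable_bound)
  show "integrable lborel (%om. h om * of_real (LB x. cmod (f x)))" using h by simp
  show "AEL om. norm (h om * fourier f om) <= norm (h om * of_real (LB x. cmod (f x)))"
  using fourier_bound[OF f(1)] by (auto simp: norm_mult intro!: mult_left_mono intro: order_trans[OF _ abs_ge_self])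
 qed measurable
 have cf: "integrable lborel (%x. cnj (f x))" using f by simp
 have "(LB om. h om * (fourier f om * cnj (fourier f om)))
  = (LB om. (h om * fourier f om) * (LB y. (case (om, y) of (om, y) => cis (2 * pi * (y \<bullet> om))) * cnj (f y)))"
  by (simp add: cnj_fourier mult.assoc)
 also have "... = (LB y. (LB om. (h om * fourier f om) * (case (om, y) of (om, y) => cis (2 * pi * (y \<bullet> om)))) * cnj (f y))"
  by (rule fubini_kernel[OF hf cf, where B=1]) auto
 also have "... = (LB y. (LB z. cor (gauss a z) * f (y - z)) * cnj (f y))"
 proof (rule bcong[OF refl])
  fix y
  have "(LB om. (h om * fourier f om) * cis (2 * pi * (y \<bullet> om)))
  = (LB om. (h om * cis (2 * pi * (y \<bullet> om))) * (LB x. (case (om, x) of (om, x) => cis (- (2 * pi * (x \<bullet> om)))) * f x))"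
  by (simp add: fourier_def mult_ac)
  also have "... = (LB x. (LB om. (h om * cis (2 * pi * (y \<bullet> om))) * (case (om, x) of (om, x) => cis (- (2 * pi * (x \<bullet> om))))) * f x)"
  by (rule fubini_kernel[OF hg(1) f(1), where B=1]) auto
  also have "... = (LB x. cor (gauss a (y - x)) * f x)"
  by (simp add: mult.assoc cis_mult hg(2)[symmetric] inner_diff_left algebra_simps)
  also have "... = (LB z. cor (gauss a z) * f (y - z))"
  using integral_reflect_shift(1)[of "%z. cor (gauss a z) * f (y - z)" y] by simp
  finally show "(LB om. (h om * fourier f om) * (case (om, y) of (om, y) => cis (2 * pi * (y \<bullet> om)))) * cnj (f y)
  = (LB z. cor (gauss a z) * f (y - z)) * cnj (f y)"
  by simp
 qed
 also have "... = (LB y. (LB z. cor (gauss a z) * (f (y - z) * cnj (f y))))"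
  by (simp add: mult.assoc flip: integral_mult_left_zero)
 also have "... = (LB z. (LB y. cor (gauss a z) * (f (y - z) * cnj (f y))))"
 proof (rule lborel_pair.Fubini_integral)
  show "integrable (lborel \<Otimes>\<^sub>M lborel) (%(z, y). cor (gauss a z) * (f (y - z) * cnj (f y)))"
  proof (rule integrableI_bounded)
  have cL: "in_L2 (%y. cnj (f y))" using f(2) by (rule in_L2_cnj)
  have "(\<integral>\<^sup>+ p. ennreal (norm (case p of (z, y) => cor (gauss a z) * (f (y - z) * cnj (f y)))) \<partial>(lborel \<Otimes>\<^sub>M lborel))
  = (NN z. (NN y. ennreal (gauss a z) * (ennreal (cmod (f (y - z))) * ennreal (cmod (f y)))))"
  using a by (subst lborel.nn_integral_fst[symmetric]) (auto simp: norm_mult ennreal_mult gauss_nonneg)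
  also have "... <= (NN z. ennreal (gauss a z) * (L2_norm f * L2_norm f))"
  proof (rule nn_integral_mono)
  fix z :: "real^2"
  have "(NN y. ennreal (cmod (f (y - z))) * ennreal (cmod (f y))) <= L2_norm (%y. f (y - z)) * L2_norm f"
  unfolding L2_norm_l2n by (rule l2n_holder) auto
  also have "L2_norm (%y. f (y - z)) = L2_norm f" using L2_norm_shift[of f "-z"] by simp
  finally show "(NN y. ennreal (gauss a z) * (ennreal (cmod (f (y - z))) * ennreal (cmod (f y))))
  <= ennreal (gauss a z) * (L2_norm f * L2_norm f)"
  by (subst nn_integral_cmult) (auto intro: mult_left_mono)
  qed
  also have "... = L2_norm f * L2_norm f"
  using gauss_integral[OF a] a by (simp add: nn_integral_multc nn_integral_eq_integral gauss_nonneg)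
  also have "... < \<infinity>" using in_L2_finite[OF f(2)] by (simp add: ennreal_mult_less_top)
  finally show "(\<integral>\<^sup>+ p. ennreal (norm (case p of (z, y) => cor (gauss a z) * (f (y - z) * cnj (f y)))) \<partial>(lborel \<Otimes>\<^sub>M lborel)) < \<infinity>" .
  qed measurable
 qed
 also have "... = (LB z. cor (gauss a z) * ip (%y. f (y - z)) f)"
  by (simp add: ip_def)
 finally show ?thesis unfolding h_def .
qed

lemma ip_shift_measurable:
 assumes [measurable]: "f \<in> bm"
 shows "(%z. ip (%y. f (y - z)) f) \<in> bm"
 unfolding ip_def by measurable

theorem plancherel_L1_L2:
 assumes f: "integrable lborel f" "in_L2 f"
 shows "in_L2 (fourier f)" "L2_norm (fourier f) = L2_norm f"
proof -
 note [measurable] = in_L2_measurable'[OF f(2)]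
 define I where "I n = (NN om. ennreal (exp (- pi * (norm om)^2 / real (Suc n))) * ennreal ((cmod (fourier f om))^2))" for n
 have lim1: "I ~~> (NN om. ennreal ((cmod (fourier f om))^2))"
  unfolding I_def
 proof (rule nn_integral_LIMSEQ)
  show "incseq (%n om. ennreal (exp (- pi * (norm om)^2 / real (Suc n))) * ennreal ((cmod (fourier f om))^2))"
  by (auto simp: incseq_def le_fun_def intro!: mult_right_mono ennreal_leI divide_left_mono)
  fix om :: "real^2"
  have "(%n. exp ((- pi * (norm om)^2) * inverse (real (Suc n)))) ~~> exp ((- pi * (norm om)^2) * 0)"
  by (intro tendsto_intros LIMSEQ_inverse_real_of_nat)
  then have "(%n. ennreal (exp (- pi * (norm om)^2 / real (Suc n)) * (cmod (fourier f om))^2)) ~~> ennreal (1 * (cmod (fourier f om))^2)"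
  by (intro tendsto_ennrealI tendsto_mult tendsto_const) (simp add: divide_inverse)
  then show "(%n. ennreal (exp (- pi * (norm om)^2 / real (Suc n))) * ennreal ((cmod (fourier f om))^2)) ~~> ennreal ((cmod (fourier f om))^2)"
  by (simp add: ennreal_mult)
 qed measurable
 have key: "\<exists>r. I n = ennreal r \<and> 0 <= r \<and> \<bar>r - (nrm f)\<^sup>2\<bar> <= nrm f * (e + 2 * nrm f * (4 / (pi * real (Suc n))) / d^2)"
  if d: "0 < d" "\<And>z. norm z < d ==> nrm (%x. f (x + z) - f x) <= e" and e: "0 < e" for n d e
 proof -
  define a where "a = real (Suc n)"
  have a: "0 < a" by (simp add: a_def)
  define D where "D = (%om. exp (- pi * (norm (om::real^2))^2 / a) * (cmod (fourier f om))^2)"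
  have [measurable]: "D \<in> bm" unfolding D_def by measurable
  have "(%om::real^2. exp (- pi * (norm om)^2 / a)) = (%om. a * gauss (1/a) om)"
  using a by (simp add: gauss_def fun_eq_iff)
  then have "integrable lborel (%om::real^2. exp (- pi * (norm om)^2 / a))"
  using gauss_integral(1)[of "1/a"] a by simp
  then have "integrable lborel (%om::real^2. exp (- pi * (norm om)^2 / a) * (LB x. cmod (f x))^2)"
  by (intro integrable_mult_left)
  then have Dint: "integrable lborel D"
  proof (rule Bochner_Integration.integrable_bound)
  have "(cmod (fourier f om))^2 <= (LB x. cmod (f x))^2" for om
  by (intro power_mono fourier_bound f norm_ge_zero)
  then show "AEL om. norm (D om) <= norm (exp (- pi * (norm om)^2 / a) * (LB x. cmod (f x))^2)"
  unfolding D_def by (intro AE_I2) (simp add: abs_mult mult_left_mono)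
  qed measurable
  define r where "r = (LB om. D om)"
  have In: "I n = ennreal r"
  unfolding r_def using Dint
  by (subst nn_integral_eq_integral[symmetric]) (auto simp: I_def D_def a_def ennreal_mult)
  have r0: "0 <= r" unfolding r_def by (intro integral_nonneg_AE) (auto simp: D_def)
  have "cor r = (LB om. cor (exp (- pi * (norm om)^2 / a)) * (fourier f om * cnj (fourier f om)))"
  proof -
  have "cor r = (LB om. cor (D om))" unfolding r_def by simp
  also have "... = (LB om. cor (exp (- pi * (norm om)^2 / a)) * (fourier f om * cnj (fourier f om)))"
  unfolding D_def of_real_mult complex_norm_square ..
  finally show ?thesis .
  qed
  also have "... = (LB z. cor (gauss a z) * ip (%y. f (y - z)) f)"
  by (rule plancherel_damped[OF f a])
  finally have r1: "cor r = (LB z. cor (gauss a z) * ip (%y. f (y - z)) f)" .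
  note [measurable] = ip_shift_measurable[of f]
  have sh: "in_L2 (%y. f (y - z))" for z using in_L2_shift[OF f(2), of "-z"] by simp
  have shn: "nrm (%y. f (y - z)) = nrm f" for z
  using L2_norm_shift[of f "-z"] by (simp add: nrm_def)
  have g: "integrable lborel (%z. cor (gauss a z))"
  using gauss_integral(1)[OF a] by simp
  have i1: "integrable lborel (%z. cor (gauss a z) * ip (%y. f (y - z)) f)"
  proof (rule Bochner_Integration.integrable_bound)
  show "integrable lborel (%z. cor (gauss a z) * of_real ((nrm f)^2))" using g by simp
  show "AEL z. norm (cor (gauss a z) * ip (%y. f (y - z)) f) <= norm (cor (gauss a z) * of_real ((nrm f)^2))"
  using ip_cauchy[OF sh f(2)] by (auto simp: norm_mult shn power2_eq_square intro!: mult_left_mono)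
  qed measurable
  have i2: "integrable lborel (%z. cor (gauss a z) * ip f f)" using g by simp
  have "cor (r - (nrm f)^2) = (LB z. cor (gauss a z) * ip (%y. f (y - z)) f)
  - (LB z. cor (gauss a z) * ip f f)"
  proof -
  have "(LB z. cor (gauss a z) * ip f f) = ip f f"
  using gauss_integral(2)[OF a] by simp
  then show ?thesis unfolding of_real_diff r1 ip_self[OF f(2)] by simp
  qed
  also have "... = (LB z. cor (gauss a z) * ip (%y. f (y - z)) f - cor (gauss a z) * ip f f)"
  by (rule Bochner_Integration.integral_diff[OF i1 i2, symmetric])
  finally have "cmod (cor (r - (nrm f)^2)) <=
  (LB z. cmod (cor (gauss a z) * ip (%y. f (y - z)) f - cor (gauss a z) * ip f f))"
  by (simp only: integral_norm_bound)
  also have "... <= (LB z. nrm f * (e * gauss a z + 2 * nrm f / d^2 * (gauss a z * (norm z)^2)))"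
  proof (rule integral_mono)
  show "integrable lborel (%z. cmod (cor (gauss a z) * ip (%y. f (y - z)) f - cor (gauss a z) * ip f f))"
  using i1 i2 by (intro integrable_norm Bochner_Integration.integrable_diff)
  show "integrable lborel (%z. nrm f * (e * gauss a z + 2 * nrm f / d^2 * (gauss a z * (norm z)^2)))"
  using gauss_integral(1)[OF a] gauss_second_moment(1)[OF a]
  by (intro integrable_mult_right Bochner_Integration.integrable_add)
  fix z
  have "cmod (ip (%y. f (y - z)) f - ip f f) = cmod (ip (%y. f (y - z) - f y) f)"
  by (simp add: ip_diff_left sh f(2))
  also have "... <= nrm (%y. f (y - z) - f y) * nrm f"
  by (intro ip_cauchy in_L2_diff sh f(2))
  also have "... <= (e + 2 * nrm f / d^2 * (norm z)^2) * nrm f"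
  proof (intro mult_right_mono)
  show "nrm (%y. f (y - z) - f y) <= e + 2 * nrm f / d^2 * (norm z)^2"
  proof (cases "norm z < d")
  case True
  then have "nrm (%y. f (y - z) - f y) <= e" using d(2)[of "-z"] by simp
  then show ?thesis using d(1) by (simp add: add_increasing2)
  next
  case False
  then have "1 <= (norm z)^2 / d^2" using d(1) by (simp add: power_mono)
  then have "2 * nrm f * 1 <= 2 * nrm f * ((norm z)^2 / d^2)" by (intro mult_left_mono) auto
  moreover have "nrm (%y. f (y - z) - f y) <= nrm f + nrm f"
  using nrm_diff[OF sh f(2)] by (simp add: shn)
  ultimately show ?thesis using e by simp
  qed
  qed auto
  finally have "cmod (ip (%y. f (y - z)) f - ip f f) <= nrm f * (e + 2 * nrm f / d^2 * (norm z)^2)"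
  by (simp add: mult.commute)
  then have "gauss a z * cmod (ip (%y. f (y - z)) f - ip f f) <= gauss a z * (nrm f * (e + 2 * nrm f / d^2 * (norm z)^2))"
  by (intro mult_left_mono gauss_nonneg a)
  moreover have "cmod (cor (gauss a z) * ip (%y. f (y - z)) f - cor (gauss a z) * ip f f)
  = gauss a z * cmod (ip (%y. f (y - z)) f - ip f f)"
  unfolding right_diff_distrib[symmetric] norm_mult using gauss_nonneg[OF a, of z] by simp
  moreover have "gauss a z * (nrm f * (e + 2 * nrm f / d^2 * (norm z)^2))
  = nrm f * (e * gauss a z + 2 * nrm f / d^2 * (gauss a z * (norm z)^2))"
  by (simp only: distrib_left mult_ac)
  ultimately show "cmod (cor (gauss a z) * ip (%y. f (y - z)) f - cor (gauss a z) * ip f f)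
  <= nrm f * (e * gauss a z + 2 * nrm f / d^2 * (gauss a z * (norm z)^2))"
  by (simp only:)
  qed
  also have "... = nrm f * (e + 2 * nrm f / d^2 * (LB z. gauss a z * (norm z)^2))"
  using gauss_integral[OF a] gauss_second_moment(1)[OF a] by simp
  also have "... <= nrm f * (e + 2 * nrm f / d^2 * (4 / (pi * a)))"
  using gauss_second_moment(2)[OF a] by (intro mult_left_mono add_left_mono) auto
  finally have "\<bar>r - (nrm f)\<^sup>2\<bar> <= nrm f * (e + 2 * nrm f * (4 / (pi * a)) / d^2)"
  by (simp only: norm_of_real) (simp only: times_divide_eq_left)
  with In r0 show ?thesis unfolding a_def by blast
 qed
 obtain d where d: "0 < d" "\<And>z. norm z < d ==> nrm (%x. f (x + z) - f x) <= 1"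
  using L2_translation[OF f(2), of 1] by auto
 have "\<forall>n. \<exists>r. I n = ennreal r \<and> 0 <= r"
  using key[OF d zero_less_one] by blast
 then obtain r where r: "\<And>n. I n = ennreal (r n)" "\<And>n. 0 <= r n" by metis
 have "r ~~> (nrm f)\<^sup>2"
 proof (rule LIMSEQ_I)
  fix \<epsilon> :: real assume \<epsilon>: "0 < \<epsilon>"
  define e where "e = \<epsilon> / (2 * (nrm f + 1))"
  have n1: "nrm f + 1 > 0" using nrm_nonneg[of f] by linarith
  have e: "0 < e" using \<epsilon> n1 by (simp add: e_def)
  have ne: "nrm f * e <= \<epsilon> / 2"
  proof -
  have "nrm f * e <= (nrm f + 1) * e" using e by (intro mult_right_mono) auto
  also have "... = \<epsilon> / 2" using n1 by (simp add: e_def field_simps)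
  finally show ?thesis .
  qed
  obtain d where d: "0 < d" "\<And>z. norm z < d ==> nrm (%x. f (x + z) - f x) <= e"
  using L2_translation[OF f(2) e] by blast
  define K where "K = nrm f * (2 * nrm f * (4 / pi) / d^2)"
  have "(%n. K * inverse (real (Suc n))) ~~> K * 0"
  by (intro tendsto_intros LIMSEQ_inverse_real_of_nat)
  then have "\<forall>\<^sub>F n in sequentially. K * inverse (real (Suc n)) < \<epsilon> / 2"
  by (rule order_tendstoD) (use \<epsilon> in auto)
  then obtain N where N: "\<And>n. n \<ge> N ==> K * inverse (real (Suc n)) < \<epsilon> / 2"
  by (auto simp: eventually_sequentially)
  show "\<exists>N. \<forall>n\<ge>N. norm (r n - (nrm f)^2) < \<epsilon>"
  proof (intro exI allI impI)
  fix n assume "n \<ge> N"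
  obtain r' where r': "I n = ennreal r'" "0 <= r'"
  "\<bar>r' - (nrm f)\<^sup>2\<bar> <= nrm f * (e + 2 * nrm f * (4 / (pi * real (Suc n))) / d^2)"
  using key[OF d e] by blast
  have "r' = r n" using r[of n] r' by simp
  moreover have "nrm f * (e + 2 * nrm f * (4 / (pi * real (Suc n))) / d^2) = nrm f * e + K * inverse (real (Suc n))"
  unfolding K_def by (simp add: distrib_left divide_inverse mult_ac del: of_nat_Suc)
  ultimately show "norm (r n - (nrm f)^2) < \<epsilon>"
  using r' ne N[OF \<open>n \<ge> N\<close>] by simp
  qed
 qed
 then have "(%n. ennreal (r n)) ~~> ennreal ((nrm f)^2)" by (rule tendsto_ennrealI)
 also have "(%n. ennreal (r n)) = I" using r(1) by (intro ext) simp
 finally have "I ~~> ennreal ((nrm f)^2)" .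
 with lim1 have "(NN om. ennreal ((cmod (fourier f om))^2)) = ennreal ((nrm f)^2)"
  by (rule LIMSEQ_unique)
 then have "(L2_norm (fourier f))^2 = (L2_norm f)^2"
  by (simp add: L2_norm_sq[of "fourier f"] L2_norm_eq_nrm[OF f(2)] ennreal_power)
 then show *: "L2_norm (fourier f) = L2_norm f" by (simp add: ennreal_sq_eq_iff)
 show "in_L2 (fourier f)" unfolding in_L2_def * using f by (auto simp: in_L2_def)
qed

section \<open>The Fourier transform of square integrable functions\<close>

lemma le_of_tendsto_0:
 fixes a b :: ennreal
 assumes "u ~~> 0" "\<And>n::nat. a <= u n + b"
 shows "a <= b"
proof -
 have "(%n. u n + b) ~~> 0 + b" by (intro tendsto_add assms tendsto_const)
 then show ?thesis using assms(2) by (intro LIMSEQ_le_const[of "%n. u n + b" b a]) auto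
qed

lemma tendsto_0_sum_bound:
 fixes u v w :: "'a => ennreal"
 assumes "(u \<longlongrightarrow> 0) F" "(v \<longlongrightarrow> 0) F" "\<And>n. w n <= u n + v n"
 shows "(w \<longlongrightarrow> 0) F"
proof (rule tendsto_sandwich[OF _ _ tendsto_const])
 have "((%n. u n + v n) \<longlongrightarrow> 0 + 0) F" by (intro tendsto_add assms)
 then show "((%n. u n + v n) \<longlongrightarrow> 0) F" by simp
qed (use assms(3) in auto)

lemma tendsto_0_nrm: "(%n. L2_norm (u n)) ~~> 0 ==> (%n. nrm (u n)) ~~> 0"
 unfolding nrm_def using tendsto_enn2real[of "%n. L2_norm (u n)" 0] by simp

definition trunc :: "nat => (real^2 => complex) => real^2 => complex" where
 "trunc n f = (%x. indicator (cball 0 (real n)) x * f x)"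

lemma trunc_L2: "in_L2 f ==> in_L2 (trunc n f)"
 unfolding trunc_def by (rule in_L2_indicator_mult) auto

lemma trunc_integrable: "in_L2 f ==> integrable lborel (trunc n f)"
 unfolding trunc_def by (rule L2_truncation_integrable)

lemma trunc_norm_le: "L2_norm (trunc n f) <= L2_norm f"
 by (rule L2_norm_mono) (auto simp: trunc_def split: split_indicator)

lemma trunc_tendsto:
 assumes "in_L2 f"
 shows "(%n. L2_norm (%x. trunc n f x - f x)) ~~> 0"
  and "(%n. L2_norm (%x. f x - trunc n f x)) ~~> 0"
 using L2_truncation[OF assms] by (simp_all add: trunc_def L2_norm_commute[of f])

text \<open>\<open>ft f g\<close>: the function \<open>g\<close> represents the Fourier transform of \<open>f\<close>. Since the transform is only
 determined almost everywhere, a relation is easier to handle than a choice of representative.\<close>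

definition ft :: "(real^2 => complex) => (real^2 => complex) => bool" where
 "ft f g \<longleftrightarrow> in_L2 f \<and> in_L2 g \<and> (%n. L2_norm (%om. g om - fourier (trunc n f) om)) ~~> 0"

lemma ft_L2: "ft f g ==> in_L2 f" "ft f g ==> in_L2 g"
 by (auto simp: ft_def)

lemma ft_meas [measurable_dest]: "ft f g ==> f \<in> bm" "ft f g ==> g \<in> bm"
 by (auto simp: ft_def in_L2_def)

lemma fourier_trunc_L2:
 assumes "in_L2 f"
 shows "in_L2 (fourier (trunc n f))" "L2_norm (fourier (trunc n f)) = L2_norm (trunc n f)"
 using plancherel_L1_L2[OF trunc_integrable trunc_L2] assms by auto

lemma L2_norm_fourier_diff:
 assumes "integrable lborel f" "integrable lborel g" "in_L2 f" "in_L2 g"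
 shows "L2_norm (%om. fourier f om - fourier g om) = L2_norm (%x. f x - g x)"
proof -
 have "L2_norm (fourier (%x. f x - g x)) = L2_norm (%x. f x - g x)"
  using assms by (intro plancherel_L1_L2 Bochner_Integration.integrable_diff in_L2_diff)
 moreover have "fourier (%x. f x - g x) = (%om. fourier f om - fourier g om)"
  by (intro ext fourier_diff assms)
 ultimately show ?thesis by simp
qed

lemma ft_exists:
 assumes f: "in_L2 f"
 shows "\<exists>g. ft f g"
proof -
 note [measurable] = in_L2_measurable'[OF f] in_L2_measurable'[OF trunc_L2[OF f]]
 have "\<exists>g. in_L2 g \<and> (%n. L2_norm (%x. g x - fourier (trunc n f) x)) ~~> 0"
 proof (rule L2_complete)
  show "in_L2 (fourier (trunc n f))" for n by (rule fourier_trunc_L2[OF f])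
  fix e :: real assume "0 < e"
  then have "\<forall>\<^sub>F n in sequentially. L2_norm (%x. trunc n f x - f x) < ennreal (e/2)"
  by (intro order_tendstoD[OF trunc_tendsto(1)[OF f]]) auto
  then obtain N where N: "\<And>n. n \<ge> N ==> L2_norm (%x. trunc n f x - f x) <= ennreal (e/2)"
  by (auto simp: eventually_sequentially intro: less_imp_le)
  show "\<exists>N. \<forall>m\<ge>N. \<forall>n\<ge>N. L2_norm (%x. fourier (trunc m f) x - fourier (trunc n f) x) <= ennreal e"
  proof (intro exI allI impI)
  fix m n assume "m \<ge> N" "n \<ge> N"
  have "L2_norm (%x. fourier (trunc m f) x - fourier (trunc n f) x) = L2_norm (%x. trunc m f x - trunc n f x)"
  by (intro L2_norm_fourier_diff trunc_integrable trunc_L2 f)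
  also have "... <= L2_norm (%x. trunc m f x - f x) + L2_norm (%x. f x - trunc n f x)"
  by (rule L2_norm_diff_trans) auto
  also have "... <= ennreal (e/2) + ennreal (e/2)"
  using N[OF \<open>m \<ge> N\<close>] N[OF \<open>n \<ge> N\<close>] by (intro add_mono) (simp_all add: L2_norm_commute[of f])
  also have "... = ennreal e" using \<open>0 < e\<close> by (simp flip: ennreal_plus)
  finally show "L2_norm (%x. fourier (trunc m f) x - fourier (trunc n f) x) <= ennreal e" .
  qed
 qed
 then show ?thesis using f by (auto simp: ft_def)
qed

lemma ft_fourier_L2: "in_L2 f ==> ft f (fourier_L2 f)"
proof -
 assume f: "in_L2 f"
 then have "\<exists>g. in_L2 g \<and>
  (%n::nat. L2_norm (%om. g om - fourier (%x. indicator (cball 0 (real n)) x * f x) om)) ~~> 0"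
  using ft_exists[OF f] by (auto simp: ft_def trunc_def)
 from someI_ex[OF this] f show ?thesis
  unfolding fourier_L2_def[symmetric] by (auto simp: ft_def trunc_def)
qed

lemma ft_isometry:
 assumes "ft f g"
 shows "L2_norm g = L2_norm f"
proof -
 have f: "in_L2 f" and g: "in_L2 g" and lim: "(%n. L2_norm (%om. g om - fourier (trunc n f) om)) ~~> 0"
  using assms by (auto simp: ft_def)
 note [measurable] = in_L2_measurable'[OF f] in_L2_measurable'[OF g] in_L2_measurable'[OF trunc_L2[OF f]]
 have "L2_norm g <= L2_norm f"
 proof (rule le_of_tendsto_0[OF lim])
  fix n
  have "L2_norm g = L2_norm (%om. (g om - fourier (trunc n f) om) + fourier (trunc n f) om)" by simp
  also have "... <= L2_norm (%om. g om - fourier (trunc n f) om) + L2_norm (fourier (trunc n f))"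
  by (rule L2_norm_add) auto
  also have "L2_norm (fourier (trunc n f)) <= L2_norm f"
  using fourier_trunc_L2[OF f] trunc_norm_le by simp
  finally show "L2_norm g <= L2_norm (%om. g om - fourier (trunc n f) om) + L2_norm f"
  by (simp add: add_left_mono)
 qed
 moreover have "L2_norm f <= L2_norm g"
 proof (rule le_of_tendsto_0)
  show "(%n. L2_norm (%x. f x - trunc n f x) + L2_norm (%om. g om - fourier (trunc n f) om)) ~~> 0"
  by (rule tendsto_0_sum_bound[OF trunc_tendsto(2)[OF f] lim]) auto
  fix n
  have "L2_norm f = L2_norm (%om. (f om - trunc n f om) + trunc n f om)" by simp
  also have "... <= L2_norm (%om. f om - trunc n f om) + L2_norm (trunc n f)"
  by (rule L2_norm_add) auto
  also have "L2_norm (trunc n f) = L2_norm (%om. g om - (g om - fourier (trunc n f) om))"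
  using fourier_trunc_L2[OF f] by simp
  also have "... <= L2_norm g + L2_norm (%om. g om - fourier (trunc n f) om)"
  by (rule L2_norm_diff) auto
  finally show "L2_norm f <= L2_norm (%x. f x - trunc n f x) + L2_norm (%om. g om - fourier (trunc n f) om) + L2_norm g"
  by (simp add: add_left_mono add_ac)
 qed
 ultimately show ?thesis by (rule antisym)
qed

lemma ft_nrm: "ft f g ==> nrm g = nrm f"
 by (simp add: nrm_def ft_isometry)

lemma ft_diff:
 assumes "ft f g" "ft f' g'"
 shows "ft (%x. f x - f' x) (%x. g x - g' x)"
proof -
 have f: "in_L2 f" "in_L2 f'" and g: "in_L2 g" "in_L2 g'" using assms by (auto simp: ft_def)
 note [measurable] = ft_meas[OF assms(1)] ft_meas[OF assms(2)]
  in_L2_measurable'[OF trunc_L2[OF f(1)]] in_L2_measurable'[OF trunc_L2[OF f(2)]]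
 have tr: "trunc n (%x. f x - f' x) = (%x. trunc n f x - trunc n f' x)" for n
  by (auto simp: trunc_def fun_eq_iff algebra_simps)
 have "(%n. L2_norm (%om. g om - g' om - fourier (trunc n (%x. f x - f' x)) om)) ~~> 0"
 proof (rule tendsto_0_sum_bound)
  show "(%n. L2_norm (%om. g om - fourier (trunc n f) om)) ~~> 0"
  "(%n. L2_norm (%om. g' om - fourier (trunc n f') om)) ~~> 0"
  using assms by (auto simp: ft_def)
  fix n
  have "fourier (trunc n (%x. f x - f' x)) om = fourier (trunc n f) om - fourier (trunc n f') om" for om
  unfolding tr by (intro fourier_diff trunc_integrable f)
  then have "(%om. g om - g' om - fourier (trunc n (%x. f x - f' x)) om)
  = (%om. (g om - fourier (trunc n f) om) - (g' om - fourier (trunc n f') om))"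
  by (simp add: fun_eq_iff)
  then show "L2_norm (%om. g om - g' om - fourier (trunc n (%x. f x - f' x)) om)
  <= L2_norm (%om. g om - fourier (trunc n f) om) + L2_norm (%om. g' om - fourier (trunc n f') om)"
  by (simp only:) (rule L2_norm_diff, measurable)
 qed
 then show ?thesis using f g by (simp add: ft_def in_L2_diff)
qed

lemma fourier_cmult: "fourier (%x. c * f x) om = c * fourier f om"
 unfolding fourier_def by (simp add: mult.left_commute)

lemma ft_cmult:
 assumes "ft f g"
 shows "ft (%x. c * f x) (%x. c * g x)"
proof -
 have f: "in_L2 f" and g: "in_L2 g" using assms by (auto simp: ft_def)
 note [measurable] = ft_meas[OF assms] in_L2_measurable'[OF trunc_L2[OF f]]
 have tr: "trunc n (%x. c * f x) = (%x. c * trunc n f x)" for n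
  by (auto simp: trunc_def fun_eq_iff algebra_simps)
 have "(%n. ennreal (cmod c) * L2_norm (%om. g om - fourier (trunc n f) om)) ~~> ennreal (cmod c) * 0"
  using assms by (intro tendsto_mult_ennreal) (auto simp: ft_def)
 moreover have "L2_norm (%om. c * g om - fourier (trunc n (%x. c * f x)) om)
  = ennreal (cmod c) * L2_norm (%om. g om - fourier (trunc n f) om)" for n
  unfolding tr fourier_cmult right_diff_distrib[symmetric] by (rule L2_norm_cmult) measurable
 ultimately have "(%n. L2_norm (%om. c * g om - fourier (trunc n (%x. c * f x)) om)) ~~> 0"
  by simp
 then show ?thesis using f g by (simp add: ft_def in_L2_cmult)
qed

lemma ft_unique:
 assumes "ft f g" "ft f' g'" "AEL x. f x = f' x"
 shows "AEL om. g om = g' om"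
proof -
 note [measurable] = ft_meas[OF assms(1)] ft_meas[OF assms(2)]
 have "L2_norm (%om. g om - g' om) = L2_norm (%x. f x - f' x)"
  by (rule ft_isometry[OF ft_diff[OF assms(1,2)]])
 also have "... = 0"
  by (subst L2_norm_eq_0_iff) (use assms(3) in \<open>auto elim: eventually_mono\<close>)
 finally have "AEL om. g om - g' om = 0"
  by (subst (asm) L2_norm_eq_0_iff) auto
 then show ?thesis by eventually_elim simp
qed

lemma in_L2_cong_AE:
 assumes "in_L2 g" "g' \<in> bm" "AEL x. g x = g' x"
 shows "in_L2 g'"
 by (rule in_L2_bound(1)[OF assms(1), of _ 1]) (use assms in \<open>auto elim: eventually_mono\<close>)

lemma ft_cong:
 assumes "ft f g" "g' \<in> bm" "AEL om. g om = g' om"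
 shows "ft f g'"
proof -
 have "L2_norm (%om. g om - fourier (trunc n f) om) = L2_norm (%om. g' om - fourier (trunc n f) om)" for n
  using assms(3) by (intro L2_norm_cong_AE) (auto elim: eventually_mono)
 then show ?thesis using assms(1) in_L2_cong_AE[OF _ assms(2,3)] by (simp add: ft_def)
qed

lemma ft_fourier:
 assumes "integrable lborel f" "in_L2 f"
 shows "ft f (fourier f)"
proof -
 have "L2_norm (%om. fourier f om - fourier (trunc n f) om) = L2_norm (%x. f x - trunc n f x)" for n
  using assms by (intro L2_norm_fourier_diff trunc_integrable trunc_L2)
 then show ?thesis using trunc_tendsto(2)[OF assms(2)] plancherel_L1_L2(1)[OF assms] assms by (simp add: ft_def)
qed

lemma ft_lim:
 assumes fg: "\<And>n::nat. ft (f n) (g n)" and "in_L2 f'" "in_L2 g'"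
  and f: "(%n. L2_norm (%x. f n x - f' x)) ~~> 0" and g: "(%n. L2_norm (%x. g n x - g' x)) ~~> 0"
 shows "ft f' g'"
proof -
 obtain h where h: "ft f' h" using ft_exists assms by blast
 note [measurable] = ft_meas[OF fg] ft_meas[OF h] in_L2_measurable'[OF assms(3)]
 have "L2_norm (%x. h x - g' x) <= 0"
 proof (rule le_of_tendsto_0)
  have *: "L2_norm (%x. h x - g n x) = L2_norm (%x. f n x - f' x)" for n
  using ft_isometry[OF ft_diff[OF h fg[of n]]] by (simp add: L2_norm_commute[of f'])
  show "(%n. L2_norm (%x. h x - g n x) + L2_norm (%x. g n x - g' x)) ~~> 0"
  unfolding * by (rule tendsto_0_sum_bound[OF f g]) auto
  show "L2_norm (%x. h x - g' x) <= L2_norm (%x. h x - g n x) + L2_norm (%x. g n x - g' x) + 0" for n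
  using L2_norm_diff_trans[of h "g n" g'] by simp
 qed
 then have "AEL x. h x - g' x = 0"
  using L2_norm_eq_0_iff[of "%x. h x - g' x"] by simp
 then have "AEL x. h x = g' x" by eventually_elim simp
 then show ?thesis by (rule ft_cong[OF h, rotated]) measurable
qed

lemma ft_parseval:
 assumes "ft f g" "ft f' g'"
 shows "ip f f' = ip g g'"
proof -
 have L: "in_L2 f" "in_L2 g" "in_L2 f'" "in_L2 g'" using assms by (auto simp: ft_def)
 have Re: "Re (ip f f') = Re (ip g g')" if "ft f g" "in_L2 f" "in_L2 g" for f g
  using nrm_diff_sq[of f f'] nrm_diff_sq[of g g'] that L ft_nrm[OF that(1)] ft_nrm[OF assms(2)]
  ft_nrm[OF ft_diff[OF that(1) assms(2)]] by simp
 have mi: "ip (%x. - \<i> * f x) h = - \<i> * ip f h" for f h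
  unfolding ip_def by (simp only: mult.assoc integral_mult_right_zero)
 have "Re (ip (%x. - \<i> * f x) f') = Re (ip (%x. - \<i> * g x) g')"
  using assms L by (intro Re ft_cmult in_L2_cmult)
 then have "Im (ip f f') = Im (ip g g')" unfolding mi by simp
 with Re[OF assms(1)] L show ?thesis by (simp add: complex_eq_iff)
qed

lemma H_norm_eq:
 assumes "ft f g"
 shows "H_norm s f = L2_norm (%om. ((1 + (norm om)^2) powr (s / 2)) *\<^sub>R g om)"
proof -
 have "AEL om. fourier_L2 f om = g om"
  using assms by (intro ft_unique[OF ft_fourier_L2 assms]) (auto simp: ft_def)
 then show ?thesis unfolding H_norm_def
  by (intro L2_norm_cong_AE) (auto elim: eventually_mono)
qed

subsection \<open>Inversion\<close>

definition invF :: "(real^2 => complex) => real^2 => complex" where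
 "invF ga x = (LB om. cis (2 * pi * (x \<bullet> om)) * ga om)"

lemma invF_fourier: "invF ga x = fourier ga (- x)"
 by (simp add: invF_def fourier_def inner_commute)

lemma invF_measurable [measurable]: 
 assumes [measurable]: "ga \<in> bm"
 shows "invF ga \<in> bm"
 unfolding invF_def[abs_def] by measurable

lemma ft_invF:
 assumes ga: "integrable lborel ga" "in_L2 ga"
 shows "ft (invF ga) ga"
proof -
 note [measurable] = in_L2_measurable'[OF ga(2)]
 define f where "f = invF ga"
 have f_eq: "f = (%x. fourier ga (0 - x))" by (simp add: f_def fun_eq_iff invF_fourier)
 have f: "in_L2 f" unfolding f_eq by (intro in_L2_reflect plancherel_L1_L2 ga)
 have nf: "nrm f = nrm ga"
 proof -
  have "L2_norm f = L2_norm (fourier ga)"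
  unfolding f_eq by (rule L2_norm_reflect) measurable
  then show ?thesis unfolding nrm_def plancherel_L1_L2(2)[OF ga] by simp
 qed
 obtain h where h: "ft f h" using ft_exists[OF f] by blast
 have hL: "in_L2 h" using h by (simp add: ft_def)
 have ipn: "ip (fourier (trunc n f)) ga = ip (trunc n f) f" for n
 proof -
  have "ip (fourier (trunc n f)) ga
  = (LB om. cnj (ga om) * (LB x. (case (om, x) of (om, x) => cis (- (2 * pi * (x \<bullet> om)))) * trunc n f x))"
  by (simp add: ip_def fourier_def mult.commute)
  also have "... = (LB x. (LB om. cnj (ga om) * (case (om, x) of (om, x) => cis (- (2 * pi * (x \<bullet> om))))) * trunc n f x)"
  by (rule fubini_kernel[where B=1]) (use ga trunc_integrable[OF f] in auto)
  also have "... = (LB x. cnj (f x) * trunc n f x)"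
  proof (rule bcong[OF refl])
  fix x
  have "cnj (f x) = (LB om. cnj (ga om) * cis (- (2 * pi * (x \<bullet> om))))"
  unfolding f_def invF_def by (subst Bochner_Integration.integral_cnj[symmetric]) (simp add: cis_cnj mult.commute)
  then show "(LB om. cnj (ga om) * (case (om, x) of (om, x) => cis (- (2 * pi * (x \<bullet> om))))) * trunc n f x
  = cnj (f x) * trunc n f x" by simp
  qed
  finally show ?thesis by (simp add: ip_def mult.commute)
 qed
 have "cmod (ip h ga - ip f f) <= 0"
 proof (rule LIMSEQ_le_const)
  have "(%n. nrm (%om. h om - fourier (trunc n f) om) * nrm ga + nrm (%x. trunc n f x - f x) * nrm f) ~~> 0 * nrm ga + 0 * nrm f"
  using h trunc_tendsto(1)[OF f] by (intro tendsto_intros tendsto_0_nrm) (auto simp: ft_def)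
  then show "(%n. nrm (%om. h om - fourier (trunc n f) om) * nrm ga + nrm (%x. trunc n f x - f x) * nrm f) ~~> 0"
  by simp
  show "\<exists>N. \<forall>n\<ge>N. cmod (ip h ga - ip f f) <= nrm (%om. h om - fourier (trunc n f) om) * nrm ga + nrm (%x. trunc n f x - f x) * nrm f"
  proof (intro exI allI impI)
  fix n
  have "ip h ga - ip f f = ip (%om. h om - fourier (trunc n f) om) ga + ip (%x. trunc n f x - f x) f"
  using f hL ga fourier_trunc_L2[OF f] trunc_L2[OF f] by (simp add: ip_diff_left ipn)
  also have "cmod ... <= nrm (%om. h om - fourier (trunc n f) om) * nrm ga + nrm (%x. trunc n f x - f x) * nrm f"
  using f hL ga fourier_trunc_L2[OF f] trunc_L2[OF f]
  by (intro order_trans[OF norm_triangle_ineq] add_mono ip_cauchy in_L2_diff)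
  finally show "cmod (ip h ga - ip f f) <= nrm (%om. h om - fourier (trunc n f) om) * nrm ga + nrm (%x. trunc n f x - f x) * nrm f" .
  qed
 qed
 then have "ip h ga = ip f f" by simp
 then have "Re (ip h ga) = (nrm ga)^2" by (simp add: ip_self[OF f] nf)
 moreover have "nrm h = nrm ga" using ft_nrm[OF h] nf by simp
 ultimately have "(nrm (%om. h om - ga om))^2 = 0"
  using nrm_diff_sq[OF hL ga(2)] by simp
 then have "L2_norm (%om. h om - ga om) = 0"
  using L2_norm_eq_nrm[OF in_L2_diff[OF hL ga(2)]] by simp
 then have "AEL om. h om - ga om = 0"
  using hL by (subst (asm) L2_norm_eq_0_iff) auto
 then have "AEL om. h om = ga om" by eventually_elim simp
 from ft_cong[OF h _ this] show ?thesis unfolding f_def by simp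
qed

subsection \<open>Convolution\<close>

lemma conv_integrable:
 assumes "in_L2 f" "in_L2 h"
 shows "integrable lborel (%y. f y * h (x - y))"
 by (rule ip_integrable[OF assms(1) in_L2_reflect[OF assms(2)]])

lemma conv_commute: "convolution f h x = convolution h f x"
 unfolding convolution_def
 using integral_reflect_shift(1)[of "%y. h y * f (x - y)" x] by (simp add: mult.commute)

lemma conv_measurable [measurable]:
 assumes [measurable]: "f \<in> bm" "h \<in> bm"
 shows "convolution f h \<in> bm"
 unfolding convolution_def[abs_def] by measurable

lemma conv_diff:
 assumes "in_L2 f" "in_L2 g" "in_L2 h"
 shows "convolution (%x. f x - g x) h x = convolution f h x - convolution g h x"
 unfolding convolution_def left_diff_distrib
 by (rule Bochner_Integration.integral_diff) (intro conv_integrable assms)+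

lemma young:
 assumes f: "in_L2 f" and h: "integrable lborel h"
 shows "L2_norm (convolution f h) <= ennreal (LB x. cmod (h x)) * L2_norm f"
proof -
 note [measurable] = in_L2_measurable'[OF f]
 have [measurable]: "h \<in> bm" using h by auto
 define A where "A = (NN x. ennreal (cmod (h x)))"
 have A: "A = ennreal (LB x. cmod (h x))"
  unfolding A_def using h by (intro nn_integral_eq_integral) auto
 have "(L2_norm (convolution f h))^2
  <= (NN x. (NN y. ennreal ((cmod (f y))^2) * ennreal (cmod (h (x - y)))) * A)"
  unfolding L2_norm_sq
 proof (rule nn_integral_mono)
  fix x
  have "ennreal (cmod (convolution f h x)) <= (NN y. ennreal (cmod (f y * h (x - y))))"
  proof (cases "integrable lborel (%y. f y * h (x - y))")
  case True
  then show ?thesis unfolding convolution_def by (rule integral_norm_bound_ennreal)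
  qed (simp add: convolution_def not_integrable_integral_eq)
  also have "... = (NN y. (ennreal (cmod (f y)) * ennreal (sqrt (cmod (h (x - y))))) * ennreal (sqrt (cmod (h (x - y)))))"
  by (intro nn_integral_cong) (simp add: norm_mult mult.assoc flip: ennreal_mult)
  finally have "(ennreal (cmod (convolution f h x)))^2 <= (NN y. (ennreal (cmod (f y)) * ennreal (sqrt (cmod (h (x - y))))) * ennreal (sqrt (cmod (h (x - y)))))^2"
  by (rule power_mono) auto
  also have "... <= (NN y. (ennreal (cmod (f y)) * ennreal (sqrt (cmod (h (x - y)))))^2) * (NN y. (ennreal (sqrt (cmod (h (x - y)))))^2)"
  by (rule Cauchy_Schwarz_nn_integral) auto
  also have "(NN y. (ennreal (sqrt (cmod (h (x - y)))))^2) = A"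
  unfolding A_def using nn_integral_reflect[of "%y. ennreal (cmod (h y))" x] by (simp add: ennreal_power)
  also have "(NN y. (ennreal (cmod (f y)) * ennreal (sqrt (cmod (h (x - y)))))^2)
  = (NN y. ennreal ((cmod (f y))^2) * ennreal (cmod (h (x - y))))"
  by (simp add: power_mult_distrib ennreal_power)
  finally show "ennreal ((cmod (convolution f h x))^2) <= (NN y. ennreal ((cmod (f y))^2) * ennreal (cmod (h (x - y)))) * A"
  by (simp add: ennreal_power)
 qed
 also have "... = (NN x. (NN y. ennreal ((cmod (f y))^2) * ennreal (cmod (h (x - y))))) * A"
  by (rule nn_integral_multc) measurable
 also have "(NN x. (NN y. ennreal ((cmod (f y))^2) * ennreal (cmod (h (x - y)))))
  = (NN y. (NN x. ennreal ((cmod (f y))^2) * ennreal (cmod (h (x - y)))))"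
  by (rule lborel_pair.Fubini') measurable
 also have "... = (NN y. ennreal ((cmod (f y))^2) * A)"
 proof (rule nn_integral_cong)
  fix y :: "real^2"
  have "(NN x. ennreal (cmod (h (x - y)))) = A"
  unfolding A_def using nn_integral_shift[of "%y. ennreal (cmod (h y))" "-y"] by simp
  then show "(NN x. ennreal ((cmod (f y))^2) * ennreal (cmod (h (x - y)))) = ennreal ((cmod (f y))^2) * A"
  by (simp add: nn_integral_cmult)
 qed
 also have "... = (L2_norm f)^2 * A" unfolding L2_norm_sq by (rule nn_integral_multc) measurable
 finally have "(L2_norm (convolution f h))^2 <= (A * L2_norm f)^2"
  by (simp add: power2_eq_square mult_ac)
 then show ?thesis by (simp add: ennreal_sq_le_iff A)
qed

lemma conv_L2:
 assumes f: "in_L2 f" and h: "integrable lborel h"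
 shows "in_L2 (convolution f h)"
proof -
 have "L2_norm (convolution f h) < \<infinity>"
  by (rule le_less_trans[OF young[OF assms]]) (use in_L2_finite[OF f] in \<open>simp add: ennreal_mult_less_top\<close>)
 then show ?thesis using assms by (auto simp: in_L2_def)
qed

lemma fourier_conv:
 assumes f: "integrable lborel f" and h: "integrable lborel h"
 shows "integrable lborel (convolution f h)" "fourier (convolution f h) om = fourier f om * fourier h om"
proof -
 have [measurable]: "f \<in> bm" "h \<in> bm" using f h by auto
 have int: "integrable (lborel \<Otimes>\<^sub>M lborel) (%(x, y). cis (- (2 * pi * (x \<bullet> om))) * (f y * h (x - y)))" for om
 proof (rule integrableI_bounded)
  have "(\<integral>\<^sup>+ p. ennreal (norm (case p of (x, y) => cis (- (2 * pi * (x \<bullet> om))) * (f y * h (x - y)))) \<partial>(lborel \<Otimes>\<^sub>M lborel))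
  = (NN y. (NN x. ennreal (cmod (f y)) * ennreal (cmod (h (x - y)))))"
  by (subst lborel_pair.nn_integral_snd[symmetric]) (auto simp: norm_mult ennreal_mult)
  also have "... = (NN y. ennreal (cmod (f y)) * (NN x. ennreal (cmod (h x))))"
  proof (rule nn_integral_cong)
  fix y :: "real^2"
  show "(NN x. ennreal (cmod (f y)) * ennreal (cmod (h (x - y)))) = ennreal (cmod (f y)) * (NN x. ennreal (cmod (h x)))"
  using nn_integral_shift[of "%y. ennreal (cmod (h y))" "-y"] by (simp add: nn_integral_cmult)
  qed
  also have "... = (NN y. ennreal (cmod (f y))) * (NN x. ennreal (cmod (h x)))"
  by (rule nn_integral_multc) measurable
  also have "... < \<infinity>" using f h by (auto simp: integrable_iff_bounded ennreal_mult_less_top)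
  finally show "(\<integral>\<^sup>+ p. ennreal (norm (case p of (x, y) => cis (- (2 * pi * (x \<bullet> om))) * (f y * h (x - y)))) \<partial>(lborel \<Otimes>\<^sub>M lborel)) < \<infinity>" .
 qed measurable
 have "integrable lborel (%x. (LB y. f y * h (x - y)))"
  using lborel_pair.integrable_fst'[OF int[of 0]] by simp
 then show "integrable lborel (convolution f h)" by (simp add: convolution_def[abs_def])
 have "fourier (convolution f h) om = (LB x. (LB y. cis (- (2 * pi * (x \<bullet> om))) * (f y * h (x - y))))"
  unfolding fourier_def convolution_def by (simp only: integral_mult_right_zero)
 also have "... = (LB y. (LB x. cis (- (2 * pi * (x \<bullet> om))) * (f y * h (x - y))))"
  using lborel_pair.Fubini_integral[OF int] by simp
 also have "... = (LB y. cis (- (2 * pi * (y \<bullet> om))) * f y * fourier h om)"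
 proof (rule bcong[OF refl])
  fix y
  have "(LB x. cis (- (2 * pi * (x \<bullet> om))) * (f y * h (x - y)))
  = (LB x. cis (- (2 * pi * ((x + y) \<bullet> om))) * (f y * h (x + y - y)))"
  by (rule integral_shift(1)[symmetric])
  also have "... = (LB x. cis (- (2 * pi * (y \<bullet> om))) * f y * (cis (- (2 * pi * (x \<bullet> om))) * h x))"
  proof (intro bcong refl)
  fix x
  have "- (2 * pi * ((x + y) \<bullet> om)) = - (2 * pi * (y \<bullet> om)) + - (2 * pi * (x \<bullet> om))"
  by (simp add: inner_add_left algebra_simps)
  then have "cis (- (2 * pi * ((x + y) \<bullet> om))) = cis (- (2 * pi * (y \<bullet> om))) * cis (- (2 * pi * (x \<bullet> om)))"
  by (simp only: cis_mult)
  then show "cis (- (2 * pi * ((x + y) \<bullet> om))) * (f y * h (x + y - y)) = cis (- (2 * pi * (y \<bullet> om))) * f y * (cis (- (2 * pi * (x \<bullet> om))) * h x)"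
  by (simp only: add_diff_cancel_right' mult_ac)
  qed
  finally show "(LB x. cis (- (2 * pi * (x \<bullet> om))) * (f y * h (x - y))) = cis (- (2 * pi * (y \<bullet> om))) * f y * fourier h om"
  unfolding fourier_def by simp
 qed
 also have "... = fourier f om * fourier h om" by (simp add: fourier_def)
 finally show "fourier (convolution f h) om = fourier f om * fourier h om" .
qed

lemma ft_conv:
 assumes fg: "ft f g" and h: "integrable lborel h" "in_L2 h"
 shows "ft (convolution f h) (%om. g om * fourier h om)"
proof -
 have f: "in_L2 f" and g: "in_L2 g" using fg by (auto simp: ft_def)
 note [measurable] = ft_meas[OF fg] in_L2_measurable'[OF h(2)] in_L2_measurable'[OF trunc_L2[OF f]]
 define B where "B = (LB x. cmod (h x))"
 have B: "0 <= B" unfolding B_def by (intro integral_nonneg_AE) auto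
 have hb: "cmod (fourier h om) <= B" for om unfolding B_def by (rule fourier_bound[OF h(1)])
 have comm: "(%om. u om * fourier h om) = (%om. fourier h om * u om)" for u by (simp add: mult.commute)
 show ?thesis
 proof (rule ft_lim)
  show "ft (convolution (trunc n f) h) (%om. fourier (trunc n f) om * fourier h om)" for n
  proof -
  have "ft (convolution (trunc n f) h) (fourier (convolution (trunc n f) h))"
  using f h by (intro ft_fourier fourier_conv conv_L2 trunc_integrable trunc_L2)
  moreover have "fourier (convolution (trunc n f) h) = (%om. fourier (trunc n f) om * fourier h om)"
  by (intro ext fourier_conv trunc_integrable f h)
  ultimately show ?thesis by simp
  qed
  show "in_L2 (convolution f h)" using f h by (intro conv_L2)
  show "in_L2 (%om. g om * fourier h om)"
  unfolding comm using hb by (intro in_L2_mult_bounded[OF g, of _ B]) auto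
  show "(%n. L2_norm (%x. convolution (trunc n f) h x - convolution f h x)) ~~> 0"
  proof (rule tendsto_sandwich[OF _ _ tendsto_const])
  have "(%n. ennreal B * L2_norm (%x. trunc n f x - f x)) ~~> ennreal B * 0"
  by (intro tendsto_mult_ennreal trunc_tendsto f tendsto_const) auto
  then show "(%n. ennreal B * L2_norm (%x. trunc n f x - f x)) ~~> 0" by simp
  have "L2_norm (%x. convolution (trunc n f) h x - convolution f h x) <= ennreal B * L2_norm (%x. trunc n f x - f x)" for n
  using young[OF in_L2_diff[OF trunc_L2[OF f] f] h(1), of n]
  by (simp add: conv_diff[OF trunc_L2[OF f] f h(2), symmetric] B_def)
  then show "\<forall>\<^sub>F n in sequentially. L2_norm (%x. convolution (trunc n f) h x - convolution f h x) <= ennreal B * L2_norm (%x. trunc n f x - f x)"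
  by simp
  qed simp
  show "(%n. L2_norm (%x. fourier (trunc n f) x * fourier h x - g x * fourier h x)) ~~> 0"
  proof (rule tendsto_sandwich[OF _ _ tendsto_const])
  have "(%n. ennreal B * L2_norm (%x. g x - fourier (trunc n f) x)) ~~> ennreal B * 0"
  using fg by (intro tendsto_mult_ennreal tendsto_const) (auto simp: ft_def)
  then show "(%n. ennreal B * L2_norm (%x. g x - fourier (trunc n f) x)) ~~> 0" by simp
  have "L2_norm (%x. fourier (trunc n f) x * fourier h x - g x * fourier h x) <= ennreal B * L2_norm (%x. g x - fourier (trunc n f) x)" for n
  proof (rule in_L2_bound(2))
  show "in_L2 (%x. g x - fourier (trunc n f) x)" using g fourier_trunc_L2[OF f] by (intro in_L2_diff)
  show "AEL x. cmod (fourier (trunc n f) x * fourier h x - g x * fourier h x) <= B * cmod (g x - fourier (trunc n f) x)"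
  using hb by (auto simp: left_diff_distrib[symmetric] norm_mult norm_minus_commute mult.commute[of B] intro!: mult_left_mono)
  qed (use B in auto)
  then show "\<forall>\<^sub>F n in sequentially. L2_norm (%x. fourier (trunc n f) x * fourier h x - g x * fourier h x) <= ennreal B * L2_norm (%x. g x - fourier (trunc n f) x)"
  by simp
  qed simp
 qed
qed

section \<open>Measure distortion of Lipschitz perturbations of the identity\<close>

lemma Basis_2: "(Basis::(real^2) set) = {axis 1 1, axis 2 1}"
 by (auto simp: Basis_vec_def UNIV_2)

lemma emeasure_cube:
 fixes u :: "real^2"
 assumes "0 <= s"
 shows "emeasure lborel (cbox u (u + s *\<^sub>R 1)) = ennreal (s^2)"
  and "emeasure lborel (box u (u + s *\<^sub>R 1)) = ennreal (s^2)"
 using assms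
 by (simp_all add: emeasure_lborel_cbox_eq emeasure_lborel_box_eq Basis_2 axis_eq_axis inner_axis
  inner_add_left inner_diff_left power2_eq_square)

lemma cube_measure_bound:
 fixes N :: "(real^2) measure"
 assumes sets[simp]: "sets N = sets borel" and K: "0 <= K"
  and cube: "\<And>u s. 0 < s ==> emeasure N (cbox u (u + s *\<^sub>R 1)) <= ennreal (K * s^2)"
  and A: "A \<in> sets borel"
 shows "emeasure N A <= ennreal K * emeasure lborel A"
proof -
 have bounded: "emeasure N B <= ennreal K * emeasure lborel B"
  if B: "B \<in> sets borel" "B \<subseteq> cbox (- (real n *\<^sub>R 1)) (real n *\<^sub>R 1)" "0 < n" for B n
 proof (rule ennreal_le_epsilon)
  fix e :: real assume e: "0 < e"
  define a b where "a = - (real n *\<^sub>R (1::real^2))" and "b = real n *\<^sub>R (1::real^2)"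
  obtain U where U: "open U" "B \<subseteq> U" "emeasure lborel (U - B) < ennreal (e / (K + 1))"
  using outer_regular_lborel[OF B(1), of "e / (K+1)"] e K by (auto simp: add_nonneg_pos)
  have [measurable]: "U \<in> sets borel" "B \<in> sets borel" using U B by auto
  have ab: "box a b \<noteq> {}" using \<open>0 < n\<close>
  by (auto simp: a_def b_def box_ne_empty Basis_vec_def inner_axis)
  have "gauge (%x. if x \<in> U then U else UNIV)" using U by (auto simp: gauge_def)
  from covering_lemma[OF B(2)[folded a_def b_def] ab this]
  obtain \<D> where D: "countable \<D>" "\<And>K. K \<in> \<D> ==> interior K \<noteq> {} \<and> (\<exists>c d. K = cbox c d)"
  "pairwise (%A B. interior A \<inter> interior B = {}) \<D>"
  "\<And>K. K \<in> \<D> ==> \<exists>x \<in> B \<inter> K. K \<subseteq> (if x \<in> U then U else UNIV)"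
  "\<And>u v. cbox u v \<in> \<D> ==> \<exists>m. \<forall>i \<in> Basis. v \<bullet> i - u \<bullet> i = (b \<bullet> i - a \<bullet> i) / 2^m"
  "B \<subseteq> \<Union>\<D>"
  by metis
  have DU: "C \<subseteq> U" if C: "C \<in> \<D>" for C
  proof -
  obtain x where x: "x \<in> B" "C \<subseteq> (if x \<in> U then U else UNIV)" using D(4)[OF C] by auto
  then have "x \<in> U" using U(2) by auto
  with x show ?thesis by simp
  qed
  have Dm[measurable]: "C \<in> \<D> ==> C \<in> sets borel" for C using D(2) by fastforce
  have NC: "emeasure N C <= ennreal K * emeasure lborel (interior C)" if C: "C \<in> \<D>" for C
  proof -
  obtain u v where uv: "C = cbox u v" using D(2)[OF C] by blast
  obtain m where m: "\<And>i. i \<in> Basis ==> v \<bullet> i - u \<bullet> i = (b \<bullet> i - a \<bullet> i) / 2^m"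
  using D(5) C uv by blast
  define s where "s = 2 * real n / 2 ^ m"
  have s: "0 < s" using \<open>0 < n\<close> by (simp add: s_def)
  have "v $ k = u $ k + s" for k
  using m[of "axis k 1"] by (simp add: inner_axis a_def b_def s_def axis_in_Basis_iff)
  then have v: "v = u + s *\<^sub>R 1" by (simp add: vec_eq_iff)
  have "emeasure lborel (interior C) = ennreal (s^2)"
  unfolding uv interior_cbox v using s by (intro emeasure_cube) simp
  then show ?thesis using cube[OF s, of u] K by (simp add: uv v ennreal_mult)
  qed
  have "emeasure N B <= (\<integral>\<^sup>+ x. \<integral>\<^sup>+ C. indicator C x \<partial>count_space \<D> \<partial>N)"
  proof -
  have "emeasure N B = (\<integral>\<^sup>+ x. indicator B x \<partial>N)" using B by simp
  also have "... <= (\<integral>\<^sup>+ x. \<integral>\<^sup>+ C. indicator C x \<partial>count_space \<D> \<partial>N)"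
  proof (rule nn_integral_mono)
  fix x
  show "indicator B x <= (\<integral>\<^sup>+ C. indicator C x \<partial>count_space \<D>)"
  proof (cases "x \<in> B")
  case True
  then obtain C where "C \<in> \<D>" "x \<in> C" using D(6) by auto
  then show ?thesis using True nn_integral_ge_point[of C \<D> "%C. indicator C x"] by simp
  qed simp
  qed
  finally show ?thesis .
  qed
  also have "... = (\<integral>\<^sup>+ C. \<integral>\<^sup>+ x. indicator C x \<partial>N \<partial>count_space \<D>)"
  by (rule nn_integral_count_space_nn_integral) (use D(1) in \<open>auto simp: measurable_cong_sets[OF sets refl]\<close>)
  also have "... = (\<integral>\<^sup>+ C. emeasure N C \<partial>count_space \<D>)"
  by (rule nn_integral_cong) simp
  also have "... <= (\<integral>\<^sup>+ C. ennreal K * emeasure lborel (interior C) \<partial>count_space \<D>)"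
  by (rule nn_integral_mono) (use NC in auto)
  also have "... = ennreal K * (\<integral>\<^sup>+ C. emeasure lborel (interior C) \<partial>count_space \<D>)"
  by (rule nn_integral_cmult) auto
  also have "(\<integral>\<^sup>+ C. emeasure lborel (interior C) \<partial>count_space \<D>) = emeasure lborel (\<Union>C\<in>\<D>. interior C)"
  by (rule emeasure_UN_countable[symmetric])
  (use D(1,3) in \<open>auto simp: disjoint_family_on_def pairwise_def\<close>)
  also have "emeasure lborel (\<Union>C\<in>\<D>. interior C) <= emeasure lborel U"
  proof (intro emeasure_mono UN_least)
  show "interior C \<subseteq> U" if "C \<in> \<D>" for C using DU[OF that] interior_subset[of C] by (rule subset_trans[rotated])
  qed simp
  also have "emeasure lborel U = emeasure lborel B + emeasure lborel (U - B)"
  using U(2) by (subst plus_emeasure) (auto intro!: arg_cong[where f="emeasure lborel"])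
  also have "ennreal K * (emeasure lborel B + emeasure lborel (U - B)) <= ennreal K * (emeasure lborel B + ennreal (e / (K + 1)))"
  using U(3) by (intro mult_left_mono add_left_mono) auto
  also have "... = ennreal K * emeasure lborel B + ennreal (K * (e / (K + 1)))"
  using K e by (simp add: distrib_left flip: ennreal_mult)
  also have "... <= ennreal K * emeasure lborel B + ennreal e"
  using K e by (intro add_left_mono ennreal_leI) (simp add: field_simps)
  finally show "emeasure N B <= ennreal K * emeasure lborel B + ennreal e"
  by (simp add: mult_left_mono)
 qed
 define C where "C n = cbox (- (real (Suc n) *\<^sub>R (1::real^2))) (real (Suc n) *\<^sub>R 1)" for n
 have C_mem: "x \<in> C n \<longleftrightarrow> (\<forall>k. \<bar>x $ k\<bar> <= real (Suc n))" for x n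
  unfolding C_def mem_box_cart by (intro all_cong1) auto
 have C: "incseq C" unfolding incseq_def
 proof (intro allI impI subsetI)
  fix m n x assume "m <= n" "x \<in> C m"
  then have "\<bar>x $ k\<bar> <= real (Suc m)" "real (Suc m) <= real (Suc n)" for k unfolding C_mem by auto
  then show "x \<in> C n" unfolding C_mem by (meson order_trans)
 qed
 have "x \<in> (\<Union>n. C n)" for x
 proof -
  obtain n where n: "norm x <= real n" using real_arch_simple by blast
  have "\<bar>x $ k\<bar> <= real (Suc n)" for k using component_le_norm_cart[of x k] n by simp
  then have "x \<in> C n" unfolding C_mem by blast
  then show ?thesis by blast
 qed
 then have CU: "(\<Union>n. A \<inter> C n) = A" by auto
 have "emeasure N A = (SUP n. emeasure N (A \<inter> C n))"
 proof -
  have Cm: "C n \<in> sets borel" for n by (simp add: C_def)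
  have "(SUP n. emeasure N (A \<inter> C n)) = emeasure N (\<Union>n. A \<inter> C n)"
  by (rule SUP_emeasure_incseq) (use C A Cm in \<open>auto simp: incseq_def\<close>)
  then show ?thesis by (simp only: CU)
 qed
 also have "... <= ennreal K * emeasure lborel A"
 proof (rule SUP_least)
  fix n
  have "emeasure N (A \<inter> C n) <= ennreal K * emeasure lborel (A \<inter> C n)"
  by (rule bounded[of _ "Suc n"]) (use A in \<open>auto simp: C_def\<close>)
  also have "... <= ennreal K * emeasure lborel A"
  using A by (intro mult_left_mono emeasure_mono) auto
  finally show "emeasure N (A \<inter> C n) <= ennreal K * emeasure lborel A" .
 qed
 finally show ?thesis .
qed

lemma coord_diam_measure:
 fixes B :: "(real^2) set"
 assumes B: "B \<in> sets borel" and d: "\<And>x y k. x \<in> B ==> y \<in> B ==> \<bar>x $ k - y $ k\<bar> <= r"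
  and r: "0 <= r"
 shows "emeasure lborel B <= ennreal (r^2)"
proof (cases "B = {}")
 case False
 then obtain x0 where x0: "x0 \<in> B" by blast
 define a :: "real^2" where "a = (\<chi> k. INF x\<in>B. x $ k)"
 have bdd: "bdd_below ((%x. x $ k) ` B)" for k
 proof (rule bdd_belowI2)
  show "x0 $ k - r <= y $ k" if y: "y \<in> B" for y using d[OF y x0, of k] by linarith
 qed
 have "B \<subseteq> cbox a (a + r *\<^sub>R 1)"
 proof
  fix x assume x: "x \<in> B"
  have "a $ k <= x $ k" for k
  unfolding a_def using cINF_lower[OF bdd x, of k] by simp
  moreover have "x $ k <= a $ k + r" for k
  proof -
  have "x $ k - r <= (INF y\<in>B. y $ k)"
  proof (rule cINF_greatest[OF False])
  show "x $ k - r <= y $ k" if y: "y \<in> B" for y using d[OF x y, of k] by linarith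
  qed
  then show ?thesis by (simp add: a_def)
  qed
  ultimately show "x \<in> cbox a (a + r *\<^sub>R 1)" by (simp add: mem_box_cart)
 qed
 then have "emeasure lborel B <= emeasure lborel (cbox a (a + r *\<^sub>R 1))"
  by (rule emeasure_mono) simp
 also have "... = ennreal (r^2)"
  using r by (rule emeasure_cube)
 finally show ?thesis .
qed simp

lemma nn_integral_distortion:
 fixes Ph :: "real^2 => real^2"
 assumes S[measurable]: "S \<in> sets borel" and Ph[measurable]: "Ph \<in> bm"
  and g[measurable]: "g \<in> bm" and K: "0 <= K"
  and cube: "\<And>s x y k. 0 < s ==> x \<in> S ==> y \<in> S ==> (\<And>k. \<bar>Ph x $ k - Ph y $ k\<bar> <= s) ==> \<bar>x $ k - y $ k\<bar> <= K * s"
 shows "(NN x. indicator S x * g (Ph x)) <= ennreal (K^2) * (NN x. g x)"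
proof -
 define N where "N = distr (density lborel (indicator S)) borel Ph"
 have sN[simp]: "sets N = sets borel" by (simp add: N_def)
 have emN: "emeasure N A = emeasure lborel (S \<inter> Ph -` A)" if [measurable]: "A \<in> sets borel" for A
 proof -
  have [measurable]: "Ph -` A \<in> sets borel"
  using measurable_sets[OF Ph that] by simp
  have "emeasure N A = (NN x. indicator S x * indicator (Ph -` A) x)"
  unfolding N_def by (subst emeasure_distr) (auto simp: emeasure_density)
  also have "... = (NN x. indicator (S \<inter> Ph -` A) x)"
  by (intro nn_integral_cong) (auto split: split_indicator)
  finally show ?thesis by simp
 qed
 have "emeasure N A <= ennreal (K^2) * emeasure lborel A" if "A \<in> sets borel" for A
 proof (rule cube_measure_bound[OF sN _ _ that])
  fix u :: "real^2" and s :: real assume s: "0 < s"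
  have "emeasure N (cbox u (u + s *\<^sub>R 1)) = emeasure lborel (S \<inter> Ph -` cbox u (u + s *\<^sub>R 1))"
  by (rule emN) simp
  also have "... <= ennreal ((K * s)^2)"
  proof (rule coord_diam_measure)
  show "S \<inter> Ph -` cbox u (u + s *\<^sub>R 1) \<in> sets borel"
  using S measurable_sets[OF Ph, of "cbox u (u + s *\<^sub>R 1)"] by auto
  fix x y k assume x: "x \<in> S \<inter> Ph -` cbox u (u + s *\<^sub>R 1)" and y: "y \<in> S \<inter> Ph -` cbox u (u + s *\<^sub>R 1)"
  have "\<bar>Ph x $ k - Ph y $ k\<bar> <= s" for k
  proof -
  have "u $ k <= Ph x $ k" "Ph x $ k <= u $ k + s" "u $ k <= Ph y $ k" "Ph y $ k <= u $ k + s"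
  using x y by (simp_all add: mem_box_cart)
  then show ?thesis by linarith
  qed
  then show "\<bar>x $ k - y $ k\<bar> <= K * s" using x y by (intro cube[OF s]) auto
  qed (use K s in auto)
  finally show "emeasure N (cbox u (u + s *\<^sub>R 1)) <= ennreal (K^2 * s^2)" by (simp add: power_mult_distrib)
 qed auto
 then have "\<forall>A\<in>sets N. emeasure N A <= emeasure (scale_measure (ennreal (K^2)) lborel) A"
  by simp
 moreover have "sets N = sets (scale_measure (ennreal (K^2)) (lborel :: (real^2) measure))" by simp
 ultimately have "N <= scale_measure (ennreal (K^2)) lborel"
  using le_measure by blast
 then have "(\<integral>\<^sup>+ x. g x \<partial>N) <= (\<integral>\<^sup>+ x. g x \<partial>scale_measure (ennreal (K^2)) lborel)"
  by (intro nn_integral_mono_measure) auto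
 also have "... = ennreal (K^2) * (NN x. g x)"
  by (rule nn_integral_scale_measure) measurable
 also have "(\<integral>\<^sup>+ x. g x \<partial>N) = (NN x. indicator S x * g (Ph x))"
  unfolding N_def by (subst nn_integral_distr) (auto simp: nn_integral_density)
 finally show ?thesis .
qed

lemma norm_le_2_coord:
 assumes "\<And>k. \<bar>(x::real^2) $ k\<bar> <= s"
 shows "norm x <= sqrt 2 * s"
proof -
 have s: "0 <= s" using assms[of 1] by linarith
 have "(norm x)^2 <= s^2 + s^2"
  unfolding norm_sq_2 using assms[of 1] assms[of 2] s
  by (intro add_mono abs_le_square_iff[THEN iffD1]) simp_all
 also have "... = (sqrt 2 * s)^2" by (simp add: power_mult_distrib)
 finally show ?thesis by (rule power2_le_imp_le) (use s in simp)
qed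

lemma nn_integral_expansive:
 fixes Ph :: "real^2 => real^2"
 assumes "S \<in> sets borel" "Ph \<in> bm" "g \<in> bm"
  and L: "0 <= L" "\<And>x y. x \<in> S ==> y \<in> S ==> norm (x - y) <= L * norm (Ph x - Ph y)"
 shows "(NN x. indicator S x * g (Ph x)) <= ennreal ((2 * L)^2) * (NN x. g x)"
proof (rule nn_integral_distortion[OF assms(1-3)])
 fix s x y k assume s: "0 < s" and xy: "x \<in> S" "y \<in> S" and d: "\<And>k. \<bar>Ph x $ k - Ph y $ k\<bar> <= s"
 have "\<bar>x $ k - y $ k\<bar> <= norm (x - y)" using component_le_norm_cart[of "x - y" k] by simp
 also have "... <= L * norm (Ph x - Ph y)" by (rule L(2)[OF xy])
 also have "... <= L * (sqrt 2 * s)"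
  by (intro mult_left_mono norm_le_2_coord L(1)) (simp add: d)
 also have "... <= L * (2 * s)"
  by (intro mult_left_mono mult_right_mono L(1) less_imp_le[OF s] less_imp_le[OF sqrt2_less_2])
 finally show "\<bar>x $ k - y $ k\<bar> <= 2 * L * s" by simp
qed (use L in auto)

lemma sqrt2_bound: "sqrt 2 <= (3/2 :: real)"
 by (rule real_le_lsqrt) (auto simp: power2_eq_square)

text \<open>A perturbation \<open>x - ta x\<close> of the identity with small Lipschitz constant and its inverse.\<close>

locale small_perturbation =
 fixes ta :: "real^2 => real^2" and ka :: real
 assumes lip: "norm (ta x - ta y) <= ka * norm (x - y)"
  and ka0: "0 <= ka" and ka_small: "ka <= 1/8"
begin

definition Ph :: "real^2 => real^2" where "Ph x = x - ta x"

definition Pz :: "real^2 => real^2" where "Pz = inv Ph"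

lemma ta_cont: "continuous_on UNIV ta"
proof -
 have "ka-lipschitz_on UNIV ta" using lip ka0 by (auto simp: lipschitz_on_def dist_norm)
 then show ?thesis by (rule lipschitz_on_continuous_on)
qed

lemma ta_meas [measurable]: "ta \<in> bm"
 by (rule borel_measurable_continuous_onI[OF ta_cont])

lemma Ph_meas [measurable]: "Ph \<in> bm"
 unfolding Ph_def[abs_def] by measurable

lemma Ph_expand: "norm (x - y) <= 8/7 * norm (Ph x - Ph y)"
proof -
 have "norm (x - y) <= norm (Ph x - Ph y) + norm (ta x - ta y)"
  using norm_triangle_ineq[of "Ph x - Ph y" "ta x - ta y"] by (simp add: Ph_def)
 moreover have "norm (ta x - ta y) <= 1/8 * norm (x - y)"
 proof -
  have "ka * norm (x - y) <= 1/8 * norm (x - y)" using ka_small by (intro mult_right_mono) auto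
  then show ?thesis using lip[of x y] by linarith
 qed
 ultimately show ?thesis by linarith
qed

lemma Ph_bij: "bij Ph"
proof (rule bijI)
 show "inj Ph"
 proof (rule injI)
  fix x y assume "Ph x = Ph y"
  then show "x = y" using Ph_expand[of x y] by simp
 qed
 show "surj Ph"
  unfolding surj_def
 proof
  fix z
  have "\<exists>!y\<in>UNIV. z + ta y = y"
  proof (rule Banach_fix[where c="1/2"])
  fix x y
  have "norm (ta x - ta y) <= ka * norm (x - y)" by (rule lip)
  also have "... <= 1/2 * norm (x - y)" using ka_small by (intro mult_right_mono) auto
  finally show "dist (z + ta x) (z + ta y) <= 1/2 * dist x y" by (simp add: dist_norm)
  qed (auto simp: complete_UNIV)
  then obtain y where "z + ta y = y" by blast
  then have "z = Ph y" by (simp add: Ph_def algebra_simps)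
  then show "\<exists>y. z = Ph y" by blast
 qed
qed

lemma Ph_Pz [simp]: "Ph (Pz x) = x"
 unfolding Pz_def using Ph_bij by (simp add: bij_is_surj surj_f_inv_f)

lemma Pz_Ph [simp]: "Pz (Ph x) = x"
 unfolding Pz_def using Ph_bij by (simp add: bij_is_inj inv_f_f)

lemma Pz_eq: "Pz x = x + ta (Pz x)"
 using Ph_Pz[of x] by (simp add: Ph_def algebra_simps)

lemma Pz_lip: "norm (Pz x - Pz y) <= 8/7 * norm (x - y)"
 using Ph_expand[of "Pz x" "Pz y"] by simp

lemma Pz_meas [measurable]: "Pz \<in> bm"
proof -
 have "(8/7)-lipschitz_on UNIV Pz" using Pz_lip by (auto simp: lipschitz_on_def dist_norm)
 then show ?thesis by (intro borel_measurable_continuous_onI lipschitz_on_continuous_on)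
qed

lemma Pz_perturb: "norm ((Pz x - x) - (Pz y - y)) <= 8/7 * ka * norm (x - y)"
proof -
 have "(Pz x - x) - (Pz y - y) = ta (Pz x) - ta (Pz y)"
  using Pz_eq by (metis add_diff_cancel_left')
 then have "norm ((Pz x - x) - (Pz y - y)) <= ka * norm (Pz x - Pz y)" using lip by simp
 also have "... <= ka * (8/7 * norm (x - y))" by (intro mult_left_mono Pz_lip ka0)
 finally show ?thesis by simp
qed

lemma distort_const: "(1 + 2 * ka)^2 <= 1 + 5 * ka"
proof -
 have "ka * ka <= 1/8 * ka" using ka0 ka_small by (intro mult_right_mono) auto
 moreover have "(1 + 2 * ka)^2 = 1 + 4 * ka + 4 * (ka * ka)" by (simp add: power2_eq_square algebra_simps)
 ultimately show ?thesis using ka0 by linarith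
qed

lemma nn_integral_Ph:
 assumes [measurable]: "g \<in> bm"
 shows "(NN x. g (Ph x)) <= ennreal (1 + 5 * ka) * (NN x. g x)"
proof -
 have "(NN x. indicator UNIV x * g (Ph x)) <= ennreal ((1 + 2 * ka)^2) * (NN x. g x)"
 proof (rule nn_integral_distortion)
  fix s x y k assume s: "0 < s" and d: "\<And>k. \<bar>Ph x $ k - Ph y $ k\<bar> <= s"
  have "x $ k - y $ k = (Ph x $ k - Ph y $ k) + (ta x - ta y) $ k" by (simp add: Ph_def)
  then have "\<bar>x $ k - y $ k\<bar> <= s + norm (ta x - ta y)"
  using d[of k] component_le_norm_cart[of "ta x - ta y" k] by linarith
  also have "norm (ta x - ta y) <= ka * norm (x - y)" by (rule lip)
  finally have 1: "\<bar>x $ k - y $ k\<bar> <= s + ka * norm (x - y)" by simp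
  have "norm (x - y) <= 2 * s"
  proof -
  have "norm (Ph x - Ph y) <= sqrt 2 * s" using d by (intro norm_le_2_coord) auto
  also have "... <= 3/2 * s" using s sqrt2_bound by (intro mult_right_mono) auto
  finally show ?thesis using Ph_expand[of x y] s by simp
  qed
  from mult_left_mono[OF this ka0] 1 show "\<bar>x $ k - y $ k\<bar> <= (1 + 2 * ka) * s" by (simp add: algebra_simps)
 qed (use ka0 in auto)
 also have "... <= ennreal (1 + 5 * ka) * (NN x. g x)"
  using distort_const by (intro mult_right_mono ennreal_leI) auto
 finally show ?thesis by simp
qed

lemma nn_integral_Pz:
 assumes [measurable]: "g \<in> bm"
 shows "(NN x. g (Pz x)) <= ennreal (1 + 5 * ka) * (NN x. g x)"
proof -
 have "(NN x. indicator UNIV x * g (Pz x)) <= ennreal ((1 + 2 * ka)^2) * (NN x. g x)"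
 proof (rule nn_integral_distortion)
  fix s x y k assume s: "0 < s" and d: "\<And>k. \<bar>Pz x $ k - Pz y $ k\<bar> <= s"
  have "x $ k - y $ k = (Pz x $ k - Pz y $ k) - (ta (Pz x) - ta (Pz y)) $ k"
  proof -
  have c: "Pz z $ k - ta (Pz z) $ k = z $ k" for z
  using Ph_Pz[of z] unfolding Ph_def by (metis vector_minus_component)
  show ?thesis using c[of x] c[of y] by (simp only: vector_minus_component)
  qed
  then have "\<bar>x $ k - y $ k\<bar> <= s + norm (ta (Pz x) - ta (Pz y))"
  using d[of k] component_le_norm_cart[of "ta (Pz x) - ta (Pz y)" k] by linarith
  also have "norm (ta (Pz x) - ta (Pz y)) <= ka * norm (Pz x - Pz y)" by (rule lip)
  finally have 1: "\<bar>x $ k - y $ k\<bar> <= s + ka * norm (Pz x - Pz y)" by simp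
  have "norm (Pz x - Pz y) <= 2 * s"
  proof -
  have "norm (Pz x - Pz y) <= sqrt 2 * s" using d by (intro norm_le_2_coord) auto
  also have "... <= 3/2 * s" using s sqrt2_bound by (intro mult_right_mono) auto
  finally show ?thesis using s by simp
  qed
  from mult_left_mono[OF this ka0] 1 show "\<bar>x $ k - y $ k\<bar> <= (1 + 2 * ka) * s" by (simp add: algebra_simps)
 qed (use ka0 in auto)
 also have "... <= ennreal (1 + 5 * ka) * (NN x. g x)"
  using distort_const by (intro mult_right_mono ennreal_leI) auto
 finally show ?thesis by simp
qed

end

section \<open>Band-limited functions along moving paths\<close>

definition bandlim :: "real => (real^2 => complex) => bool" where
 "bandlim R ga \<longleftrightarrow> in_L2 ga \<and> (\<forall>om. R <= norm om --> ga om = 0)"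

definition dmul :: "2 => (real^2 => complex) => real^2 => complex" where
 "dmul k ga om = 2 * of_real pi * \<i> * of_real (om $ k) * ga om"

definition gradsq :: "(real^2 => complex) => real^2 => real" where
 "gradsq ga x = (cmod (invF (dmul 1 ga) x))^2 + (cmod (invF (dmul 2 ga) x))^2"

definition genergy :: "(real^2 => complex) => ennreal" where
 "genergy ga = (NN om. ennreal ((2 * pi * norm om)^2 * (cmod (ga om))^2))"

lemma bandlim_L2: "bandlim R ga ==> in_L2 ga"
 by (simp add: bandlim_def)

lemma bandlim_meas [measurable_dest]: "bandlim R ga ==> ga \<in> bm"
 by (simp add: bandlim_def in_L2_def)

lemma bandlim_norm: "bandlim R ga ==> ga om \<noteq> 0 ==> norm om < R"
 unfolding bandlim_def by (meson not_le)

lemma bandlim_integrable: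
 assumes "bandlim R ga" shows "integrable lborel ga"
proof -
 have "(%om. indicator (cball 0 R) om * ga om) = ga"
  using assms by (auto simp: bandlim_def fun_eq_iff split: split_indicator)
 then show ?thesis using L2_truncation_integrable[of ga R] assms by (simp add: bandlim_def)
qed

lemma dmul_meas [measurable]: "ga \<in> bm ==> dmul k ga \<in> bm"
 unfolding dmul_def[abs_def] by measurable

lemma bandlim_dmul:
 assumes "bandlim R ga" shows "bandlim R (dmul k ga)"
proof -
 note [measurable] = bandlim_meas[OF assms]
 have "in_L2 (dmul k ga)"
 proof (rule in_L2_bound(1)[OF bandlim_L2[OF assms], of _ "2 * pi * max R 0"])
  have "cmod (dmul k ga om) <= 2 * pi * max R 0 * cmod (ga om)" for om
  proof (cases "ga om = 0")
  case False
  then have "norm om <= R" using bandlim_norm[OF assms] by (simp add: less_imp_le)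
  then have "\<bar>om $ k\<bar> <= max R 0" using component_le_norm_cart[of om k] by linarith
  then have "2 * pi * \<bar>om $ k\<bar> * cmod (ga om) <= 2 * pi * max R 0 * cmod (ga om)"
  by (intro mult_right_mono mult_left_mono) auto
  then show ?thesis by (simp add: dmul_def norm_mult)
  qed (simp add: dmul_def)
  then show "AEL om. cmod (dmul k ga om) <= 2 * pi * max R 0 * cmod (ga om)" by simp
 qed auto
 then show ?thesis using assms by (simp add: bandlim_def dmul_def)
qed

lemma ft_bandlim: "bandlim R ga ==> ft (invF ga) ga"
 by (intro ft_invF bandlim_integrable) (auto simp: bandlim_def)

lemma gradsq_meas [measurable]:
 assumes [measurable]: "ga \<in> bm"
 shows "gradsq ga \<in> bm"
 unfolding gradsq_def[abs_def] by measurable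

lemma gradsq_integral:
 assumes "bandlim R ga"
 shows "(NN x. ennreal (gradsq ga x)) = genergy ga"
proof -
 note [measurable] = bandlim_meas[OF assms]
 have *: "(NN x. ennreal ((cmod (invF (dmul k ga) x))^2)) = (NN x. ennreal ((cmod (dmul k ga x))^2))" for k
  using ft_isometry[OF ft_bandlim[OF bandlim_dmul[OF assms]], of k] by (simp flip: L2_norm_sq)
 have "(NN x. ennreal (gradsq ga x))
  = (NN x. ennreal ((cmod (dmul 1 ga x))^2)) + (NN x. ennreal ((cmod (dmul 2 ga x))^2))"
  unfolding gradsq_def *[symmetric] by (subst nn_integral_add[symmetric]) auto
 also have "... = genergy ga"
  unfolding genergy_def
  by (subst nn_integral_add[symmetric])
  (auto simp: dmul_def norm_mult power_mult_distrib norm_sq_2 algebra_simps simp flip: ennreal_plus intro!: nn_integral_cong)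
 finally show ?thesis .
qed

lemma genergy_le:
 assumes "bandlim R ga" "0 <= R"
 shows "genergy ga <= ennreal ((2 * pi * R)^2) * (L2_norm ga)^2"
proof -
 note [measurable] = bandlim_meas[OF assms(1)]
 have "genergy ga <= (NN om. ennreal ((2 * pi * R)^2) * ennreal ((cmod (ga om))^2))"
  unfolding genergy_def
 proof (rule nn_integral_mono)
  fix om
  show "ennreal ((2 * pi * norm om)^2 * (cmod (ga om))^2) <= ennreal ((2 * pi * R)^2) * ennreal ((cmod (ga om))^2)"
  proof (cases "R <= norm om")
  case False
  then have "(2 * pi * norm om)^2 <= (2 * pi * R)^2" by (intro power_mono mult_left_mono) auto
  then show ?thesis by (simp add: ennreal_mult[symmetric] mult_right_mono ennreal_leI)
  qed (use assms in \<open>simp add: bandlim_def\<close>)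
 qed
 also have "... = ennreal ((2 * pi * R)^2) * (L2_norm ga)^2"
  unfolding L2_norm_sq by (rule nn_integral_cmult) measurable
 finally show ?thesis .
qed

lemma cis_increment:
 "has_bochner_integral lborel (%t. indicator {0..1} t *\<^sub>R (\<i> * of_real b * cis (a + t * b))) (cis (a + b) - cis a)"
proof -
 have "has_bochner_integral lborel (%t. indicator {0..1} t *\<^sub>R (\<i> * of_real b * cis (a + t * b)))
  (cis (a + 1 * b) - cis (a + 0 * b))"
 proof (rule has_bochner_integral_FTC_Icc)
  fix t :: real
  have "((%z. exp (\<i> * (of_real a + z * of_real b))) has_field_derivative
  (\<i> * of_real b * exp (\<i> * (of_real a + of_real t * of_real b)))) (at (cor t))"
  by (auto intro!: derivative_eq_intros)
  from has_vector_derivative_real_field[OF this]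
  show "((%t. cis (a + t * b)) has_vector_derivative (\<i> * of_real b * cis (a + t * b))) (at t within {0..1})"
  by (simp only: cis_conv_exp of_real_add of_real_mult)
 qed (auto intro!: continuous_intros)
 then show ?thesis by simp
qed

lemma invF_increment_integral:
 assumes "bandlim R ga"
 shows "invF ga q - invF ga p = (LB t. indicator {0..1} t *\<^sub>R
  (of_real ((q - p)$1) * invF (dmul 1 ga) (p + t *\<^sub>R (q - p)) + of_real ((q - p)$2) * invF (dmul 2 ga) (p + t *\<^sub>R (q - p))))"
proof -
 note [measurable] = bandlim_meas[OF assms]
 define v where "v = q - p"
 define F where "F = (%(t::real) (om::real^2). indicator {0..1} t *\<^sub>R (\<i> * of_real (2 * pi * (v \<bullet> om)) * cis (2 * pi * (p \<bullet> om) + t * (2 * pi * (v \<bullet> om)))) * ga om)"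
 have ga: "integrable lborel ga" by (rule bandlim_integrable[OF assms])
 have i1: "integrable lborel (%om. cis (2 * pi * (x \<bullet> om)) * ga om)" for x
  using ga by (rule Bochner_Integration.integrable_bound) (auto simp: norm_mult)
 have "invF ga q - invF ga p = (LB om. cis (2 * pi * (q \<bullet> om)) * ga om - cis (2 * pi * (p \<bullet> om)) * ga om)"
  unfolding invF_def by (rule Bochner_Integration.integral_diff[symmetric]) (rule i1)+
 also have "... = (LB om. (LB t. F t om))"
 proof (rule bcong[OF refl])
  fix om
  have e: "2 * pi * (p \<bullet> om) + 2 * pi * (v \<bullet> om) = 2 * pi * (q \<bullet> om)"
  by (simp add: v_def inner_diff_left algebra_simps)
  have "(LB t. F t om) = (cis (2 * pi * (p \<bullet> om) + 2 * pi * (v \<bullet> om)) - cis (2 * pi * (p \<bullet> om))) * ga om"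
  unfolding F_def integral_mult_left_zero
  by (subst has_bochner_integral_integral_eq[OF cis_increment]) (rule refl)
  then show "cis (2 * pi * (q \<bullet> om)) * ga om - cis (2 * pi * (p \<bullet> om)) * ga om = (LB t. F t om)"
  unfolding e by (simp only: left_diff_distrib)
 qed
 also have "... = (LB t. (LB om. F t om))"
 proof (rule lborel_pair.Fubini_integral)
  show "integrable (lborel \<Otimes>\<^sub>M lborel) (%(t, om). F t om)"
  proof (rule integrableI_bounded)
  show "(%(t, om). F t om) \<in> borel_measurable (lborel \<Otimes>\<^sub>M lborel)" unfolding F_def by measurable
  have Fb: "ennreal (cmod (F t om)) <= indicator {0..1} t * ennreal (2 * pi * norm v * max R 0 * cmod (ga om))" for t om
  proof (cases "t \<in> {0..1} \<and> ga om \<noteq> 0")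
  case True
  then have "norm om < R" using bandlim_norm[OF assms] by blast
  then have "norm om <= max R 0" by simp
  then have "\<bar>v \<bullet> om\<bar> <= norm v * max R 0"
  using Cauchy_Schwarz_ineq2[of v om] mult_left_mono[of "norm om" "max R 0" "norm v"] by simp
  then have "2 * pi * \<bar>v \<bullet> om\<bar> * cmod (ga om) <= 2 * pi * (norm v * max R 0) * cmod (ga om)"
  by (intro mult_right_mono mult_left_mono) auto
  moreover have "cmod (F t om) = 2 * pi * \<bar>v \<bullet> om\<bar> * cmod (ga om)"
  using True by (simp add: F_def norm_mult abs_mult)
  ultimately show ?thesis using True by (simp add: ennreal_leI mult.assoc)
  qed (auto simp: F_def)
  have "(\<integral>\<^sup>+ p. ennreal (norm (case p of (t, om) => F t om)) \<partial>(lborel \<Otimes>\<^sub>M lborel))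
  = (NN t. (NN om. ennreal (cmod (F t om))))"
  by (subst lborel.nn_integral_fst[symmetric]) (simp_all add: F_def)
  also have "... <= (NN t. (NN om. indicator {0..1::real} t * ennreal (2 * pi * norm v * max R 0 * cmod (ga om))))"
  by (intro nn_integral_mono Fb)
  also have "... = (NN om. ennreal (2 * pi * norm v * max R 0 * cmod (ga om)))"
  by (simp add: nn_integral_cmult nn_integral_multc)
  also have "... < \<infinity>"
  proof -
  have "integrable lborel (%om. 2 * pi * norm v * max R 0 * cmod (ga om))"
  using ga by (intro integrable_mult_right integrable_norm)
  then have "(NN om. ennreal (norm (2 * pi * norm v * max R 0 * cmod (ga om)))) < \<infinity>"
  unfolding integrable_iff_bounded by (elim conjE)
  moreover have "norm (2 * pi * norm v * max R 0 * cmod (ga om)) = 2 * pi * norm v * max R 0 * cmod (ga om)" for om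
  unfolding real_norm_def by (intro abs_of_nonneg mult_nonneg_nonneg) auto
  ultimately show ?thesis by (simp only:)
  qed
  finally show "(\<integral>\<^sup>+ p. ennreal (norm (case p of (t, om) => F t om)) \<partial>(lborel \<Otimes>\<^sub>M lborel)) < \<infinity>" .
  qed
 qed
 also have "... = (LB t. indicator {0..1} t *\<^sub>R
  (of_real (v$1) * invF (dmul 1 ga) (p + t *\<^sub>R v) + of_real (v$2) * invF (dmul 2 ga) (p + t *\<^sub>R v)))"
 proof (rule bcong[OF refl])
  fix t :: real
  have i2: "integrable lborel (%om. of_real (v$k) * (cis (2 * pi * ((p + t *\<^sub>R v) \<bullet> om)) * dmul k ga om))" for k
  using bandlim_integrable[OF bandlim_dmul[OF assms], of k]
  by (intro integrable_mult_right, elim Bochner_Integration.integrable_bound) (auto simp: norm_mult)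
  have "of_real (v$1) * invF (dmul 1 ga) (p + t *\<^sub>R v) + of_real (v$2) * invF (dmul 2 ga) (p + t *\<^sub>R v)
  = (LB om. of_real (v$1) * (cis (2 * pi * ((p + t *\<^sub>R v) \<bullet> om)) * dmul 1 ga om) + of_real (v$2) * (cis (2 * pi * ((p + t *\<^sub>R v) \<bullet> om)) * dmul 2 ga om))"
  unfolding invF_def integral_mult_right_zero[symmetric]
  by (rule Bochner_Integration.integral_add[symmetric]) (rule i2)+
  then have "indicator {0..1} t *\<^sub>R (of_real (v$1) * invF (dmul 1 ga) (p + t *\<^sub>R v) + of_real (v$2) * invF (dmul 2 ga) (p + t *\<^sub>R v))
  = (LB om. indicator {0..1} t *\<^sub>R (of_real (v$1) * (cis (2 * pi * ((p + t *\<^sub>R v) \<bullet> om)) * dmul 1 ga om) + of_real (v$2) * (cis (2 * pi * ((p + t *\<^sub>R v) \<bullet> om)) * dmul 2 ga om)))"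
  by simp
  also have "... = (LB om. F t om)"
  proof (rule bcong[OF refl])
  fix om
  have "2 * pi * (p \<bullet> om) + t * (2 * pi * (v \<bullet> om)) = 2 * pi * ((p + t *\<^sub>R v) \<bullet> om)"
  by (simp add: inner_add_left algebra_simps)
  moreover have "cor (2 * pi * (v \<bullet> om)) = 2 * of_real pi * (of_real (v$1) * of_real (om$1) + of_real (v$2) * of_real (om$2))"
  by (simp add: inner_2)
  ultimately show "indicator {0..1} t *\<^sub>R (of_real (v$1) * (cis (2 * pi * ((p + t *\<^sub>R v) \<bullet> om)) * dmul 1 ga om) + of_real (v$2) * (cis (2 * pi * ((p + t *\<^sub>R v) \<bullet> om)) * dmul 2 ga om)) = F t om"
  unfolding F_def dmul_def by (simp only: scaleR_conv_of_real) (simp only: algebra_simps)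
  qed
  finally show "(LB om. F t om) = indicator {0..1} t *\<^sub>R (of_real (v$1) * invF (dmul 1 ga) (p + t *\<^sub>R v) + of_real (v$2) * invF (dmul 2 ga) (p + t *\<^sub>R v))"
  by (rule sym)
 qed
 finally show ?thesis unfolding v_def .
qed

lemma invF_increment:
 assumes "bandlim R ga"
 shows "ennreal ((cmod (invF ga q - invF ga p))^2)
  <= ennreal ((norm (q - p))^2) * (NN t. indicator {0..1} t * ennreal (gradsq ga (p + t *\<^sub>R (q - p))))"
proof -
 note [measurable] = bandlim_meas[OF assms]
 define v where "v = q - p"
 define H where "H t = of_real (v$1) * invF (dmul 1 ga) (p + t *\<^sub>R v) + of_real (v$2) * invF (dmul 2 ga) (p + t *\<^sub>R v)" for t
 have [measurable]: "H \<in> bm" unfolding H_def by measurable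
 have Hb: "(cmod (H t))^2 <= (norm v)^2 * gradsq ga (p + t *\<^sub>R v)" for t
 proof -
  have "cmod (H t) <= \<bar>v$1\<bar> * cmod (invF (dmul 1 ga) (p + t *\<^sub>R v)) + \<bar>v$2\<bar> * cmod (invF (dmul 2 ga) (p + t *\<^sub>R v))"
  unfolding H_def by (rule order_trans[OF norm_triangle_ineq]) (simp add: norm_mult)
  then have "(cmod (H t))^2 <= (\<bar>v$1\<bar> * cmod (invF (dmul 1 ga) (p + t *\<^sub>R v)) + \<bar>v$2\<bar> * cmod (invF (dmul 2 ga) (p + t *\<^sub>R v)))^2"
  by (rule power_mono) simp
  also have "(a * c + b * d)^2 <= (a^2 + b^2) * (c^2 + d^2)" for a b c d :: real
  using zero_le_power2[of "a * d - b * c"] by (simp add: power2_eq_square algebra_simps)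
  finally show ?thesis by (simp add: norm_sq_2 gradsq_def)
 qed
 have "ennreal (cmod (invF ga q - invF ga p)) <= (NN t. indicator {0..1} t * ennreal (cmod (H t)))"
 proof -
  have "invF ga q - invF ga p = (LB t. indicator {0..1} t *\<^sub>R H t)"
  using invF_increment_integral[OF assms, of q p] by (simp only: v_def H_def)
  moreover have "ennreal (cmod (LB t. indicator {0..1} t *\<^sub>R H t)) <= (NN t. ennreal (cmod (indicator {0..1} t *\<^sub>R H t)))"
  proof (cases "integrable lborel (%t. indicator {0..1} t *\<^sub>R H t)")
  case True
  then show ?thesis by (rule integral_norm_bound_ennreal)
  qed (simp add: not_integrable_integral_eq)
  moreover have "(NN t. ennreal (cmod (indicator {0..1} t *\<^sub>R H t))) = (NN t. indicator {0..1} t * ennreal (cmod (H t)))"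
  by (intro nn_integral_cong) (auto split: split_indicator)
  ultimately show ?thesis by simp
 qed
 then have "(ennreal (cmod (invF ga q - invF ga p)))^2 <= (NN t. indicator {0..1} t * (indicator {0..1} t * ennreal (cmod (H t))))^2"
 proof (intro power_mono)
  assume a: "ennreal (cmod (invF ga q - invF ga p)) <= (NN t. indicator {0..1} t * ennreal (cmod (H t)))"
  have "indicator {0..1} t * (indicator {0..1} t * ennreal (cmod (H t))) = indicator {0..1} t * ennreal (cmod (H t))" for t
  by (auto split: split_indicator)
  with a show "ennreal (cmod (invF ga q - invF ga p)) <= (NN t. indicator {0..1} t * (indicator {0..1} t * ennreal (cmod (H t))))"
  by (simp only:)
 qed simp
 also have "... <= (NN t. (indicator {0..1::real} t)^2) * (NN t. (indicator {0..1} t * ennreal (cmod (H t)))^2)"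
  by (rule Cauchy_Schwarz_nn_integral) auto
 also have "(NN t. (indicator {0..1::real} t)^2) = (NN t. (indicator {0..1::real} t :: ennreal))"
  by (intro nn_integral_cong) (auto split: split_indicator)
 also have "... = 1" by simp
 also have "1 * (NN t. (indicator {0..1} t * ennreal (cmod (H t)))^2)
  <= (NN t. ennreal ((norm v)^2) * (indicator {0..1} t * ennreal (gradsq ga (p + t *\<^sub>R v))))"
  unfolding mult_1
 proof (rule nn_integral_mono)
  fix t :: real
  show "(indicator {0..1} t * ennreal (cmod (H t)))^2 <= ennreal ((norm v)^2) * (indicator {0..1} t * ennreal (gradsq ga (p + t *\<^sub>R v)))"
  using ennreal_leI[OF Hb[of t]]
  by (cases "t \<in> {0..1}") (auto simp: ennreal_power ennreal_mult gradsq_def)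
 qed
 also have "... = ennreal ((norm v)^2) * (NN t. indicator {0..1} t * ennreal (gradsq ga (p + t *\<^sub>R v)))"
  by (rule nn_integral_cmult) measurable
 finally show ?thesis by (simp add: v_def ennreal_power)
qed

text \<open>Moving the argument of a band-limited function along segments that distort areas by a bounded
 factor only costs the length of the segments times the gradient.\<close>

lemma path_estimate:
 assumes ga: "bandlim R ga" and S[measurable]: "S \<in> sets borel"
  and P[measurable]: "P0 \<in> bm" "P1 \<in> bm"
  and \<eta>: "0 <= \<eta>" "\<And>x. x \<in> S ==> norm (P1 x - P0 x) <= \<eta>"
  and lip: "\<And>t x y. 0 <= t ==> t <= 1 ==> x \<in> S ==> y \<in> S ==>
  norm ((x - (P0 x + t *\<^sub>R (P1 x - P0 x))) - (y - (P0 y + t *\<^sub>R (P1 y - P0 y)))) <= 1/2 * norm (x - y)"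
 shows "(NN x. indicator S x * ennreal ((cmod (invF ga (P1 x) - invF ga (P0 x)))^2))
  <= ennreal (16 * \<eta>\<^sup>2) * genergy ga"
proof -
 note [measurable] = bandlim_meas[OF ga]
 define Q where "Q t x = P0 x + t *\<^sub>R (P1 x - P0 x)" for t x
 have "(NN x. indicator S x * ennreal ((cmod (invF ga (P1 x) - invF ga (P0 x)))^2))
  <= (NN x. (NN t. ennreal (\<eta>\<^sup>2) * (indicator {0..1::real} t * (indicator S x * ennreal (gradsq ga (Q t x))))))"
 proof (rule nn_integral_mono)
  fix x
  show "indicator S x * ennreal ((cmod (invF ga (P1 x) - invF ga (P0 x)))^2)
  <= (NN t. ennreal (\<eta>\<^sup>2) * (indicator {0..1::real} t * (indicator S x * ennreal (gradsq ga (Q t x)))))"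
  proof (cases "x \<in> S")
  case True
  have "ennreal ((cmod (invF ga (P1 x) - invF ga (P0 x)))^2)
  <= ennreal ((norm (P1 x - P0 x))^2) * (NN t. indicator {0..1} t * ennreal (gradsq ga (Q t x)))"
  unfolding Q_def by (rule invF_increment[OF ga])
  also have "... <= ennreal (\<eta>\<^sup>2) * (NN t. indicator {0..1} t * ennreal (gradsq ga (Q t x)))"
  by (intro mult_right_mono ennreal_leI power_mono \<eta> True) auto
  also have "... = (NN t. ennreal (\<eta>\<^sup>2) * (indicator {0..1} t * ennreal (gradsq ga (Q t x))))"
  by (rule nn_integral_cmult[symmetric]) (unfold Q_def, measurable)
  finally show ?thesis using True by simp
  qed simp
 qed
 also have "... = (NN t. (NN x. ennreal (\<eta>\<^sup>2) * (indicator {0..1::real} t * (indicator S x * ennreal (gradsq ga (Q t x))))))"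
  by (rule lborel_pair.Fubini') (unfold Q_def, measurable)
 also have "... <= (NN t. ennreal (\<eta>\<^sup>2) * (indicator {0..1::real} t * (16 * genergy ga)))"
 proof (rule nn_integral_mono)
  fix t :: real
  have Qm[measurable]: "Q t \<in> bm" unfolding Q_def by measurable
  show "(NN x. ennreal (\<eta>\<^sup>2) * (indicator {0..1::real} t * (indicator S x * ennreal (gradsq ga (Q t x)))))
  <= ennreal (\<eta>\<^sup>2) * (indicator {0..1::real} t * (16 * genergy ga))"
  proof (cases "t \<in> {0..1}")
  case True
  have "(NN x. indicator S x * ennreal (gradsq ga (Q t x))) <= ennreal ((2 * 2)^2) * (NN x. ennreal (gradsq ga x))"
  proof (rule nn_integral_expansive)
  fix x y assume xy: "x \<in> S" "y \<in> S"
  have "norm (x - y) <= norm ((x - Q t x) - (y - Q t y)) + norm (Q t x - Q t y)"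
  using norm_triangle_ineq[of "(x - Q t x) - (y - Q t y)" "Q t x - Q t y"] by simp
  moreover have "norm ((x - Q t x) - (y - Q t y)) <= 1/2 * norm (x - y)"
  unfolding Q_def using True xy by (intro lip) auto
  ultimately show "norm (x - y) <= 2 * norm (Q t x - Q t y)" by linarith
  qed auto
  then have "(NN x. indicator S x * ennreal (gradsq ga (Q t x))) <= 16 * genergy ga"
  by (simp add: gradsq_integral[OF ga])
  then show ?thesis using True by (simp add: nn_integral_cmult mult_left_mono)
  qed simp
 qed
 also have "... = ennreal (\<eta>\<^sup>2) * (16 * genergy ga)"
  by (simp add: nn_integral_cmult nn_integral_multc)
 also have "... = ennreal (16 * \<eta>\<^sup>2) * genergy ga"
  by (simp add: ennreal_mult mult_ac)
 finally show ?thesis .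
qed

section \<open>Averages\<close>

lemma average_sq_le:
 fixes w :: "real^2 => real" and a :: "real^2 => complex"
 assumes w: "integrable lborel w" "\<And>z. 0 <= w z" "(LB z. w z) = 1" and [measurable]: "a \<in> bm"
 shows "ennreal ((cmod (LB z. of_real (w z) * a z))^2) <= (NN z. ennreal (w z) * ennreal ((cmod (a z))^2))"
proof -
 have [measurable]: "w \<in> bm" using w(1) by auto
 have "ennreal (cmod (LB z. of_real (w z) * a z)) <= (NN z. ennreal (cmod (of_real (w z) * a z)))"
 proof (cases "integrable lborel (%z. of_real (w z) * a z)")
  case True
  then show ?thesis by (rule integral_norm_bound_ennreal)
 qed (simp add: not_integrable_integral_eq)
 also have "... = (NN z. ennreal (sqrt (w z)) * (ennreal (sqrt (w z)) * ennreal (cmod (a z))))"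
  by (intro nn_integral_cong) (simp add: norm_mult w(2) mult.assoc[symmetric] flip: ennreal_mult)
 finally have "(ennreal (cmod (LB z. of_real (w z) * a z)))^2
  <= (NN z. ennreal (sqrt (w z)) * (ennreal (sqrt (w z)) * ennreal (cmod (a z))))^2"
  by (rule power_mono) simp
 also have "... <= (NN z. (ennreal (sqrt (w z)))^2) * (NN z. (ennreal (sqrt (w z)) * ennreal (cmod (a z)))^2)"
  by (rule Cauchy_Schwarz_nn_integral) auto
 also have "(NN z. (ennreal (sqrt (w z)))^2) = (NN z. ennreal (w z))"
  by (intro nn_integral_cong) (simp add: ennreal_power w(2))
 also have "... = 1" using w by (simp add: nn_integral_eq_integral)
 also have "(NN z. (ennreal (sqrt (w z)) * ennreal (cmod (a z)))^2) = (NN z. ennreal (w z) * ennreal ((cmod (a z))^2))"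
  by (intro nn_integral_cong) (simp add: ennreal_power power_mult_distrib w(2))
 finally show ?thesis by (simp add: ennreal_power)
qed

lemma average_L2_le:
 fixes w :: "real^2 => real" and v :: "real^2 => real^2 => complex"
 assumes w: "integrable lborel w" "\<And>z. 0 <= w z" "(LB z. w z) = 1"
  and [measurable]: "case_prod v \<in> borel_measurable (borel \<Otimes>\<^sub>M borel)"
 shows "(L2_norm (%x. (LB z. of_real (w z) * v x z)))^2 <= (NN z. ennreal (w z) * (L2_norm (%x. v x z))^2)"
proof -
 have [measurable]: "w \<in> bm" using w(1) by auto
 have "(L2_norm (%x. (LB z. of_real (w z) * v x z)))^2
  <= (NN x. (NN z. ennreal (w z) * ennreal ((cmod (v x z))^2)))"
  unfolding L2_norm_sq by (intro nn_integral_mono average_sq_le w) measurable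
 also have "... = (NN z. (NN x. ennreal (w z) * ennreal ((cmod (v x z))^2)))"
  by (rule lborel_pair.Fubini') measurable
 also have "... = (NN z. ennreal (w z) * (L2_norm (%x. v x z))^2)"
  unfolding L2_norm_sq by (intro nn_integral_cong nn_integral_cmult) measurable
 finally show ?thesis .
qed

section \<open>Test functions\<close>

definition flat :: "real poly => real => real" where
 "flat p t = (if t > 0 then poly p (1 / t) * exp (- (1 / t)) else 0)"

lemma poly_exp_tendsto_0: "((%s. s ^ k * poly p s / exp s) \<longlongrightarrow> 0) (at_top :: real filter)"
proof (induction p arbitrary: k)
 case (pCons a p)
 have "((%s. a * (s ^ k / exp s) + s ^ Suc k * poly p s / exp s) \<longlongrightarrow> a * 0 + 0) (at_top :: real filter)"
  by (intro tendsto_intros tendsto_power_div_exp_0 pCons.IH)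
 also have "(%s. a * (s ^ k / exp s) + s ^ Suc k * poly p s / exp s) = (%s. s ^ k * poly (pCons a p) s / exp s)"
  by (simp add: fun_eq_iff algebra_simps add_divide_distrib)
 finally show ?case by simp
qed simp

lemma flat_over_t: "((%t. flat p t / t) \<longlongrightarrow> 0) (at_right 0)"
proof -
 have "((%t::real. inverse t ^ 1 * poly p (inverse t) / exp (inverse t)) \<longlongrightarrow> 0) (at_right 0)"
  by (rule filterlim_compose[OF poly_exp_tendsto_0 filterlim_inverse_at_top_right])
 moreover have "\<forall>\<^sub>F t in at_right 0. inverse t ^ 1 * poly p (inverse t) / exp (inverse t) = flat p t / t"
  unfolding eventually_at_right_field
  by (intro exI[of _ 1]) (auto simp: flat_def divide_inverse exp_minus)
 ultimately show ?thesis by (rule Lim_transform_eventually)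
qed

lemma flat_deriv: "(flat p has_real_derivative flat ([:0, 0, 1:] * (p - pderiv p)) t) (at t)"
proof -
 consider "t > 0" | "t < 0" | "t = 0" by linarith
 then show ?thesis
 proof cases
  case 1
  define s where "s = 1 / t"
  have 2: "((%t. 1 / t) has_real_derivative - (s * s)) (at t)"
  using DERIV_inverse[of t] 1 by (simp add: inverse_eq_divide s_def)
  have e: "((%s. exp (- s)) has_real_derivative (exp (- s) * (- 1))) (at s)" for s :: real
  by (rule DERIV_chain2[OF DERIV_exp DERIV_minus[OF DERIV_ident]])
  have 3: "((%s. poly p s * exp (- s)) has_real_derivative (poly (pderiv p) s * exp (- s) + (exp (- s) * (- 1)) * poly p s)) (at (1 / t))"
  unfolding s_def[symmetric] by (rule DERIV_mult[OF poly_DERIV e])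
  have "(poly (pderiv p) s * exp (- s) + (exp (- s) * (- 1)) * poly p s) * (- (s * s)) = flat ([:0, 0, 1:] * (p - pderiv p)) t"
  using 1 by (simp add: flat_def flip: s_def) (simp add: algebra_simps)
  with DERIV_chain2[OF 3 2]
  have "((%t. poly p (1 / t) * exp (- (1 / t))) has_real_derivative flat ([:0, 0, 1:] * (p - pderiv p)) t) (at t)"
  by simp
  then show ?thesis
  by (rule has_field_derivative_transform_within_open[where S="{0<..}"]) (use 1 in \<open>auto simp: flat_def\<close>)
 next
  case 2
  have "((%t. 0) has_real_derivative flat ([:0, 0, 1:] * (p - pderiv p)) t) (at t)"
  using 2 by (simp add: flat_def)
  then show ?thesis
  by (rule has_field_derivative_transform_within_open[where S="{..<0}"]) (use 2 in \<open>auto simp: flat_def\<close>)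
 next
  case 3
  have "((%h. flat p h / h) \<longlongrightarrow> 0) (at_left 0)"
  by (rule tendsto_eventually) (auto simp: eventually_at_left_field flat_def intro!: exI[of _ "-1"])
  with flat_over_t[of p] have "((%h. flat p h / h) \<longlongrightarrow> 0) (at 0)"
  by (simp add: filterlim_split_at)
  with 3 show ?thesis by (simp add: has_field_derivative_iff flat_def[of _ 0])
 qed
qed

text \<open>Products and sums of flat functions of one coordinate form a class that is closed under partial
 derivatives, hence consists of infinitely differentiable functions.\<close>

inductive smooth_cl :: "(real^2 => real) => bool" where
 flat: "smooth_cl (%x. flat p (a + c * x $ k))"
| const: "smooth_cl (%x. c)"
| add: "smooth_cl f ==> smooth_cl g ==> smooth_cl (%x. f x + g x)"
| mult: "smooth_cl f ==> smooth_cl g ==> smooth_cl (%x. f x * g x)"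

lemma smooth_cl_deriv:
 "smooth_cl f ==> \<exists>f'. (\<forall>x. (f has_derivative f' x) (at x)) \<and> (\<forall>l. smooth_cl (%x. f' x (axis l 1)))"
proof (induction rule: smooth_cl.induct)
 case (flat p a c k)
 define q where "q = [:0, 0, 1:] * (p - pderiv p)"
 show ?case
 proof (intro exI[of _ "%x v. flat q (a + c * x $ k) * (c * v $ k)"] conjI allI)
  fix x
  have 1: "(flat p has_derivative (%h. flat q (a + c * x $ k) * h)) (at (a + c * x $ k))"
  using flat_deriv[of p "a + c * x $ k"] by (simp add: q_def has_field_derivative_def)
  have 2: "((%x::real^2. a + c * x $ k) has_derivative (%v. c * v $ k)) (at x)"
  by (auto intro!: derivative_eq_intros bounded_linear_imp_has_derivative bounded_linear_vec_nth)
  from has_derivative_compose[OF 2 1]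
  show "((%x. flat p (a + c * x $ k)) has_derivative (%v. flat q (a + c * x $ k) * (c * v $ k))) (at x)" .
 next
  fix l
  show "smooth_cl (%x. flat q (a + c * x $ k) * (c * axis l 1 $ k))"
  by (intro smooth_cl.intros)
 qed
next
 case (const c)
 show ?case by (intro exI[of _ "%x v. 0"]) (auto intro: smooth_cl.const)
next
 case (add f g)
 then obtain f' g' where "\<forall>x. (f has_derivative f' x) (at x)" "\<forall>l. smooth_cl (%x. f' x (axis l 1))"
  "\<forall>x. (g has_derivative g' x) (at x)" "\<forall>l. smooth_cl (%x. g' x (axis l 1))" by blast
 then show ?case
  by (intro exI[of _ "%x v. f' x v + g' x v"]) (auto intro: smooth_cl.add has_derivative_add)
next
 case (mult f g)
 then obtain f' g' where *: "\<forall>x. (f has_derivative f' x) (at x)" "\<forall>l. smooth_cl (%x. f' x (axis l 1))"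
  "\<forall>x. (g has_derivative g' x) (at x)" "\<forall>l. smooth_cl (%x. g' x (axis l 1))" by blast
 show ?case
 proof (intro exI[of _ "%x v. f x * g' x v + f' x v * g x"] conjI allI)
  show "((%x. f x * g x) has_derivative (%v. f x * g' x v + f' x v * g x)) (at x)" for x
  using * by (intro has_derivative_mult) auto
  show "smooth_cl (%x. f x * g' x (axis l 1) + f' x (axis l 1) * g x)" for l
  using * mult.hyps by (intro smooth_cl.add smooth_cl.mult) auto
 qed
qed

lemma smooth_cl_partial:
 assumes "smooth_cl f"
 shows "f differentiable (at x)" "smooth_cl (partial_deriv l f)"
proof -
 obtain f' where f': "\<And>x. (f has_derivative f' x) (at x)" "\<And>l. smooth_cl (%x. f' x (axis l 1))"
  using smooth_cl_deriv[OF assms] by blast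
 show "f differentiable (at x)" using f'(1) by (auto simp: differentiable_def)
 have "partial_deriv l f = (%x. f' x (axis l 1))"
  unfolding partial_deriv_def by (rule ext) (simp add: frechet_derivative_at[OF f'(1), symmetric])
 then show "smooth_cl (partial_deriv l f)" using f'(2) by simp
qed

lemma smooth_cl_times_differentiable:
 assumes "smooth_cl f" shows "times_differentiable n f"
proof -
 have "smooth_cl (fold partial_deriv ks f)" for ks
  using assms by (induction ks arbitrary: f) (auto intro: smooth_cl_partial)
 then show ?thesis unfolding times_differentiable_def using smooth_cl_partial(1) by blast
qed

lemma smooth_cl_cont: "smooth_cl f ==> continuous_on UNIV f"
 unfolding continuous_on_eq_continuous_at[OF open_UNIV]
 by (intro ballI differentiable_imp_continuous_within smooth_cl_partial(1))

lemma smooth_cl_meas: "smooth_cl f ==> f \<in> bm"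
 by (intro borel_measurable_continuous_onI smooth_cl_cont)

lemma smooth_cl_reflect: "smooth_cl f ==> smooth_cl (%y. f (x - y))"
proof (induction rule: smooth_cl.induct)
 case (flat p a c k)
 have "(%y. flat p (a + c * (x - y) $ k)) = (%y. flat p ((a + c * x $ k) + (- c) * y $ k))"
  by (simp add: fun_eq_iff algebra_simps)
 then show ?case using smooth_cl.flat by metis
qed (auto intro: smooth_cl.intros)

lemma partial_deriv_reflect:
 assumes "smooth_cl f"
 shows "partial_deriv l (%y. f (x - y)) y = - partial_deriv l f (x - y)"
proof -
 obtain f' where f': "\<And>x. (f has_derivative f' x) (at x)" using smooth_cl_deriv[OF assms] by blast
 have "((%y. x - y) has_derivative (%v. - v)) (at y)" by (auto intro!: derivative_eq_intros)
 from has_derivative_compose[OF this f'[of "x - y"]]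
 have "((%y. f (x - y)) has_derivative (%v. f' (x - y) (- v))) (at y)" .
 then have "partial_deriv l (%y. f (x - y)) y = f' (x - y) (- axis l 1)"
  unfolding partial_deriv_def by (simp add: frechet_derivative_at[symmetric])
 also have "... = - f' (x - y) (axis l 1)"
  using linear_neg[OF has_derivative_linear[OF f']] by simp
 finally show ?thesis unfolding partial_deriv_def by (simp add: frechet_derivative_at[OF f', symmetric])
qed

lemma smooth_cl_increment:
 assumes f: "smooth_cl f"
 shows "has_bochner_integral lborel (%t. indicator {0..1} t *\<^sub>R
  (v$1 * partial_deriv 1 f (p + t *\<^sub>R v) + v$2 * partial_deriv 2 f (p + t *\<^sub>R v))) (f (p + v) - f p)"
proof -
 obtain f' where f': "\<And>x. (f has_derivative f' x) (at x)" using smooth_cl_deriv[OF f] by blast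
 have pd: "partial_deriv l f x = f' x (axis l 1)" for l x
  unfolding partial_deriv_def by (simp add: frechet_derivative_at[OF f', symmetric])
 have lin: "f' x v = v$1 * f' x (axis 1 1) + v$2 * f' x (axis 2 1)" for x v
 proof -
  have "v = v$1 *\<^sub>R axis 1 1 + v$2 *\<^sub>R axis 2 1"
  by (auto simp: vec_eq_iff forall_2 axis_def)
  then have "f' x v = f' x (v$1 *\<^sub>R axis 1 1 + v$2 *\<^sub>R axis 2 1)" by simp
  also have "... = v$1 * f' x (axis 1 1) + v$2 * f' x (axis 2 1)"
  using has_derivative_linear[OF f'[of x]] by (simp add: linear_add linear_scale)
  finally show ?thesis .
 qed
 have "has_bochner_integral lborel (%t. indicator {0..1} t *\<^sub>R f' (p + t *\<^sub>R v) v) (f (p + 1 *\<^sub>R v) - f (p + 0 *\<^sub>R v))"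
 proof (rule has_bochner_integral_FTC_Icc)
  fix t :: real
  have "((%t. p + t *\<^sub>R v) has_derivative (%h. h *\<^sub>R v)) (at t within {0..1})"
  by (auto intro!: derivative_eq_intros)
  from has_derivative_compose[OF this f'[of "p + t *\<^sub>R v"]]
  have "((%t. f (p + t *\<^sub>R v)) has_derivative (%h. f' (p + t *\<^sub>R v) (h *\<^sub>R v))) (at t within {0..1})" .
  then show "((%t. f (p + t *\<^sub>R v)) has_vector_derivative f' (p + t *\<^sub>R v) v) (at t within {0..1})"
  unfolding has_vector_derivative_def
  using linear_scale[OF has_derivative_linear[OF f'[of "p + t *\<^sub>R v"]]] by simp
 next
  have c: "continuous_on UNIV (%x. f' x v)"
  unfolding lin[of _ v] pd[symmetric] using smooth_cl_cont[OF smooth_cl_partial(2)[OF f]]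
  by (intro continuous_intros) auto
  show "continuous_on {0..1} (%t. f' (p + t *\<^sub>R v) v)"
  by (rule continuous_on_compose2[OF c]) (auto intro!: continuous_intros)
 qed simp
 then show ?thesis unfolding pd lin[symmetric] by simp
qed

definition bump :: "real => real^2 => real" where
 "bump N z = (flat 1 (1 + N * z $ 1) * flat 1 (1 + (- N) * z $ 1)) * (flat 1 (1 + N * z $ 2) * flat 1 (1 + (- N) * z $ 2))"

lemma bump_smooth: "smooth_cl (bump N)"
 unfolding bump_def[abs_def] by (intro smooth_cl.intros)

lemma bump_nonneg: "0 <= bump N z"
 by (simp add: bump_def flat_def)

lemma bump_supp:
 assumes N: "0 < N" and z: "bump N z \<noteq> 0"
 shows "norm z <= 2 / N"
proof -
 have "\<bar>z $ k\<bar> <= 1 / N" for k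
 proof -
  have "0 < 1 + N * z $ k \<and> 0 < 1 + (- N) * z $ k"
  using z exhaust_2[of k] by (auto simp: bump_def flat_def split: if_splits)
  then show ?thesis using N by (simp add: abs_le_iff field_simps)
 qed
 then have "norm z <= sqrt 2 * (1 / N)" by (rule norm_le_2_coord)
 also have "... <= 2 * (1 / N)" using N by (intro mult_right_mono less_imp_le[OF sqrt2_less_2]) auto
 finally show ?thesis by simp
qed

lemma compact_supp_bounded:
 fixes f :: "real^2 => real"
 assumes "continuous_on UNIV f" "\<And>z. r < norm z ==> f z = 0"
 shows "\<exists>M\<ge>0. \<forall>z. \<bar>f z\<bar> <= M"
proof -
 have "compact (f ` cball 0 r)" by (intro compact_continuous_image continuous_on_subset[OF assms(1)]) auto
 then obtain M where M: "\<And>z. norm z <= r ==> \<bar>f z\<bar> <= M"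
  using compact_imp_bounded bounded_iff by (metis image_eqI mem_cball_0 real_norm_def)
 show ?thesis
  by (intro exI[of _ "max M 0"]) (use M assms(2) in \<open>auto simp: not_le[symmetric] le_max_iff_disj\<close>)
qed

lemma integrable_compact_supp:
 fixes f :: "real^2 => real"
 assumes "continuous_on UNIV f" "\<And>z. r < norm z ==> f z = 0"
 shows "integrable lborel f"
proof -
 have "integrable lborel (%z. indicator (cball 0 r) z *\<^sub>R f z)"
  by (rule borel_integrable_compact) (auto intro: continuous_on_subset[OF assms(1)])
 also have "(%z. indicator (cball 0 r) z *\<^sub>R f z) = f"
  using assms(2) by (auto simp: fun_eq_iff split: split_indicator)
 finally show ?thesis .
qed

lemma bump_zero: "0 < N ==> 2 / N < norm z ==> bump N z = 0"
 using bump_supp[of N z] by force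

lemma bump_integrable: "0 < N ==> integrable lborel (bump N)"
 by (rule integrable_compact_supp[OF smooth_cl_cont[OF bump_smooth] bump_zero])

lemma bump_integral_pos:
 assumes "0 < N" shows "0 < (LB z. bump N z)"
proof -
 have "(LB z. bump N z) \<noteq> 0"
 proof
  assume "(LB z. bump N z) = 0"
  then have "AEL z. bump N z = 0"
  using integral_nonneg_eq_0_iff_AE[OF bump_integrable[OF assms]] bump_nonneg by simp
  moreover have "bump N z \<noteq> 0" if "norm z < 1 / N" for z
  proof -
  have "\<bar>z $ k\<bar> < 1 / N" for k using component_le_norm_cart[of z k] that by linarith
  then have "- 1 < N * z $ k \<and> N * z $ k < 1" for k
  using assms by (simp add: abs_less_iff field_simps)
  then have "0 < 1 + N * z $ k \<and> 0 < 1 + (- N) * z $ k" for k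
  proof -
  have "- 1 < N * z $ k" "N * z $ k < 1" using \<open>\<And>k. - 1 < N * z $ k \<and> N * z $ k < 1\<close> by auto
  then show ?thesis by (simp only: mult_minus_left) linarith
  qed
  then have "0 < flat 1 (1 + N * z $ k)" "0 < flat 1 (1 + (- N) * z $ k)" for k
  by (simp_all add: flat_def)
  then show ?thesis unfolding bump_def by (metis mult_eq_0_iff less_irrefl)
  qed
  ultimately have "AEL z. z \<notin> ball (0::real^2) (1/N)" by (auto elim: eventually_mono)
  then have "ball (0::real^2) (1/N) \<in> null_sets lborel"
  by (subst AE_iff_null_sets) auto
  then show False
  using assms negligible_iff_null_sets null_sets_completionI open_not_negligible[of "ball (0::real^2) (1/N)"] by auto
 qed
 moreover have "0 <= (LB z. bump N z)" by (intro integral_nonneg_AE) (simp add: bump_nonneg)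
 ultimately show ?thesis by linarith
qed

text \<open>The mollifier at scale \<open>1/N\<close>.\<close>

definition moll :: "real => real^2 => real" where
 "moll N z = inverse (LB z. bump N z) * bump N z"

lemma moll_smooth: "smooth_cl (moll N)"
 unfolding moll_def[abs_def] by (intro smooth_cl.mult smooth_cl.const bump_smooth)

lemma moll_props:
 assumes "0 < N"
 shows "0 <= moll N z" "integrable lborel (moll N)" "(LB z. moll N z) = 1"
  "2 / N < norm z ==> moll N z = 0"
proof -
 note b = bump_integral_pos[OF assms] bump_integrable[OF assms] bump_nonneg bump_zero[OF assms]
 show "0 <= moll N z" using b(1,3) by (simp add: moll_def)
 show "integrable lborel (moll N)" using b(2) unfolding moll_def[abs_def] by (intro integrable_mult_right)
 show "(LB z. moll N z) = 1" using b(1,2) unfolding moll_def by simp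
 show "2 / N < norm z ==> moll N z = 0" using b(4) by (simp add: moll_def)
qed

lemma moll_test_function:
 assumes "0 < N"
 shows "test_function (%y. moll N (x - y))"
 unfolding test_function_def
proof
 show "\<forall>n. times_differentiable n (%y. moll N (x - y))"
  by (intro allI smooth_cl_times_differentiable smooth_cl_reflect moll_smooth)
 have "{y. moll N (x - y) \<noteq> 0} \<subseteq> cball x (2 / N)"
  using moll_props(4)[OF assms] by (force simp: dist_norm not_le[symmetric])
 then have "bounded {y. moll N (x - y) \<noteq> 0}" by (rule bounded_subset[OF bounded_cball])
 then show "compact (closure {y. moll N (x - y) \<noteq> 0})" by simp
qed

lemma partial_moll_zero:
 assumes "0 < N" "2 / N < norm z"
 shows "partial_deriv l (moll N) z = 0"
proof -
 have "((%z. 0::real) has_derivative (%v. 0)) (at z)" by simp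
 then have "(moll N has_derivative (%v. 0)) (at z)"
 proof (rule has_derivative_transform_within_open)
  show "open {z::real^2. 2 / N < norm z}"
  by (rule open_Collect_less) (auto intro: continuous_intros)
 qed (use assms moll_props(4) in auto)
 then show ?thesis unfolding partial_deriv_def by (simp add: frechet_derivative_at[symmetric])
qed

section \<open>Weakly differentiable bounded vector fields are Lipschitz\<close>

definition smear :: "real => (real^2 => real) => real^2 => real" where
 "smear N h x = (LB y. h y * moll N (x - y))"

lemma moll_meas [measurable]: "moll N \<in> bm"
 by (rule smooth_cl_meas[OF moll_smooth])

lemma smear_cong_AE:
 assumes [measurable]: "h \<in> bm" "h' \<in> bm"
  and "AEL y. h y = h' y"
 shows "smear N h x = smear N h' x"
 unfolding smear_def by (rule integral_cong_AE) (use assms(3) in \<open>auto elim: eventually_mono\<close>)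

lemma integrable_bounded_mult:
 fixes w h :: "real^2 => real"
 assumes "integrable lborel w" and [measurable]: "h \<in> bm" and "\<And>y. \<bar>h y\<bar> <= B"
 shows "integrable lborel (%y. h y * w y)"
proof (rule Bochner_Integration.integrable_bound)
 show "integrable lborel (%y. B * w y)" using assms(1) by simp
 have "0 <= B" using assms(3)[of 0] by linarith
 then show "AEL y. norm (h y * w y) <= norm (B * w y)"
  using assms(3) by (auto simp: abs_mult intro!: mult_right_mono)
 show "(%y. h y * w y) \<in> borel_measurable lborel" using assms(1) by (auto dest: borel_measurable_integrable)
qed

lemma moll_reflect_integrable: "0 < N ==> integrable lborel (%y. moll N (x - y))"
 using moll_props(2) by (rule integral_reflect_shift(2))

text \<open>If \<open>G l\<close> is the weak partial derivative of the bounded function \<open>h\<close> in direction \<open>l\<close> and the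
 derivative in direction \<open>v\<close> is bounded by \<open>K\<close>, then the increments of the mollified
 function along \<open>v\<close> are bounded by \<open>K\<close>: write the increment of the mollifier as an integral of
 its gradient and move the derivative onto \<open>h\<close>.\<close>

lemma smear_increment:
 assumes N: "0 < N" and h[measurable]: "h \<in> bm" and hB: "\<And>y. \<bar>h y\<bar> <= B"
  and G[measurable]: "\<And>l. G l \<in> bm"
  and weak: "\<And>l x. (LB y. h y * partial_deriv l (%y. moll N (x - y)) y) = - (LB y. G l y * moll N (x - y))"
  and GB: "\<And>l y. \<bar>G l y\<bar> <= B'"
  and K: "AEL y. \<bar>v$1 * G 1 y + v$2 * G 2 y\<bar> <= K"
 shows "\<bar>smear N h (p + v) - smear N h p\<bar> <= K"
proof -
 define P where "P l = partial_deriv l (moll N)" for l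
 have Ps: "smooth_cl (P l)" for l unfolding P_def by (rule smooth_cl_partial(2)[OF moll_smooth])
 have Pm[measurable]: "P l \<in> bm" for l by (rule smooth_cl_meas[OF Ps])
 have P0: "2 / N < norm z ==> P l z = 0" for l z unfolding P_def by (rule partial_moll_zero[OF N])
 have Pi: "integrable lborel (P l)" for l by (rule integrable_compact_supp[OF smooth_cl_cont[OF Ps] P0])
 have "\<exists>M\<ge>0. \<forall>z. \<bar>P l z\<bar> <= M" for l by (rule compact_supp_bounded[OF smooth_cl_cont[OF Ps] P0])
 then obtain M where M: "\<And>l. 0 <= M l" "\<And>l z. \<bar>P l z\<bar> <= M l" by metis
 have Pri: "integrable lborel (%y. P l (x - y))" for l x by (rule integral_reflect_shift(2)[OF Pi])
 define J where "J t = (LB y. h y * (v$1 * P 1 (p + t *\<^sub>R v - y) + v$2 * P 2 (p + t *\<^sub>R v - y)))" for t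
 define f where "f = (%(t::real) y. indicator {0..1} t * (h y * (v$1 * P 1 (p + t *\<^sub>R v - y) + v$2 * P 2 (p + t *\<^sub>R v - y))))"
 have K0: "0 <= K"
 proof -
  have "\<exists>y. \<bar>v$1 * G 1 y + v$2 * G 2 y\<bar> <= K"
  proof (rule ccontr)
  assume "\<nexists>y. \<bar>v$1 * G 1 y + v$2 * G 2 y\<bar> <= K"
  with K have "AE y in (lborel :: (real^2) measure). False" by (auto elim: eventually_mono)
  then have "emeasure lborel (space (lborel :: (real^2) measure)) = 0"
  unfolding ae_filter_eq_bot_iff[symmetric] trivial_limit_def[symmetric] by simp
  then show False by simp
  qed
  then show ?thesis by (meson abs_ge_zero order_trans)
 qed
 have fint: "integrable (lborel \<Otimes>\<^sub>M lborel) (%(t, y). f t y)"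
 proof (rule integrableI_bounded)
  show "(%(t, y). f t y) \<in> borel_measurable (lborel \<Otimes>\<^sub>M lborel)" unfolding f_def by measurable
  define c where "c = B * (\<bar>v$1\<bar> * M 1 + \<bar>v$2\<bar> * M 2)"
  define r where "r = norm p + norm v + 2 / N"
  have B0: "0 <= B" using hB[of 0] by linarith
  have fb: "ennreal (norm (f t y)) <= indicator {0..1} t * (ennreal c * indicator (cball 0 r) y)" for t y
  proof (cases "t \<in> {0..1} \<and> norm y <= r")
  case True
  have "\<bar>v$1 * P 1 (p + t *\<^sub>R v - y) + v$2 * P 2 (p + t *\<^sub>R v - y)\<bar> <= \<bar>v$1\<bar> * M 1 + \<bar>v$2\<bar> * M 2"
  by (rule order_trans[OF abs_triangle_ineq]) (auto simp: abs_mult intro!: add_mono mult_left_mono M)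
  then have "\<bar>h y\<bar> * \<bar>v$1 * P 1 (p + t *\<^sub>R v - y) + v$2 * P 2 (p + t *\<^sub>R v - y)\<bar> <= c"
  unfolding c_def using hB[of y] B0 by (intro mult_mono) auto
  then show ?thesis using True by (simp add: f_def abs_mult ennreal_leI)
  next
  case False
  have "f t y = 0"
  proof (cases "t \<in> {0..1}")
  case True
  then have "r < norm y" using False by auto
  moreover have "norm (t *\<^sub>R v) <= norm v" using True by (simp add: mult_left_le_one_le)
  moreover have "norm y <= norm (p + t *\<^sub>R v - y) + (norm p + norm (t *\<^sub>R v))"
  using norm_triangle_ineq4[of "p + t *\<^sub>R v" "p + t *\<^sub>R v - y"] norm_triangle_ineq[of p "t *\<^sub>R v"] by simp
  ultimately have "2 / N < norm (p + t *\<^sub>R v - y)" unfolding r_def by linarith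
  then show ?thesis by (simp add: f_def P0)
  qed (simp add: f_def)
  then show ?thesis by simp
  qed
  have "(\<integral>\<^sup>+ q. ennreal (norm (case q of (t, y) => f t y)) \<partial>(lborel \<Otimes>\<^sub>M lborel))
  = (NN t. (NN y. ennreal (norm (f t y))))"
  by (subst lborel.nn_integral_fst[symmetric]) (simp_all add: f_def)
  also have "... <= (NN t. (NN y. indicator {0..1::real} t * (ennreal c * indicator (cball (0::real^2) r) y)))"
  by (intro nn_integral_mono fb)
  also have "... = ennreal c * emeasure lborel (cball (0::real^2) r)"
  by (simp add: nn_integral_cmult nn_integral_multc)
  also have "... < \<infinity>"
  using emeasure_bounded_finite[of "cball (0::real^2) r"] by (simp add: ennreal_mult_less_top)
  finally show "(\<integral>\<^sup>+ q. ennreal (norm (case q of (t, y) => f t y)) \<partial>(lborel \<Otimes>\<^sub>M lborel)) < \<infinity>" .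
 qed
 have hm: "integrable lborel (%y. h y * moll N (x - y))" for x
  by (rule integrable_bounded_mult[OF moll_reflect_integrable[OF N] h hB])
 have "smear N h (p + v) - smear N h p = (LB y. h y * moll N (p + v - y) - h y * moll N (p - y))"
  unfolding smear_def by (rule Bochner_Integration.integral_diff[symmetric]) (rule hm)+
 also have "... = (LB y. (LB t. f t y))"
 proof (rule bcong[OF refl])
  fix y
  have "moll N (p - y + v) - moll N (p - y) = (LB t. indicator {0..1} t *\<^sub>R (v$1 * P 1 (p - y + t *\<^sub>R v) + v$2 * P 2 (p - y + t *\<^sub>R v)))"
  unfolding P_def by (rule has_bochner_integral_integral_eq[symmetric, OF smooth_cl_increment[OF moll_smooth]])
  moreover have "p - y + v = p + v - y" by simp
  ultimately have "h y * (moll N (p + v - y) - moll N (p - y)) = (LB t. h y * (indicator {0..1} t *\<^sub>R (v$1 * P 1 (p - y + t *\<^sub>R v) + v$2 * P 2 (p - y + t *\<^sub>R v))))"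
  by (simp only: integral_mult_right_zero)
  also have "... = (LB t. f t y)"
  by (intro bcong refl) (simp add: f_def algebra_simps)
  finally show "h y * moll N (p + v - y) - h y * moll N (p - y) = (LB t. f t y)"
  by (simp add: right_diff_distrib)
 qed
 also have "... = (LB t. (LB y. f t y))"
  by (rule lborel_pair.Fubini_integral[OF fint])
 also have "... = (LB t. indicator {0..1} t * J t)"
  by (simp add: f_def J_def)
 finally have eq: "smear N h (p + v) - smear N h p = (LB t. indicator {0..1} t * J t)" .
 have JK: "\<bar>J t\<bar> <= K" for t
 proof -
  define x where "x = p + t *\<^sub>R v"
  have hP: "integrable lborel (%y. h y * P l (x - y))" for l
  by (rule integrable_bounded_mult[OF Pri h hB])
  have GM: "integrable lborel (%y. G l y * moll N (x - y))" for l
  by (rule integrable_bounded_mult[OF moll_reflect_integrable[OF N] G GB])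
  have w: "(LB y. h y * P l (x - y)) = (LB y. G l y * moll N (x - y))" for l
  using weak[of l x] by (simp add: partial_deriv_reflect[OF moll_smooth] P_def)
  have "J t = (LB y. v$1 * (h y * P 1 (x - y)) + v$2 * (h y * P 2 (x - y)))"
  unfolding J_def x_def by (simp add: algebra_simps)
  also have "... = v$1 * (LB y. G 1 y * moll N (x - y)) + v$2 * (LB y. G 2 y * moll N (x - y))"
  using hP by (subst Bochner_Integration.integral_add) (auto simp: w)
  also have "... = (LB y. v$1 * (G 1 y * moll N (x - y)) + v$2 * (G 2 y * moll N (x - y)))"
  using GM by (subst Bochner_Integration.integral_add) auto
  also have "\<bar>...\<bar> <= (LB y. K * moll N (x - y))"
  proof (rule order_trans[OF integral_abs_bound integral_mono_AE])
  show "integrable lborel (%y. \<bar>v$1 * (G 1 y * moll N (x - y)) + v$2 * (G 2 y * moll N (x - y))\<bar>)"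
  by (intro integrable_abs Bochner_Integration.integrable_add integrable_mult_right GM)
  show "integrable lborel (%y. K * moll N (x - y))"
  by (intro integrable_mult_right moll_reflect_integrable N)
  show "AEL y. \<bar>v$1 * (G 1 y * moll N (x - y)) + v$2 * (G 2 y * moll N (x - y))\<bar> <= K * moll N (x - y)"
  using K
  proof eventually_elim
  fix y assume "\<bar>v$1 * G 1 y + v$2 * G 2 y\<bar> <= K"
  then have "\<bar>v$1 * G 1 y + v$2 * G 2 y\<bar> * moll N (x - y) <= K * moll N (x - y)"
  using moll_props(1)[OF N] by (rule mult_right_mono)
  moreover have "\<bar>v$1 * (G 1 y * moll N (x - y)) + v$2 * (G 2 y * moll N (x - y))\<bar> = \<bar>v$1 * G 1 y + v$2 * G 2 y\<bar> * moll N (x - y)"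
  proof -
  have "v$1 * (G 1 y * moll N (x - y)) + v$2 * (G 2 y * moll N (x - y)) = (v$1 * G 1 y + v$2 * G 2 y) * moll N (x - y)"
  by (simp add: algebra_simps)
  then show ?thesis using moll_props(1)[OF N, of "x - y"] by (simp add: abs_mult)
  qed
  ultimately show "\<bar>v$1 * (G 1 y * moll N (x - y)) + v$2 * (G 2 y * moll N (x - y))\<bar> <= K * moll N (x - y)" by simp
  qed
  qed
  also have "... = K" using moll_props(3)[OF N] integral_reflect_shift(1)[of "moll N" x] by simp
  finally show ?thesis .
 qed
 have "\<bar>(LB t. indicator {0..1} t * J t)\<bar> <= (LB t. K * indicator {0..1::real} t)"
 proof (rule order_trans[OF integral_abs_bound integral_mono_AE'])
  show "integrable lborel (%t. K * indicator {0..1::real} t)" by simp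
  show "AEL t. \<bar>indicator {0..1} t * J t\<bar> <= K * indicator {0..1::real} t"
  using JK by (auto simp: abs_mult split: split_indicator)
 qed (use K0 in auto)
 also have "... = K" by simp
 finally show ?thesis using eq by simp
qed

lemma component_measurable [measurable]:
 "f \<in> borel_measurable M ==> (%x. (f x :: real^2) $ k) \<in> borel_measurable M"
 by (rule measurable_compose[OF _ borel_measurable_continuous_onI]) (auto intro!: continuous_intros)

lemma matrix_component_measurable [measurable]:
 "f \<in> borel_measurable M ==> (%x. (f x :: real^2^2) $ k) \<in> borel_measurable M"
 by (rule measurable_compose[OF _ borel_measurable_continuous_onI]) (auto intro!: continuous_intros)

lemma smear_tendsto_L2:
 fixes r :: real
 assumes h[measurable]: "h \<in> bm" and hB: "\<And>y. \<bar>h y\<bar> <= B"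
 defines "g \<equiv> (%x. cor (indicator (cball 0 r) x * h x))"
 shows "(%n. L2_norm (%x. (LB z. of_real (moll (real (Suc n)) z) * (g (x - z) - g x)))) ~~> 0"
proof (rule tendsto_0_le_ennreal)
 fix e :: real assume e: "0 < e"
 have [measurable]: "g \<in> bm" unfolding g_def by measurable
 have B0: "0 <= B" using hB[of 0] by linarith
 have g: "in_L2 g"
 proof (rule in_L2_bound(1)[of "%x. indicator (cball 0 r) x" _ B])
  show "in_L2 (%x. indicator (cball (0::real^2) r) x)"
  using emeasure_bounded_finite[of "cball (0::real^2) r"] by (intro in_L2_indicator) auto
  show "AEL x. cmod (g x) <= B * cmod (indicator (cball 0 r) x)"
  using hB by (auto simp: g_def split: split_indicator)
 qed (use B0 in auto)
 obtain d where d: "0 < d" "\<And>z. norm z < d ==> nrm (%x. g (x + z) - g x) <= e"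
  using L2_translation[OF g e] by blast
 obtain n0 :: nat where n0: "2 / d < real n0" using reals_Archimedean2 by blast
 show "\<forall>\<^sub>F n in sequentially. L2_norm (%x. (LB z. of_real (moll (real (Suc n)) z) * (g (x - z) - g x))) <= ennreal e"
 proof (rule eventually_sequentiallyI)
  fix n assume "n0 <= n"
  then have "2 / d < real (Suc n)" using n0 by linarith
  then have nd: "2 / real (Suc n) < d" using d(1) by (simp add: field_simps)
  have N: "0 < real (Suc n)" by simp
  note mp = moll_props[OF N]
  have "(L2_norm (%x. (LB z. of_real (moll (real (Suc n)) z) * (g (x - z) - g x))))^2
  <= (NN z. ennreal (moll (real (Suc n)) z) * (L2_norm (%x. g (x - z) - g x))^2)"
  by (rule average_L2_le[OF mp(2,1,3)]) measurable
  also have "... <= (NN z. ennreal (moll (real (Suc n)) z) * ennreal (e^2))"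
  proof (rule nn_integral_mono)
  fix z
  show "ennreal (moll (real (Suc n)) z) * (L2_norm (%x. g (x - z) - g x))^2 <= ennreal (moll (real (Suc n)) z) * ennreal (e^2)"
  proof (cases "moll (real (Suc n)) z = 0")
  case False
  then have "norm (- z) < d" using mp(4)[of z] nd by force
  from d(2)[OF this] have "nrm (%x. g (x - z) - g x) <= e" by simp
  then have "(nrm (%x. g (x - z) - g x))^2 <= e^2" by (intro power_mono) auto
  moreover have "in_L2 (%x. g (x - z) - g x)" using in_L2_diff[OF in_L2_shift[OF g, of "-z"] g] by simp
  ultimately show ?thesis by (intro mult_left_mono) (simp_all add: L2_norm_eq_nrm ennreal_power ennreal_leI)
  qed simp
  qed
  also have "... = ennreal (e^2)"
  using mp by (simp add: nn_integral_multc nn_integral_eq_integral)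
  also have "... = (ennreal e)^2" using e by (simp add: ennreal_power)
  finally show "L2_norm (%x. (LB z. of_real (moll (real (Suc n)) z) * (g (x - z) - g x))) <= ennreal e"
  by (simp add: ennreal_sq_le_iff)
 qed
qed

lemma smear_local:
 assumes h[measurable]: "h \<in> bm" and hB: "\<And>y. \<bar>h y\<bar> <= B"
  and N: "1 <= N" and x: "norm x <= r - 2"
 shows "(LB z. cor (moll N z) * (cor (indicator (cball 0 r) (x - z) * h (x - z)) - cor (indicator (cball 0 r) x * h x)))
  = cor (smear N h x - h x)"
proof -
 have N0: "0 < N" using N by simp
 have i: "integrable lborel (%z. moll N z * h (x - z))"
  using integrable_bounded_mult[OF moll_props(2)[OF N0], of "%z. h (x - z)" B] hB by (simp add: mult.commute)
 have "(LB z. cor (moll N z) * (cor (indicator (cball 0 r) (x - z) * h (x - z)) - cor (indicator (cball 0 r) x * h x)))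
  = (LB z. cor (moll N z * h (x - z) - moll N z * h x))"
 proof (rule bcong[OF refl])
  fix z
  show "cor (moll N z) * (cor (indicator (cball 0 r) (x - z) * h (x - z)) - cor (indicator (cball 0 r) x * h x))
  = cor (moll N z * h (x - z) - moll N z * h x)"
  proof (cases "moll N z = 0")
  case False
  then have "norm z <= 2 / N" using moll_props(4)[OF N0, of z] by force
  also have "... <= 2" using N by (simp add: field_simps)
  finally have "norm (x - z) <= r" using x norm_triangle_ineq4[of x z] by linarith
  moreover have "norm x <= r" using x by linarith
  ultimately show ?thesis by (simp add: right_diff_distrib)
  qed simp
 qed
 also have "... = cor ((LB z. moll N z * h (x - z)) - (LB z. moll N z * h x))"
  using i moll_props(2)[OF N0] by (simp only: integral_complex_of_real) (subst Bochner_Integration.integral_diff, auto)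
 also have "(LB z. moll N z * h x) = h x" using moll_props(3)[OF N0] by simp
 also have "(LB z. moll N z * h (x - z)) = smear N h x"
  unfolding smear_def using integral_reflect_shift(1)[of "%z. moll N z * h (x - z)" x] by (simp add: mult.commute)
 finally show ?thesis .
qed

lemma smear_AE_subseq:
 assumes h[measurable]: "\<And>k. h k \<in> bm" and hB: "\<And>k y. \<bar>h k y\<bar> <= B"
 shows "\<exists>s::nat => nat. AEL x. norm x <= r - 2 -->
  (\<forall>k::2. (%m. smear (real (Suc (s m))) (h k) x) ~~> h k x)"
proof -
 define g where "g k x = cor (indicator (cball 0 r) x * h k x)" for k x
 have [measurable]: "g k \<in> bm" for k unfolding g_def[abs_def] by measurable
 define m where "m k n x = (LB z. of_real (moll (real (Suc n)) z) * (g k (x - z) - g k x))" for k n x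
 have mm[measurable]: "m k n \<in> bm" for k n unfolding m_def[abs_def] by measurable
 have lim: "(%n. L2_norm (m k n)) ~~> 0" for k
  using smear_tendsto_L2[OF h[of k] hB[of k], of r] by (simp add: m_def[abs_def] g_def)
 have sub: "\<exists>s::nat => nat. strict_mono s \<and> (AEL x. (%i. m k (q (s i)) x) ~~> 0)"
  if q: "strict_mono q" for k and q :: "nat => nat"
 proof -
  have lq: "(%n. L2_norm (m k (q n))) ~~> 0"
  using LIMSEQ_subseq_LIMSEQ[OF lim q] by (simp add: o_def)
  then have "\<forall>\<^sub>F n in sequentially. L2_norm (m k (q n)) < 1" by (rule order_tendstoD) simp
  then obtain n0 where n0: "\<And>n. n \<ge> n0 ==> L2_norm (m k (q n)) < 1" by (auto simp: eventually_sequentially)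
  have L: "in_L2 (m k (q (n + n0)))" for n
  unfolding in_L2_def using n0[of "n + n0"] by (auto simp: less_le_trans[OF _ top_greatest] intro: less_trans)
  have "(%n. L2_norm (m k (q (n + n0)))) ~~> 0" using lq by (rule LIMSEQ_ignore_initial_segment)
  then have "(%n. (nrm (m k (q (n + n0))))^2) ~~> 0\<^sup>2" by (intro tendsto_power tendsto_0_nrm)
  then have "(%n. (LB x. norm ((cmod (m k (q (n + n0)) x))^2))) ~~> 0"
  by (simp add: nrm_sq[OF L])
  from tendsto_L1_AE_subseq[OF in_L2_integrable_sq[OF L] this]
  obtain s where s: "strict_mono s" "AEL x. (%n. (cmod (m k (q (s n + n0)) x))^2) ~~> 0" by blast
  have "AEL x. (%i. m k (q (s i + n0)) x) ~~> 0"
  using s(2)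
  proof eventually_elim
  fix x assume "(%n. (cmod (m k (q (s n + n0)) x))^2) ~~> 0"
  then have "(%n. sqrt ((cmod (m k (q (s n + n0)) x))^2)) ~~> sqrt 0" by (rule tendsto_real_sqrt)
  then have "(%n. cmod (m k (q (s n + n0)) x)) ~~> 0" by simp
  then show "(%i. m k (q (s i + n0)) x) ~~> 0" by (rule tendsto_norm_zero_cancel)
  qed
  moreover have "strict_mono (%i. s i + n0)" using s(1) by (simp add: strict_mono_def)
  ultimately show ?thesis by blast
 qed
 obtain s1 where s1: "strict_mono s1" "AEL x. (%i. m 1 (s1 i) x) ~~> 0"
  using sub[of id 1] by (auto simp: strict_mono_id)
 obtain s2 where s2: "strict_mono s2" "AEL x. (%i. m 2 (s1 (s2 i)) x) ~~> 0"
  using sub[OF s1(1), of 2] by blast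
 have "AEL x. norm x <= r - 2 --> (\<forall>k::2. (%i. smear (real (Suc (s1 (s2 i)))) (h k) x) ~~> h k x)"
  using s1(2) s2(2)
 proof eventually_elim
  fix x assume 1: "(%i. m 1 (s1 i) x) ~~> 0" and 2: "(%i. m 2 (s1 (s2 i)) x) ~~> 0"
  have A1: "(%i. m 1 (s1 (s2 i)) x) ~~> 0"
  using LIMSEQ_subseq_LIMSEQ[OF 1 s2(1)] by (simp add: o_def)
  show "norm x <= r - 2 --> (\<forall>k::2. (%i. smear (real (Suc (s1 (s2 i)))) (h k) x) ~~> h k x)"
  proof (intro impI allI)
  fix k :: 2 assume x: "norm x <= r - 2"
  have "m k n x = cor (smear (real (Suc n)) (h k) x - h k x)" for n
  unfolding m_def g_def by (rule smear_local[OF h hB _ x]) simp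
  moreover have "(%i. m k (s1 (s2 i)) x) ~~> 0" using A1 2 exhaust_2[of k] by auto
  ultimately have "(%i. cor (smear (real (Suc (s1 (s2 i)))) (h k) x - h k x)) ~~> cor 0" by simp
  then have "(%i. smear (real (Suc (s1 (s2 i)))) (h k) x - h k x) ~~> 0" by (simp only: tendsto_of_real_iff)
  then show "(%i. smear (real (Suc (s1 (s2 i)))) (h k) x) ~~> h k x" by (rule LIM_zero_cancel)
  qed
 qed
 then show ?thesis by (rule exI[of _ "%i. s1 (s2 i)"])
qed

lemma AE_dense:
 assumes "AEL x. P (x::real^2)"
 shows "closure {x. P x} = UNIV"
proof (rule ccontr)
 assume "closure {x. P x} \<noteq> UNIV"
 then obtain x where "x \<in> - closure {x. P x}" by blast
 moreover have "open (- closure {x. P x})" by auto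
 ultimately have ne: "\<not> negligible (- closure {x. P x})" by (intro open_not_negligible) auto
 have "AEL x. x \<notin> - closure {x. P x}"
  using assms by (rule eventually_mono) (use closure_subset[of "{x. P x}"] in auto)
 then have "- closure {x. P x} \<in> null_sets lborel"
  by (subst AE_iff_null_sets) auto
 then show False using ne negligible_iff_null_sets null_sets_completionI by blast
qed

theorem W1inf_lipschitz:
 assumes W: "W1inf ta D"
 defines "ka \<equiv> enn2real (Linf_opnorm D)" and "T \<equiv> enn2real (Linf_norm ta)"
 shows "\<exists>ta'. (\<forall>x y. norm (ta' x - ta' y) <= ka * norm (x - y)) \<and> (\<forall>x. norm (ta' x) <= T) \<and> (AEL x. ta x = ta' x)"
proof -
 have tm[measurable]: "ta \<in> bm" "D \<in> bm"
  and fin: "Linf_norm ta < \<infinity>" "Linf_opnorm D < \<infinity>"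
  and weak: "\<And>k l \<phi>. test_function \<phi> ==> (LB x. ta x $ k * partial_deriv l \<phi> x) = - (LB x. D x $ k $ l * \<phi> x)"
  using W by (auto simp: W1inf_def)
 have ka0: "0 <= ka" and T0: "0 <= T" by (simp_all add: ka_def T_def)
 have "AEL x. ennreal (norm (ta x)) <= Linf_norm ta" unfolding Linf_norm_def by (rule esssup_AE)
 then have TB: "AEL x. norm (ta x) <= T"
 proof eventually_elim
  fix x assume "ennreal (norm (ta x)) <= Linf_norm ta"
  also have "Linf_norm ta = ennreal T" using fin(1) by (simp add: T_def)
  finally show "norm (ta x) <= T" using T0 by simp
 qed
 have "AEL x. ennreal (onorm ((*v) (D x))) <= Linf_opnorm D" unfolding Linf_opnorm_def by (rule esssup_AE)
 then have DB: "AEL x. onorm ((*v) (D x)) <= ka"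
 proof eventually_elim
  fix x assume "ennreal (onorm ((*v) (D x))) <= Linf_opnorm D"
  also have "Linf_opnorm D = ennreal ka" using fin(2) by (simp add: ka_def)
  finally show "onorm ((*v) (D x)) <= ka" using ka0 by simp
 qed
 have entry: "\<bar>D x $ k $ l\<bar> <= onorm ((*v) (D x))" for x k l
 proof -
  have "D x $ k $ l = (D x *v axis l 1) $ k" by (simp add: matrix_vector_mult_basis column_def)
  then have "\<bar>D x $ k $ l\<bar> <= norm (D x *v axis l 1)" using component_le_norm_cart by metis
  also have "... <= onorm ((*v) (D x)) * norm (axis l (1::real))"
  by (rule onorm) (rule matrix_vector_mul_bounded_linear)
  finally show ?thesis by simp
 qed
 define h where "h k x = (if norm (ta x) <= T then ta x $ k else 0)" for k x
 have hm[measurable]: "h k \<in> bm" for k unfolding h_def[abs_def] by measurable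
 have hB: "\<bar>h k x\<bar> <= T" for k x
  using component_le_norm_cart[of "ta x" k] T0 by (auto simp: h_def intro: order_trans)
 define G where "G k l x = max (- ka) (min ka (D x $ k $ l))" for k l x
 have Gm[measurable]: "G k l \<in> bm" for k l unfolding G_def[abs_def] by measurable
 have GB: "\<bar>G k l x\<bar> <= ka" for k l x using ka0 by (auto simp: G_def abs_le_iff)
 have hAE: "AEL x. \<forall>k. h k x = ta x $ k" using TB by eventually_elim (simp add: h_def)
 have GAE: "AEL x. \<forall>k l. G k l x = D x $ k $ l"
  using DB
 proof eventually_elim
  fix x assume "onorm ((*v) (D x)) <= ka"
  then have "D x $ k $ l <= ka" "- ka <= D x $ k $ l" for k l using entry[of x k l] by linarith+
  then show "\<forall>k l. G k l x = D x $ k $ l" by (simp add: G_def min_absorb2 max_absorb2)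
 qed
 have lip: "\<bar>(e$1 * smear N (h 1) y + e$2 * smear N (h 2) y) - (e$1 * smear N (h 1) x + e$2 * smear N (h 2) x)\<bar> <= ka * norm e * norm (y - x)"
  if N: "0 < N" for N x y and e :: "real^2"
 proof -
  define v where "v = y - x"
  define he where "he z = e$1 * h 1 z + e$2 * h 2 z" for z
  define Ge where "Ge l z = e$1 * G 1 l z + e$2 * G 2 l z" for l z
  have mi: "integrable lborel (%z. moll N (x - z))" for x by (rule moll_reflect_integrable[OF N])
  have hi: "integrable lborel (%z. h k z * moll N (x - z))" for k x by (rule integrable_bounded_mult[OF mi hm hB])
  have Gi: "integrable lborel (%z. G k l z * moll N (x - z))" for k l x by (rule integrable_bounded_mult[OF mi Gm GB])
  have sm: "smear N he x = e$1 * smear N (h 1) x + e$2 * smear N (h 2) x" for x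
  proof -
  have "smear N he x = (LB z. e$1 * (h 1 z * moll N (x - z)) + e$2 * (h 2 z * moll N (x - z)))"
  unfolding smear_def he_def by (intro bcong refl) (simp add: algebra_simps)
  also have "... = e$1 * smear N (h 1) x + e$2 * smear N (h 2) x"
  unfolding smear_def using hi by (subst Bochner_Integration.integral_add) auto
  finally show ?thesis .
  qed
  have "\<bar>smear N he (x + v) - smear N he x\<bar> <= ka * norm e * norm v"
  proof (rule smear_increment[OF N, where G=Ge])
  show "he \<in> bm" unfolding he_def[abs_def] by measurable
  show "Ge l \<in> bm" for l unfolding Ge_def[abs_def] by measurable
  show "\<bar>he z\<bar> <= \<bar>e$1\<bar> * T + \<bar>e$2\<bar> * T" for z
  unfolding he_def by (rule order_trans[OF abs_triangle_ineq]) (auto simp: abs_mult intro!: add_mono mult_left_mono hB)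
  show "\<bar>Ge l z\<bar> <= \<bar>e$1\<bar> * ka + \<bar>e$2\<bar> * ka" for l z
  unfolding Ge_def by (rule order_trans[OF abs_triangle_ineq]) (auto simp: abs_mult intro!: add_mono mult_left_mono GB)
  show "AEL z. \<bar>v$1 * Ge 1 z + v$2 * Ge 2 z\<bar> <= ka * norm e * norm v"
  using DB GAE
  proof eventually_elim
  fix z assume on: "onorm ((*v) (D z)) <= ka" and GD: "\<forall>k l. G k l z = D z $ k $ l"
  have ev: "v$1 * Ge 1 z + v$2 * Ge 2 z = e \<bullet> (D z *v v)"
  unfolding Ge_def using GD by (simp add: inner_2 matrix_vector_mult_def sum_2 algebra_simps)
  have "norm (D z *v v) <= onorm ((*v) (D z)) * norm v"
  by (rule onorm) (rule matrix_vector_mul_bounded_linear)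
  also have "... <= ka * norm v" using on by (rule mult_right_mono) simp
  finally have "norm e * norm (D z *v v) <= norm e * (ka * norm v)" by (rule mult_left_mono) simp
  then show "\<bar>v$1 * Ge 1 z + v$2 * Ge 2 z\<bar> <= ka * norm e * norm v"
  unfolding ev using Cauchy_Schwarz_ineq2[of e "D z *v v"] by (simp add: mult_ac)
  qed
  fix l :: 2 and x
  define Q where "Q = partial_deriv l (%y. moll N (x - y))"
  have Qs: "smooth_cl Q" unfolding Q_def by (intro smooth_cl_partial(2) smooth_cl_reflect moll_smooth)
  have Qm[measurable]: "Q \<in> bm" by (rule smooth_cl_meas[OF Qs])
  have Qi: "integrable lborel Q"
  proof (rule integrable_compact_supp[OF smooth_cl_cont[OF Qs]])
  fix z :: "real^2" assume "norm x + 2 / N < norm z"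
  then have "2 / N < norm (x - z)" using norm_triangle_ineq2[of z x] by (simp add: norm_minus_commute)
  then show "Q z = 0" unfolding Q_def partial_deriv_reflect[OF moll_smooth] by (simp add: partial_moll_zero[OF N])
  qed
  have hQ: "integrable lborel (%z. h k z * Q z)" for k by (rule integrable_bounded_mult[OF Qi hm hB])
  have wk: "(LB z. h k z * Q z) = - (LB z. G k l z * moll N (x - z))" for k
  proof -
  have "(LB z. h k z * Q z) = (LB z. ta z $ k * Q z)"
  by (rule integral_cong_AE) (use hAE in \<open>auto elim: eventually_mono\<close>)
  also have "... = - (LB z. D z $ k $ l * moll N (x - z))"
  unfolding Q_def by (rule weak[OF moll_test_function[OF N]])
  also have "(LB z. D z $ k $ l * moll N (x - z)) = (LB z. G k l z * moll N (x - z))"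
  by (rule integral_cong_AE) (use GAE in \<open>auto elim: eventually_mono\<close>)
  finally show ?thesis .
  qed
  have "(LB z. he z * Q z) = (LB z. e$1 * (h 1 z * Q z) + e$2 * (h 2 z * Q z))"
  unfolding he_def by (intro bcong refl) (simp add: algebra_simps)
  also have "... = - (e$1 * (LB z. G 1 l z * moll N (x - z)) + e$2 * (LB z. G 2 l z * moll N (x - z)))"
  using hQ by (subst Bochner_Integration.integral_add) (auto simp: wk)
  also have "... = - (LB z. e$1 * (G 1 l z * moll N (x - z)) + e$2 * (G 2 l z * moll N (x - z)))"
  using Gi by (subst Bochner_Integration.integral_add) auto
  also have "... = - (LB z. Ge l z * moll N (x - z))"
  unfolding Ge_def by (intro arg_cong[where f=uminus] bcong refl) (simp add: algebra_simps)
  finally show "(LB z. he z * partial_deriv l (%y. moll N (x - y)) z) = - (LB z. Ge l z * moll N (x - z))"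
  unfolding Q_def .
  qed
  then show ?thesis unfolding sm v_def by simp
 qed
 have "\<forall>R::nat. \<exists>s::nat => nat. AEL x. norm x <= real R - 2 --> (\<forall>k::2. (%m. smear (real (Suc (s m))) (h k) x) ~~> h k x)"
  by (intro allI smear_AE_subseq[OF hm hB])
 from choice[OF this] obtain s :: "nat => nat => nat" where
  "\<forall>R. AEL x. norm x <= real R - 2 --> (\<forall>k::2. (%m. smear (real (Suc (s R m))) (h k) x) ~~> h k x)" ..
 then have s: "AEL x. norm x <= real R - 2 --> (\<forall>k::2. (%m. smear (real (Suc (s R m))) (h k) x) ~~> h k x)" for R
  by (rule spec)
 define P where "P x \<longleftrightarrow> (\<forall>R. norm x <= real R - 2 --> (\<forall>k::2. (%m. smear (real (Suc (s R m))) (h k) x) ~~> h k x))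
  \<and> norm (ta x) <= T \<and> (\<forall>k. h k x = ta x $ k)" for x
 have PAE: "AEL x. P x"
 proof -
  have "AEL x. \<forall>R. norm x <= real R - 2 --> (\<forall>k::2. (%m. smear (real (Suc (s R m))) (h k) x) ~~> h k x)"
  unfolding AE_all_countable by (intro allI s)
  with TB hAE show ?thesis unfolding P_def by (intro AE_conjI)
 qed
 have Plip: "norm (ta x - ta y) <= ka * norm (x - y)" if P: "P x" "P y" for x y
 proof -
  define e where "e = ta y - ta x"
  obtain R :: nat where R: "max (norm x) (norm y) + 2 <= real R" using real_arch_simple by blast
  then have "norm x <= real R - 2" "norm y <= real R - 2" by auto
  then have lim: "(%m. smear (real (Suc (s R m))) (h k) x) ~~> ta x $ k" "(%m. smear (real (Suc (s R m))) (h k) y) ~~> ta y $ k" for k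
  using P unfolding P_def by metis+
  have "(%m. \<bar>(e$1 * smear (real (Suc (s R m))) (h 1) y + e$2 * smear (real (Suc (s R m))) (h 2) y) - (e$1 * smear (real (Suc (s R m))) (h 1) x + e$2 * smear (real (Suc (s R m))) (h 2) x)\<bar>)
  ~~> \<bar>(e$1 * ta y $ 1 + e$2 * ta y $ 2) - (e$1 * ta x $ 1 + e$2 * ta x $ 2)\<bar>"
  by (intro tendsto_intros lim)
  then have "\<bar>(e$1 * ta y $ 1 + e$2 * ta y $ 2) - (e$1 * ta x $ 1 + e$2 * ta x $ 2)\<bar> <= ka * norm e * norm (y - x)"
  by (rule LIMSEQ_le_const2) (use lip[of "real (Suc n)" for n] in auto)
  moreover have "(e$1 * ta y $ 1 + e$2 * ta y $ 2) - (e$1 * ta x $ 1 + e$2 * ta x $ 2) = (norm e)^2"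
  unfolding norm_sq_2 by (simp add: e_def power2_eq_square algebra_simps)
  ultimately have "norm e * norm e <= norm e * (ka * norm (y - x))" by (simp add: power2_eq_square mult_ac)
  then have "norm e <= ka * norm (y - x)"
  using ka0 by (cases "norm e = 0") (auto simp: mult_le_cancel_left)
  then show ?thesis by (simp add: e_def norm_minus_commute)
 qed
 have "ka-lipschitz_on {x. P x} ta" using Plip ka0 by (auto simp: lipschitz_on_def dist_norm)
 from lipschitz_extend_closure[OF this]
 obtain ta' where ta': "ka-lipschitz_on UNIV ta'" "\<And>x. P x ==> ta' x = ta x"
  unfolding AE_dense[OF PAE] by auto
 have L: "norm (ta' x - ta' y) <= ka * norm (x - y)" for x y
  using ta'(1) by (auto simp: lipschitz_on_def dist_norm)
 have "norm (ta' x) <= T" for x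
 proof (rule field_le_epsilon)
  fix e :: real assume e: "0 < e"
  have "x \<in> closure {x. P x}" using AE_dense[OF PAE] by simp
  moreover have "0 < e / (ka + 1)" using e ka0 by simp
  ultimately obtain y where y: "P y" "dist y x < e / (ka + 1)"
  unfolding closure_approachable by blast
  have "norm (ta' x) <= norm (ta' y) + norm (ta' x - ta' y)" using norm_triangle_ineq[of "ta' y" "ta' x - ta' y"] by simp
  also have "norm (ta' y) <= T" using ta'(2)[OF y(1)] y(1) by (simp add: P_def)
  also have "norm (ta' x - ta' y) <= ka * norm (x - y)" by (rule L)
  also have "... <= ka * (e / (ka + 1))" using y(2) ka0 by (intro mult_left_mono) (auto simp: dist_norm norm_minus_commute)
  also have "... <= e" using e ka0 by (simp add: field_simps)
  finally show "norm (ta' x) <= T + e" by simp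
 qed
 moreover have "AEL x. ta x = ta' x" using PAE by eventually_elim (simp add: ta'(2))
 ultimately show ?thesis using L by blast
qed

section \<open>Low frequencies of a deformed function\<close>

lemma in_L2_of_nn: "f \<in> bm ==> L2_norm f <= B ==> B < \<infinity> ==> in_L2 f"
 by (auto simp: in_L2_def intro: le_less_trans)

lemma nrm_bandlim: "bandlim R ga ==> nrm (invF ga) = nrm ga"
 using ft_nrm[OF ft_bandlim] by simp

lemma genergy_finite:
 assumes "bandlim R ga" "0 <= R"
 shows "genergy ga <= ennreal ((2 * pi * R * nrm ga)^2)"
 using genergy_le[OF assms] by (simp add: L2_norm_eq_nrm[OF bandlim_L2[OF assms(1)]] ennreal_power power_mult_distrib flip: ennreal_mult)

definition lowpass :: "real => (real^2 => complex) => real^2 => complex" where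
 "lowpass R g om = indicator (ball 0 R) om * g om"

lemma bandlim_lowpass: "in_L2 g ==> bandlim R (lowpass R g)"
 unfolding bandlim_def lowpass_def[abs_def] by (auto intro: in_L2_indicator_mult)

lemma ip_lowpass:
 assumes "in_L2 g"
 shows "ip g (lowpass R g) = of_real ((nrm (lowpass R g))^2)"
proof -
 have "ip g (lowpass R g) = ip (lowpass R g) (lowpass R g)"
  unfolding ip_def by (intro bcong refl) (auto simp: lowpass_def split: split_indicator)
 also have "... = of_real ((nrm (lowpass R g))^2)"
  by (rule ip_self[OF bandlim_L2[OF bandlim_lowpass[OF assms]]])
 finally show ?thesis .
qed

lemma nrm_le_of_sq: "(nrm v)^2 <= C * nrm v ==> 0 <= C ==> nrm v <= C"
 by (cases "nrm v = 0") (auto simp: power2_eq_square mult_le_cancel_right)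

text \<open>Absorption: an estimate that reproduces half of an a priori bound plus \<open>c\<close> improves, by
  iteration, any bound to \<open>2 * c\<close>. The last hypothesis lets the limit of the improved
  bounds be taken.\<close>

lemma contraction_bound:
 fixes c :: real
 assumes step: "\<And>M. 0 <= M ==> B M ==> B (M / 2 + c)" and init: "B M0" "0 <= M0" and c: "0 <= c"
  and closed: "\<And>M. (\<And>e. 0 < e ==> \<exists>M'\<le>M + e. B M') ==> B M"
 shows "B (2 * c)"
proof (rule closed)
 fix e :: real assume e: "0 < e"
 have B: "B (2 * c * (1 - (1/2)^n) + M0 / 2^n) \<and> 0 <= 2 * c * (1 - (1/2)^n) + M0 / 2^n" for n :: nat
 proof (induction n)
  case (Suc n)
  have "(2 * c * (1 - (1/2)^n) + M0 / 2^n) / 2 + c = 2 * c * (1 - (1/2)^Suc n) + M0 / 2^Suc n"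
  by (simp add: field_simps)
  with step[of "2 * c * (1 - (1/2)^n) + M0 / 2^n"] Suc c show ?case by (metis add_nonneg_nonneg divide_nonneg_pos zero_less_numeral)
 qed (use init in simp)
 have "(%n. M0 * (1/2)^n) ~~> M0 * 0" by (intro tendsto_intros LIMSEQ_realpow_zero) auto
 then have "\<forall>\<^sub>F n in sequentially. M0 * (1/2)^n < e" by (rule order_tendstoD) (use e in auto)
 then obtain n :: nat where n: "M0 * (1/2)^n < e" by (auto simp: eventually_sequentially)
 have "2 * c * (1 - (1/2)^n) <= 2 * c * 1" using c by (intro mult_left_mono) auto
 then have "2 * c * (1 - (1/2)^n) + M0 / 2^n <= 2 * c + e" using n by (simp add: power_divide)
 then show "\<exists>M'\<le>2 * c + e. B M'" using B by blast
qed

lemma fourier_gauss: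
 assumes "0 < a"
 shows "fourier (%x. cor (gauss a x)) om = cor (exp (- pi * (norm om)^2 / a))"
proof -
 have "fourier (%x. cor (gauss a x)) om
  = (LB x. of_real a * (cor (exp (- pi * a * (norm x)^2)) * cis (2 * pi * ((- om) \<bullet> x))))"
  unfolding fourier_def gauss_def by (intro bcong refl) (simp add: inner_commute mult_ac)
 also have "... = of_real a * cor (exp (- pi * (norm (- om))^2 / a) / a)"
  unfolding integral_mult_right_zero gauss_fourier(2)[OF assms] ..
 also have "... = cor (exp (- pi * (norm om)^2 / a))" using assms by simp
 finally show ?thesis .
qed

lemma gauss_L1_L2:
 assumes "0 < a"
 shows "integrable lborel (%x. cor (gauss a x))" "in_L2 (%x. cor (gauss a x))"
proof -
 show 1: "integrable lborel (%x. cor (gauss a x))" using gauss_integral(1)[OF assms] by simp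
 have "integrable lborel (%x. a * gauss a x)" using gauss_integral(1)[OF assms] by simp
 then have "integrable lborel (%x. (cmod (cor (gauss a x)))^2)"
 proof (rule Bochner_Integration.integrable_bound)
  have "(gauss a x)^2 <= a * gauss a x" for x
  unfolding power2_eq_square by (intro mult_right_mono gauss_le gauss_nonneg assms)
  then show "AEL x. norm ((cmod (cor (gauss a x)))^2) <= norm (a * gauss a x)"
  using gauss_nonneg[OF assms] assms by (auto simp: abs_mult)
 qed measurable
 then show "in_L2 (%x. cor (gauss a x))" by (intro in_L2I_integrable) measurable
qed

text \<open>Gaussian averages of a band-limited function act on its frequency side as multiplication.\<close>

lemma average_invF:
 assumes ga: "bandlim R ga" and a: "0 < a"
 shows "(LB h. cor (gauss a h) * invF ga (x + h))
  = invF (%om. cor (exp (- pi * (norm om)^2 / a)) * ga om) x"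
proof -
 note [measurable] = bandlim_meas[OF ga]
 have "(LB h. cor (gauss a h) * invF ga (x + h))
  = (LB h. cor (gauss a h) * (LB om. (case (h, om) of (h, om) => cis (2 * pi * ((x + h) \<bullet> om))) * ga om))"
  by (simp add: invF_def)
 also have "... = (LB om. (LB h. cor (gauss a h) * (case (h, om) of (h, om) => cis (2 * pi * ((x + h) \<bullet> om)))) * ga om)"
  by (rule fubini_kernel[where B=1, OF gauss_L1_L2(1)[OF a] bandlim_integrable[OF ga]]) auto
 also have "... = (LB om. cis (2 * pi * (x \<bullet> om)) * (cor (exp (- pi * (norm om)^2 / a)) * ga om))"
 proof (rule bcong[OF refl])
  fix om
  have "(LB h. cor (gauss a h) * cis (2 * pi * ((x + h) \<bullet> om)))
  = (LB h. cis (2 * pi * (x \<bullet> om)) * (cis (- (2 * pi * (h \<bullet> (- om)))) * cor (gauss a h)))"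
  by (intro bcong refl) (simp add: inner_add_left distrib_left cis_mult[symmetric] mult_ac)
  also have "... = cis (2 * pi * (x \<bullet> om)) * fourier (%x. cor (gauss a x)) (- om)"
  unfolding fourier_def by (rule integral_mult_right_zero)
  finally show "(LB h. cor (gauss a h) * (case (h, om) of (h, om) => cis (2 * pi * ((x + h) \<bullet> om)))) * ga om
  = cis (2 * pi * (x \<bullet> om)) * (cor (exp (- pi * (norm om)^2 / a)) * ga om)"
  by (simp add: fourier_gauss[OF a])
 qed
 finally show ?thesis by (simp add: invF_def)
qed

lemma conv_gauss: "convolution F (%x. cor (gauss a x)) x = (LB h. cor (gauss a h) * F (x + h))"
proof -
 have "convolution F (%x. cor (gauss a x)) x = (LB y. F y * cor (gauss a (y - x)))"
  unfolding convolution_def using gauss_minus[of a "x - y" for y] by simp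
 also have "... = (LB h. F (h + x) * cor (gauss a (h + x - x)))"
  by (rule integral_shift(1)[symmetric])
 finally show ?thesis by (simp add: mult.commute add.commute)
qed

lemma ip_mult_left:
 "ip (%om. cor (s om) * g om) h = ip g (%om. cor (s om) * h om)"
 unfolding ip_def by (intro bcong refl) simp

context small_perturbation
begin

lemma L2_Ph:
 assumes [measurable]: "f \<in> bm"
 shows "L2_norm (%x. f (Ph x)) <= 2 * L2_norm f"
proof -
 have "(L2_norm (%x. f (Ph x)))^2 <= ennreal (1 + 5 * ka) * (L2_norm f)^2"
  unfolding L2_norm_sq by (rule nn_integral_Ph) measurable
 also have "... <= ennreal 4 * (L2_norm f)^2"
  using ka_small by (intro mult_right_mono ennreal_leI) auto
 also have "... = (2 * L2_norm f)^2" by (simp add: power_mult_distrib)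
 finally show ?thesis by (simp only: ennreal_sq_le_iff)
qed

lemma L2_Pz:
 assumes [measurable]: "f \<in> bm"
 shows "L2_norm (%x. f (Pz x)) <= 2 * L2_norm f"
proof -
 have "(L2_norm (%x. f (Pz x)))^2 <= ennreal (1 + 5 * ka) * (L2_norm f)^2"
  unfolding L2_norm_sq by (rule nn_integral_Pz) measurable
 also have "... <= ennreal 4 * (L2_norm f)^2"
  using ka_small by (intro mult_right_mono ennreal_leI) auto
 also have "... = (2 * L2_norm f)^2" by (simp add: power_mult_distrib)
 finally show ?thesis by (simp only: ennreal_sq_le_iff)
qed

lemma in_L2_Ph: "in_L2 f ==> in_L2 (%x. f (Ph x))"
 using in_L2_of_nn[OF _ L2_Ph, of f] by (auto simp: in_L2_def ennreal_mult_less_top)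

lemma in_L2_Pz: "in_L2 f ==> in_L2 (%x. f (Pz x))"
 using in_L2_of_nn[OF _ L2_Pz, of f] by (auto simp: in_L2_def ennreal_mult_less_top)

lemma nrm_2: "in_L2 f ==> in_L2 g ==> L2_norm g <= 2 * L2_norm f ==> nrm g <= 2 * nrm f"
 by (simp add: L2_norm_eq_nrm ennreal_mult[of 2, symmetric, simplified])

lemma nrm_Pz: "in_L2 f ==> nrm (%x. f (Pz x)) <= 2 * nrm f"
 by (intro nrm_2 in_L2_Pz L2_Pz) auto

lemma AE_Ph:
 assumes "f \<in> bm" "g \<in> bm" "AEL x. f x = (g x :: complex)"
 shows "AEL x. f (Ph x) = g (Ph x)"
proof -
 note [measurable] = assms(1,2)
 have "L2_norm (%x. f (Ph x) - g (Ph x)) <= 2 * L2_norm (%x. f x - g x)"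
  by (rule L2_Ph[of "%x. f x - g x"]) measurable
 also have "L2_norm (%x. f x - g x) = 0"
  using assms(3) by (subst L2_norm_eq_0_iff) (auto elim: eventually_mono)
 finally have "AEL x. f (Ph x) - g (Ph x) = 0"
  by (subst L2_norm_eq_0_iff[symmetric]) auto
 then show ?thesis by (auto elim: eventually_mono)
qed

lemma integral_Ph_nonneg:
 fixes F :: "real^2 => real"
 assumes F: "integrable lborel F" "\<And>x. 0 <= F x"
 shows "integrable lborel (%x. F (Ph x))" "\<bar>(LB x. F (Ph x)) - (LB x. F x)\<bar> <= 10 * ka * (LB x. F x)"
proof -
 have [measurable]: "F \<in> bm" using F by auto
 have nF: "(NN x. ennreal (F x)) = ennreal (LB x. F x)"
  using F by (intro nn_integral_eq_integral) auto
 have F0: "0 <= (LB x. F x)" using F by (intro integral_nonneg_AE) auto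
 have le1: "(NN x. ennreal (F (Ph x))) <= ennreal (1 + 5 * ka) * ennreal (LB x. F x)"
  unfolding nF[symmetric] by (rule nn_integral_Ph) measurable
 show i: "integrable lborel (%x. F (Ph x))"
  by (rule integrableI_bounded) (use le1 F(2) in \<open>auto intro!: le_less_trans[OF le1] simp: ennreal_mult_less_top\<close>)
 have nPh: "(NN x. ennreal (F (Ph x))) = ennreal (LB x. F (Ph x))"
  using i F by (intro nn_integral_eq_integral) auto
 have Ph0: "0 <= (LB x. F (Ph x))" using F by (intro integral_nonneg_AE) auto
 have "(NN x. ennreal (F (Ph (Pz x)))) <= ennreal (1 + 5 * ka) * (NN x. ennreal (F (Ph x)))"
  by (rule nn_integral_Pz[of "%x. ennreal (F (Ph x))"]) measurable
 then have "ennreal (LB x. F x) <= ennreal ((1 + 5 * ka) * (LB x. F (Ph x)))"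
  using ka0 Ph0 by (simp add: nF nPh ennreal_mult)
 then have 2: "(LB x. F x) <= (1 + 5 * ka) * (LB x. F (Ph x))"
  using ka0 Ph0 by (subst (asm) ennreal_le_iff) auto
 have 1: "(LB x. F (Ph x)) <= (1 + 5 * ka) * (LB x. F x)"
  using le1 ka0 F0 unfolding nPh by (subst (asm) ennreal_mult[symmetric]) (auto simp: ennreal_le_iff)
 have "5 * ka * (LB x. F (Ph x)) <= 5 * ka * (2 * (LB x. F x))"
 proof (intro mult_left_mono)
  have "(1 + 5 * ka) * (LB x. F x) <= 2 * (LB x. F x)"
  using ka_small F0 by (intro mult_right_mono) auto
  then show "(LB x. F (Ph x)) <= 2 * (LB x. F x)" using 1 by linarith
 qed (use ka0 in auto)
 moreover have "0 <= ka * (LB x. F x)" using ka0 F0 by simp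
 ultimately show "\<bar>(LB x. F (Ph x)) - (LB x. F x)\<bar> <= 10 * ka * (LB x. F x)"
  using 1 2 by (simp add: abs_le_iff distrib_right)
qed

lemma integral_Ph_real:
 fixes F :: "real^2 => real"
 assumes F: "integrable lborel F"
 shows "integrable lborel (%x. F (Ph x))" "\<bar>(LB x. F (Ph x)) - (LB x. F x)\<bar> <= 20 * ka * (LB x. \<bar>F x\<bar>)"
proof -
 define p q where "p x = max (F x) 0" and "q x = max (- F x) 0" for x
 have pq: "integrable lborel p" "integrable lborel q" using F unfolding p_def q_def by (auto intro: integrable_max)
 have F_eq: "F x = p x - q x" for x by (simp add: p_def q_def max_def)
 note P = integral_Ph_nonneg[OF pq(1)] and Q = integral_Ph_nonneg[OF pq(2)]
 have p0: "0 <= p x" "0 <= q x" for x by (simp_all add: p_def q_def)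
 show "integrable lborel (%x. F (Ph x))" unfolding F_eq by (intro Bochner_Integration.integrable_diff P Q p0)
 have "(LB x. F (Ph x)) = (LB x. p (Ph x)) - (LB x. q (Ph x))"
  unfolding F_eq by (intro Bochner_Integration.integral_diff P(1) Q(1) p0)
 moreover have "(LB x. F x) = (LB x. p x) - (LB x. q x)"
  unfolding F_eq by (intro Bochner_Integration.integral_diff pq)
 moreover have "(LB x. p x) <= (LB x. \<bar>F x\<bar>)"
  by (intro integral_mono pq integrable_abs F) (auto simp: p_def)
 moreover have "(LB x. q x) <= (LB x. \<bar>F x\<bar>)"
  by (intro integral_mono pq integrable_abs F) (auto simp: q_def)
 ultimately show "\<bar>(LB x. F (Ph x)) - (LB x. F x)\<bar> <= 20 * ka * (LB x. \<bar>F x\<bar>)"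
  using P(2)[OF p0(1)] Q(2)[OF p0(2)]
  mult_left_mono[of "(LB x. p x)" "(LB x. \<bar>F x\<bar>)" "10 * ka"]
  mult_left_mono[of "(LB x. q x)" "(LB x. \<bar>F x\<bar>)" "10 * ka"] ka0
  by linarith
qed

text \<open>The deformation changes integrals by a relative error of order \<open>ka\<close> only: this replaces the Jacobian
 of the change of variables.\<close>

lemma integral_Ph:
 fixes F :: "real^2 => complex"
 assumes F: "integrable lborel F"
 shows "cmod ((LB x. F (Ph x)) - (LB x. F x)) <= 40 * ka * (LB x. cmod (F x))"
proof -
 have R: "integrable lborel (%x. Re (F x))" "integrable lborel (%x. Im (F x))" using F by auto
 note r = integral_Ph_real[OF R(1)] and i = integral_Ph_real[OF R(2)]
 have FPh: "integrable lborel (%x. F (Ph x))"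
 proof -
  have "integrable lborel (%x. cor (Re (F (Ph x))) + \<i> * cor (Im (F (Ph x))))"
  using r(1) i(1) by (intro Bochner_Integration.integrable_add integrable_mult_right) auto
  then show ?thesis by (simp add: complex_eq[symmetric])
 qed
 have "(LB x. \<bar>Re (F x)\<bar>) <= (LB x. cmod (F x))" "(LB x. \<bar>Im (F x)\<bar>) <= (LB x. cmod (F x))"
  by (intro integral_mono integrable_abs R integrable_norm F abs_Re_le_cmod abs_Im_le_cmod)+
 then have "20 * ka * (LB x. \<bar>Re (F x)\<bar>) <= 20 * ka * (LB x. cmod (F x))"
  "20 * ka * (LB x. \<bar>Im (F x)\<bar>) <= 20 * ka * (LB x. cmod (F x))"
  using ka0 by (auto intro!: mult_left_mono)
 then show ?thesis
  using r(2) i(2) cmod_le[of "(LB x. F (Ph x)) - (LB x. F x)"]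
  by (simp add: integral_Re[OF F, symmetric] integral_Im[OF F, symmetric] integral_Re[OF FPh, symmetric] integral_Im[OF FPh, symmetric])
qed

lemma ip_Ph:
 assumes f: "in_L2 f" and u: "in_L2 u"
 shows "cmod (ip (%x. f (Ph x)) u - ip f (%x. u (Pz x))) <= 80 * ka * nrm f * nrm u"
proof -
 define F where "F z = f z * cnj (u (Pz z))" for z
 have uP: "in_L2 (%z. cnj (u (Pz z)))" by (intro in_L2_cnj in_L2_Pz u)
 have F: "integrable lborel F" unfolding F_def by (rule ip_integrable[OF f uP])
 have "(LB x. cmod (F x)) <= nrm f * nrm (%z. cnj (u (Pz z)))"
 proof -
  have fa: "in_L2 (%x. cor (cmod (f x)))" using f by (auto simp: in_L2_def L2_norm_def)
  have ua: "in_L2 (%x. cor (cmod (u (Pz x))))" using in_L2_Pz[OF u] by (auto simp: in_L2_def L2_norm_def)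
  have "cmod (LB x. cor (cmod (f x)) * cor (cmod (u (Pz x)))) <= nrm f * nrm (%z. cnj (u (Pz z)))"
  using ip_bound[OF fa ua] by (simp add: nrm_def L2_norm_def)
  moreover have "(LB x. cor (cmod (f x)) * cor (cmod (u (Pz x)))) = cor (LB x. cmod (F x))"
  unfolding F_def by (subst integral_complex_of_real[symmetric]) (simp add: norm_mult)
  moreover have "\<bar>(LB x. cmod (F x))\<bar> = (LB x. cmod (F x))" by (intro abs_of_nonneg integral_nonneg_AE) auto
  ultimately show ?thesis by (simp only: norm_of_real)
 qed
 also have "... <= nrm f * (2 * nrm u)" using nrm_Pz[OF u] by (intro mult_left_mono) (auto simp: nrm_cnj)
 finally have "40 * ka * (LB x. cmod (F x)) <= 40 * ka * (nrm f * (2 * nrm u))" using ka0 by (intro mult_left_mono) auto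
 moreover have "ip (%x. f (Ph x)) u = (LB x. F (Ph x))" "ip f (%x. u (Pz x)) = (LB x. F x)"
  by (simp_all add: ip_def F_def)
 ultimately show ?thesis using integral_Ph[OF F] by simp
qed

lemma Pz_path_lip:
 assumes t: "0 <= t" "t <= 1"
 shows "norm (((x + h) - (Pz x + h + t *\<^sub>R (Pz (x + h) - (Pz x + h)))) - ((y + h) - (Pz y + h + t *\<^sub>R (Pz (y + h) - (Pz y + h))))) <= 1/2 * norm (x - y)"
proof -
 define d where "d z = Pz z - z" for z
 have dl: "norm (d x - d y) <= 1/7 * norm (x - y)" for x y
 proof -
  have "norm (d x - d y) <= 8/7 * ka * norm (x - y)" unfolding d_def by (rule Pz_perturb)
  also have "... <= 1/7 * norm (x - y)" using ka_small by (intro mult_right_mono) auto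
  finally show ?thesis .
 qed
 have "((x + h) - (Pz x + h + t *\<^sub>R (Pz (x + h) - (Pz x + h)))) - ((y + h) - (Pz y + h + t *\<^sub>R (Pz (y + h) - (Pz y + h))))
  = - ((1 - t) *\<^sub>R (d x - d y) + t *\<^sub>R (d (x + h) - d (y + h)))"
  by (simp add: d_def algebra_simps)
 also have "norm ... <= (1 - t) * norm (d x - d y) + t * norm (d (x + h) - d (y + h))"
  unfolding norm_minus_cancel by (rule order_trans[OF norm_triangle_ineq]) (use t in simp)
 also have "... <= (1 - t) * (1/7 * norm (x - y)) + t * (1/7 * norm (x - y))"
  using t dl[of x y] dl[of "x + h" "y + h"] by (intro add_mono mult_left_mono) auto
 also have "... = 1/7 * norm (x - y)" unfolding distrib_right[symmetric] by simp
 finally show ?thesis using norm_ge_zero[of "x - y"] by linarith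
qed

lemma Pz_shift_diff:
 assumes ga: "bandlim R ga"
 shows "(L2_norm (%x. invF ga (Pz (x + h)) - invF ga (Pz x + h)))^2 <= ennreal (16 * (8/7 * ka * norm h)^2) * genergy ga"
proof -
 have "(NN x. indicator UNIV x * ennreal ((cmod (invF ga (Pz (x + h)) - invF ga (Pz x + h)))^2))
  <= ennreal (16 * (8/7 * ka * norm h)^2) * genergy ga"
 proof (rule path_estimate[OF ga])
  show "0 <= 8/7 * ka * norm h" using ka0 by simp
  show "norm (Pz (x + h) - (Pz x + h)) <= 8/7 * ka * norm h" for x
  using Pz_perturb[of "x + h" x] by (simp add: algebra_simps)
  show "norm ((x - (Pz x + h + t *\<^sub>R (Pz (x + h) - (Pz x + h)))) - (y - (Pz y + h + t *\<^sub>R (Pz (y + h) - (Pz y + h))))) <= 1/2 * norm (x - y)"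
  if "0 <= t" "t <= 1" for t x y
  using Pz_path_lip[OF that, of x h y] by (simp add: algebra_simps)
 qed measurable
 then show ?thesis by (simp add: L2_norm_sq)
qed

lemma Pz_minus_id:
 assumes ga: "bandlim R ga" and R: "0 <= R" and T: "\<And>x. norm (ta x) <= T"
 shows "nrm (%x. invF ga (Pz x) - invF ga x) <= 8 * pi * R * T * nrm ga"
proof -
 note [measurable] = bandlim_meas[OF ga]
 have T0: "0 <= T" using T[of 0] norm_ge_zero order_trans by blast
 have "(NN x. indicator UNIV x * ennreal ((cmod (invF ga (Pz x) - invF ga x))^2)) <= ennreal (16 * T^2) * genergy ga"
 proof (rule path_estimate[OF ga])
  show "norm (Pz x - x) <= T" for x
  proof -
  have "Pz x - x = ta (Pz x)" using Pz_eq[of x] by (metis add_diff_cancel_left')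
  then show ?thesis using T by simp
  qed
  fix t :: real and x y :: "real^2" assume t: "0 <= t" "t <= 1"
  have "(x - (x + t *\<^sub>R (Pz x - x))) - (y - (y + t *\<^sub>R (Pz y - y))) = - (t *\<^sub>R ((Pz x - x) - (Pz y - y)))"
  by (simp add: algebra_simps)
  then have "norm ((x - (x + t *\<^sub>R (Pz x - x))) - (y - (y + t *\<^sub>R (Pz y - y)))) = t * norm ((Pz x - x) - (Pz y - y))"
  using t by simp
  also have "... <= 1 * (8/7 * ka * norm (x - y))"
  using t by (intro mult_mono Pz_perturb) auto
  also have "... <= 1/2 * norm (x - y)" unfolding mult_1 using ka_small by (intro mult_right_mono) auto
  finally show "norm ((x - (x + t *\<^sub>R (Pz x - x))) - (y - (y + t *\<^sub>R (Pz y - y)))) <= 1/2 * norm (x - y)" .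
 qed (use T0 in measurable)
 then have "(L2_norm (%x. invF ga (Pz x) - invF ga x))^2 <= ennreal (16 * T^2) * genergy ga" by (simp add: L2_norm_sq)
 also have "... <= ennreal (16 * T^2) * ennreal ((2 * pi * R * nrm ga)^2)"
  by (intro mult_left_mono genergy_finite[OF ga R]) auto
 also have "... = (ennreal (8 * pi * R * T * nrm ga))^2"
  using T0 R by (simp add: ennreal_power power_mult_distrib mult_ac flip: ennreal_mult)
 finally have "L2_norm (%x. invF ga (Pz x) - invF ga x) <= ennreal (8 * pi * R * T * nrm ga)"
  by (simp only: ennreal_sq_le_iff)
 moreover have "in_L2 (%x. invF ga (Pz x) - invF ga x)"
  using ft_L2(1)[OF ft_bandlim[OF ga]] by (intro in_L2_diff in_L2_Pz)
 ultimately show ?thesis using T0 R by (subst nrm_le_iff) auto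
qed

text \<open>Low frequencies do not see the displacement: by duality the deformation can be moved onto the
 smooth low-frequency part.\<close>

lemma lowpass_displacement:
 assumes f: "in_L2 f" and R: "0 <= R" and T: "\<And>x. norm (ta x) <= T" and g: "ft (%x. f (Ph x) - f x) g"
 shows "nrm (lowpass R g) <= (80 * ka + 8 * pi * R * T) * nrm f"
proof (rule nrm_le_of_sq)
 have T0: "0 <= T" using T[of 0] norm_ge_zero order_trans by blast
 show "0 <= (80 * ka + 8 * pi * R * T) * nrm f" using ka0 R T0 by simp
 define ga where "ga = lowpass R g"
 have gL: "in_L2 g" using g by (rule ft_L2)
 have ga: "bandlim R ga" unfolding ga_def by (rule bandlim_lowpass[OF gL])
 define v where "v = invF ga"
 have v: "ft v ga" unfolding v_def by (rule ft_bandlim[OF ga])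
 have vL: "in_L2 v" using v by (rule ft_L2)
 have nv: "nrm v = nrm ga" using ft_nrm[OF v] by simp
 have "of_real ((nrm ga)^2) = ip g ga" unfolding ga_def by (rule ip_lowpass[OF gL, symmetric])
 also have "... = ip (%x. f (Ph x) - f x) v" by (rule ft_parseval[OF g v, symmetric])
 also have "... = (ip (%x. f (Ph x)) v - ip f (%x. v (Pz x))) + ip f (%x. v (Pz x) - v x)"
  using f vL by (simp add: ip_diff_left ip_diff_right in_L2_Ph in_L2_Pz)
 finally have "cmod (cor ((nrm ga)^2)) <= cmod (ip (%x. f (Ph x)) v - ip f (%x. v (Pz x))) + cmod (ip f (%x. v (Pz x) - v x))"
  by (simp only: norm_triangle_ineq)
 also have "... <= 80 * ka * nrm f * nrm v + nrm f * (8 * pi * R * T * nrm ga)"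
 proof (intro add_mono ip_Ph f vL)
  have "cmod (ip f (%x. v (Pz x) - v x)) <= nrm f * nrm (%x. v (Pz x) - v x)"
  using f vL by (intro ip_cauchy in_L2_diff in_L2_Pz)
  also have "... <= nrm f * (8 * pi * R * T * nrm ga)"
  unfolding v_def by (intro mult_left_mono Pz_minus_id[OF ga R T]) auto
  finally show "cmod (ip f (%x. v (Pz x) - v x)) <= nrm f * (8 * pi * R * T * nrm ga)" .
 qed
 also have "... = (80 * ka + 8 * pi * R * T) * nrm f * nrm ga" unfolding nv by (simp add: algebra_simps)
 finally show "(nrm (lowpass R g))^2 <= (80 * ka + 8 * pi * R * T) * nrm f * nrm (lowpass R g)"
  unfolding ga_def[symmetric] norm_of_real by simp
qed

text \<open>High frequencies of \<open>f\<close> are nearly orthogonal to deformed low-frequency functions. Averaging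
 with a Gaussian at the intermediate scale almost preserves the low frequencies, almost kills the
 high ones and commutes with the deformation up to an error of order \<open>ka\<close>; hence any bound \<open>M\<close>
 improves to \<open>M / 2 + 10 * ka\<close>.\<close>

definition high_low_bound :: "real => real => bool" where
 "high_low_bound R M \<longleftrightarrow> (\<forall>f g ga. ft f g --> (AEL om. norm om < 3 * R --> g om = 0) --> bandlim R ga -->
  cmod (ip f (%x. invF ga (Pz x))) <= M * nrm f * nrm ga)"

lemma high_low_init: "high_low_bound R 2"
 unfolding high_low_bound_def
proof (intro allI impI)
 fix f g ga assume fg: "ft f g" and ga: "bandlim R ga"
 have u: "in_L2 (invF ga)" using ft_bandlim[OF ga] by (rule ft_L2)
 have "cmod (ip f (%x. invF ga (Pz x))) <= nrm f * nrm (%x. invF ga (Pz x))"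
  by (intro ip_cauchy in_L2_Pz u ft_L2(1)[OF fg])
 also have "... <= nrm f * (2 * nrm ga)"
  using nrm_Pz[OF u] nrm_bandlim[OF ga] by (intro mult_left_mono) auto
 finally show "cmod (ip f (%x. invF ga (Pz x))) <= 2 * nrm f * nrm ga" by simp
qed

text \<open>The displacement of \<open>Ps\<close> changes by at most \<open>8/7 * ka * norm h\<close> under a
  shift by \<open>h\<close>. A band-limited function at frequency \<open>R\<close> varies at the scale
  \<open>1/R\<close>, which is also the scale of the Gaussian; so the two scales cancel and only
  \<open>ka\<close> remains.\<close>

lemma gauss_commutator:
 assumes ga: "bandlim R ga" and R: "0 < R"
 defines "a \<equiv> 16 * R^2"
 shows "nrm (%x. (LB h. cor (gauss a h) * (invF ga (Pz (x + h)) - invF ga (Pz x + h)))) <= 10 * ka * nrm ga"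
  and "in_L2 (%x. (LB h. cor (gauss a h) * (invF ga (Pz (x + h)) - invF ga (Pz x + h))))"
proof -
 note [measurable] = bandlim_meas[OF ga]
 have a: "0 < a" using R by (simp add: a_def)
 note g = gauss_integral[OF a] gauss_second_moment[OF a] gauss_nonneg[OF a]
 define c where "c = 16 * (8/7 * ka)^2 * (2 * pi * R * nrm ga)^2"
 have c0: "0 <= c" by (simp add: c_def)
 let ?E = "%x. (LB h. cor (gauss a h) * (invF ga (Pz (x + h)) - invF ga (Pz x + h)))"
 have "(L2_norm ?E)^2 <= (NN h. ennreal (gauss a h) * (L2_norm (%x. invF ga (Pz (x + h)) - invF ga (Pz x + h)))^2)"
  by (rule average_L2_le[OF g(1,5,2)]) measurable
 also have "... <= (NN h. ennreal c * ennreal (gauss a h * (norm h)^2))"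
 proof (rule nn_integral_mono)
  fix h
  have "(L2_norm (%x. invF ga (Pz (x + h)) - invF ga (Pz x + h)))^2 <= ennreal (16 * (8/7 * ka * norm h)^2) * genergy ga"
  by (rule Pz_shift_diff[OF ga])
  also have "... <= ennreal (16 * (8/7 * ka * norm h)^2) * ennreal ((2 * pi * R * nrm ga)^2)"
  using R by (intro mult_left_mono genergy_finite[OF ga]) auto
  also have "... = ennreal (16 * (8/7 * ka * norm h)^2 * (2 * pi * R * nrm ga)^2)"
  by (rule ennreal_mult[symmetric]) simp_all
  also have "16 * (8/7 * ka * norm h)^2 * (2 * pi * R * nrm ga)^2 = c * (norm h)^2"
  unfolding c_def power_mult_distrib by (simp only: mult_ac)
  finally have "ennreal (gauss a h) * (L2_norm (%x. invF ga (Pz (x + h)) - invF ga (Pz x + h)))^2 <= ennreal (gauss a h) * ennreal (c * (norm h)^2)"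
  by (rule mult_left_mono) simp
  also have "... = ennreal c * ennreal (gauss a h * (norm h)^2)"
  using g(5) c0 by (simp add: mult_ac flip: ennreal_mult)
  finally show "ennreal (gauss a h) * (L2_norm (%x. invF ga (Pz (x + h)) - invF ga (Pz x + h)))^2 <= ennreal c * ennreal (gauss a h * (norm h)^2)" .
 qed
 also have "... = ennreal c * ennreal (LB h. gauss a h * (norm h)^2)"
  using g(3,5) by (simp add: nn_integral_cmult nn_integral_eq_integral)
 also have "... <= ennreal c * ennreal (4 / (pi * a))"
  by (intro mult_left_mono ennreal_leI g) auto
 also have "... = ennreal (c * (4 / (pi * a)))" using c0 a by (intro ennreal_mult[symmetric]) auto
 also have "... <= ennreal ((10 * ka * nrm ga)^2)"
 proof (rule ennreal_leI)
  have "c * (4 / (pi * a)) = (1024/49) * pi * (ka * nrm ga)^2"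
  using R by (simp add: c_def a_def power2_eq_square field_simps)
  also have "... <= 100 * (ka * nrm ga)^2"
  using pi_less_4 by (intro mult_right_mono) auto
  finally show "c * (4 / (pi * a)) <= (10 * ka * nrm ga)^2" by (simp add: power_mult_distrib)
 qed
 also have "... = (ennreal (10 * ka * nrm ga))^2" using ka0 by (simp add: ennreal_power)
 finally have le: "L2_norm ?E <= ennreal (10 * ka * nrm ga)" by (simp only: ennreal_sq_le_iff)
 show L: "in_L2 ?E" by (rule in_L2_of_nn[OF _ le]) simp_all
 show "nrm ?E <= 10 * ka * nrm ga" using le ka0 by (subst nrm_le_iff[OF L]) auto
qed

lemma high_low_step:
 assumes R: "0 < R" and M: "0 <= M" and B: "high_low_bound R M"
 shows "high_low_bound R (M / 2 + 10 * ka)"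
 unfolding high_low_bound_def
proof (intro allI impI)
 fix f g ga assume fg: "ft f g" and high: "AEL om. norm om < 3 * R --> g om = 0" and ga: "bandlim R ga"
 note [measurable] = bandlim_meas[OF ga] ft_meas[OF fg]
 define a where "a = 16 * R^2"
 have a: "0 < a" using R by (simp add: a_def)
 define s where "s om = exp (- pi * (norm (om::real^2))^2 / a)" for om
 have [measurable]: "s \<in> bm" unfolding s_def by measurable
 have s01: "0 <= s om" "s om <= 1" for om using a by (simp_all add: s_def)
 have slow: "1 - s om <= 1/4" if "norm om < R" for om
 proof -
  have "(norm om)^2 <= R^2" using that R by (intro power_mono) auto
  then have "pi * (norm om)^2 <= 4 * R^2" using pi_less_4 by (intro mult_mono) auto
  then have "pi * (norm om)^2 / a <= 1/4" using R by (simp add: a_def field_simps)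
  then show ?thesis using exp_ge_add_one_self[of "- pi * (norm om)^2 / a"] by (simp add: s_def)
 qed
 have shigh: "s om <= 1/4" if "3 * R <= norm om" for om
 proof -
  have "(3 * R)^2 <= (norm om)^2" using that R by (intro power_mono) auto
  then have "3 * (3 * R)^2 <= pi * (norm om)^2" using pi_gt3 by (intro mult_mono) auto
  then have "27/16 <= pi * (norm om)^2 / a" using R by (simp add: a_def field_simps power_mult_distrib)
  then have "exp (27/16) <= exp (pi * (norm om)^2 / a)" by simp
  moreover have "4 <= exp (27/16::real)"
  using exp_lower_Taylor_quadratic[of "27/16"] by (simp add: power2_eq_square)
  ultimately have "4 <= exp (pi * (norm om)^2 / a)" by linarith
  then show ?thesis by (simp add: s_def exp_minus field_simps)
 qed
 define u where "u = invF ga"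
 have uL: "in_L2 u" unfolding u_def using ft_bandlim[OF ga] by (rule ft_L2)
 note [measurable] = in_L2_measurable'[OF uL]
 define ga1 where "ga1 om = cor (1 - s om) * ga om" for om
 define ga2 where "ga2 om = cor (s om) * ga om" for om
 have ga1b: "bandlim R ga1" "nrm ga1 <= 1/4 * nrm ga"
 proof -
  have bd: "AEL om. cmod (ga1 om) <= 1/4 * cmod (ga om)"
  proof (rule AE_I2)
  fix om
  show "cmod (ga1 om) <= 1/4 * cmod (ga om)"
  proof (cases "ga om = 0")
  case False
  then have "1 - s om <= 1/4" using bandlim_norm[OF ga] slow by blast
  then have "(1 - s om) * cmod (ga om) <= 1/4 * cmod (ga om)" by (rule mult_right_mono) simp
  moreover have "cmod (ga1 om) = (1 - s om) * cmod (ga om)"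
  unfolding ga1_def norm_mult norm_of_real using s01[of om] by simp
  ultimately show ?thesis by simp
  qed (simp add: ga1_def)
  qed
  have m: "ga1 \<in> borel_measurable lborel" unfolding ga1_def[abs_def] by measurable
  have L: "in_L2 ga1" by (rule in_L2_bound(1)[OF bandlim_L2[OF ga] m bd]) simp
  then show "bandlim R ga1" using ga by (simp add: bandlim_def ga1_def)
  have "L2_norm ga1 <= ennreal (1/4) * L2_norm ga" by (rule in_L2_bound(2)[OF bandlim_L2[OF ga] m bd]) simp
  also have "... = ennreal (1/4 * nrm ga)"
  unfolding L2_norm_eq_nrm[OF bandlim_L2[OF ga]] by (rule ennreal_mult[symmetric]) auto
  finally show "nrm ga1 <= 1/4 * nrm ga" by (subst nrm_le_iff[OF L]) auto
 qed
 have ga2b: "bandlim R ga2"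
 proof -
  have "in_L2 ga2" unfolding ga2_def[abs_def]
  by (rule in_L2_mult_bounded[OF bandlim_L2[OF ga], of _ 1]) (use s01 in \<open>auto simp: abs_of_nonneg\<close>)
  then show ?thesis using ga by (simp add: bandlim_def ga2_def)
 qed
 have fL: "in_L2 f" using fg by (rule ft_L2)
 define f2 where "f2 = convolution f (%x. cor (gauss a x))"
 have f2: "ft f2 (%om. cor (s om) * g om)"
  using ft_conv[OF fg gauss_L1_L2[OF a]] by (simp add: f2_def fourier_gauss[OF a] s_def mult.commute)
 have f2n: "nrm f2 <= 1/4 * nrm f"
 proof -
  have gL: "in_L2 g" using fg by (rule ft_L2)
  have L: "in_L2 (%om. cor (s om) * g om)" using f2 by (rule ft_L2)
  have "L2_norm (%om. cor (s om) * g om) <= ennreal (1/4) * L2_norm g"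
  proof (rule in_L2_bound(2)[OF gL])
  show "AEL om. cmod (cor (s om) * g om) <= 1/4 * cmod (g om)"
  using high
  proof eventually_elim
  fix om assume h: "norm om < 3 * R --> g om = 0"
  show "cmod (cor (s om) * g om) <= 1/4 * cmod (g om)"
  proof (cases "g om = 0")
  case False
  then have "s om * cmod (g om) <= 1/4 * cmod (g om)" using h shigh[of om] by (intro mult_right_mono) auto
  then show ?thesis unfolding norm_mult norm_of_real using s01[of om] by simp
  qed simp
  qed
  qed (use L in auto)
  also have "... = ennreal (1/4 * nrm g)" unfolding L2_norm_eq_nrm[OF gL] by (rule ennreal_mult[symmetric]) auto
  finally have "nrm (%om. cor (s om) * g om) <= 1/4 * nrm g" by (subst nrm_le_iff[OF L]) auto
  then show ?thesis by (simp add: ft_nrm[OF f2] ft_nrm[OF fg])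
 qed
 have high2: "AEL om. norm om < 3 * R --> cor (s om) * g om = 0"
  using high by eventually_elim simp
 define E where "E x = (LB h. cor (gauss a h) * (u (Pz (x + h)) - u (Pz x + h)))" for x
 have E: "nrm E <= 10 * ka * nrm ga" "in_L2 E"
  using gauss_commutator[OF ga R] unfolding E_def[abs_def] u_def a_def by auto
 define F where "F x = u (Pz x)" for x
 have FL: "in_L2 F" unfolding F_def[abs_def] by (rule in_L2_Pz[OF uL])
 obtain F' where F': "ft F F'" using ft_exists[OF FL] by blast
 define SF where "SF = convolution F (%x. cor (gauss a x))"
 have SF: "ft SF (%om. cor (s om) * F' om)"
  using ft_conv[OF F' gauss_L1_L2[OF a]] by (simp add: SF_def fourier_gauss[OF a] s_def mult.commute)
 have SFL: "in_L2 SF" using SF by (rule ft_L2)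
 have S1L: "in_L2 (invF ga1)" "in_L2 (invF ga2)"
  using ft_bandlim[OF ga1b(1)] ft_bandlim[OF ga2b] by (auto dest: ft_L2)
 have uS: "u x = invF ga1 x + invF ga2 x" for x
 proof -
  have "u x = invF (%om. ga1 om + ga2 om) x"
  unfolding u_def ga1_def ga2_def by (intro arg_cong2[where f=invF] refl ext) (simp add: algebra_simps)
  also have "... = invF ga1 x + invF ga2 x"
  proof -
  have i: "integrable lborel (%om. cis (2 * pi * (x \<bullet> om)) * ga' om)" if "bandlim R ga'" for ga'
  using bandlim_integrable[OF that] bandlim_meas[OF that]
  by (elim Bochner_Integration.integrable_bound) (auto simp: norm_mult)
  show ?thesis unfolding invF_def distrib_left
  by (rule Bochner_Integration.integral_add[OF i[OF ga1b(1)] i[OF ga2b]])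
  qed
  finally show ?thesis .
 qed
 have key: "u (Pz x) = invF ga1 (Pz x) + (SF x - E x)" for x
 proof -
  have i1: "integrable lborel (%h. cor (gauss a h) * u (Pz (x + h)))"
  using ip_integrable[OF gauss_L1_L2(2)[OF a] in_L2_shift[OF FL, of x]] by (simp add: F_def add.commute)
  have i2: "integrable lborel (%h. cor (gauss a h) * u (Pz x + h))"
  using ip_integrable[OF gauss_L1_L2(2)[OF a] in_L2_shift[OF uL, of "Pz x"]] by (simp add: add.commute)
  have "E x = (LB h. cor (gauss a h) * u (Pz (x + h))) - (LB h. cor (gauss a h) * u (Pz x + h))"
  unfolding E_def right_diff_distrib by (rule Bochner_Integration.integral_diff[OF i1 i2])
  also have "(LB h. cor (gauss a h) * u (Pz (x + h))) = SF x"
  unfolding SF_def conv_gauss F_def ..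
  also have "(LB h. cor (gauss a h) * u (Pz x + h)) = invF ga2 (Pz x)"
  unfolding u_def ga2_def s_def by (rule average_invF[OF ga a])
  finally show ?thesis using uS[of "Pz x"] by simp
 qed
 have "ip f (%x. u (Pz x)) = ip f (%x. invF ga1 (Pz x)) + ip f SF - ip f E"
 proof -
  have "ip f (%x. u (Pz x)) = ip f (%x. (SF x - E x) - (- invF ga1 (Pz x)))"
  by (simp add: key add.commute)
  also have "... = ip f SF - ip f E - ip f (%x. - invF ga1 (Pz x))"
  unfolding ip_diff_right[OF fL in_L2_diff[OF SFL E(2)] in_L2_minus[OF in_L2_Pz[OF S1L(1)]]]
  unfolding ip_diff_right[OF fL SFL E(2)] ..
  also have "ip f (%x. - invF ga1 (Pz x)) = - ip f (%x. invF ga1 (Pz x))"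
  unfolding ip_def by simp
  finally show ?thesis by simp
 qed
 moreover have "ip f SF = ip f2 F"
 proof -
  have "ip f SF = ip g (%om. cor (s om) * F' om)" by (rule ft_parseval[OF fg SF])
  also have "... = ip (%om. cor (s om) * g om) F'" by (rule ip_mult_left[symmetric])
  also have "... = ip f2 F" by (rule ft_parseval[OF f2 F', symmetric])
  finally show ?thesis .
 qed
 ultimately have "cmod (ip f (%x. u (Pz x))) <= cmod (ip f (%x. invF ga1 (Pz x))) + cmod (ip f2 (%x. invF ga (Pz x))) + cmod (ip f E)"
  unfolding F_def u_def
  by (metis (no_types, lifting) add_right_mono norm_triangle_ineq norm_triangle_ineq4 order_trans)
 also have "cmod (ip f (%x. invF ga1 (Pz x))) <= M * nrm f * nrm ga1"
  using B fg high ga1b(1) unfolding high_low_bound_def by blast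
 also have "... <= M * nrm f * (1/4 * nrm ga)" using M ga1b(2) by (intro mult_left_mono) auto
 also have "cmod (ip f2 (%x. invF ga (Pz x))) <= M * nrm f2 * nrm ga"
  using B f2 high2 ga unfolding high_low_bound_def by blast
 also have "... <= M * (1/4 * nrm f) * nrm ga" using M f2n by (intro mult_right_mono mult_left_mono) auto
 also have "cmod (ip f E) <= nrm f * nrm E" by (rule ip_cauchy[OF fL E(2)])
 also have "... <= nrm f * (10 * ka * nrm ga)" using E(1) by (intro mult_left_mono) auto
 finally show "cmod (ip f (%x. invF ga (Pz x))) <= (M / 2 + 10 * ka) * nrm f * nrm ga"
  unfolding u_def by (simp add: algebra_simps)
qed

lemma high_low:
 assumes R: "0 < R" shows "high_low_bound R (20 * ka)"
proof -
 have "high_low_bound R (2 * (10 * ka))"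
 proof (rule contraction_bound[OF high_low_step[OF R] high_low_init])
  fix M assume H: "\<And>e. 0 < e ==> \<exists>M'\<le>M + e. high_low_bound R M'"
  show "high_low_bound R M" unfolding high_low_bound_def
  proof (intro allI impI)
  fix f g ga assume *: "ft f g" "AEL om. norm om < 3 * R --> g om = 0" "bandlim R ga"
  show "cmod (ip f (%x. invF ga (Pz x))) <= M * nrm f * nrm ga"
  proof (rule field_le_epsilon)
  fix e :: real assume e: "0 < e"
  define p where "p = nrm f * nrm ga"
  have p: "0 <= p" by (simp add: p_def)
  obtain M' where M': "M' <= M + e / (p + 1)" "high_low_bound R M'" using H[of "e / (p + 1)"] e p by auto
  have "cmod (ip f (%x. invF ga (Pz x))) <= M' * nrm f * nrm ga"
  using M'(2) * unfolding high_low_bound_def by blast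
  also have "... = M' * p" by (simp add: p_def)
  also have "... <= (M + e / (p + 1)) * p" using M'(1) p by (rule mult_right_mono)
  also have "... = M * p + e * (p / (p + 1))" by (simp add: algebra_simps)
  also have "e * (p / (p + 1)) <= e * 1" using e p by (intro mult_left_mono) auto
  finally show "cmod (ip f (%x. invF ga (Pz x))) <= M * nrm f * nrm ga + e" by (simp add: p_def)
  qed
  qed
 qed (use ka0 in auto)
 then show ?thesis by simp
qed

text \<open>Duality with the low part itself: the pairing with a deformed low-frequency function is small by the
  preceding estimate, and the change of variables costs one more error of order \<open>ka\<close>.\<close>

lemma lowpass_of_high:
 assumes fg: "ft f g" and high: "AEL om. norm om < 3 * R --> g om = 0" and R: "0 < R"
  and g': "ft (%x. f (Ph x)) g'"
 shows "nrm (lowpass R g') <= 100 * ka * nrm f"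
proof (rule nrm_le_of_sq)
 show "0 <= 100 * ka * nrm f" using ka0 by simp
 define ga where "ga = lowpass R g'"
 have gL: "in_L2 g'" using g' by (rule ft_L2)
 have fL: "in_L2 f" using fg by (rule ft_L2)
 have ga: "bandlim R ga" unfolding ga_def by (rule bandlim_lowpass[OF gL])
 define v where "v = invF ga"
 have v: "ft v ga" unfolding v_def by (rule ft_bandlim[OF ga])
 have vL: "in_L2 v" using v by (rule ft_L2)
 have nv: "nrm v = nrm ga" using ft_nrm[OF v] by simp
 have "of_real ((nrm ga)^2) = ip g' ga" unfolding ga_def by (rule ip_lowpass[OF gL, symmetric])
 also have "... = ip (%x. f (Ph x)) v" by (rule ft_parseval[OF g' v, symmetric])
 also have "... = (ip (%x. f (Ph x)) v - ip f (%x. v (Pz x))) + ip f (%x. v (Pz x))" by simp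
 finally have "cmod (cor ((nrm ga)^2)) <= cmod (ip (%x. f (Ph x)) v - ip f (%x. v (Pz x))) + cmod (ip f (%x. v (Pz x)))"
  by (simp only: norm_triangle_ineq)
 also have "... <= 80 * ka * nrm f * nrm v + 20 * ka * nrm f * nrm ga"
  using high_low[OF R] fg high ga unfolding high_low_bound_def v_def[symmetric] nv
  by (intro add_mono ip_Ph[OF fL vL, unfolded nv]) (auto simp: v_def)
 also have "... = 100 * ka * nrm f * nrm ga" unfolding nv by (simp add: algebra_simps)
 finally show "(nrm (lowpass R g'))^2 <= 100 * ka * nrm f * nrm (lowpass R g')"
  unfolding ga_def[symmetric] norm_of_real by simp
qed

end

section \<open>The commutator with a family of localized convolutions\<close>

subsection \<open>Square functions over a finite family\<close>

definition vnorm :: "'i set => ('i => real^2 => complex) => ennreal" where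
 "vnorm J F = l2n (count_space J) (%i. L2_norm (F i))"

lemma vnorm_sq: "finite J ==> (vnorm J F)\<^sup>2 = (\<Sum>i\<in>J. (L2_norm (F i))^2)"
 by (simp add: vnorm_def l2n_sq nn_integral_count_space_finite)

lemma vnorm_mono: "(\<And>i. i \<in> J ==> L2_norm (F i) <= L2_norm (G i)) ==> vnorm J F <= vnorm J G"
 unfolding vnorm_def by (intro l2n_mono) auto

lemma vnorm_triangle:
 assumes "\<And>i. i \<in> J ==> F i \<in> bm" "\<And>i. i \<in> J ==> G i \<in> bm"
 shows "vnorm J (%i x. F i x + G i x) <= vnorm J F + vnorm J G"
proof -
 have "vnorm J (%i x. F i x + G i x) <= l2n (count_space J) (%i. L2_norm (F i) + L2_norm (G i))"
  unfolding vnorm_def using assms by (intro l2n_mono L2_norm_add) auto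
 also have "... <= vnorm J F + vnorm J G" unfolding vnorm_def by (rule l2n_triangle) auto
 finally show ?thesis .
qed

lemma vnorm_sum:
 assumes "finite A" "\<And>n i. n \<in> A ==> i \<in> J ==> F n i \<in> bm"
 shows "vnorm J (%i x. \<Sum>n\<in>A. F n i x) <= (\<Sum>n\<in>A. vnorm J (F n))"
 using assms
proof (induction A rule: finite_induct)
 case empty
 have "vnorm J (%i x. 0) = 0" by (simp add: vnorm_def l2n_def ennreal_sqrt_def)
 then show ?case by simp
next
 case (insert n A)
 have "vnorm J (%i x. \<Sum>n\<in>insert n A. F n i x) = vnorm J (%i x. F n i x + (\<Sum>n\<in>A. F n i x))"
  using insert by simp
 also have "... <= vnorm J (F n) + vnorm J (%i x. \<Sum>n\<in>A. F n i x)"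
  using insert.prems by (intro vnorm_triangle borel_measurable_sum) auto
 also have "... <= vnorm J (F n) + (\<Sum>n\<in>A. vnorm J (F n))"
  using insert by (intro add_left_mono) auto
 finally show ?case using insert by simp
qed

subsection \<open>Cells\<close>

definition cell :: "real => real^2 => int \<times> int" where
 "cell de x = (\<lfloor>x $ 1 / de\<rfloor>, \<lfloor>x $ 2 / de\<rfloor>)"

definition cpt :: "int \<times> int => 2 => int" where
 "cpt a k = (if k = 1 then fst a else snd a)"

definition corner :: "real => int \<times> int => real^2" where
 "corner de a = (\<chi> k. de * of_int (cpt a k))"

definition csize :: "int \<times> int => int" where
 "csize n = max \<bar>fst n\<bar> \<bar>snd n\<bar>"

lemma cpt_cell: "cpt (cell de x) k = \<lfloor>x $ k / de\<rfloor>"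
 using exhaust_2[of k] by (auto simp: cpt_def cell_def)

lemma cpt_add: "cpt (a + b) k = cpt a k + cpt b k"
 by (simp add: cpt_def)

lemma cpt_diff: "cpt (a - b) k = cpt a k - cpt b k"
 by (simp add: cpt_def)

lemma csize_cpt: "\<bar>cpt n k\<bar> <= csize n"
 by (simp add: cpt_def csize_def)

lemma csize_attained: "\<exists>k. \<bar>cpt n k\<bar> = csize n"
proof (cases "\<bar>fst n\<bar> <= \<bar>snd n\<bar>")
 case True then show ?thesis by (intro exI[of _ 2]) (simp add: cpt_def csize_def)
next
 case False then show ?thesis by (intro exI[of _ 1]) (simp add: cpt_def csize_def)
qed

lemma cell_bounds:
 assumes "0 < de"
 shows "de * of_int (cpt (cell de x) k) <= x $ k" "x $ k < de * of_int (cpt (cell de x) k) + de"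
proof -
 have "of_int \<lfloor>x $ k / de\<rfloor> <= x $ k / de" "x $ k / de < of_int \<lfloor>x $ k / de\<rfloor> + 1" by linarith+
 then have "of_int \<lfloor>x $ k / de\<rfloor> * de <= x $ k" "x $ k < (of_int \<lfloor>x $ k / de\<rfloor> + 1) * de"
  by (simp_all only: pos_le_divide_eq[OF assms] pos_divide_less_eq[OF assms])
 then show "de * of_int (cpt (cell de x) k) <= x $ k" "x $ k < de * of_int (cpt (cell de x) k) + de"
  unfolding cpt_cell by (simp_all add: algebra_simps)
qed

lemma cell_eq_iff: "cell de x = a \<longleftrightarrow> (real_of_int \<lfloor>x $ 1 / de\<rfloor> = real_of_int (fst a) \<and> real_of_int \<lfloor>x $ 2 / de\<rfloor> = real_of_int (snd a))"
 by (cases a) (simp add: cell_def)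

lemma cell_sets [measurable]: "{x. cell de x = a} \<in> sets borel"
 unfolding cell_eq_iff by measurable

lemma cell_measurable: "cell de \<in> borel \<rightarrow>\<^sub>M count_space UNIV"
proof (rule measurable_count_space_eq2_countable[THEN iffD2])
 show "cell de \<in> space borel \<rightarrow> UNIV \<and> (\<forall>a\<in>UNIV. cell de -` {a} \<inter> space borel \<in> sets borel)"
  using cell_sets[of de] by (auto simp: vimage_def)
qed

lemma corner_cell_measurable [measurable]: "(%x. corner de (cell de x + n)) \<in> bm"
 by (rule measurable_compose[OF cell_measurable]) simp

lemma cell_pair_sets [measurable]: "{p. cell de (snd p) = cell de (fst p) - n} \<in> sets (borel \<Otimes>\<^sub>M borel)"
proof -
 have "{p. cell de (snd p) = cell de (fst p) - n} = (\<Union>a. (%p. cell de (fst p)) -` {a} \<inter> (%p. cell de (snd p)) -` {a - n})"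
  by auto
 moreover have "(%p. cell de (fst p)) -` {a} \<in> sets ((borel :: (real^2) measure) \<Otimes>\<^sub>M (borel :: (real^2) measure))" for a
  using measurable_sets[OF measurable_compose[OF measurable_fst cell_measurable[of de]], of "{a}" "borel :: (real^2) measure"] by (simp add: space_pair_measure)
 moreover have "(%p. cell de (snd p)) -` {a} \<in> sets ((borel :: (real^2) measure) \<Otimes>\<^sub>M (borel :: (real^2) measure))" for a
  using measurable_sets[OF measurable_compose[OF measurable_snd cell_measurable[of de]], of "{a}" "borel :: (real^2) measure"] by (simp add: space_pair_measure)
 ultimately show ?thesis by (simp add: sets.countable_UN' )
qed

lemma nn_integral_cells:
 assumes [measurable]: "f \<in> bm"
 shows "(NN x. f x) = (\<integral>\<^sup>+ a. (NN x. indicator {x. cell de x = a} x * f x) \<partial>count_space UNIV)"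
proof -
 have "(\<integral>\<^sup>+ a. indicator {x. cell de x = a} x * f x \<partial>count_space UNIV) = f x" for x
 proof -
  have "(\<integral>\<^sup>+ a. indicator {x. cell de x = a} x * f x \<partial>count_space UNIV) = (\<integral>\<^sup>+ a. f x * indicator {cell de x} a \<partial>count_space UNIV)"
  by (intro nn_integral_cong) (auto split: split_indicator)
  then show ?thesis by simp
 qed
 then have "(NN x. f x) = (NN x. \<integral>\<^sup>+ a. indicator {x. cell de x = a} x * f x \<partial>count_space UNIV)"
  by simp
 also have "... = (\<integral>\<^sup>+ a. (NN x. indicator {x. cell de x = a} x * f x) \<partial>count_space UNIV)"
  by (rule nn_integral_count_space_nn_integral) auto
 finally show ?thesis .
qed

subsection \<open>Off-diagonal decay between cells\<close>

text \<open>A finite family of kernels whose first four moments in each coordinate have symbols of size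
 \<open>C de\<^sup>r\<close>; \<open>de\<close> is the scale at which the kernels are localized.\<close>

locale kernel_family =
 fixes J :: "'i set" and K :: "'i => real^2 => complex" and de C :: real
  and \<mu> :: "2 => nat => 'i => real^2 => complex"
 assumes fin: "finite J" and de: "0 < de" and C: "0 <= C"
  and K_int: "\<And>i. i \<in> J ==> integrable lborel (K i)"
  and mom_ft: "\<And>k r i. i \<in> J ==> r <= 4 ==> ft (%x. of_real (x $ k) ^ r * K i x) (\<mu> k r i)"
  and mom_bound: "\<And>k r. r <= 4 ==> AEL om. (\<Sum>i\<in>J. (cmod (\<mu> k r i om))^2) <= (C * de ^ r)^2"
begin

definition Kr :: "2 => nat => 'i => real^2 => complex" where
 "Kr k r i x = of_real (x $ k) ^ r * K i x"

lemma K_L2: "i \<in> J ==> in_L2 (K i)"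
 using mom_ft[of i 0 1] by (auto dest: ft_L2)

lemma Kr_L2: "i \<in> J ==> r <= 4 ==> in_L2 (Kr k r i)"
 using mom_ft[of i r k] unfolding Kr_def[abs_def] by (auto dest: ft_L2)

lemma Kr_meas [measurable]: "i \<in> J ==> r <= 4 ==> Kr k r i \<in> bm"
 using Kr_L2 by (auto dest: in_L2_measurable')

lemma Kr_conv_bound:
 assumes f: "integrable lborel f" "in_L2 f" and r: "r <= 4"
 shows "vnorm J (%i. convolution f (Kr k r i)) <= ennreal (C * de ^ r) * L2_norm f"
proof -
 note [measurable] = in_L2_measurable'[OF f(2)]
 have F: "ft (convolution f (Kr k r i)) (%om. \<mu> k r i om * fourier f om)" if "i \<in> J" for i
  using ft_conv[OF mom_ft[OF that r] f] unfolding Kr_def[abs_def] conv_commute[of f, abs_def] by simp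
 have [measurable]: "i \<in> J ==> \<mu> k r i \<in> bm" for i
  using ft_meas(2)[OF mom_ft[OF _ r]] by blast
 have "(vnorm J (%i. convolution f (Kr k r i)))^2 = (\<Sum>i\<in>J. (NN om. ennreal ((cmod (\<mu> k r i om * fourier f om))^2)))"
  unfolding vnorm_sq[OF fin] by (intro sum.cong refl) (simp add: ft_isometry[OF F, symmetric] L2_norm_sq)
 also have "... = (NN om. (\<Sum>i\<in>J. ennreal ((cmod (\<mu> k r i om * fourier f om))^2)))"
  by (rule nn_integral_sum[symmetric]) simp
 also have "... <= (NN om. ennreal ((C * de ^ r)^2) * ennreal ((cmod (fourier f om))^2))"
 proof (rule nn_integral_mono_AE)
  show "AEL om. (\<Sum>i\<in>J. ennreal ((cmod (\<mu> k r i om * fourier f om))^2)) <= ennreal ((C * de ^ r)^2) * ennreal ((cmod (fourier f om))^2)"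
  using mom_bound[OF r]
  proof eventually_elim
  fix om assume "(\<Sum>i\<in>J. (cmod (\<mu> k r i om))^2) <= (C * de ^ r)^2"
  then have "(\<Sum>i\<in>J. (cmod (\<mu> k r i om))^2) * (cmod (fourier f om))^2 <= (C * de ^ r)^2 * (cmod (fourier f om))^2"
  by (rule mult_right_mono) simp
  then have "(\<Sum>i\<in>J. (cmod (\<mu> k r i om * fourier f om))^2) <= (C * de ^ r)^2 * (cmod (fourier f om))^2"
  by (simp add: sum_distrib_right norm_mult power_mult_distrib)
  then show "(\<Sum>i\<in>J. ennreal ((cmod (\<mu> k r i om * fourier f om))^2)) <= ennreal ((C * de ^ r)^2) * ennreal ((cmod (fourier f om))^2)"
  by (simp add: sum_ennreal ennreal_leI flip: ennreal_mult)
  qed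
 qed
 also have "... = ennreal ((C * de ^ r)^2) * (L2_norm (fourier f))^2"
  unfolding L2_norm_sq by (rule nn_integral_cmult) measurable
 also have "... = (ennreal (C * de ^ r) * L2_norm f)^2"
  using C de by (simp add: plancherel_L1_L2(2)[OF f] power_mult_distrib ennreal_power)
 finally show ?thesis by (simp only: ennreal_sq_le_iff)
qed

definition block :: "int \<times> int => 2 => nat => (real^2 => complex) => ennreal" where
 "block a k r f = vnorm J (%i x. indicator {x. cell de x = a} x * convolution f (Kr k r i) x)"

definition block_bound :: "int \<times> int => int \<times> int => 2 => nat => real => bool" where
 "block_bound a b k r M \<longleftrightarrow> (\<forall>f. in_L2 f --> (\<forall>x. f x \<noteq> 0 --> cell de x = b) --> block a k r f <= ennreal (M * nrm f))"

lemma cell_norm: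
 assumes "cell de x = b" shows "norm x <= 2 * (de * (\<bar>of_int (csize b)\<bar> + 1))"
proof -
 have "\<bar>x $ k\<bar> <= de * (\<bar>of_int (csize b)\<bar> + 1)" for k
 proof -
  have "\<bar>real_of_int (cpt b k)\<bar> <= \<bar>of_int (csize b)\<bar>" using csize_cpt[of b k] by linarith
  then have "de * \<bar>real_of_int (cpt b k)\<bar> <= de * \<bar>of_int (csize b)\<bar>" using de by (intro mult_left_mono) auto
  moreover have "\<bar>de * real_of_int (cpt b k)\<bar> = de * \<bar>real_of_int (cpt b k)\<bar>" using de by (simp add: abs_mult)
  moreover note cell_bounds[OF de, of x k, unfolded assms]
  ultimately have "\<bar>x $ k\<bar> <= de * \<bar>of_int (csize b)\<bar> + de" using de by linarith
  then show ?thesis by (simp add: distrib_left)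
 qed
 then have "norm x <= sqrt 2 * (de * (\<bar>of_int (csize b)\<bar> + 1))" by (rule norm_le_2_coord)
 also have "... <= 2 * (de * (\<bar>of_int (csize b)\<bar> + 1))" using de by (intro mult_right_mono less_imp_le[OF sqrt2_less_2]) auto
 finally show ?thesis .
qed

lemma cell_supported_integrable:
 assumes "in_L2 f" "\<And>x. f x \<noteq> 0 ==> cell de x = b"
 shows "integrable lborel f"
proof -
 have "(%x. indicator (cball 0 (2 * (de * (\<bar>of_int (csize b)\<bar> + 1)))) x * f x) = f"
 proof
  fix x show "indicator (cball 0 (2 * (de * (\<bar>of_int (csize b)\<bar> + 1)))) x * f x = f x"
  using assms(2)[of x] cell_norm[of x b] by (cases "f x = 0") auto
 qed
 then show ?thesis using L2_truncation_integrable[OF assms(1)] by metis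
qed

lemma block_le: "block a k r f <= vnorm J (%i. convolution f (Kr k r i))"
 unfolding block_def by (intro vnorm_mono L2_norm_mono) (auto split: split_indicator)

lemma block_bound_trivial:
 assumes "r <= 4" shows "block_bound a b k r (C * de ^ r)"
 unfolding block_bound_def
proof (intro allI impI)
 fix f assume f: "in_L2 f" "\<forall>x. f x \<noteq> 0 --> cell de x = b"
 have "block a k r f <= ennreal (C * de ^ r) * L2_norm f"
  by (rule order_trans[OF block_le Kr_conv_bound]) (use f assms cell_supported_integrable in auto)
 then show "block a k r f <= ennreal (C * de ^ r * nrm f)"
  using C de by (simp add: L2_norm_eq_nrm[OF f(1)] ennreal_mult)
qed

text \<open>For points \<open>x\<close>, \<open>y\<close> in distant cells \<open>x\<^sub>k - y\<^sub>k\<close> is large. Multiplying the kernel by it gives the next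
 moment; expanding around the centre \<open>c\<close> of the cell of \<open>y\<close>, the term with \<open>y\<^sub>k - c\<close> is absorbed.\<close>

lemma block_bound_step:
 assumes r: "r < 4" and N: "2 <= \<bar>cpt a k - cpt b k\<bar>" and Q: "block_bound a b k (Suc r) Q" "0 <= Q"
  and M: "0 <= M" "block_bound a b k r M"
 shows "block_bound a b k r (M / 2 + 2 * Q / (de * (1 + of_int \<bar>cpt a k - cpt b k\<bar>)))"
 unfolding block_bound_def
proof (intro allI impI)
 fix f assume f: "in_L2 f" and supp: "\<forall>x. f x \<noteq> 0 --> cell de x = b"
 note [measurable] = in_L2_measurable'[OF f]
 define N where "N = real_of_int \<bar>cpt a k - cpt b k\<bar>"
 have N2: "2 <= N" using assms(2) unfolding N_def by linarith
 define c where "c = de * (of_int (cpt b k) + 1/2)"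
 define f' where "f' y = of_real (y $ k - c) * f y" for y
 have f'b: "AEL y. cmod (f' y) <= de / 2 * cmod (f y)"
 proof (rule AE_I2)
  fix y
  show "cmod (f' y) <= de / 2 * cmod (f y)"
  proof (cases "f y = 0")
  case False
  then have "cell de y = b" using supp by blast
  then have "\<bar>y $ k - c\<bar> <= de / 2"
  proof -
  have "c = de * of_int (cpt b k) + de / 2" by (simp add: c_def distrib_left)
  then show ?thesis using cell_bounds[OF de, of y k, unfolded \<open>cell de y = b\<close>] by linarith
  qed
  then show ?thesis unfolding f'_def norm_mult norm_of_real by (intro mult_right_mono) auto
  qed (simp add: f'_def)
 qed
 have f'm: "f' \<in> borel_measurable lborel" unfolding f'_def[abs_def] by measurable
 have f': "in_L2 f'" by (rule in_L2_bound(1)[OF f f'm f'b]) (use de in simp)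
 note [measurable] = in_L2_measurable'[OF f']
 have f'n: "nrm f' <= de / 2 * nrm f"
 proof -
  have "L2_norm f' <= ennreal (de / 2) * L2_norm f" by (rule in_L2_bound(2)[OF f f'm f'b]) (use de in simp)
  also have "... = ennreal (de / 2 * nrm f)"
  unfolding L2_norm_eq_nrm[OF f] by (rule ennreal_mult[symmetric]) (use de in auto)
  finally show ?thesis using de by (subst nrm_le_iff[OF f']) auto
 qed
 have f'supp: "\<forall>x. f' x \<noteq> 0 --> cell de x = b" using supp by (auto simp: f'_def)
 define I where "I x = (indicator {x. cell de x = a} x :: complex)" for x
 have [measurable]: "I \<in> bm" unfolding I_def[abs_def] by measurable
 have conv: "of_real (x $ k - c) * convolution f (Kr k r i) x = convolution f (Kr k (Suc r) i) x + convolution f' (Kr k r i) x"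
  if i: "i \<in> J" for i x
 proof -
  have "convolution f (Kr k (Suc r) i) x + convolution f' (Kr k r i) x
  = (LB y. f y * Kr k (Suc r) i (x - y) + f' y * Kr k r i (x - y))"
  unfolding convolution_def using i r
  by (intro Bochner_Integration.integral_add[symmetric] conv_integrable f f' Kr_L2) auto
  also have "... = (LB y. of_real (x $ k - c) * (f y * Kr k r i (x - y)))"
  by (intro bcong refl) (simp add: Kr_def f'_def algebra_simps)
  finally show ?thesis by (simp add: convolution_def)
 qed
 have pw: "de * (1 + N) / 2 * cmod (I x * convolution f (Kr k r i) x)
  <= cmod (I x * convolution f (Kr k (Suc r) i) x + I x * convolution f' (Kr k r i) x)" if i: "i \<in> J" for i x
 proof (cases "cell de x = a")
  case True
  have "de * (1 + N) / 2 <= \<bar>x $ k - c\<bar>"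
  proof -
  have x: "de * of_int (cpt a k) <= x $ k" "x $ k < de * of_int (cpt a k) + de" using cell_bounds[OF de, of x k] True by auto
  have h: "de * (1 + N) / 2 <= de * N - de / 2"
  using mult_left_mono[OF N2, of "de"] de by (simp add: field_simps)
  show ?thesis
  proof (cases "cpt b k <= cpt a k")
  case True
  then have "de * N = de * of_int (cpt a k) - de * of_int (cpt b k)" by (simp add: N_def right_diff_distrib)
  then have "de * N - de / 2 <= x $ k - c" using x by (simp add: c_def distrib_left)
  then show ?thesis using h by linarith
  next
  case False
  then have "de * N = de * of_int (cpt b k) - de * of_int (cpt a k)" by (simp add: N_def right_diff_distrib)
  then have "de * N - de / 2 <= c - x $ k" using x by (simp add: c_def distrib_left)
  then show ?thesis using h by linarith
  qed
  qed
  then have "de * (1 + N) / 2 * cmod (convolution f (Kr k r i) x) <= cmod (of_real (x $ k - c) * convolution f (Kr k r i) x)"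
  unfolding norm_mult norm_of_real by (rule mult_right_mono) simp
  then show ?thesis unfolding conv[OF i] using True by (simp add: I_def)
 qed (simp add: I_def)
 have "ennreal (de * (1 + N) / 2) * block a k r f <= vnorm J (%i x. I x * convolution f (Kr k (Suc r) i) x + I x * convolution f' (Kr k r i) x)"
 proof -
  have "ennreal (de * (1 + N) / 2) * block a k r f = l2n (count_space J) (%i. ennreal (de * (1 + N) / 2) * L2_norm (%x. I x * convolution f (Kr k r i) x))"
  unfolding block_def vnorm_def I_def by (rule l2n_cmult[symmetric]) simp
  also have "... <= vnorm J (%i x. I x * convolution f (Kr k (Suc r) i) x + I x * convolution f' (Kr k r i) x)"
  unfolding vnorm_def
  proof (rule l2n_mono)
  fix i assume "i \<in> space (count_space J)"
  then have i: "i \<in> J" by simp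
  have [measurable]: "Kr k r i \<in> bm" using i r by auto
  have "ennreal (de * (1 + N) / 2) * L2_norm (%x. I x * convolution f (Kr k r i) x)
  = L2_norm (%x. of_real (de * (1 + N) / 2) * (I x * convolution f (Kr k r i) x))"
  proof (subst L2_norm_cmult)
  have "0 <= de * (1 + N) / 2" using de N2 by simp
  then show "ennreal (de * (1 + N) / 2) * L2_norm (%x. I x * convolution f (Kr k r i) x)
  = ennreal (cmod (of_real (de * (1 + N) / 2))) * L2_norm (%x. I x * convolution f (Kr k r i) x)"
  unfolding norm_of_real by (simp only: abs_of_nonneg)
  qed measurable
  also have "... <= L2_norm (%x. I x * convolution f (Kr k (Suc r) i) x + I x * convolution f' (Kr k r i) x)"
  proof (rule L2_norm_mono)
  fix x
  have "0 <= de * (1 + N) / 2" using de N2 by simp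
  then have "cmod (of_real (de * (1 + N) / 2) * (I x * convolution f (Kr k r i) x)) = de * (1 + N) / 2 * cmod (I x * convolution f (Kr k r i) x)"
  unfolding norm_mult[of "of_real _"] norm_of_real by (simp only: abs_of_nonneg)
  then show "cmod (of_real (de * (1 + N) / 2) * (I x * convolution f (Kr k r i) x)) <= cmod (I x * convolution f (Kr k (Suc r) i) x + I x * convolution f' (Kr k r i) x)"
  using pw[OF i, of x] by simp
  qed
  finally show "ennreal (de * (1 + N) / 2) * L2_norm (%x. I x * convolution f (Kr k r i) x) <= L2_norm (%x. I x * convolution f (Kr k (Suc r) i) x + I x * convolution f' (Kr k r i) x)" .
  qed
  finally show ?thesis .
 qed
 also have "... <= block a k (Suc r) f + block a k r f'"
  unfolding block_def I_def[symmetric] by (rule vnorm_triangle) (use r in auto)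
 also have "... <= ennreal (Q * nrm f) + ennreal (M * nrm f')"
  using Q(1) M(2) f f' supp f'supp unfolding block_bound_def by (intro add_mono) auto
 also have "... <= ennreal (Q * nrm f) + ennreal (M * (de / 2 * nrm f))"
  using M(1) f'n by (intro add_left_mono ennreal_leI mult_left_mono) auto
 also have "... = ennreal ((Q + M * de / 2) * nrm f)"
  using Q(2) M(1) de by (subst ennreal_plus[symmetric]) (auto simp: algebra_simps)
 finally have le: "ennreal (de * (1 + N) / 2) * block a k r f <= ennreal ((Q + M * de / 2) * nrm f)" .
 have p: "0 < de * (1 + N) / 2" using de N2 by simp
 have "block a k r f = ennreal (1 / (de * (1 + N) / 2)) * (ennreal (de * (1 + N) / 2) * block a k r f)"
 proof -
  have "ennreal (1 / q) * (ennreal q * z) = z" if "0 < q" for q z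
  using that by (simp add: mult.assoc[symmetric] flip: ennreal_mult)
  then show ?thesis using p by metis
 qed
 also have "... <= ennreal (1 / (de * (1 + N) / 2)) * ennreal ((Q + M * de / 2) * nrm f)"
  by (rule mult_left_mono[OF le]) simp
 also have "... = ennreal (1 / (de * (1 + N) / 2) * ((Q + M * de / 2) * nrm f))"
  using p Q(2) M(1) de by (intro ennreal_mult[symmetric]) auto
 also have "... <= ennreal ((M / 2 + 2 * Q / (de * (1 + N))) * nrm f)"
 proof (rule ennreal_leI)
  have "1 / (de * (1 + N) / 2) * (Q + M * de / 2) = M / (1 + N) + 2 * Q / (de * (1 + N))"
  proof -
  have "M / (1 + N) = M * de / (de * (1 + N))" using de by simp
  moreover have "1 / (P / 2) * (Q + X / 2) = X / P + 2 * Q / P" for P X :: real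
  by (cases "P = 0") (simp_all add: field_simps)
  ultimately show ?thesis by metis
  qed
  also have "... <= M / 2 + 2 * Q / (de * (1 + N))"
  using M(1) N2 by (intro add_right_mono divide_left_mono) auto
  finally show "1 / (de * (1 + N) / 2) * ((Q + M * de / 2) * nrm f) <= (M / 2 + 2 * Q / (de * (1 + N))) * nrm f"
  unfolding mult.assoc[symmetric] by (rule mult_right_mono) simp
 qed
 finally show "block a k r f <= ennreal ((M / 2 + 2 * Q / (de * (1 + of_int \<bar>cpt a k - cpt b k\<bar>))) * nrm f)"
  by (simp add: N_def)
qed

lemma block_bound_improve:
 assumes r: "r < 4" and N: "2 <= \<bar>cpt a k - cpt b k\<bar>" and Q: "block_bound a b k (Suc r) Q" "0 <= Q"
 shows "block_bound a b k r (4 * Q / (de * (1 + of_int \<bar>cpt a k - cpt b k\<bar>)))"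
proof -
 have "block_bound a b k r (2 * (2 * Q / (de * (1 + of_int \<bar>cpt a k - cpt b k\<bar>))))"
 proof (rule contraction_bound[where B="block_bound a b k r" and ?M0.0="C * de ^ r"])
  show "block_bound a b k r (M / 2 + 2 * Q / (de * (1 + of_int \<bar>cpt a k - cpt b k\<bar>)))"
  if "0 <= M" "block_bound a b k r M" for M using block_bound_step[OF r N Q that] .
  show "block_bound a b k r (C * de ^ r)" using r by (intro block_bound_trivial) auto
  show "0 <= C * de ^ r" using C de by simp
  show "0 <= 2 * Q / (de * (1 + of_int \<bar>cpt a k - cpt b k\<bar>))" using Q de by simp
  fix M assume H: "\<And>e. 0 < e ==> \<exists>M'\<le>M + e. block_bound a b k r M'"
  show "block_bound a b k r M" unfolding block_bound_def
  proof (intro allI impI)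
  fix f assume *: "in_L2 f" "\<forall>x. f x \<noteq> 0 --> cell de x = b"
  show "block a k r f <= ennreal (M * nrm f)"
  proof (rule ennreal_le_epsilon)
  fix e :: real assume e: "0 < e"
  define p where "p = nrm f"
  have p: "0 <= p" by (simp add: p_def)
  obtain M' where M': "M' <= M + e / (p + 1)" "block_bound a b k r M'" using H[of "e / (p + 1)"] e p by auto
  have "block a k r f <= ennreal (M' * p)" using M'(2) * unfolding block_bound_def p_def by blast
  also have "... <= ennreal (M * p + e)"
  proof (rule ennreal_leI)
  have "M' * p <= (M + e / (p + 1)) * p" using M'(1) p by (rule mult_right_mono)
  also have "... = M * p + e * (p / (p + 1))" by (simp add: algebra_simps)
  also have "e * (p / (p + 1)) <= e * 1" using e p by (intro mult_left_mono) auto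
  finally show "M' * p <= M * p + e" by simp
  qed
  also have "... <= ennreal (M * p) + ennreal e"
  proof (cases "0 <= M * p")
  case True
  then show ?thesis using e by simp
  next
  case False
  then show ?thesis using e by (simp add: ennreal_neg ennreal_leI)
  qed
  finally show "block a k r f <= ennreal (M * nrm f) + ennreal e" by (simp add: p_def)
  qed
  qed
 qed
 then show ?thesis by simp
qed

text \<open>Each of the four moments gains one factor \<open>1 / (1 + N)\<close> at cell distance
  \<open>N\<close>. The fourth power is what the summation over the plane needs: one power is lost to
  the size of the displacement at distance \<open>N\<close>, and the remaining three make the sum over
  the lattice finite.\<close>

lemma block_decay:
 shows "\<exists>k. block_bound a b k 0 (256 * C / (1 + of_int (csize (a - b))) ^ 4)"
proof -
 obtain k where k: "\<bar>cpt (a - b) k\<bar> = csize (a - b)" using csize_attained by blast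
 define N where "N = real_of_int (csize (a - b))"
 have N0: "0 <= N" unfolding N_def using k by (metis abs_ge_zero of_int_0_le_iff)
 have mono: "block_bound a b k 0 M'" if "block_bound a b k 0 M" "M <= M'" for M M'
  using that unfolding block_bound_def by (meson ennreal_leI mult_right_mono nrm_nonneg order_trans)
 show ?thesis
 proof (cases "2 <= csize (a - b)")
  case False
  then have "N <= 1" unfolding N_def by linarith
  then have "(1 + N) ^ 4 <= 2 ^ 4" using N0 by (intro power_mono) auto
  then have "C * (1 + N) ^ 4 <= C * 256" using C by (intro mult_left_mono) auto
  moreover have "0 < (1 + N) ^ 4" using N0 by simp
  ultimately have le: "C * de ^ 0 <= 256 * C / (1 + N) ^ 4" by (simp add: field_simps)
  have "block_bound a b k 0 (256 * C / (1 + N) ^ 4)" by (rule mono[OF block_bound_trivial le]) simp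
  then show ?thesis unfolding N_def by blast
 next
  case True
  then have N2: "2 <= \<bar>cpt a k - cpt b k\<bar>" using k by (simp add: cpt_diff)
  have Neq: "of_int \<bar>cpt a k - cpt b k\<bar> = N" unfolding N_def using k by (simp add: cpt_diff)
  have pos: "0 < de * (1 + N)" using de N0 by simp
  have s: "block_bound a b k r (4 * Q / (de * (1 + N)))" if "r < 4" "block_bound a b k (Suc r) Q" "0 <= Q" for r Q
  using block_bound_improve[OF that(1) N2 that(2,3)] unfolding Neq .
  have q0: "0 <= 4 * Q / (de * (1 + N))" if "0 <= Q" for Q using that pos by simp
  have C4: "0 <= C * de ^ 4" using C de by simp
  have b4: "block_bound a b k (Suc 3) (C * de ^ 4)" using block_bound_trivial[of 4 a b k] by (simp add: numeral_eq_Suc)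
  have b3: "block_bound a b k (Suc 2) (4 * (C * de ^ 4) / (de * (1 + N)))" using s[OF _ b4 C4] by (simp add: numeral_eq_Suc)
  have b2: "block_bound a b k (Suc 1) (4 * (4 * (C * de ^ 4) / (de * (1 + N))) / (de * (1 + N)))" using s[OF _ b3 q0[OF C4]] by (simp add: numeral_eq_Suc)
  have b1: "block_bound a b k (Suc 0) (4 * (4 * (4 * (C * de ^ 4) / (de * (1 + N))) / (de * (1 + N))) / (de * (1 + N)))" using s[OF _ b2 q0[OF q0[OF C4]]] by simp
  have b0: "block_bound a b k 0 (4 * (4 * (4 * (4 * (C * de ^ 4) / (de * (1 + N))) / (de * (1 + N))) / (de * (1 + N))) / (de * (1 + N)))" using s[OF _ b1 q0[OF q0[OF q0[OF C4]]]] by simp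
  have "4 * (4 * (4 * (4 * (C * de ^ 4) / (de * (1 + N))) / (de * (1 + N))) / (de * (1 + N))) / (de * (1 + N)) = 256 * C / (1 + N) ^ 4"
  proof -
  have e: "x / (de * (1 + N)) = x / de / (1 + N)" for x by simp
  have "4 * (4 * (4 * (4 * (C * de ^ 4) / (de * (1 + N))) / (de * (1 + N))) / (de * (1 + N))) / (de * (1 + N))
  = 256 * (C * de ^ 4) / (de * (1 + N)) ^ 4"
  by (simp add: power4_eq_xxxx)
  also have "... = 256 * C / (1 + N) ^ 4" using de by (simp add: power_mult_distrib)
  finally show ?thesis .
  qed
  then show ?thesis using b0 unfolding N_def by metis
 qed
qed

lemma block_decay_conv:
 assumes f: "in_L2 f" "\<And>x. f x \<noteq> 0 ==> cell de x = b"
 shows "vnorm J (%i x. indicator {x. cell de x = a} x * convolution f (K i) x)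
  <= ennreal (256 * C / (1 + of_int (csize (a - b))) ^ 4 * nrm f)"
proof -
 obtain k where k: "block_bound a b k 0 (256 * C / (1 + of_int (csize (a - b))) ^ 4)" using block_decay by blast
 have "Kr k 0 i = K i" for i by (simp add: Kr_def fun_eq_iff)
 then show ?thesis using k f unfolding block_bound_def block_def by auto
qed

end

subsection \<open>Deforming band-limited functions\<close>

lemma norm_le_coord:
 fixes x :: "real^2" assumes "\<And>k. \<bar>x $ k\<bar> <= c" "0 <= c" shows "norm x <= 2 * c"
proof -
 have "norm x <= sqrt 2 * c" by (rule norm_le_2_coord) (use assms in auto)
 also have "... <= 2 * c" using assms sqrt2_less_2 by (intro mult_right_mono) auto
 finally show ?thesis .
qed

lemma csize_nonneg: "0 <= csize n"
 by (simp add: csize_def)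

lemma corner_nth: "corner de a $ k = de * of_int (cpt a k)"
 by (simp add: corner_def)

lemma corner_dist:
 assumes "0 < de"
 shows "norm (corner de (cell de y + n) - y) <= 2 * (de * (1 + of_int (csize n)))"
proof (rule norm_le_coord)
 fix k
 have "\<bar>real_of_int (cpt n k)\<bar> <= of_int (csize n)" using csize_cpt[of n k] by linarith
 then have "de * \<bar>real_of_int (cpt n k)\<bar> <= de * of_int (csize n)" using assms by (intro mult_left_mono) auto
 moreover have "\<bar>de * real_of_int (cpt n k)\<bar> = de * \<bar>real_of_int (cpt n k)\<bar>" using assms by (simp add: abs_mult)
 moreover have "(corner de (cell de y + n) - y) $ k = de * of_int (cpt (cell de y) k) - y $ k + de * of_int (cpt n k)"
  by (simp add: corner_nth cpt_add distrib_left)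
 ultimately have "\<bar>(corner de (cell de y + n) - y) $ k\<bar> <= de + de * of_int (csize n)"
  using cell_bounds[OF assms, of y k] by linarith
 then show "\<bar>(corner de (cell de y + n) - y) $ k\<bar> <= de * (1 + of_int (csize n))" by (simp add: distrib_left)
qed (use assms csize_nonneg in simp)

text \<open>Rounding to a corner is discontinuous; on cells whose indices have prescribed parities, it is
 Lipschitz, since two distinct cells of such a class are separated by a third one.\<close>

lemma corner_lipschitz:
 assumes de: "0 < de" and par: "\<And>k. even (cpt (cell de x) k) = even (cpt (cell de y) k)"
 shows "norm (corner de (cell de x + n) - corner de (cell de y + n)) <= 2 * norm (x - y)"
proof -
 have "norm (corner de (cell de x + n) - corner de (cell de y + n)) <= norm (2 *\<^sub>R (x - y))"
 proof (rule norm_le_componentwise_cart)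
  fix k
  define b where "b = cpt (cell de x) k"
  define b' where "b' = cpt (cell de y) k"
  have d: "(corner de (cell de x + n) - corner de (cell de y + n)) $ k = de * of_int b - de * of_int b'"
  by (simp add: corner_nth cpt_add b_def b'_def algebra_simps)
  have x: "de * of_int b <= x $ k" "x $ k < de * of_int b + de" and y: "de * of_int b' <= y $ k" "y $ k < de * of_int b' + de"
  using cell_bounds[OF de, of x k] cell_bounds[OF de, of y k] by (simp_all add: b_def b'_def)
  have "\<bar>de * of_int b - de * of_int b'\<bar> <= 2 * \<bar>x $ k - y $ k\<bar>"
  proof (cases "b = b'")
  case False
  have ev: "even b = even b'" using par[of k] by (simp add: b_def b'_def)
  have "b + 2 <= b' \<or> b' + 2 <= b" using False ev by presburger
  have sep: "\<bar>p - q\<bar> <= 2 * \<bar>X - Y\<bar>" if "p + 2 * d <= q" "X < p + d" "q <= Y" "0 < d" for p q X Y d :: real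
  proof -
  have "q - p - d <= Y - X" "2 * d <= q - p" using that by linarith+
  then have "(q - p) + (q - p) <= 2 * (Y - X) + (q - p)" by argo
  then have "q - p <= 2 * (Y - X)" by simp
  moreover have "X < Y" "p < q" using that by linarith+
  ultimately
  show ?thesis by (simp add: abs_of_neg)
  qed
  from \<open>b + 2 <= b' \<or> b' + 2 <= b\<close> consider "b + 2 <= b'" | "b' + 2 <= b" by blast
  then show ?thesis
  proof cases
  case 1
  then have "de * (real_of_int b + 2) <= de * of_int b'" using de by (intro mult_left_mono) linarith+
  then have "de * of_int b + 2 * de <= de * of_int b'" by (simp add: distrib_left)
  then show ?thesis using sep x y de by blast
  next
  case 2
  then have "de * (real_of_int b' + 2) <= de * of_int b" using de by (intro mult_left_mono) linarith+
  then have "de * of_int b' + 2 * de <= de * of_int b" by (simp add: distrib_left)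
  then have "\<bar>de * of_int b' - de * of_int b\<bar> <= 2 * \<bar>y $ k - x $ k\<bar>" using sep x y de by blast
  then show ?thesis by (simp only: abs_minus_commute)
  qed
  qed simp
  moreover have "norm ((2 *\<^sub>R (x - y)) $ k) = 2 * \<bar>x $ k - y $ k\<bar>" unfolding vector_scaleR_component norm_scaleR by simp
  ultimately show "norm ((corner de (cell de x + n) - corner de (cell de y + n)) $ k) <= norm ((2 *\<^sub>R (x - y)) $ k)"
  using d by (simp only: real_norm_def)
 qed
 then show ?thesis by simp
qed

text \<open>On each of the four parity classes the segments from \<open>y - ta (corner)\<close> to \<open>Ph
  y\<close> form a Lipschitz family close to the identity, so that the estimate along moving paths
  applies.\<close>

lemma (in small_perturbation) corner_displacement:
 assumes ga: "bandlim R ga" and de: "0 < de"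
 shows "(L2_norm (%y. invF ga (Ph y) - invF ga (y - ta (corner de (cell de y + n)))))^2
  <= ennreal (64 * (2 * ka * de * (1 + of_int (csize n)))^2) * genergy ga"
proof -
 note [measurable] = bandlim_meas[OF ga]
 define \<eta> where "\<eta> = 2 * ka * de * (1 + of_int (csize n))"
 have \<eta>0: "0 <= \<eta>" using ka0 de csize_nonneg[of n] by (simp add: \<eta>_def)
 define c where "c y = corner de (cell de y + n)" for y
 have [measurable]: "c \<in> bm" unfolding c_def[abs_def] by measurable
 define S where "S p = {y. (even (cpt (cell de y) 1), even (cpt (cell de y) 2)) = p}" for p
 have S[measurable]: "S p \<in> sets borel" for p
 proof -
  have "S p = cell de -` {a. (even (cpt a 1), even (cpt a 2)) = p} \<inter> space borel" by (auto simp: S_def)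
  also have "... \<in> sets borel" by (rule measurable_sets[OF cell_measurable]) simp
  finally show ?thesis .
 qed
 let ?d = "%y. ennreal ((cmod (invF ga (Ph y) - invF ga (y - ta (c y))))^2)"
 have part: "(NN y. indicator (S p) y * ?d y) <= ennreal (16 * \<eta>\<^sup>2) * genergy ga" for p
 proof (rule path_estimate[OF ga S _ _ \<eta>0])
  fix x assume "x \<in> S p"
  have "norm (Ph x - (x - ta (c x))) = norm (ta (c x) - ta x)" by (simp add: Ph_def)
  also have "... <= ka * norm (c x - x)" by (rule lip)
  also have "... <= ka * (2 * (de * (1 + of_int (csize n))))"
  using corner_dist[OF de, of x n] ka0 by (intro mult_left_mono) (auto simp: c_def)
  finally show "norm (Ph x - (x - ta (c x))) <= \<eta>" by (simp add: \<eta>_def mult_ac)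
 next
  fix t :: real and x y assume t: "0 <= t" "t <= 1" and xy: "x \<in> S p" "y \<in> S p"
  have par: "even (cpt (cell de x) k) = even (cpt (cell de y) k)" for k
  using xy exhaust_2[of k] by (auto simp: S_def)
  have "(x - (x - ta (c x) + t *\<^sub>R (Ph x - (x - ta (c x))))) - (y - (y - ta (c y) + t *\<^sub>R (Ph y - (y - ta (c y)))))
  = (1 - t) *\<^sub>R (ta (c x) - ta (c y)) + t *\<^sub>R (ta x - ta y)"
  by (simp add: Ph_def algebra_simps)
  also have "norm ... <= (1 - t) * norm (ta (c x) - ta (c y)) + t * norm (ta x - ta y)"
  using t by (intro order_trans[OF norm_triangle_ineq]) simp
  also have "... <= (1 - t) * (1/2 * norm (x - y)) + t * (1/2 * norm (x - y))"
  proof (intro add_mono mult_left_mono)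
  have "norm (ta (c x) - ta (c y)) <= ka * norm (c x - c y)" by (rule lip)
  also have "... <= 1/8 * (2 * norm (x - y))"
  using corner_lipschitz[OF de par] ka_small ka0 by (intro mult_mono) (auto simp: c_def)
  finally show "norm (ta (c x) - ta (c y)) <= 1/2 * norm (x - y)" using norm_ge_zero[of "x - y"] by linarith
  have "norm (ta x - ta y) <= 1/2 * norm (x - y)"
  using order_trans[OF lip[of x y] mult_right_mono[OF ka_small norm_ge_zero[of "x - y"]]] norm_ge_zero[of "x - y"] by linarith
  then show "norm (ta x - ta y) <= 1/2 * norm (x - y)" .
  qed (use t in auto)
  also have "... = 1/2 * norm (x - y)" by (simp only: distrib_right[symmetric]) simp
  finally show "norm ((x - (x - ta (c x) + t *\<^sub>R (Ph x - (x - ta (c x))))) - (y - (y - ta (c y) + t *\<^sub>R (Ph y - (y - ta (c y))))))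
  <= 1/2 * norm (x - y)" .
 qed measurable
 have "(NN y. ?d y) <= (NN y. (\<Sum>p\<in>(UNIV :: (bool \<times> bool) set). indicator (S p) y * ?d y))"
 proof (rule nn_integral_mono)
  fix y
  have "indicator (S p) y * ?d y <= (\<Sum>p\<in>(UNIV :: (bool \<times> bool) set). indicator (S p) y * ?d y)" for p
  by (rule member_le_sum) auto
  from this[of "(even (cpt (cell de y) 1), even (cpt (cell de y) 2))"]
  show "?d y <= (\<Sum>p\<in>(UNIV :: (bool \<times> bool) set). indicator (S p) y * ?d y)" by (simp add: S_def)
 qed
 also have "... = (\<Sum>p\<in>(UNIV :: (bool \<times> bool) set). (NN y. indicator (S p) y * ?d y))"
  by (rule nn_integral_sum) measurable
 also have "... <= (\<Sum>p\<in>(UNIV :: (bool \<times> bool) set). ennreal (16 * \<eta>\<^sup>2) * genergy ga)"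
  by (rule sum_mono) (rule part)
 also have "... = of_nat (card (UNIV :: (bool \<times> bool) set)) * (ennreal (16 * \<eta>\<^sup>2) * genergy ga)" by simp
 also have "card (UNIV :: (bool \<times> bool) set) = 4" by (simp add: card_UNIV_bool flip: UNIV_Times_UNIV)
 also have "of_nat 4 * (ennreal (16 * \<eta>\<^sup>2) * genergy ga) = ennreal (64 * \<eta>\<^sup>2) * genergy ga"
  by (simp add: mult.assoc[symmetric] ennreal_mult' flip: ennreal_numeral) (simp add: ennreal_mult'[symmetric] del: ennreal_numeral flip: ennreal_numeral)
 finally show ?thesis unfolding L2_norm_sq c_def \<eta>_def .
qed

text \<open>The number of cells at distance \<open>r\<close> from a given one is \<open>8 * r\<close>.\<close>

definition square_cells :: "nat => (int \<times> int) set" where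
 "square_cells m = {- int m..int m} \<times> {- int m..int m}"

lemma square_cells_iff: "n \<in> square_cells m \<longleftrightarrow> csize n <= int m"
 by (cases n) (auto simp: square_cells_def csize_def)

lemma finite_square_cells [simp]: "finite (square_cells m)"
 by (simp add: square_cells_def)

lemma csize_sum: "(\<Sum>n\<in>square_cells m. 1 / (1 + real_of_int (csize n)) ^ 3) <= 9 - 8 / (real m + 1)"
proof (induction m)
 case 0
 have "square_cells 0 = {(0, 0)}" by (auto simp: square_cells_def)
 then show ?case by (simp add: csize_def)
next
 case (Suc m)
 let ?f = "%n. 1 / (1 + real_of_int (csize n)) ^ 3"
 let ?A = "square_cells (Suc m) - square_cells m"
 have sub: "square_cells m \<subseteq> square_cells (Suc m)" by (auto simp: square_cells_iff)
 have c: "card (square_cells m) = (2 * m + 1)^2" for m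
  by (simp add: square_cells_def card_cartesian_product power2_eq_square nat_add_distrib nat_mult_distrib)
 have "card ?A = card (square_cells (Suc m)) - card (square_cells m)"
  by (rule card_Diff_subset[OF _ sub]) simp
 also have "... = 8 * (m + 1)" unfolding c by (simp add: power2_eq_square algebra_simps)
 finally have cA: "card ?A = 8 * (m + 1)" .
 have "sum ?f ?A = (\<Sum>n\<in>?A. 1 / (real m + 2) ^ 3)"
 proof (rule sum.cong[OF refl])
  fix n assume "n \<in> ?A"
  then have "csize n = int (Suc m)" by (auto simp: square_cells_iff)
  then show "?f n = 1 / (real m + 2) ^ 3" by (simp add: add.commute)
 qed
 also have "... = 8 * ((real m + 1) / (real m + 2) ^ 3)" by (simp add: cA)
 also have "... <= 8 * (1 / (real m + 1) - 1 / (real m + 2))"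
 proof (rule mult_left_mono)
  have "(real m + 1) / (real m + 2) ^ 3 <= (real m + 2) / (real m + 2) ^ 3" by (intro divide_right_mono) auto
  also have "... = 1 / ((real m + 2) * (real m + 2))" by (simp add: power3_eq_cube)
  also have "... <= 1 / ((real m + 1) * (real m + 2))" by (intro divide_left_mono mult_right_mono) auto
  also have "... = 1 / (real m + 1) - 1 / (real m + 2)" by (simp add: field_simps)
  finally show "(real m + 1) / (real m + 2) ^ 3 <= 1 / (real m + 1) - 1 / (real m + 2)" .
 qed simp
 finally have "sum ?f ?A <= 8 / (real m + 1) - 8 / (real m + 2)" by simp
 moreover have "sum ?f (square_cells (Suc m)) = sum ?f ?A + sum ?f (square_cells m)"
  by (rule sum.subset_diff[OF sub]) simp
 ultimately show ?case using Suc by (simp add: add.commute)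
qed

context kernel_family
begin

definition offset_conv :: "int \<times> int => (real^2 => complex) => 'i => real^2 => complex" where
 "offset_conv n f i x = (LB y. indicator {p. cell de (snd p) = cell de (fst p) - n} (x, y) * f y * K i (x - y))"

lemma K_meas [measurable]: "i \<in> J ==> K i \<in> bm"
 using K_L2 by (auto dest: in_L2_measurable')

lemma offset_conv_measurable [measurable]:
 assumes [measurable]: "f \<in> bm" and i: "i \<in> J"
 shows "offset_conv n f i \<in> bm"
proof -
 note [measurable] = K_meas[OF i]
 have "(%(x, y). indicator {p. cell de (snd p) = cell de (fst p) - n} (x, y) * f y * K i (x - y)) \<in> borel_measurable (borel \<Otimes>\<^sub>M lborel)"
  by measurable
 then show ?thesis unfolding offset_conv_def[abs_def]
  by (intro lborel.borel_measurable_lebesgue_integral) simp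
qed

lemma offset_conv_cell:
 "indicator {x. cell de x = a} x * offset_conv n f i x
  = indicator {x. cell de x = a} x * convolution (%y. indicator {y. cell de y = a - n} y * f y) (K i) x"
 unfolding offset_conv_def convolution_def
 by (cases "cell de x = a") (auto intro!: bcong split: split_indicator)

text \<open>The cells being disjoint, the offset-\<open>n\<close> part of the convolutions is block diagonal up to a
 shift.\<close>

lemma offset_conv_bound:
 assumes f: "in_L2 f"
 shows "vnorm J (offset_conv n f) <= ennreal (256 * C / (1 + of_int (csize n)) ^ 4) * L2_norm f"
proof -
 note [measurable] = in_L2_measurable'[OF f]
 define M where "M = 256 * C / (1 + of_int (csize n)) ^ 4"
 have M0: "0 <= M" using C csize_nonneg[of n] by (simp add: M_def)
 let ?I = "%a x. indicator {x. cell de x = a} x :: complex"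
 have sq: "(L2_norm (%x. ?I a x * g x))^2 = (NN x. indicator {x. cell de x = a} x * ennreal ((cmod (g x))^2))" for a g
  unfolding L2_norm_sq by (intro nn_integral_cong) (auto split: split_indicator)
 have cells: "(L2_norm g)^2 = (\<integral>\<^sup>+ a. (L2_norm (%x. ?I a x * g x))^2 \<partial>count_space UNIV)"
  if [measurable]: "g \<in> bm" for g
  unfolding sq unfolding L2_norm_sq by (rule nn_integral_cells) measurable
 have "(vnorm J (offset_conv n f))^2 = (\<Sum>i\<in>J. \<integral>\<^sup>+ a. (L2_norm (%x. ?I a x * offset_conv n f i x))^2 \<partial>count_space UNIV)"
  unfolding vnorm_sq[OF fin] by (intro sum.cong refl cells) measurable
 also have "... = (\<integral>\<^sup>+ a. (\<Sum>i\<in>J. (L2_norm (%x. ?I a x * offset_conv n f i x))^2) \<partial>count_space UNIV)"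
  by (rule nn_integral_sum[symmetric]) simp
 also have "... <= (\<integral>\<^sup>+ a. (ennreal M)^2 * (L2_norm (%y. ?I (a - n) y * f y))^2 \<partial>count_space UNIV)"
 proof (rule nn_integral_mono)
  fix a
  let ?f = "%y. ?I (a - n) y * f y"
  have f': "in_L2 ?f" by (rule in_L2_indicator_mult[OF f]) measurable
  have "vnorm J (%i x. ?I a x * convolution ?f (K i) x) <= ennreal (256 * C / (1 + of_int (csize (a - (a - n)))) ^ 4 * nrm ?f)"
  by (rule block_decay_conv[OF f']) (auto simp: indicator_def split: if_splits)
  also have "... = ennreal M * L2_norm ?f"
  unfolding L2_norm_eq_nrm[OF f'] using M0 by (subst ennreal_mult[symmetric]) (auto simp: M_def)
  finally have "(vnorm J (%i x. ?I a x * convolution ?f (K i) x))^2 <= (ennreal M * L2_norm ?f)^2"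
  by (simp only: ennreal_sq_le_iff)
  then show "(\<Sum>i\<in>J. (L2_norm (%x. ?I a x * offset_conv n f i x))^2) <= (ennreal M)^2 * (L2_norm ?f)^2"
  unfolding vnorm_sq[OF fin] offset_conv_cell power_mult_distrib .
 qed
 also have "... = (\<integral>\<^sup>+ b. (ennreal M)^2 * (L2_norm (%y. ?I b y * f y))^2 \<partial>count_space UNIV)"
  by (rule nn_integral_bij_count_space[where g="%a. a - n" and A=UNIV and B=UNIV])
  (rule bij_betw_byWitness[where f'="%a. a + n"], auto)
 also have "... = (ennreal M)^2 * (\<integral>\<^sup>+ b. (L2_norm (%y. ?I b y * f y))^2 \<partial>count_space UNIV)"
  by (rule nn_integral_cmult) simp
 also have "... = (ennreal M * L2_norm f)^2" by (simp add: cells[symmetric] power_mult_distrib)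
 finally show ?thesis unfolding M_def by (simp only: ennreal_sq_le_iff)
qed

text \<open>The moment of order zero is the kernel itself, whose transform is the Fourier integral almost
  everywhere.\<close>

lemma symbol_bound: "AEL om. (\<Sum>i\<in>J. (cmod (fourier (K i) om))^2) <= C^2"
proof -
 have "AEL om. \<mu> 1 0 i om = fourier (K i) om" if "i \<in> J" for i
  using mom_ft[OF that, of 0 1] by (intro ft_unique[OF _ ft_fourier[OF K_int[OF that] K_L2[OF that]]]) auto
 then have "AEL om. \<forall>i\<in>J. \<mu> 1 0 i om = fourier (K i) om" using fin by (simp add: AE_finite_all)
 then show ?thesis using mom_bound[of 0 1, OF le0] by eventually_elim simp
qed

end

locale deformed_kernels = kernel_family J K de C \<mu> + small_perturbation ta ka
 for J :: "'i set" and K de C \<mu> ta ka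
begin

text \<open>The commutator integrand compares \<open>G\<close> at \<open>y - ta y\<close> and at \<open>y - ta x\<close>. Replacing \<open>ta x\<close> by its
 value at the corner of the cell of \<open>x\<close> makes the difference, for each offset between the cells
 of \<open>x\<close> and \<open>y\<close>, a function of \<open>y\<close> alone; the off-diagonal decay then makes the
 sum over all offsets converge.\<close>

lemma low_commutator:
 assumes ga: "bandlim R ga" and R: "0 <= R"
 shows "(vnorm J (%i x. convolution (%y. invF ga (Ph y)) (K i) x - convolution (invF ga) (K i) (Ph x)))^2
  <= ennreal ((40000 * C * ka * de)^2) * genergy ga"
proof -
 note [measurable] = bandlim_meas[OF ga]
 define G where "G = invF ga"
 have GL: "in_L2 G" unfolding G_def using ft_bandlim[OF ga] by (rule ft_L2)
 note [measurable] = in_L2_measurable'[OF GL]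
 define B where "B = (LB om. cmod (ga om))"
 have Gb: "cmod (G x) <= B" for x
  unfolding G_def invF_def B_def by (rule order_trans[OF integral_norm_bound]) (simp add: norm_mult)
 have B0: "0 <= B" by (rule order_trans[OF norm_ge_zero Gb])
 define e where "e = sqrt (enn2real (genergy ga))"
 have e0: "0 <= e" by (simp add: e_def)
 have fin_g: "genergy ga < \<infinity>" using genergy_finite[OF ga R] by (rule le_less_trans) simp
 then have ge: "genergy ga = ennreal (e^2)" by (simp add: e_def)
 define c where "c x = corner de (cell de x)" for x
 have c_off: "c x = corner de (cell de x + 0)" for x by (simp add: c_def)
 have [measurable]: "c \<in> bm" unfolding c_off[abs_def] by measurable
 define Dn where "Dn n y = G (Ph y) - G (y - ta (corner de (cell de y + n)))" for n y
 have Dm [measurable]: "Dn n \<in> bm" for n unfolding Dn_def[abs_def] by measurable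
 have Dle: "L2_norm (Dn n) <= ennreal (16 * ka * de * (1 + of_int (csize n)) * e)" for n
 proof -
  have p: "0 <= 16 * ka * de * (1 + real_of_int (csize n)) * e" using ka0 de e0 csize_nonneg[of n] by simp
  have "(L2_norm (Dn n))^2 <= ennreal (64 * (2 * ka * de * (1 + of_int (csize n)))^2) * ennreal (e^2)"
  using corner_displacement[OF ga de, of n] unfolding Dn_def G_def ge .
  also have "... = ennreal (64 * (2 * ka * de * (1 + of_int (csize n)))^2 * e^2)"
  by (rule ennreal_mult[symmetric]) simp_all
  also have "64 * (2 * ka * de * (1 + of_int (csize n)))^2 * e^2 = (16 * ka * de * (1 + of_int (csize n)) * e)^2"
  by (simp add: power_mult_distrib)
  also have "ennreal ... = (ennreal (16 * ka * de * (1 + of_int (csize n)) * e))^2" using p by (simp only: ennreal_power)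
  finally show ?thesis by (simp only: ennreal_sq_le_iff)
 qed
 have DL: "in_L2 (Dn n)" for n by (rule in_L2_of_nn[OF Dm Dle]) simp
 have off: "vnorm J (offset_conv n (Dn n)) <= ennreal (4096 * C * ka * de * e * (1 / (1 + of_int (csize n)) ^ 3))" for n
 proof -
  define N where "N = 1 + real_of_int (csize n)"
  have N: "0 < N" using csize_nonneg[of n] by (simp add: N_def)
  have "vnorm J (offset_conv n (Dn n)) <= ennreal (256 * C / N ^ 4) * ennreal (16 * ka * de * N * e)"
  using order_trans[OF offset_conv_bound[OF DL] mult_left_mono[OF Dle]] by (simp add: N_def)
  also have "... = ennreal (256 * C / N ^ 4 * (16 * ka * de * N * e))"
  using C ka0 de N e0 by (intro ennreal_mult[symmetric]) auto
  also have "256 * C / N ^ 4 * (16 * ka * de * N * e) = 4096 * C * ka * de * e * (1 / N ^ 3)"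
  using N by (simp add: power4_eq_xxxx power3_eq_cube)
  finally show ?thesis by (simp add: N_def)
 qed
 define V where "V m i x = (\<Sum>n\<in>square_cells m. offset_conv n (Dn n) i x)" for m i x
 have Vm [measurable]: "i \<in> J ==> V m i \<in> bm" for m i
  unfolding V_def[abs_def] by measurable
 have Vb: "vnorm J (V m) <= ennreal (36864 * C * ka * de * e)" for m
 proof -
  have "vnorm J (V m) <= (\<Sum>n\<in>square_cells m. vnorm J (offset_conv n (Dn n)))"
  unfolding V_def[abs_def] by (rule vnorm_sum) (auto intro!: offset_conv_measurable)
  also have "... <= (\<Sum>n\<in>square_cells m. ennreal (4096 * C * ka * de * e * (1 / (1 + of_int (csize n)) ^ 3)))"
  by (intro sum_mono off)
  also have "... = ennreal (4096 * C * ka * de * e * (\<Sum>n\<in>square_cells m. 1 / (1 + of_int (csize n)) ^ 3))"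
  using C ka0 de e0 csize_nonneg unfolding sum_distrib_left by (intro sum_ennreal) (simp add: csize_nonneg)
  also have "... <= ennreal (4096 * C * ka * de * e * 9)"
  proof (intro ennreal_leI mult_left_mono)
  have "0 <= 8 / (real m + 1)" by simp
  then show "(\<Sum>n\<in>square_cells m. 1 / (1 + real_of_int (csize n)) ^ 3) <= 9" using csize_sum[of m] by linarith
  qed (use C ka0 de e0 in simp)
  finally show ?thesis by (simp add: mult_ac)
 qed
 define W where "W i x = convolution (%y. G (Ph y)) (K i) x - convolution G (K i) (x - ta (c x))" for i x
 have Wm [measurable]: "i \<in> J ==> W i \<in> bm" for i
  unfolding W_def[abs_def] by measurable
 have lim: "(%m. V m i x) ~~> W i x" if i: "i \<in> J" for i x
 proof -
  note [measurable] = K_meas[OF i]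
  have Ki: "integrable lborel (%y. K i (x - y))" using integral_reflect_shift(2)[of "K i" x] K_int[OF i] by simp
  have bK: "integrable lborel (%y. g y * K i (x - y))" if [measurable]: "g \<in> bm" and "\<And>y. cmod (g y) <= 2 * B" for g
  proof (rule Bochner_Integration.integrable_bound)
  show "integrable lborel (%y. (2 * B) *\<^sub>R K i (x - y))" using Ki by simp
  show "AEL y. norm (g y * K i (x - y)) <= norm ((2 * B) *\<^sub>R K i (x - y))"
  using that B0 by (auto simp: norm_mult intro!: mult_right_mono)
  qed measurable
  have G2: "cmod (G a) <= 2 * B" "cmod (G a - G b) <= 2 * B" for a b
  using Gb[of a] Gb[of b] B0 norm_triangle_ineq4[of "G a" "G b"] by linarith+
  define S where "S n = {p. cell de (snd p) = cell de (fst p) - n}" for n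
  have S[measurable]: "S n \<in> sets (borel \<Otimes>\<^sub>M borel)" for n unfolding S_def by measurable
  have Sx: "(x, y) \<in> S n \<longleftrightarrow> n = cell de x - cell de y" for n y by (auto simp: S_def algebra_simps)
  have V: "V m i x = (LB y. (\<Sum>n\<in>square_cells m. indicator (S n) (x, y)) * ((G (Ph y) - G (y - ta (c x))) * K i (x - y)))" for m
  proof -
  have "V m i x = (\<Sum>n\<in>square_cells m. (LB y. indicator (S n) (x, y) * ((G (Ph y) - G (y - ta (c x))) * K i (x - y))))"
  unfolding V_def offset_conv_def S_def[symmetric]
  by (intro sum.cong refl bcong) (auto simp: Dn_def c_def Sx split: split_indicator)
  also have "... = (LB y. (\<Sum>n\<in>square_cells m. indicator (S n) (x, y) * ((G (Ph y) - G (y - ta (c x))) * K i (x - y))))"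
  proof (rule Bochner_Integration.integral_sum[symmetric])
  fix n
  have "integrable lborel (%y. (indicator (S n) (x, y) * (G (Ph y) - G (y - ta (c x)))) * K i (x - y))"
  by (rule bK) (use B0 G2 in \<open>auto split: split_indicator\<close>)
  then show "integrable lborel (%y. indicator (S n) (x, y) * ((G (Ph y) - G (y - ta (c x))) * K i (x - y)))"
  by (simp only: mult.assoc)
  qed
  finally show ?thesis by (simp only: sum_distrib_right)
  qed
  have ind: "(\<Sum>n\<in>square_cells m. indicator (S n) (x, y) :: complex) = of_bool (csize (cell de x - cell de y) <= int m)" for m y
  proof -
  have "(\<Sum>n\<in>square_cells m. indicator (S n) (x, y) :: complex) = (\<Sum>n\<in>square_cells m. if n = cell de x - cell de y then 1 else 0)"
  by (intro sum.cong refl) (simp add: indicator_def Sx)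
  then show ?thesis by (simp add: square_cells_iff)
  qed
  have "(%m. V m i x) ~~> (LB y. (G (Ph y) - G (y - ta (c x))) * K i (x - y))"
  unfolding V
  proof (rule integral_dominated_convergence[where w="%y. 2 * B * cmod (K i (x - y))"])
  show "integrable lborel (%y. 2 * B * cmod (K i (x - y)))" using Ki by simp
  show "AEL y. (%m. (\<Sum>n\<in>square_cells m. indicator (S n) (x, y)) * ((G (Ph y) - G (y - ta (c x))) * K i (x - y)))
  ~~> (G (Ph y) - G (y - ta (c x))) * K i (x - y)"
  proof (rule AE_I2, rule tendsto_eventually)
  fix y
  show "\<forall>\<^sub>F m in sequentially. (\<Sum>n\<in>square_cells m. indicator (S n) (x, y)) * ((G (Ph y) - G (y - ta (c x))) * K i (x - y))
  = (G (Ph y) - G (y - ta (c x))) * K i (x - y)"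
  using eventually_ge_at_top[of "nat (csize (cell de x - cell de y))"]
  by eventually_elim (simp add: ind nat_le_iff)
  qed
  show "AEL y. norm ((\<Sum>n\<in>square_cells m. indicator (S n) (x, y)) * ((G (Ph y) - G (y - ta (c x))) * K i (x - y)))
  <= 2 * B * cmod (K i (x - y))" for m
  using G2 B0 by (auto simp: ind norm_mult intro!: mult_right_mono)
  qed measurable
  also have "(LB y. (G (Ph y) - G (y - ta (c x))) * K i (x - y))
  = (LB y. G (Ph y) * K i (x - y)) - (LB y. G (y - ta (c x)) * K i (x - y))"
  unfolding left_diff_distrib by (intro Bochner_Integration.integral_diff bK G2) measurable
  also have "(LB y. G (y - ta (c x)) * K i (x - y)) = convolution G (K i) (x - ta (c x))"
  using integral_shift(1)[of "%y. G y * K i (x - ta (c x) - y)" "- ta (c x)"]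
  by (simp add: convolution_def algebra_simps)
  finally show ?thesis by (simp add: W_def convolution_def)
 qed
 have Wb: "vnorm J W <= ennreal (36864 * C * ka * de * e)"
 proof -
  have "(vnorm J W)^2 = (NN x. (\<Sum>i\<in>J. ennreal ((cmod (W i x))^2)))"
  unfolding vnorm_sq[OF fin] L2_norm_sq by (rule nn_integral_sum[symmetric]) measurable
  also have "... = (NN x. liminf (%m. \<Sum>i\<in>J. ennreal ((cmod (V m i x))^2)))"
  proof (rule nn_integral_cong)
  fix x
  have "(%m. \<Sum>i\<in>J. ennreal ((cmod (V m i x))^2)) ~~> (\<Sum>i\<in>J. ennreal ((cmod (W i x))^2))"
  by (intro tendsto_sum tendsto_ennrealI tendsto_power tendsto_norm lim)
  then show "(\<Sum>i\<in>J. ennreal ((cmod (W i x))^2)) = liminf (%m. \<Sum>i\<in>J. ennreal ((cmod (V m i x))^2))"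
  by (intro lim_imp_Liminf[symmetric]) simp_all
  qed
  also have "... <= liminf (%m. (NN x. (\<Sum>i\<in>J. ennreal ((cmod (V m i x))^2))))"
  by (rule nn_integral_liminf) measurable
  also have "... = liminf (%m. (vnorm J (V m))^2)"
  unfolding vnorm_sq[OF fin] L2_norm_sq by (subst nn_integral_sum) measurable
  also have "... <= liminf (%m::nat. (ennreal (36864 * C * ka * de * e))^2)"
  using Vb by (intro Liminf_mono always_eventually allI) (simp only: ennreal_sq_le_iff)
  also have "... = (ennreal (36864 * C * ka * de * e))^2" by (simp add: Liminf_const)
  finally show ?thesis by (simp only: ennreal_sq_le_iff)
 qed
 define Z where "Z i x = convolution G (K i) (Ph x) - convolution G (K i) (x - ta (c x))" for i x
 have Zm [measurable]: "i \<in> J ==> Z i \<in> bm" for i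
  unfolding Z_def[abs_def] by measurable
 have Zb: "vnorm J Z <= ennreal (16 * C * ka * de * e)"
 proof -
  define g where "g i om = fourier (K i) om * ga om" for i om
  have gi: "bandlim R (g i)" if i: "i \<in> J" for i
  proof -
  note [measurable] = K_meas[OF i]
  have "in_L2 (g i)" unfolding g_def[abs_def]
  by (rule in_L2_mult_bounded[OF bandlim_L2[OF ga]]) (auto intro!: AE_I2 fourier_bound[OF K_int[OF i]])
  then show ?thesis using ga by (simp add: bandlim_def g_def)
  qed
  have conv: "convolution G (K i) x = invF (g i) x" if i: "i \<in> J" for i x
  proof -
  note [measurable] = K_meas[OF i]
  have "convolution G (K i) x = (LB y. K i y * (LB om. cis (- (2 * pi * (y \<bullet> om))) * (cis (2 * pi * (x \<bullet> om)) * ga om)))"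
  unfolding conv_commute[of G] unfolding convolution_def G_def invF_def mult.assoc[symmetric] cis_mult
  by (simp add: algebra_simps)
  also have "... = (LB om. (LB y. K i y * cis (- (2 * pi * (y \<bullet> om)))) * (cis (2 * pi * (x \<bullet> om)) * ga om))"
  proof -
  have ig: "integrable lborel (%om. cis (2 * pi * (x \<bullet> om)) * ga om)"
  using bandlim_integrable[OF ga] by (rule Bochner_Integration.integrable_bound) (auto simp: norm_mult)
  have km: "(%p::(real^2) \<times> (real^2). cis (- (2 * pi * (fst p \<bullet> snd p)))) \<in> borel_measurable (lborel \<Otimes>\<^sub>M lborel)"
  by measurable
  show ?thesis using fubini_kernel[OF K_int[OF i] ig km, of 1] by simp
  qed
  also have "... = invF (g i) x"
  unfolding invF_def g_def fourier_def by (intro bcong refl) (simp add: mult_ac)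
  finally show ?thesis .
  qed
  have "(vnorm J Z)^2 = (\<Sum>i\<in>J. (L2_norm (%x. invF (g i) (Ph x) - invF (g i) (x - ta (corner de (cell de x + 0)))))^2)"
  unfolding vnorm_sq[OF fin] by (intro sum.cong refl) (simp add: Z_def[abs_def] conv c_def)
  also have "... <= (\<Sum>i\<in>J. ennreal (64 * (2 * ka * de)^2) * genergy (g i))"
  proof (rule sum_mono)
  fix i assume "i \<in> J"
  then show "(L2_norm (%x. invF (g i) (Ph x) - invF (g i) (x - ta (corner de (cell de x + 0)))))^2 <= ennreal (64 * (2 * ka * de)^2) * genergy (g i)"
  using corner_displacement[OF gi de, of i 0] by (simp add: csize_def)
  qed
  also have "... = ennreal (64 * (2 * ka * de)^2) * (\<Sum>i\<in>J. genergy (g i))" by (simp add: sum_distrib_left)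
  also have "(\<Sum>i\<in>J. genergy (g i)) <= ennreal (C^2) * genergy ga"
  proof -
  have "(\<Sum>i\<in>J. genergy (g i)) = (NN om. (\<Sum>i\<in>J. ennreal ((2 * pi * norm om)^2 * (cmod (g i om))^2)))"
  unfolding genergy_def by (rule nn_integral_sum[symmetric]) (use gi in measurable)
  also have "... <= (NN om. ennreal (C^2) * ennreal ((2 * pi * norm om)^2 * (cmod (ga om))^2))"
  proof (rule nn_integral_mono_AE)
  show "AEL om. (\<Sum>i\<in>J. ennreal ((2 * pi * norm om)^2 * (cmod (g i om))^2)) <= ennreal (C^2) * ennreal ((2 * pi * norm om)^2 * (cmod (ga om))^2)"
  using symbol_bound
  proof eventually_elim
  fix om :: "real^2" assume *: "(\<Sum>i\<in>J. (cmod (fourier (K i) om))^2) <= C^2"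
  have "(\<Sum>i\<in>J. (2 * pi * norm om)^2 * (cmod (g i om))^2) = (\<Sum>i\<in>J. (cmod (fourier (K i) om))^2) * ((2 * pi * norm om)^2 * (cmod (ga om))^2)"
  unfolding sum_distrib_right by (simp add: g_def norm_mult power_mult_distrib mult_ac)
  also have "... <= C^2 * ((2 * pi * norm om)^2 * (cmod (ga om))^2)" using * by (rule mult_right_mono) simp
  finally have "(\<Sum>i\<in>J. (2 * pi * norm om)^2 * (cmod (g i om))^2) <= C^2 * ((2 * pi * norm om)^2 * (cmod (ga om))^2)" .
  then have "ennreal (\<Sum>i\<in>J. (2 * pi * norm om)^2 * (cmod (g i om))^2) <= ennreal (C^2 * ((2 * pi * norm om)^2 * (cmod (ga om))^2))"
  by (rule ennreal_leI)
  then show "(\<Sum>i\<in>J. ennreal ((2 * pi * norm om)^2 * (cmod (g i om))^2)) <= ennreal (C^2) * ennreal ((2 * pi * norm om)^2 * (cmod (ga om))^2)"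
  by (subst sum_ennreal) (simp_all add: ennreal_mult)
  qed
  qed
  also have "... = ennreal (C^2) * genergy ga" unfolding genergy_def by (rule nn_integral_cmult) measurable
  finally show ?thesis .
  qed
  also have "ennreal (64 * (2 * ka * de)^2) * (ennreal (C^2) * genergy ga) = ennreal (64 * (2 * ka * de)^2 * (C^2 * e^2))"
  unfolding ge by (simp only: ennreal_mult zero_le_power2 mult_nonneg_nonneg zero_le_numeral)
  also have "64 * (2 * ka * de)^2 * (C^2 * e^2) = (16 * C * ka * de * e)^2" by (simp add: power_mult_distrib)
  also have "ennreal ... = (ennreal (16 * C * ka * de * e))^2" using C ka0 de e0 by (simp add: ennreal_power)
  finally show ?thesis by (simp add: mult_left_mono ennreal_sq_le_iff)
 qed
 have "vnorm J (%i x. convolution (%y. G (Ph y)) (K i) x - convolution G (K i) (Ph x)) = vnorm J (%i x. W i x + - Z i x)"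
  by (simp add: W_def Z_def)
 also have "... <= vnorm J W + vnorm J (%i x. - Z i x)" by (rule vnorm_triangle) measurable
 also have "vnorm J (%i x. - Z i x) = vnorm J Z" by (simp add: vnorm_def L2_norm_def)
 also have "vnorm J W + vnorm J Z <= ennreal (36864 * C * ka * de * e) + ennreal (16 * C * ka * de * e)"
  by (intro add_mono Wb Zb)
 also have "... = ennreal (36864 * C * ka * de * e + 16 * C * ka * de * e)" using C ka0 de e0 by (intro ennreal_plus[symmetric]) auto
 also have "... <= ennreal (40000 * C * ka * de * e)"
  using C ka0 de e0 mult_nonneg_nonneg[of "C * ka * de" e] by (intro ennreal_leI) (simp add: mult_ac)
 finally have "(vnorm J (%i x. convolution (%y. G (Ph y)) (K i) x - convolution G (K i) (Ph x)))^2 <= (ennreal (40000 * C * ka * de * e))^2"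
  by (simp only: ennreal_sq_le_iff)
 also have "... = ennreal ((40000 * C * ka * de)^2 * e^2)" using C ka0 de e0 by (simp add: ennreal_power power_mult_distrib)
 also have "... = ennreal ((40000 * C * ka * de)^2) * genergy ga" unfolding ge by (rule ennreal_mult) simp_all
 finally show ?thesis by (simp add: G_def)
qed

end

section \<open>Moments of the filters\<close>

lemma difference_quotient_limit:
 fixes f :: "real => complex"
 assumes "(f has_vector_derivative p) (at 0)"
 shows "(%n. (f (1 / real (Suc n)) - f 0) / of_real (1 / real (Suc n))) ~~> p"
proof -
 let ?h = "%n. 1 / real (Suc n)"
 have "(%h. norm (f (0 + h) - f 0 - h *\<^sub>R p) / norm h) \<midarrow>0\<rightarrow> 0" (is "?X \<midarrow>0\<rightarrow> 0")
  using assms unfolding has_vector_derivative_def has_derivative_at by blast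
 from LIMSEQ_SEQ_conv[THEN iffD2, OF this, rule_format, of ?h]
 have X: "?h ~~> 0 ==> (%n. norm (f (0 + ?h n) - f 0 - ?h n *\<^sub>R p) / norm (?h n)) ~~> 0" by auto
 have "?h ~~> 0" using LIMSEQ_inverse_real_of_nat by (simp add: inverse_eq_divide)
 note lim = X[OF this]
 have eq: "norm (f (0 + ?h n) - f 0 - ?h n *\<^sub>R p) / norm (?h n) = norm ((f (?h n) - f 0) / of_real (?h n) - p)" for n
 proof -
  have g: "a / of_real h - p = (a - h *\<^sub>R p) / of_real h" if "h \<noteq> 0" for a and h :: real
  using that by (simp add: scaleR_conv_of_real diff_divide_distrib)
  have hn: "?h n \<noteq> 0" by simp
  show ?thesis by (simp only: g[OF hn] norm_divide norm_of_real real_norm_def add_0)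
 qed
 have "(%n. norm ((f (?h n) - f 0) / of_real (?h n) - p)) ~~> 0"
  by (rule back_subst[where P="%X. X ~~> 0", OF lim]) (intro ext eq)
 then show ?thesis by (rule LIM_zero_cancel[OF tendsto_norm_zero_cancel])
qed

lemma vector_derivative_mean_value:
 fixes f :: "real => complex"
 assumes d: "\<And>t. (f has_vector_derivative p t) (at t)" and b: "\<And>t. cmod (p t) <= B"
 shows "cmod (f t - f 0) <= B * \<bar>t\<bar>"
proof -
 have "norm (f t - f 0) <= B * norm (t - 0)"
 proof (rule differentiable_bound[OF convex_UNIV])
  fix x
  show "(f has_derivative (%h. h *\<^sub>R p x)) (at x within UNIV)" using d[of x] by (simp add: has_vector_derivative_def)
  have "0 <= B" by (rule order_trans[OF norm_ge_zero b])
  then show "onorm (%h. h *\<^sub>R p x) <= B"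
  by (rule onorm_bound) (use b in \<open>auto simp: mult.commute[of B] intro!: mult_left_mono\<close>)
 qed auto
 then show ?thesis by simp
qed

lemma has_partial_derivative:
 assumes "\<And>om. m differentiable (at om)"
 shows "((%t. m (om + t *\<^sub>R axis k 1)) has_vector_derivative partial_deriv k m (om + t *\<^sub>R axis k 1)) (at t)"
proof -
 let ?F = "frechet_derivative m (at (om + t *\<^sub>R axis k 1))"
 have F: "(m has_derivative ?F) (at (om + t *\<^sub>R axis k 1))" using assms by (simp add: frechet_derivative_works)
 have "((%t. om + t *\<^sub>R axis k 1) has_derivative (%h. h *\<^sub>R axis k 1)) (at t)"
  by (auto intro!: derivative_eq_intros)
 from has_derivative_compose[OF this F]
 have "((%t. m (om + t *\<^sub>R axis k 1)) has_derivative (%h. ?F (h *\<^sub>R axis k 1))) (at t)" .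
 moreover have "?F (h *\<^sub>R axis k 1) = h *\<^sub>R partial_deriv k m (om + t *\<^sub>R axis k 1)" for h
  unfolding partial_deriv_def by (rule linear_scale[OF has_derivative_linear[OF F]])
 ultimately show ?thesis by (simp add: has_vector_derivative_def)
qed

lemma partial_deriv_outside:
 assumes "\<And>om. R < norm om ==> m om = (0 :: complex)" "R < norm om"
 shows "partial_deriv k m om = 0"
proof -
 have "open {om :: real^2. R < norm om}" by (intro open_Collect_less continuous_intros)
 then have "(m has_derivative (%_. 0)) (at om)"
 proof (rule has_derivative_transform_within_open[OF has_derivative_const])
  show "om \<in> {om. R < norm om}" using assms(2) by simp
  show "0 = m x" if "x \<in> {om. R < norm om}" for x using assms(1)[of x] that by simp
 qed
 then show ?thesis unfolding partial_deriv_def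
  by (rule fun_cong[OF frechet_derivative_at, symmetric])
qed

lemma ft_modulate:
 assumes "ft f g"
 shows "ft (%x. cis (- (2 * pi * (x \<bullet> z))) * f x) (%om. g (om + z))"
proof -
 have f: "in_L2 f" and g: "in_L2 g" using assms by (rule ft_L2)+
 note [measurable] = in_L2_measurable'[OF f] in_L2_measurable'[OF g]
 have e: "cis (- (2 * pi * (x \<bullet> (om + z)))) = cis (- (2 * pi * (x \<bullet> om))) * cis (- (2 * pi * (x \<bullet> z)))" for x om
  by (simp add: cis_mult inner_add_right distrib_left)
 have "in_L2 (%x. cis (- (2 * pi * (x \<bullet> z))) * f x)"
  by (rule in_L2_mult_bounded[OF f, of _ 1]) auto
 moreover have "fourier (trunc n (%x. cis (- (2 * pi * (x \<bullet> z))) * f x)) om = fourier (trunc n f) (om + z)" for n om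
  unfolding fourier_def trunc_def
  by (intro bcong refl) (subst e, simp only: mult_ac)
 moreover have "L2_norm (%om. g (om + z) - fourier (trunc n f) (om + z)) = L2_norm (%om. g om - fourier (trunc n f) om)" for n
  by (rule L2_norm_shift[of "%om. g om - fourier (trunc n f) om"]) (simp add: trunc_def)
 ultimately show ?thesis using assms in_L2_shift[OF g] by (simp add: ft_def)
qed

text \<open>Differentiating the symbol multiplies the function by a coordinate: the difference quotients of
 the symbol converge in the mean, so their inverse transforms do, and Fatou's lemma
 identifies the limit.\<close>

lemma ft_moment:
 assumes fm: "ft \<psi> m" and d: "\<And>om. m differentiable (at om)" and b: "\<And>om. cmod (partial_deriv k m om) <= B"
  and supp: "\<And>om. R < norm om ==> m om = 0"
 shows "ft (%x. of_real (x $ k) * \<psi> x) (%om. \<i> / of_real (2 * pi) * partial_deriv k m om)"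
proof -
 note [measurable] = ft_meas[OF fm]
 define h where "h n = 1 / real (Suc n)" for n
 have h: "0 < h n" "h n <= 1" for n by (simp_all add: h_def)
 have B0: "0 <= B" by (rule order_trans[OF norm_ge_zero b])
 define c where "c = \<i> / of_real (2 * pi)"
 have c1: "cmod c <= 1" using pi_gt3 by (simp add: c_def norm_divide)
 define Q where "Q n om = (m (om + h n *\<^sub>R axis k 1) - m om) / of_real (h n)" for n om
 define q where "q n x = (cis (- (2 * pi * (x \<bullet> (h n *\<^sub>R axis k 1)))) - 1) / of_real (h n) * \<psi> x" for n x
 have ax: "x \<bullet> axis k 1 = x $ k" for x :: "real^2" by (simp add: inner_axis)
 have Qlim: "(%n. Q n om) ~~> partial_deriv k m om" for om
  using difference_quotient_limit[OF has_partial_derivative[OF d, of om k 0, simplified]] by (simp add: Q_def h_def)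
 have [measurable]: "partial_deriv k m \<in> bm"
  by (rule borel_measurable_LIMSEQ_metric[OF _ Qlim]) (simp add: Q_def)
 have Qb: "cmod (Q n om) <= B" for n om
 proof -
  have "cmod (m (om + h n *\<^sub>R axis k 1) - m (om + 0 *\<^sub>R axis k 1)) <= B * \<bar>h n\<bar>"
  by (rule vector_derivative_mean_value[OF has_partial_derivative[OF d] b])
  then show ?thesis using h[of n] by (simp add: Q_def norm_divide pos_divide_le_eq)
 qed
 have Qz: "Q n om = 0" if "R + 1 < norm om" for n om
 proof -
  have "norm om <= norm (om + h n *\<^sub>R axis k 1) + norm (h n *\<^sub>R axis k (1::real) :: real^2)"
  using norm_triangle_ineq4[of "om + h n *\<^sub>R axis k 1" "h n *\<^sub>R axis k 1"] by simp
  also have "norm (h n *\<^sub>R axis k (1::real) :: real^2) <= 1" using h[of n] by (simp add: norm_axis_1)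
  finally show ?thesis using that supp by (simp add: Q_def)
 qed
 have Dz: "partial_deriv k m om = 0" if "R < norm om" for om
  by (rule partial_deriv_outside[OF _ that]) (rule supp)
 define w where "w om = of_real (2 * B) * (indicator (cball 0 (R + 1)) om :: complex)" for om :: "real^2"
 have "emeasure lborel (cball (0::real^2) (R + 1)) < \<infinity>" by (rule emeasure_bounded_finite) simp
 then have w: "in_L2 w" unfolding w_def[abs_def] by (intro in_L2_cmult in_L2_indicator) simp_all
 have ftq: "ft (q n) (Q n)" for n
 proof -
  have "ft (%x. 1 / of_real (h n) * (cis (- (2 * pi * (x \<bullet> (h n *\<^sub>R axis k 1)))) * \<psi> x - \<psi> x)) (%om. 1 / of_real (h n) * (m (om + h n *\<^sub>R axis k 1) - m om))"
  by (intro ft_cmult ft_diff ft_modulate fm)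
  then show ?thesis by (simp add: q_def[abs_def] Q_def[abs_def] diff_divide_distrib left_diff_distrib)
 qed
 have Q2: "(%n. L2_norm (%om. Q n om - partial_deriv k m om)) ~~> 0"
 proof (rule L2_dominated[OF _ _ w])
  show "AEL om. cmod (Q n om - partial_deriv k m om) <= cmod (w om)" for n
  proof (rule AE_I2)
  fix om
  show "cmod (Q n om - partial_deriv k m om) <= cmod (w om)"
  proof (cases "norm om <= R + 1")
  case True
  then show ?thesis using norm_triangle_ineq4[of "Q n om" "partial_deriv k m om"] Qb[of n om] b[of om] B0
  by (simp add: w_def norm_mult)
  next
  case False
  then show ?thesis using Qz Dz by simp
  qed
  qed
 qed (use Qlim in \<open>simp_all add: Q_def\<close>)
 have Dw: "L2_norm (Q n) <= L2_norm w" for n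
 proof (rule L2_norm_mono)
  fix om :: "real^2" show "cmod (Q n om) <= cmod (w om)"
  using Qb[of n om] Qz[of om n] B0 by (cases "norm om <= R + 1") (simp_all add: w_def norm_mult)
 qed
 have D2: "in_L2 (partial_deriv k m)"
 proof (rule in_L2_bound(1)[OF w, of _ 1])
  show "AEL om. cmod (partial_deriv k m om) <= 1 * cmod (w om)"
  proof (rule AE_I2)
  fix om :: "real^2" show "cmod (partial_deriv k m om) <= 1 * cmod (w om)"
  using b[of om] B0 Dz[of om] by (cases "norm om <= R + 1") (simp_all add: w_def norm_mult)
  qed
 qed simp_all
 define p where "p x = - (2 * pi * x $ k)" for x :: "real^2"
 have cd: "((%t. cis (t * a)) has_vector_derivative \<i> * of_real a * cis (t * a)) (at t)" for a t :: real
 proof -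
  have "((%z. exp (\<i> * (z * of_real a))) has_field_derivative (\<i> * of_real a * exp (\<i> * (of_real t * of_real a)))) (at (cor t))"
  by (auto intro!: derivative_eq_intros)
  from has_vector_derivative_real_field[OF this] show ?thesis by (simp only: cis_conv_exp of_real_mult)
 qed
 have q: "q n x = (cis (h n * p x) - cis (0 * p x)) / of_real (h n) * \<psi> x" for n x
  by (simp add: q_def p_def ax mult_ac)
 have qlim: "(%n. q n x) ~~> (\<i> * of_real (p x)) * \<psi> x" for x
  unfolding q using difference_quotient_limit[OF cd[of "p x" 0]] by (intro tendsto_mult_right) (simp add: h_def)
 have qb: "cmod (q n x) <= cmod ((\<i> * of_real (p x)) * \<psi> x)" for n x
 proof -
  have "cmod (cis (h n * p x) - cis (0 * p x)) <= \<bar>p x\<bar> * \<bar>h n\<bar>"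
  by (rule vector_derivative_mean_value[OF cd]) (simp add: norm_mult)
  then have "cmod ((cis (h n * p x) - cis (0 * p x)) / of_real (h n)) <= \<bar>p x\<bar>"
  using h[of n] by (simp add: norm_divide pos_divide_le_eq)
  then show ?thesis unfolding q norm_mult[of _ "\<psi> x"] by (intro mult_right_mono) (simp_all add: norm_mult)
 qed
 let ?f = "%x. (\<i> * of_real (p x)) * \<psi> x"
 have [measurable]: "?f \<in> bm" "\<And>n. q n \<in> bm"
  using ft_meas[OF ftq] by (auto simp: p_def[abs_def])
 have "L2_norm ?f <= L2_norm w"
 proof (rule L2_fatou[where f=q])
  show "\<forall>\<^sub>F n in sequentially. L2_norm (q n) <= L2_norm w"
  using Dw ft_isometry[OF ftq] by (simp add: always_eventually)
 qed (use qlim in auto)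
 then have f2: "in_L2 ?f" using w by (intro in_L2_of_nn[of _ "L2_norm w"]) (auto simp: in_L2_def)
 have "(%n. L2_norm (%x. q n x - ?f x)) ~~> 0"
 proof (rule L2_dominated[OF _ _ in_L2_cmult[OF f2, of 2]])
  show "AEL x. cmod (q n x - ?f x) <= cmod (2 * ?f x)" for n
  proof (rule AE_I2)
  fix x show "cmod (q n x - ?f x) <= cmod (2 * ?f x)"
  using norm_triangle_ineq4[of "q n x" "?f x"] qb[of n x] unfolding norm_mult[of 2] by simp
  qed
 qed (use qlim in auto)
 then have "ft ?f (partial_deriv k m)" by (rule ft_lim[OF ftq f2 D2 _ Q2])
 from ft_cmult[OF this, of c] show ?thesis
  by (simp add: c_def p_def mult.assoc[symmetric])
qed

lemma ft_iterated_moment: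
 assumes fm: "ft \<psi> m" and d: "times_differentiable n m"
  and b: "\<And>r. 1 <= r ==> r <= n ==> \<exists>B. \<forall>om. cmod ((partial_deriv k ^^ r) m om) <= B"
  and supp: "\<And>om. R < norm om ==> m om = 0" and r: "r <= n"
 shows "ft (%x. of_real (x $ k) ^ r * \<psi> x) (%om. (\<i> / of_real (2 * pi)) ^ r * (partial_deriv k ^^ r) m om)"
 using r
proof (induction r)
 case 0
 then show ?case using fm by simp
next
 case (Suc r)
 let ?c = "(\<i> / of_real (2 * pi)) ^ r" and ?m = "(partial_deriv k ^^ r) m"
 have z: "?m om = 0" if "R < norm om" for om
  using that by (induction r arbitrary: om) (auto simp: supp intro!: partial_deriv_outside[of R])
 have dm: "?m differentiable (at om)" for om
 proof -
  have "fold partial_deriv (replicate r k) m differentiable (at om)"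
  using d Suc.prems unfolding times_differentiable_def by (metis length_replicate Suc_le_lessD)
  then show ?thesis by (simp only: fold_replicate)
 qed
 obtain B where B: "\<And>om. cmod ((partial_deriv k ^^ Suc r) m om) <= B" using b[of "Suc r"] Suc.prems by auto
 have pd: "partial_deriv k (%om. ?c * ?m om) om = ?c * (partial_deriv k ^^ Suc r) m om" for om
 proof -
  have "((%om. ?c * ?m om) has_derivative (%v. ?c * frechet_derivative ?m (at om) v)) (at om)"
  using dm by (intro has_derivative_mult_right) (simp add: frechet_derivative_works)
  then show ?thesis unfolding partial_deriv_def by (simp add: frechet_derivative_at[symmetric] partial_deriv_def)
 qed
 have "ft (%x. of_real (x $ k) * (of_real (x $ k) ^ r * \<psi> x)) (%om. \<i> / of_real (2 * pi) * partial_deriv k (%om. ?c * ?m om) om)"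
 proof (rule ft_moment[where B="cmod ?c * B" and R=R])
  show "ft (%x. of_real (x $ k) ^ r * \<psi> x) (%om. ?c * ?m om)" using Suc by simp
  show "(%om. ?c * ?m om) differentiable (at om)" for om using dm by (intro differentiable_mult) auto
  show "cmod (partial_deriv k (%om. ?c * ?m om) om) <= cmod ?c * B" for om
  unfolding pd norm_mult by (intro mult_left_mono B) simp
 qed (use z in simp)
 then show ?case unfolding pd by (simp add: mult.assoc)
qed

subsection \<open>The filters of one level\<close>

lemma Q_set_bounded:
 assumes \<alpha>: "0 <= \<beta>" "\<beta> <= \<alpha>" "\<alpha> <= 1" and \<epsilon>: "0 < \<epsilon>" "\<epsilon> < 1 / 32"
  and i: "i \<in> I_level \<alpha> \<beta> j" and om: "om \<in> Q_set \<alpha> \<beta> \<epsilon> i"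
 shows "norm om < 8 * 2 ^ j"
proof -
 obtain m l where im: "i = (j, m, l)" "m <= m_max \<alpha> j" using i by (auto simp: I_level_def I_star_def)
 define a where "a = 2 powr (\<alpha> * j)"
 define b where "b = 2 powr (\<beta> * j)"
 define t where "t = (2::real) ^ j"
 have t: "t = 2 powr (real j)" by (simp add: t_def powr_realpow)
 have "\<alpha> * j <= 1 * real j" "\<beta> * j <= 1 * real j" using \<alpha> by (intro mult_right_mono; simp)+
 then have ab: "0 < a" "a <= t" "0 < b" "b <= t" by (simp_all add: a_def b_def t)
 obtain x where x: "x \<in> Q_ref \<epsilon>" and omx: "om = rotation (angle \<beta> j l) *v (A_mat \<alpha> \<beta> j *v x + c_vec \<alpha> j m)"
  using om im by auto
 define y where "y = A_mat \<alpha> \<beta> j *v x + c_vec \<alpha> j m"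
 have y: "y $ 1 = a * x $ 1 + (t / 2 + m * a)" "y $ 2 = b * x $ 2"
  by (simp_all add: y_def A_mat_def c_vec_def matrix_vector_mult_def sum_2 a_def b_def t powr_diff)
 have "norm (rotation \<theta> *v y) = norm y" for \<theta>
 proof (rule power2_eq_imp_eq)
  have "(cos \<theta> * y $ 1 - sin \<theta> * y $ 2)^2 + (sin \<theta> * y $ 1 + cos \<theta> * y $ 2)^2 = ((sin \<theta>)^2 + (cos \<theta>)^2) * ((y $ 1)^2 + (y $ 2)^2)"
  by algebra
  then show "(norm (rotation \<theta> *v y))^2 = (norm y)^2"
  by (simp add: norm_sq_2 rotation_def matrix_vector_mult_def sum_2)
 qed auto
 then have n: "norm om <= \<bar>y $ 1\<bar> + \<bar>y $ 2\<bar>" using norm_le_l1_cart[of y] by (simp add: omx y_def sum_2)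
 have "real m <= 2 powr ((1 - \<alpha>) * j - 1) + 1"
 proof -
  have "-1 < 2 powr ((1 - \<alpha>) * j - 1)" using powr_ge_zero[of 2 "(1 - \<alpha>) * j - 1"] by linarith
  then have c0: "0 <= \<lceil>2 powr ((1 - \<alpha>) * j - 1)\<rceil>" by (simp add: le_ceiling_iff)
  have "real m <= real (nat \<lceil>2 powr ((1 - \<alpha>) * j - 1)\<rceil>)" using im(2) unfolding m_max_def by (rule of_nat_mono)
  also have "... = of_int \<lceil>2 powr ((1 - \<alpha>) * j - 1)\<rceil>" using c0 by (rule of_nat_nat)
  also have "... <= 2 powr ((1 - \<alpha>) * j - 1) + 1" by (rule of_int_ceiling_le_add_one)
  finally show ?thesis .
 qed
 then have "m * a <= (2 powr ((1 - \<alpha>) * j - 1) + 1) * a" using ab by (intro mult_right_mono) auto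
 also have "2 powr ((1 - \<alpha>) * j - 1) = t / 2 / a" by (simp add: a_def t powr_diff left_diff_distrib)
 finally have m: "m * a <= t / 2 + a" using ab by (simp add: distrib_right)
 have x12: "\<bar>x $ 1\<bar> <= 2" "\<bar>x $ 2\<bar> <= 2" using x \<epsilon> by (auto simp: Q_ref_def)
 have "\<bar>y $ 1\<bar> <= \<bar>a * x $ 1\<bar> + \<bar>t / 2 + m * a\<bar>" unfolding y by (rule abs_triangle_ineq)
 also have "... <= a * 2 + (t + a)" using x12(1) ab m by (intro add_mono) (auto simp: abs_mult t_def)
 also have "... <= 4 * t" using ab by linarith
 finally have "\<bar>y $ 1\<bar> <= 4 * t" .
 moreover have "\<bar>y $ 2\<bar> <= t * 2" unfolding y abs_mult using x12(2) ab by (intro mult_mono) auto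
 ultimately show ?thesis using n ab by (simp add: t_def)
qed

lemma finite_I_level [simp]: "finite (I_level \<alpha> \<beta> j)"
 by (rule finite_subset[of _ "{j} \<times> {..m_max \<alpha> j} \<times> {..l_max \<beta> j}"]) (auto simp: I_level_def I_star_def)

text \<open>Sums over index sets are computed as integrals for the counting measure, where monotone convergence
  and the interchange with Lebesgue integrals are at hand.\<close>

lemma infsum_count_space:
 fixes f :: "'a :: countable => ennreal"
 shows "(\<Sum>\<^sub>\<infinity>i\<in>A. f i) = (\<integral>\<^sup>+ i. f i \<partial>count_space A)"
proof (rule antisym)
 have fin: "sum f F <= (\<integral>\<^sup>+ i. f i \<partial>count_space A)" if "finite F" "F \<subseteq> A" for F
 proof -
  have "sum f F = (\<integral>\<^sup>+ i. f i * indicator F i \<partial>count_space UNIV)"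
  using that(1) by (simp add: nn_integral_count_space_indicator[symmetric] nn_integral_count_space_finite)
  also have "... <= (\<integral>\<^sup>+ i. f i * indicator A i \<partial>count_space UNIV)"
  using that(2) by (intro nn_integral_mono) (auto split: split_indicator)
  also have "... = (\<integral>\<^sup>+ i. f i \<partial>count_space A)" by (simp add: nn_integral_count_space_indicator[symmetric])
  finally show ?thesis .
 qed
 have S: "(\<Sum>\<^sub>\<infinity>i\<in>A. f i) = Sup (sum f ` {F. finite F \<and> F \<subseteq> A})" by (rule nonneg_infsum_complete) simp
 show "(\<Sum>\<^sub>\<infinity>i\<in>A. f i) <= (\<integral>\<^sup>+ i. f i \<partial>count_space A)" unfolding S by (rule Sup_least) (auto intro: fin)
 define F where "F n = {i\<in>A. to_nat i < n}" for n
 have Ff: "finite (F n)" for n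
  by (rule finite_subset[OF _ finite_vimageI[of "{..<n}" to_nat]]) (auto simp: F_def inj_to_nat)
 have "(%n. \<integral>\<^sup>+ i. f i * indicator (F n) i \<partial>count_space UNIV) ~~> (\<integral>\<^sup>+ i. f i * indicator A i \<partial>count_space UNIV)"
 proof (rule nn_integral_LIMSEQ)
  show "incseq (%n i. f i * indicator (F n) i)" by (auto simp: incseq_def le_fun_def F_def split: split_indicator)
  show "(%n. f i * indicator (F n) i) ~~> f i * indicator A i" for i
  by (rule tendsto_eventually) (use eventually_gt_at_top[of "to_nat i"] in eventually_elim, auto simp: F_def indicator_def)
 qed auto
 then have "(%n. sum f (F n)) ~~> (\<integral>\<^sup>+ i. f i \<partial>count_space A)"
  using Ff by (simp add: nn_integral_count_space_indicator[symmetric] nn_integral_count_space_finite)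
 moreover have "sum f (F n) <= (\<Sum>\<^sub>\<infinity>i\<in>A. f i)" for n
  unfolding S by (rule Sup_upper) (use Ff in \<open>auto simp: F_def\<close>)
 ultimately show "(\<integral>\<^sup>+ i. f i \<partial>count_space A) <= (\<Sum>\<^sub>\<infinity>i\<in>A. f i)" by (intro LIMSEQ_le_const2) auto
qed

locale filter_bank =
 fixes \<alpha> \<beta> \<epsilon> :: real and chi :: "real^2 => complex" and \<psi> :: "nat \<times> nat \<times> nat => real^2 => complex"
 assumes \<beta>0: "0 <= \<beta>" and \<beta>\<alpha>: "\<beta> <= \<alpha>" and \<alpha>1: "\<alpha> <= 1" and \<beta>1: "\<beta> < 1" and \<epsilon>: "0 < \<epsilon>" "\<epsilon> < 1 / 32"
  and bank: "wave_packet_bank \<alpha> \<beta> \<epsilon> chi \<psi>" and regular: "multiplier_regularity \<alpha> \<beta> \<psi>"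
begin

abbreviation "I \<equiv> I_star \<alpha> \<beta>"
abbreviation "J \<equiv> I_level \<alpha> \<beta>"

lemma J_I: "i \<in> J j ==> i \<in> I" by (simp add: I_level_def)

lemma \<psi>_int: "i \<in> I ==> integrable lborel (\<psi> i)" and \<psi>_L2: "i \<in> I ==> in_L2 (\<psi> i)"
 and chi_int: "integrable lborel chi" and chi_L2: "in_L2 chi"
 using bank by (auto simp: wave_packet_bank_def)

lemma partition: "AEL om. ennreal ((cmod (fourier chi om))^2) + (\<integral>\<^sup>+ i. ennreal ((cmod (fourier (\<psi> i) om))^2) \<partial>count_space I) = 1"
 using bank by (simp add: wave_packet_bank_def infsum_count_space)

lemma partition_finite:
 assumes F: "finite F" "F \<subseteq> I"
 shows "AEL om. (\<Sum>i\<in>F. (cmod (fourier (\<psi> i) om))^2) <= 1"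
 using partition
proof eventually_elim
 fix om assume p: "ennreal ((cmod (fourier chi om))^2) + (\<integral>\<^sup>+ i. ennreal ((cmod (fourier (\<psi> i) om))^2) \<partial>count_space I) = 1"
 have "ennreal (\<Sum>i\<in>F. (cmod (fourier (\<psi> i) om))^2) = (\<Sum>\<^sub>\<infinity>i\<in>F. ennreal ((cmod (fourier (\<psi> i) om))^2))" using F by simp
 also have "... <= (\<Sum>\<^sub>\<infinity>i\<in>I. ennreal ((cmod (fourier (\<psi> i) om))^2))"
  by (rule infsum_mono_neutral) (use F in \<open>auto intro!: nonneg_summable_on_complete\<close>)
 also have "... <= 1" unfolding infsum_count_space p[symmetric] by simp
 finally show "(\<Sum>i\<in>F. (cmod (fourier (\<psi> i) om))^2) <= 1" by simp
qed

lemma \<psi>_supp: assumes "i \<in> J j" "8 * 2 ^ j <= norm om" shows "fourier (\<psi> i) om = 0"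
proof (rule ccontr)
 assume "fourier (\<psi> i) om \<noteq> 0"
 then have "om \<in> {om. fourier (\<psi> i) om \<noteq> 0}" by simp
 then have "om \<in> closure {om. fourier (\<psi> i) om \<noteq> 0}" by (rule closure_subset[THEN subsetD])
 then have "om \<in> Q_set \<alpha> \<beta> \<epsilon> i" using bank J_I[OF assms(1)] unfolding wave_packet_bank_def by blast
 then show False using Q_set_bounded[OF \<beta>0 \<beta>\<alpha> \<alpha>1 \<epsilon> assms(1)] assms(2) by force
qed

definition deriv_bound :: "nat => 2 => nat => real => bool" where
 "deriv_bound j k r c \<longleftrightarrow> (\<forall>om. (\<Sum>i\<in>J j. (cmod ((partial_deriv k ^^ r) (fourier (\<psi> i)) om))^2) <= (c * 2 powr (- \<beta> * j * r))^2)"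

lemma deriv_bound_mono: "deriv_bound j k r c ==> 0 <= c ==> c <= c' ==> deriv_bound j k r c'"
 unfolding deriv_bound_def by (meson mult_nonneg_nonneg mult_right_mono order_trans power_mono powr_ge_zero)

text \<open>Above the regularity index this is the uniform hypothesis; the finitely many levels below it have
  finitely many bounded symbols and only enlarge the constant.\<close>

lemma deriv_bound_uniform:
 assumes r: "1 <= r" "r <= 4"
 shows "\<exists>c\<ge>0. \<forall>j\<ge>1. deriv_bound j k r c"
proof -
 define \<nu> where "\<nu> = (if k = 1 then (r, 0) else (0, r))"
 have \<nu>: "multi_deriv \<nu> f = (partial_deriv k ^^ r) f" for f :: "real^2 => complex"
  using exhaust_2[of k] by (auto simp: \<nu>_def multi_deriv_def)
 have \<nu>r: "fst \<nu> + snd \<nu> = r" by (simp add: \<nu>_def)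
 obtain jr where 1: "\<forall>i\<in>(\<Union>j\<in>{1..<jr}. J j). compact (closure {om. fourier (\<psi> i) om \<noteq> 0}) \<and>
  (\<forall>\<nu>. fst \<nu> + snd \<nu> <= 4 --> bounded (range (multi_deriv \<nu> (fourier (\<psi> i)))))"
  and 2: "\<forall>\<nu>. 1 <= fst \<nu> + snd \<nu> \<and> fst \<nu> + snd \<nu> <= 4 --> (SUP j\<in>{jr..}. SUP om. ennreal (2 powr (\<beta> * j * (fst \<nu> + snd \<nu>)) *
  sqrt (\<Sum>i\<in>J j. (cmod (multi_deriv \<nu> (fourier (\<psi> i)) om))^2))) < \<infinity>"
  using regular unfolding multiplier_regularity_def by blast
 have jr: "bounded (range (multi_deriv \<nu> (fourier (\<psi> i))))" if "1 <= j" "j < jr" "i \<in> J j" for i j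
 proof -
  have "i \<in> (\<Union>j\<in>{1..<jr}. J j)" using that by auto
  from bspec[OF 1 this] show ?thesis using \<nu>r r by blast
 qed
 have sup: "(SUP j\<in>{jr..}. SUP om. ennreal (2 powr (\<beta> * j * r) * sqrt (\<Sum>i\<in>J j. (cmod (multi_deriv \<nu> (fourier (\<psi> i)) om))^2))) < \<infinity>"
 proof -
  have "fst (case \<nu> of (x, y) => (real x, y)) + snd (case \<nu> of (x, y) => (x, real y)) = real r"
  using \<nu>r by (cases \<nu>) auto
  then show ?thesis using 2[THEN spec, of \<nu>] r \<nu>r by simp
 qed
 obtain s where s: "0 <= s" "(SUP j\<in>{jr..}. SUP om. ennreal (2 powr (\<beta> * j * r) * sqrt (\<Sum>i\<in>J j. (cmod (multi_deriv \<nu> (fourier (\<psi> i)) om))^2))) = ennreal s"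
 proof -
  have "\<exists>s\<ge>0. x = ennreal s" if "x < \<infinity>" for x :: ennreal using that by (cases x) auto
  from this[OF sup] that show ?thesis by blast
 qed
 have high: "deriv_bound j k r s" if "jr <= j" for j
  unfolding deriv_bound_def
 proof
  fix om
  let ?S = "\<Sum>i\<in>J j. (cmod ((partial_deriv k ^^ r) (fourier (\<psi> i)) om))^2"
  have "ennreal (2 powr (\<beta> * j * r) * sqrt ?S) <= ennreal s"
  unfolding s(2)[symmetric] \<nu> by (rule SUP_upper2[of j]) (use that in \<open>auto intro: SUP_upper\<close>)
  then have "2 powr (\<beta> * j * r) * sqrt ?S <= s" using s(1) by simp
  then have "sqrt ?S <= s * 2 powr (- \<beta> * j * r)" by (simp add: powr_minus field_simps)
  then have "(sqrt ?S)^2 <= (s * 2 powr (- \<beta> * j * r))^2" by (rule power_mono) (simp add: sum_nonneg)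
  then show "?S <= (s * 2 powr (- \<beta> * j * r))^2" by (simp add: sum_nonneg)
 qed
 have "\<exists>c\<ge>0. deriv_bound j k r c" if "j \<in> {1..<jr}" for j
 proof -
  have "\<exists>B. \<forall>om. cmod ((partial_deriv k ^^ r) (fourier (\<psi> i)) om) <= B" if "i \<in> J j" for i
  using jr[of j i] that \<open>j \<in> _\<close> unfolding \<nu> bounded_iff by auto
  then obtain B where B: "\<And>i om. i \<in> J j ==> cmod ((partial_deriv k ^^ r) (fourier (\<psi> i)) om) <= B i" by metis
  define c where "c = sqrt (\<Sum>i\<in>J j. (B i)^2) / 2 powr (- \<beta> * j * r)"
  have "deriv_bound j k r c" unfolding deriv_bound_def
  by (auto simp: c_def sum_nonneg intro!: sum_mono power_mono B)
  moreover have "0 <= c" by (simp add: c_def sum_nonneg)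
  ultimately show ?thesis by blast
 qed
 then obtain c where c: "\<And>j. j \<in> {1..<jr} ==> 0 <= c j \<and> deriv_bound j k r (c j)" by metis
 have S0: "0 <= (\<Sum>j\<in>{1..<jr}. c j)" by (rule sum_nonneg) (use c in blast)
 have "deriv_bound j k r (s + (\<Sum>j\<in>{1..<jr}. c j))" if "1 <= j" for j
 proof (cases "jr <= j")
  case True
  show ?thesis by (rule deriv_bound_mono[OF high[OF True] s(1)]) (use S0 in simp)
 next
  case False
  then have j: "j \<in> {1..<jr}" using that by simp
  have "c j <= (\<Sum>j\<in>{1..<jr}. c j)"
  proof (rule member_le_sum[OF j])
  show "0 <= c x" if "x \<in> {1..<jr} - {j}" for x using c[of x] that by blast
  qed simp
  then show ?thesis using c[OF j] s(1) deriv_bound_mono[of j k r "c j" "s + (\<Sum>j\<in>{1..<jr}. c j)"] by linarith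
 qed
 then show ?thesis using S0 s(1) by (intro exI[of _ "s + (\<Sum>j\<in>{1..<jr}. c j)"]) auto
qed

lemma level_kernels:
 "\<exists>C\<ge>1. \<forall>j\<ge>1. kernel_family (J j) \<psi> (2 powr (- \<beta> * j)) C (%k r i om. (\<i> / of_real (2 * pi)) ^ r * (partial_deriv k ^^ r) (fourier (\<psi> i)) om)"
proof -
 have "\<exists>c. \<forall>p\<in>(UNIV :: 2 set) \<times> {1..4::nat}. 0 <= c p \<and> (\<forall>j\<ge>1. deriv_bound j (fst p) (snd p) (c p))"
  by (rule bchoice) (use deriv_bound_uniform in auto)
 then obtain c where c0: "\<forall>p\<in>(UNIV :: 2 set) \<times> {1..4::nat}. 0 <= c p \<and> (\<forall>j\<ge>1. deriv_bound j (fst p) (snd p) (c p))" by (rule exE)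
 have c: "0 <= c p \<and> (\<forall>j\<ge>1. deriv_bound j (fst p) (snd p) (c p))" if "p \<in> (UNIV :: 2 set) \<times> {1..4::nat}" for p
  using c0 that by (rule bspec)
 define C where "C = 1 + (\<Sum>p\<in>(UNIV :: 2 set) \<times> {1..4}. c p)"
 have "0 <= (\<Sum>p\<in>(UNIV :: 2 set) \<times> {1..4}. c p)" by (rule sum_nonneg) (use c in blast)
 then have C1: "1 <= C" by (simp add: C_def)
 have db: "deriv_bound j k r C" if "1 <= j" "1 <= r" "r <= 4" for j k r
 proof (rule deriv_bound_mono)
  have m: "(k, r) \<in> (UNIV :: 2 set) \<times> {1..4}" using that by simp
  show "deriv_bound j k r (c (k, r))" "0 <= c (k, r)" using c[OF m] that by auto
  have "c (k, r) <= (\<Sum>p\<in>(UNIV :: 2 set) \<times> {1..4}. c p)"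
  proof (rule member_le_sum[OF m])
  show "0 <= c x" if "x \<in> (UNIV :: 2 set) \<times> {1..4} - {(k, r)}" for x using c[of x] that by blast
  qed simp
  then show "c (k, r) <= C" by (simp add: C_def)
 qed
 have "kernel_family (J j) \<psi> (2 powr (- \<beta> * j)) C (%k r i om. (\<i> / of_real (2 * pi)) ^ r * (partial_deriv k ^^ r) (fourier (\<psi> i)) om)" if j: "1 <= j" for j
 proof
  show "integrable lborel (\<psi> i)" if "i \<in> J j" for i using that J_I \<psi>_int by blast
  show "ft (%x. of_real (x $ k) ^ r * \<psi> i x) (%om. (\<i> / of_real (2 * pi)) ^ r * (partial_deriv k ^^ r) (fourier (\<psi> i)) om)"
  if i: "i \<in> J j" and r: "r <= 4" for k r i
  proof (rule ft_iterated_moment[where R="8 * 2 ^ j" and n=4])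
  show "ft (\<psi> i) (fourier (\<psi> i))" using J_I[OF i] by (intro ft_fourier \<psi>_int \<psi>_L2)
  show "times_differentiable 4 (fourier (\<psi> i))" using regular J_I[OF i] by (simp add: multiplier_regularity_def)
  show "\<exists>B. \<forall>om. cmod ((partial_deriv k ^^ r) (fourier (\<psi> i)) om) <= B" if r: "1 <= r" "r <= 4" for r
  proof (intro exI allI)
  fix om
  have "(cmod ((partial_deriv k ^^ r) (fourier (\<psi> i)) om))^2 <= (\<Sum>i\<in>J j. (cmod ((partial_deriv k ^^ r) (fourier (\<psi> i)) om))^2)"
  by (rule member_le_sum[OF i]) auto
  also have "... <= (C * 2 powr (- \<beta> * j * r))^2" using db[OF j r] by (simp add: deriv_bound_def)
  finally show "cmod ((partial_deriv k ^^ r) (fourier (\<psi> i)) om) <= C * 2 powr (- \<beta> * j * r)"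
  by (rule power2_le_imp_le) (use C1 in simp)
  qed
  qed (use \<psi>_supp[OF i] r in auto)
  show "AEL om. (\<Sum>i\<in>J j. (cmod ((\<i> / of_real (2 * pi)) ^ r * (partial_deriv k ^^ r) (fourier (\<psi> i)) om))^2) <= (C * (2 powr (- \<beta> * j)) ^ r)^2"
  if r: "r <= 4" for k r
  proof (cases "r = 0")
  case True
  have "1 <= C^2" using C1 by simp
  moreover have "AEL om. (\<Sum>i\<in>J j. (cmod (fourier (\<psi> i) om))^2) <= 1" by (rule partition_finite) (auto dest: J_I)
  ultimately show ?thesis unfolding True by auto
  next
  case False
  show ?thesis
  proof (rule AE_I2)
  fix om
  have "cmod (\<i> / of_real (2 * pi)) ^ r <= 1" using pi_gt3 by (intro power_le_one) (auto simp: norm_divide)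
  then have "(\<Sum>i\<in>J j. (cmod ((\<i> / of_real (2 * pi)) ^ r * (partial_deriv k ^^ r) (fourier (\<psi> i)) om))^2)
  <= (\<Sum>i\<in>J j. (cmod ((partial_deriv k ^^ r) (fourier (\<psi> i)) om))^2)"
  unfolding norm_mult norm_power by (intro sum_mono power_mono mult_left_le_one_le) auto
  also have "... <= (C * 2 powr (- \<beta> * j * r))^2" using db[OF j, of r k] False r by (simp add: deriv_bound_def)
  also have "2 powr (- \<beta> * j * r) = (2 powr (- \<beta> * j)) ^ r" by (simp add: powr_powr flip: powr_realpow)
  finally show "(\<Sum>i\<in>J j. (cmod ((\<i> / of_real (2 * pi)) ^ r * (partial_deriv k ^^ r) (fourier (\<psi> i)) om))^2) <= (C * (2 powr (- \<beta> * j)) ^ r)^2" .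
  qed
  qed
 qed (use C1 in auto)
 then show ?thesis using C1 by blast
qed

end

section \<open>The commutator of filtering and deformation\<close>

lemma finite_sum_le_count_space:
 fixes f :: "'a :: countable => ennreal"
 assumes "finite F" "F \<subseteq> A" shows "sum f F <= (\<integral>\<^sup>+ i. f i \<partial>count_space A)"
proof -
 have "(\<Sum>\<^sub>\<infinity>i\<in>A. f i) = Sup (sum f ` {F. finite F \<and> F \<subseteq> A})" by (rule nonneg_infsum_complete) simp
 then show ?thesis using assms unfolding infsum_count_space[symmetric] by (auto intro!: Sup_upper)
qed

lemma count_space_le:
 fixes f :: "'a :: countable => ennreal"
 assumes "\<And>F. finite F ==> F \<subseteq> A ==> sum f F <= b" shows "(\<integral>\<^sup>+ i. f i \<partial>count_space A) <= b"
proof -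
 have "(\<Sum>\<^sub>\<infinity>i\<in>A. f i) = Sup (sum f ` {F. finite F \<and> F \<subseteq> A})" by (rule nonneg_infsum_complete) simp
 then show ?thesis using assms unfolding infsum_count_space[symmetric] by (auto intro!: Sup_least)
qed

lemma ennreal_add_sq_le: "(a + b)^2 <= 4 * a^2 + 4 * (b^2 :: ennreal)"
proof -
 have *: "(a + b)^2 <= 4 * b^2" if "a <= b" for a b :: ennreal
 proof -
  have "(a + b)^2 <= (2 * b)^2" unfolding ennreal_sq_le_iff mult_2 by (rule add_right_mono[OF that])
  then show ?thesis by (simp add: power_mult_distrib)
 qed
 show ?thesis
 proof (cases "a <= b")
  case True
  show ?thesis by (rule order_trans[OF *[OF True]]) simp
 next
  case False
  then have "(b + a)^2 <= 4 * a^2" by (intro *) simp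
  then show ?thesis by (simp add: add.commute add_increasing2)
 qed
qed

subsection \<open>Displacements of weakly differentiable functions\<close>

definition gnorm :: "(real^2 => complex) => ennreal" where
 "gnorm g = L2_norm (%om. of_real (2 * pi * norm om) * g om)"

lemma gnorm_sq: "(gnorm g)^2 = genergy g"
 unfolding gnorm_def L2_norm_sq genergy_def by (simp add: norm_mult power_mult_distrib)

text \<open>For band-limited functions this is the estimate along the segments from \<open>x\<close> to
  \<open>Ph x\<close>; the general case follows by cutting off high frequencies.\<close>

lemma (in small_perturbation) displacement_le_gradient:
 assumes fg: "ft f g" and T: "\<And>x. norm (ta x) <= T"
 shows "L2_norm (%x. f (Ph x) - f x) <= ennreal (4 * T) * gnorm g"
proof -
 have T0: "0 <= T" by (rule order_trans[OF norm_ge_zero T])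
 have f: "in_L2 f" and g: "in_L2 g" using fg by (rule ft_L2)+
 note [measurable] = in_L2_measurable'[OF f] in_L2_measurable'[OF g]
 define ga where "ga n = lowpass (real n) g" for n
 have ga: "bandlim (real n) (ga n)" for n unfolding ga_def by (rule bandlim_lowpass[OF g])
 define u where "u n = invF (ga n)" for n
 have u: "ft (u n) (ga n)" for n unfolding u_def by (rule ft_bandlim[OF ga])
 have [measurable]: "u n \<in> bm" "ga n \<in> bm" for n using ft_meas[OF u] by auto
 define r where "r n = L2_norm (%om. ga n om - g om)" for n
 have r: "r ~~> 0" unfolding r_def
 proof (rule L2_dominated[OF _ _ g])
  show "AEL om. (%n. ga n om) ~~> g om"
  proof (rule AE_I2, rule tendsto_eventually)
  fix om
  show "\<forall>\<^sub>F n in sequentially. ga n om = g om"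
  using eventually_gt_at_top[of "nat \<lceil>norm om\<rceil>"]
  proof eventually_elim
  fix n assume "nat \<lceil>norm om\<rceil> < n"
  then have "norm om < real n" by linarith
  then show "ga n om = g om" by (simp add: ga_def lowpass_def)
  qed
  qed
  show "AEL om. cmod (ga n om - g om) <= cmod (g om)" for n
  by (rule AE_I2) (simp add: ga_def lowpass_def indicator_def)
 qed auto
 have ur: "L2_norm (%x. u n x - f x) = r n" for n
  unfolding r_def by (rule ft_isometry[OF ft_diff[OF u fg], symmetric])
 have low: "L2_norm (%x. u n (Ph x) - u n x) <= ennreal (4 * T) * gnorm g" for n
 proof -
  have "(NN x. indicator UNIV x * ennreal ((cmod (invF (ga n) (Ph x) - invF (ga n) x))^2)) <= ennreal (16 * T^2) * genergy (ga n)"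
  proof (rule path_estimate[OF ga _ _ _ T0])
  show "norm (Ph x - x) <= T" for x using T by (simp add: Ph_def)
  fix t :: real and x y :: "real^2" assume t: "0 <= t" "t <= 1"
  have "x - (x + t *\<^sub>R (Ph x - x)) - (y - (y + t *\<^sub>R (Ph y - y))) = t *\<^sub>R (ta x - ta y)" by (simp add: Ph_def algebra_simps)
  also have "norm ... <= 1 * norm (ta x - ta y)" using t unfolding norm_scaleR by (intro mult_right_mono) auto
  also have "... <= ka * norm (x - y)" using lip by simp
  also have "... <= 1/2 * norm (x - y)" using ka_small by (intro mult_right_mono) auto
  finally show "norm (x - (x + t *\<^sub>R (Ph x - x)) - (y - (y + t *\<^sub>R (Ph y - y)))) <= 1/2 * norm (x - y)" .
  qed auto
  also have "genergy (ga n) <= genergy g" unfolding genergy_def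
  by (intro nn_integral_mono ennreal_leI mult_left_mono power_mono) (auto simp: ga_def lowpass_def indicator_def)
  finally have "(L2_norm (%x. u n (Ph x) - u n x))^2 <= ennreal (16 * T^2) * genergy g"
  unfolding L2_norm_sq u_def by (simp add: mult_left_mono)
  also have "ennreal (16 * T^2) * genergy g = (ennreal (4 * T) * gnorm g)^2"
  using T0 by (simp add: power_mult_distrib gnorm_sq ennreal_power)
  finally show ?thesis by (simp only: ennreal_sq_le_iff)
 qed
 have "(%n. r n + r n + r n) ~~> 0" using tendsto_add[OF tendsto_add[OF r r] r] by simp
 then show ?thesis
 proof (rule le_of_tendsto_0)
  fix n
  have "L2_norm (%x. f (Ph x) - f x) <= L2_norm (%x. f (Ph x) - u n (Ph x)) + L2_norm (%x. u n (Ph x) - f x)"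
  by (rule L2_norm_diff_trans) auto
  also have "L2_norm (%x. u n (Ph x) - f x) <= L2_norm (%x. u n (Ph x) - u n x) + L2_norm (%x. u n x - f x)"
  by (rule L2_norm_diff_trans) auto
  also have "L2_norm (%x. f (Ph x) - u n (Ph x)) <= 2 * L2_norm (%x. u n x - f x)"
  unfolding L2_norm_commute[of "%x. f (Ph x)"] by (rule L2_Ph[of "%x. u n x - f x"]) simp
  finally have "L2_norm (%x. f (Ph x) - f x) <= 2 * r n + (L2_norm (%x. u n (Ph x) - u n x) + r n)"
  by (simp add: ur add_left_mono add_mono)
  also have "... <= 2 * r n + (ennreal (4 * T) * gnorm g + r n)" using low by (intro add_mono) auto
  also have "... = r n + r n + r n + ennreal (4 * T) * gnorm g" by (simp only: mult_2 mult_2_right ac_simps)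
  finally show "L2_norm (%x. f (Ph x) - f x) <= r n + r n + r n + ennreal (4 * T) * gnorm g" .
 qed
qed

subsection \<open>Summing over the levels\<close>

definition level_weight :: "real => nat => real => real" where
 "level_weight \<beta> j r = (if r < 24 * 2 ^ j then (2 powr (- \<beta> * j))\<^sup>2 * (2 * pi * r)^2 else 1)"

lemma geometric_subset_sum:
 fixes q :: real assumes "0 <= q" "q < 1" "finite S" shows "(\<Sum>i\<in>S. q ^ i) <= 1 / (1 - q)"
proof -
 have "(\<Sum>i\<in>S. q ^ i) <= (\<Sum>i. q ^ i)" using assms by (intro sum_le_suminf summable_geometric) auto
 then show ?thesis using assms by (simp add: suminf_geometric)
qed

text \<open>At the frequency \<open>om\<close> with \<open>norm om = r\<close>, the levels above \<open>r\<close> form a geometric series with ratio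
 \<open>4 powr - \<beta>\<close>, dominated by its first term; the levels below \<open>r\<close> are at most
 logarithmically many, and compared with a geometric series of ratio \<open>4 powr (\<beta> - 1)\<close>.\<close>

lemma level_weight_sum:
 assumes \<beta>: "0 < \<beta>" "\<beta> < 1"
 shows "\<exists>c\<ge>0. \<forall>r\<ge>0. \<forall>N. (\<Sum>j\<in>{1..N}. level_weight \<beta> j r) <= c * (1 + r^2) powr (1 - \<beta>)"
proof -
 define q where "q = 2 powr (- 2 * \<beta>)"
 define q' where "q' = 2 powr (- 2 * (1 - \<beta>))"
 have q: "0 <= q" "q < 1" "0 <= q'" "q' < 1" using \<beta> powr_less_mono[of _ 0 "2::real"] by (simp_all add: q_def q'_def)
 define c where "c = 4 * pi^2 * (576 / (1 - q)) + 1 / (1 - q')"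
 have qj: "q ^ j = (2 powr (- \<beta> * j))^2" "q ^ j = (2 ^ j) powr (- 2 * \<beta>)" "q' ^ j = (2 ^ j) powr (- 2 * (1 - \<beta>))" for j
  by (simp_all add: q_def q'_def powr_powr mult_ac flip: powr_realpow)
 have "(\<Sum>j\<in>{1..N}. level_weight \<beta> j r) <= c * (1 + r^2) powr (1 - \<beta>)" if r: "0 <= r" for r N
 proof (cases "r = 0")
  case True
  then have "(\<Sum>j\<in>{1..N}. level_weight \<beta> j r) = 0" by (simp add: level_weight_def)
  then show ?thesis using q by (simp add: c_def)
 next
  case False
  then have rp: "0 < r" using r by simp
  define F where "F = {j\<in>{1..N}. r < 24 * 2 ^ j}"
  have fin: "finite F" "finite {j\<in>{1..N}. \<not> r < 24 * 2 ^ j}" by (simp_all add: F_def)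
  have r2: "r powr (2 - 2 * \<beta>) = (r^2) powr (1 - \<beta>)"
  proof -
  have "r^2 = r powr 2" using rp by (simp add: powr_numeral)
  then show ?thesis by (simp add: powr_powr algebra_simps)
  qed
  have low: "(\<Sum>j\<in>F. level_weight \<beta> j r) <= 4 * pi^2 * (576 / (1 - q) * (r^2) powr (1 - \<beta>))"
  proof (cases "F = {}")
  case False
  define j0 where "j0 = Min F"
  have j0: "j0 \<in> F" "\<And>j. j \<in> F ==> j0 <= j" using False fin by (simp_all add: j0_def)
  have "(\<Sum>j\<in>F. q ^ j) = (\<Sum>j\<in>F. q ^ j0 * q ^ (j - j0))" by (intro sum.cong refl) (simp add: j0 flip: power_add)
  also have "... = q ^ j0 * (\<Sum>i\<in>(%j. j - j0) ` F. q ^ i)"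
  unfolding sum_distrib_left[symmetric] by (subst sum.reindex) (auto simp: inj_on_def dest!: j0(2))
  also have "... <= q ^ j0 * (1 / (1 - q))" using fin q by (intro mult_left_mono geometric_subset_sum) auto
  finally have s: "(\<Sum>j\<in>F. q ^ j) <= q ^ j0 / (1 - q)" by simp
  have "r / 24 <= 2 ^ j0" using j0(1) by (simp add: F_def)
  then have "(2 ^ j0) powr (- 2 * \<beta>) <= (r / 24) powr (- 2 * \<beta>)" using rp \<beta> by (intro powr_mono2') auto
  also have "... = 24 powr (2 * \<beta>) * r powr (- 2 * \<beta>)" using rp by (simp add: powr_divide powr_minus field_simps)
  also have "... <= 576 * r powr (- 2 * \<beta>)"
  proof (rule mult_right_mono)
  have "(24::real) powr (2 * \<beta>) <= 24 powr 2" using \<beta> by (intro powr_mono) auto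
  then show "(24::real) powr (2 * \<beta>) <= 576" by (simp add: powr_numeral)
  qed simp
  finally have "q ^ j0 * r^2 <= 576 * r powr (- 2 * \<beta>) * r^2" unfolding qj(2) by (rule mult_right_mono) simp
  also have "... = 576 * (r^2) powr (1 - \<beta>)"
  proof -
  have "r powr (- 2 * \<beta>) * r powr 2 = r powr (2 - 2 * \<beta>)" by (simp flip: powr_add)
  then show ?thesis using rp r2 by (simp add: powr_numeral)
  qed
  finally have p: "q ^ j0 * r^2 / (1 - q) <= 576 * (r^2) powr (1 - \<beta>) / (1 - q)" using q by (intro divide_right_mono) auto
  have "(\<Sum>j\<in>F. level_weight \<beta> j r) = 4 * pi^2 * ((\<Sum>j\<in>F. q ^ j) * r^2)"
  unfolding sum_distrib_left sum_distrib_right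
  by (intro sum.cong refl) (simp add: F_def level_weight_def qj(1) power_mult_distrib)
  also have "... <= 4 * pi^2 * (q ^ j0 / (1 - q) * r^2)" using s by (intro mult_left_mono mult_right_mono) auto
  also have "... <= 4 * pi^2 * (576 / (1 - q) * (r^2) powr (1 - \<beta>))" using p by (intro mult_left_mono) auto
  finally show ?thesis .
  qed (use q in simp)
  have high: "(\<Sum>j\<in>{j\<in>{1..N}. \<not> r < 24 * 2 ^ j}. level_weight \<beta> j r) <= 1 / (1 - q') * (r^2) powr (1 - \<beta>)"
  proof -
  have "(\<Sum>j\<in>{j\<in>{1..N}. \<not> r < 24 * 2 ^ j}. level_weight \<beta> j r) <= (\<Sum>j\<in>{j\<in>{1..N}. \<not> r < 24 * 2 ^ j}. q' ^ j * (r^2) powr (1 - \<beta>))"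
  proof (rule sum_mono)
  fix j assume "j \<in> {j\<in>{1..N}. \<not> r < 24 * 2 ^ j}"
  then have j: "24 * 2 ^ j <= r" by simp
  then have "2 ^ j <= r" using zero_le_power[of "2::real" j] by linarith
  then have "r powr (- 2 * (1 - \<beta>)) <= (2 ^ j) powr (- 2 * (1 - \<beta>))" using \<beta> by (intro powr_mono2') auto
  then have "r powr (- 2 * (1 - \<beta>)) * r powr (2 - 2 * \<beta>) <= q' ^ j * (r^2) powr (1 - \<beta>)"
  unfolding qj r2 by (rule mult_right_mono) simp
  moreover have "r powr (- 2 * (1 - \<beta>)) * r powr (2 - 2 * \<beta>) = 1" using rp by (simp flip: powr_add)
  ultimately show "level_weight \<beta> j r <= q' ^ j * (r^2) powr (1 - \<beta>)" using j by (simp add: level_weight_def)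
  qed
  also have "... <= 1 / (1 - q') * (r^2) powr (1 - \<beta>)"
  unfolding sum_distrib_right[symmetric] using q fin(2) by (intro mult_right_mono geometric_subset_sum) auto
  finally show ?thesis .
  qed
  have P: "{1..N} = F \<union> {j\<in>{1..N}. \<not> r < 24 * 2 ^ j}" and Q: "F \<inter> {j\<in>{1..N}. \<not> r < 24 * 2 ^ j} = {}" by (auto simp: F_def)
  have "(\<Sum>j\<in>{1..N}. level_weight \<beta> j r) = (\<Sum>j\<in>F. level_weight \<beta> j r) + (\<Sum>j\<in>{j\<in>{1..N}. \<not> r < 24 * 2 ^ j}. level_weight \<beta> j r)"
  by (subst P) (rule sum.union_disjoint[OF fin Q])
  also have "... <= c * (r^2) powr (1 - \<beta>)" using low high by (simp add: c_def distrib_right)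
  also have "... <= c * (1 + r^2) powr (1 - \<beta>)" using q \<beta> by (intro mult_left_mono powr_mono2) (auto simp: c_def)
  finally show ?thesis .
 qed
 moreover have "0 <= c" using q by (simp add: c_def)
 ultimately show ?thesis by blast
qed

context filter_bank
begin

lemma [measurable]: "i \<in> I ==> \<psi> i \<in> bm" "chi \<in> bm"
 using \<psi>_L2 chi_L2 by (auto dest: in_L2_measurable')

text \<open>The Parseval frame identity on the frequency side, for an arbitrary measurable factor
  \<open>h\<close>; it will also be applied to a gradient and to a low-frequency part.\<close>

lemma bessel_multiplier:
 assumes [measurable]: "h \<in> bm"
 shows "(L2_norm (%om. h om * fourier chi om))^2 + (\<integral>\<^sup>+ i. (L2_norm (%om. h om * fourier (\<psi> i) om))^2 \<partial>count_space I) = (L2_norm h)^2"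
proof -
 let ?m = "%i om. ennreal ((cmod (fourier (\<psi> i) om))^2)"
 have sq: "ennreal ((cmod (h om * z))^2) = ennreal ((cmod (h om))^2) * ennreal ((cmod z)^2)" for om z
  by (simp add: norm_mult power_mult_distrib ennreal_mult)
 have "(\<integral>\<^sup>+ i. (L2_norm (%om. h om * fourier (\<psi> i) om))^2 \<partial>count_space I)
  = (NN om. \<integral>\<^sup>+ i. ennreal ((cmod (h om))^2) * ?m i om \<partial>count_space I)"
  unfolding L2_norm_sq sq by (rule nn_integral_count_space_nn_integral[symmetric]) auto
 also have "... = (NN om. ennreal ((cmod (h om))^2) * (\<integral>\<^sup>+ i. ?m i om \<partial>count_space I))"
  by (intro nn_integral_cong nn_integral_cmult) simp
 finally have s: "(\<integral>\<^sup>+ i. (L2_norm (%om. h om * fourier (\<psi> i) om))^2 \<partial>count_space I) = ..." .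
 have p: "AEL om. (cmod (fourier chi om))^2 <= 1 \<and> (\<integral>\<^sup>+ i. ?m i om \<partial>count_space I) = ennreal (1 - (cmod (fourier chi om))^2)"
  using partition
 proof eventually_elim
  fix om
  have *: "a <= 1 \<and> t = ennreal (1 - a)" if "ennreal a + t = 1" "0 <= a" for a t
  proof -
  have "ennreal a <= ennreal a + t" by simp
  then have a: "a <= 1" unfolding that(1) by simp
  have "ennreal a + t = ennreal a + ennreal (1 - a)" using a that by (simp flip: ennreal_plus)
  then show ?thesis using a by (simp add: ennreal_add_left_cancel)
  qed
  show "ennreal ((cmod (fourier chi om))^2) + (\<integral>\<^sup>+ i. ?m i om \<partial>count_space I) = 1 ==>
  (cmod (fourier chi om))\<^sup>2 <= 1 \<and> (\<integral>\<^sup>+ i. ?m i om \<partial>count_space I) = ennreal (1 - (cmod (fourier chi om))^2)"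
  by (rule *) auto
 qed
 have "(\<integral>\<^sup>+ i. (L2_norm (%om. h om * fourier (\<psi> i) om))^2 \<partial>count_space I)
  = (NN om. ennreal ((cmod (h om))^2) * ennreal (1 - (cmod (fourier chi om))^2))"
  unfolding s by (rule nn_integral_cong_AE) (use p in eventually_elim, simp)
 then have "(L2_norm (%om. h om * fourier chi om))^2 + (\<integral>\<^sup>+ i. (L2_norm (%om. h om * fourier (\<psi> i) om))^2 \<partial>count_space I)
  = (NN om. ennreal ((cmod (h om))^2) * ennreal ((cmod (fourier chi om))^2) + ennreal ((cmod (h om))^2) * ennreal (1 - (cmod (fourier chi om))^2))"
  unfolding L2_norm_sq[of "%om. h om * fourier chi om"] sq by (simp add: nn_integral_add)
 also have "... = (L2_norm h)^2"
  unfolding L2_norm_sq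
 proof (rule nn_integral_cong_AE, use p in eventually_elim)
  fix om assume "(cmod (fourier chi om))^2 <= 1 \<and> (\<integral>\<^sup>+ i. ?m i om \<partial>count_space I) = ennreal (1 - (cmod (fourier chi om))^2)"
  then have "ennreal ((cmod (fourier chi om))^2) + ennreal (1 - (cmod (fourier chi om))^2) = 1" by (simp flip: ennreal_plus)
  then show "ennreal ((cmod (h om))^2) * ennreal ((cmod (fourier chi om))^2) + ennreal ((cmod (h om))^2) * ennreal (1 - (cmod (fourier chi om))^2) = ennreal ((cmod (h om))^2)"
  by (simp only: distrib_left[symmetric] mult_1_right)
 qed
 finally show ?thesis .
qed

lemma ft_filter: "ft f g ==> i \<in> I ==> ft (convolution f (\<psi> i)) (%om. g om * fourier (\<psi> i) om)"
 by (rule ft_conv[OF _ \<psi>_int \<psi>_L2])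

lemma bessel:
 assumes f: "in_L2 f"
 shows "(L2_norm (convolution f chi))^2 + (\<integral>\<^sup>+ i. (L2_norm (convolution f (\<psi> i)))^2 \<partial>count_space I) = (L2_norm f)^2"
proof -
 obtain g where g: "ft f g" using ft_exists[OF f] by blast
 note [measurable] = ft_meas[OF g]
 have "(\<integral>\<^sup>+ i. (L2_norm (convolution f (\<psi> i)))^2 \<partial>count_space I) = (\<integral>\<^sup>+ i. (L2_norm (%om. g om * fourier (\<psi> i) om))^2 \<partial>count_space I)"
  by (intro nn_integral_cong) (simp add: ft_isometry[OF ft_filter[OF g]])
 then show ?thesis using bessel_multiplier[of g]
  by (simp add: ft_isometry[OF g] ft_isometry[OF ft_conv[OF g chi_int chi_L2]])
qed

definition filter_commutator :: "(real^2 => real^2) => (real^2 => complex) => nat \<times> nat \<times> nat => real^2 => complex" where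
 "filter_commutator ta g i x = convolution (%y. g (y - ta y)) (\<psi> i) x - convolution g (\<psi> i) (x - ta x)"

text \<open>Frequencies below \<open>24 * 2 ^ j\<close> are handled by the commutator estimate for band-limited
 functions. The filters of level \<open>j\<close> do not see the other ones, and hardly see them after the
 deformation.\<close>

lemma level_commutator:
 assumes j: "1 <= j" and K: "kernel_family (J j) \<psi> (2 powr (- \<beta> * j)) C \<mu>"
  and ta: "small_perturbation ta ka" and fg: "ft g h"
 shows "(\<Sum>i\<in>J j. (L2_norm (filter_commutator ta g i))^2)
  <= (NN om. ennreal (ka^2 * (4 * (40000 * C)^2 + 40000) * level_weight \<beta> j (norm om) * (cmod (h om))^2))"
proof -
 define de where "de = 2 powr (- \<beta> * j)"
 interpret deformed_kernels "J j" \<psi> de C \<mu> ta ka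
  by (intro deformed_kernels.intro ta) (use K in \<open>simp only: de_def\<close>)
 define R where "R = 8 * (2::real) ^ j"
 have R: "0 < R" by (simp add: R_def)
 define ga where "ga = lowpass (3 * R) h"
 define g1 where "g1 = invF ga"
 define g2 where "g2 x = g x - g1 x" for x
 have g: "in_L2 g" and h: "in_L2 h" using fg by (rule ft_L2)+
 have ga: "bandlim (3 * R) ga" unfolding ga_def by (rule bandlim_lowpass[OF h])
 have f1: "ft g1 ga" unfolding g1_def by (rule ft_bandlim[OF ga])
 have f2: "ft g2 (%om. h om - ga om)" unfolding g2_def[abs_def] by (rule ft_diff[OF fg f1])
 have L: "in_L2 g1" "in_L2 g2" using f1 f2 by (auto dest: ft_L2)
 note [measurable] = ft_meas[OF fg] ft_meas[OF f1] ft_meas[OF f2]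
 have high: "h om - ga om = 0" if "norm om < 3 * R" for om using that by (simp add: ga_def lowpass_def)
 obtain h' where h': "ft (%x. g2 (Ph x)) h'" using ft_exists[OF in_L2_Ph[OF L(2)]] by blast
 note [measurable] = ft_meas[OF h']
 define A where "A i x = convolution (%y. g1 (Ph y)) (\<psi> i) x - convolution g1 (\<psi> i) (Ph x)" for i x
 define B where "B i = convolution (%y. g2 (Ph y)) (\<psi> i)" for i
 have split: "(L2_norm (filter_commutator ta g i))^2 <= 4 * (L2_norm (A i))^2 + 4 * (L2_norm (B i))^2" if i: "i \<in> J j" for i
 proof -
  note iI = J_I[OF i]
  note [measurable] = \<psi>_L2[OF iI, THEN in_L2_measurable']
  have "convolution g2 (\<psi> i) \<in> bm" by measurable
  moreover have "L2_norm (convolution g2 (\<psi> i)) = 0"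
  proof -
  have "(h om - ga om) * fourier (\<psi> i) om = 0" for om
  proof (cases "norm om < 3 * R")
  case False
  then have "8 * 2 ^ j <= norm om" using R unfolding R_def by linarith
  then show ?thesis using \<psi>_supp[OF i] by simp
  qed (use high in simp)
  then have "(%om. (h om - ga om) * fourier (\<psi> i) om) = (%_. 0)" by (intro ext)
  then show ?thesis
  unfolding ft_isometry[OF ft_filter[OF f2 iI], symmetric] by (simp add: L2_norm_def ennreal_sqrt_def)
  qed
  ultimately have z: "AEL x. convolution g2 (\<psi> i) x = 0" by (subst (asm) L2_norm_eq_0_iff) auto
  have "AEL x. convolution g2 (\<psi> i) (Ph x) = 0"
  using AE_Ph[OF _ _ z] by simp
  then have "AEL x. filter_commutator ta g i x = A i x + B i x"
  proof eventually_elim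
  fix x assume "convolution g2 (\<psi> i) (Ph x) = 0"
  then have "convolution g (\<psi> i) (Ph x) = convolution g1 (\<psi> i) (Ph x)"
  using conv_diff[OF g L(1) \<psi>_L2[OF iI], of "Ph x"] by (simp add: g2_def[abs_def])
  moreover have "B i x = convolution (%y. g (Ph y)) (\<psi> i) x - convolution (%y. g1 (Ph y)) (\<psi> i) x"
  using conv_diff[OF in_L2_Ph[OF g] in_L2_Ph[OF L(1)] \<psi>_L2[OF iI], of x] by (simp add: B_def g2_def)
  ultimately show "filter_commutator ta g i x = A i x + B i x"
  by (simp add: filter_commutator_def A_def Ph_def)
  qed
  then have "L2_norm (filter_commutator ta g i) = L2_norm (%x. A i x + B i x)"
  by (intro L2_norm_cong_AE) (auto elim: eventually_mono)
  also have "... <= L2_norm (A i) + L2_norm (B i)"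
  by (rule L2_norm_add) (simp_all add: A_def[abs_def] B_def)
  finally have "(L2_norm (filter_commutator ta g i))^2 <= (L2_norm (A i) + L2_norm (B i))^2" by (simp only: ennreal_sq_le_iff)
  then show ?thesis by (rule order_trans[OF _ ennreal_add_sq_le])
 qed
 have SA: "(\<Sum>i\<in>J j. (L2_norm (A i))^2) <= ennreal ((40000 * C * ka * de)^2) * genergy ga"
  using low_commutator[OF ga] R unfolding vnorm_sq[OF fin] A_def[abs_def] g1_def by simp
 have SB: "(\<Sum>i\<in>J j. (L2_norm (B i))^2) <= ennreal ((100 * ka)^2) * (L2_norm (%om. h om - ga om))^2"
 proof -
  have hL: "in_L2 h'" using h' by (rule ft_L2)
  have lL: "in_L2 (lowpass R h')" using bandlim_lowpass[OF hL] by (rule bandlim_L2)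
  have "(\<Sum>i\<in>J j. (L2_norm (B i))^2) = (\<Sum>i\<in>J j. (L2_norm (%om. lowpass R h' om * fourier (\<psi> i) om))^2)"
  proof (rule sum.cong[OF refl])
  fix i assume i: "i \<in> J j"
  have "h' om * fourier (\<psi> i) om = lowpass R h' om * fourier (\<psi> i) om" for om
  using \<psi>_supp[OF i, of om] by (cases "norm om < R") (auto simp: lowpass_def R_def)
  then show "(L2_norm (B i))^2 = (L2_norm (%om. lowpass R h' om * fourier (\<psi> i) om))^2"
  unfolding B_def ft_isometry[OF ft_filter[OF h' J_I[OF i]], symmetric] by presburger
  qed
  also have "... <= (\<integral>\<^sup>+ i. (L2_norm (%om. lowpass R h' om * fourier (\<psi> i) om))^2 \<partial>count_space I)"
  by (rule finite_sum_le_count_space) (auto dest: J_I)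
  also have "... <= (L2_norm (lowpass R h'))^2"
  unfolding bessel_multiplier[OF in_L2_measurable'[OF lL], symmetric] by simp
  also have "... <= (ennreal (100 * ka * nrm g2))^2"
  proof -
  have "nrm (lowpass R h') <= 100 * ka * nrm g2"
  by (rule lowpass_of_high[OF f2 _ R h']) (use high in auto)
  then show ?thesis using ka0 unfolding ennreal_sq_le_iff by (subst nrm_le_iff[OF lL, symmetric]) auto
  qed
  also have "ennreal (100 * ka * nrm g2) = ennreal (100 * ka) * L2_norm (%om. h om - ga om)"
  unfolding ft_isometry[OF f2] L2_norm_eq_nrm[OF L(2)] using ka0 by (intro ennreal_mult) auto
  finally show ?thesis using ka0 by (simp add: power_mult_distrib ennreal_power)
 qed
 define W where "W om = ennreal (ka^2 * (4 * (40000 * C)^2 + 40000) * level_weight \<beta> j (norm om) * (cmod (h om))^2)" for om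
 have "(\<Sum>i\<in>J j. (L2_norm (filter_commutator ta g i))^2) <= (\<Sum>i\<in>J j. 4 * (L2_norm (A i))^2 + 4 * (L2_norm (B i))^2)"
  by (rule sum_mono) (rule split)
 also have "... = 4 * (\<Sum>i\<in>J j. (L2_norm (A i))^2) + 4 * (\<Sum>i\<in>J j. (L2_norm (B i))^2)"
  by (simp only: sum.distrib sum_distrib_left)
 also have "... <= 4 * (ennreal ((40000 * C * ka * de)^2) * genergy ga) + 4 * (ennreal ((100 * ka)^2) * (L2_norm (%om. h om - ga om))^2)"
  by (intro add_mono mult_left_mono SA SB) auto
 also have "... = (NN om. 4 * (ennreal ((40000 * C * ka * de)^2) * ennreal ((2 * pi * norm om)^2 * (cmod (ga om))^2))
  + 4 * (ennreal ((100 * ka)^2) * ennreal ((cmod (h om - ga om))^2)))"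
  unfolding genergy_def L2_norm_sq by (simp add: nn_integral_add nn_integral_cmult)
 also have "... <= (NN om. W om)"
 proof (rule nn_integral_mono)
  fix om
  have e: "4 * (ennreal a * ennreal b) = ennreal (4 * a * b)" if "0 <= a" "0 <= b" for a b
  using that by (simp add: ennreal_mult mult.assoc)
  have *: "4 * (ennreal a * ennreal b) + 4 * (ennreal a' * ennreal b') = ennreal (4 * a * b + 4 * a' * b')"
  if "0 <= a" "0 <= b" "0 <= a'" "0 <= b'" for a b a' b'
  unfolding e[OF that(1,2)] e[OF that(3,4)] using that by (intro ennreal_plus[symmetric]) auto
  let ?l = "4 * (40000 * C * ka * de)^2 * ((2 * pi * norm om)^2 * (cmod (ga om))^2) + 4 * (100 * ka)^2 * (cmod (h om - ga om))^2"
  let ?r = "ka^2 * (4 * (40000 * C)^2 + 40000) * level_weight \<beta> j (norm om) * (cmod (h om))^2"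
  have s: "?l <= ?r"
  proof (cases "norm om < 24 * 2 ^ j")
  case True
  have g: "ga om = h om" using True by (simp add: ga_def lowpass_def R_def)
  have lw: "level_weight \<beta> j (norm om) = de^2 * (2 * pi * norm om)^2"
  using True by (simp only: level_weight_def de_def if_True)
  have i: "ka^2 * (4 * (40000 * C)^2) * (de^2 * (2 * pi * norm om)^2) * (cmod (h om))^2
  <= ka^2 * (4 * (40000 * C)^2 + 40000) * (de^2 * (2 * pi * norm om)^2) * (cmod (h om))^2"
  by (intro mult_right_mono mult_left_mono) auto
  have e: "4 * (40000 * C * ka * de)^2 * ((2 * pi * norm om)^2 * (cmod (h om))^2)
  = ka^2 * (4 * (40000 * C)^2) * (de^2 * (2 * pi * norm om)^2) * (cmod (h om))^2"
  unfolding power_mult_distrib by (simp only: mult_ac)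
  show ?thesis by (simp only: g lw e i diff_self norm_zero zero_power2 mult_zero_right add_0_right)
  next
  case False
  have g: "ga om = 0" using False by (simp add: ga_def lowpass_def R_def)
  have lw: "level_weight \<beta> j (norm om) = 1" using False by (simp only: level_weight_def if_False)
  have e: "4 * (100 * ka)^2 = ka^2 * 40000" by (simp add: power_mult_distrib)
  have i: "ka^2 * 40000 * (cmod (h om))^2 <= ka^2 * (4 * (40000 * C)^2 + 40000) * (cmod (h om))^2"
  by (intro mult_right_mono mult_left_mono) auto
  show ?thesis by (simp only: g lw e i diff_zero norm_zero zero_power2 mult_zero_right add_0_left mult_1_right)
  qed
  have "4 * (ennreal ((40000 * C * ka * de)^2) * ennreal ((2 * pi * norm om)^2 * (cmod (ga om))^2))
  + 4 * (ennreal ((100 * ka)^2) * ennreal ((cmod (h om - ga om))^2)) = ennreal ?l" by (rule *) simp_all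
  also have "... <= W om" unfolding W_def by (rule ennreal_leI[OF s])
  finally show "4 * (ennreal ((40000 * C * ka * de)^2) * ennreal ((2 * pi * norm om)^2 * (cmod (ga om))^2))
  + 4 * (ennreal ((100 * ka)^2) * ennreal ((cmod (h om - ga om))^2)) <= W om" .
 qed
 finally show ?thesis unfolding W_def .
qed

lemma H_norm_sq: "ft g h ==> (H_norm s g)\<^sup>2 = (NN om. ennreal ((1 + (norm om)^2) powr s * (cmod (h om))^2))"
 unfolding H_norm_eq L2_norm_sq by (simp add: power_mult_distrib) (simp flip: powr_add add: power2_eq_square)

lemma commutator_positive:
 assumes "0 < \<beta>"
 shows "\<exists>K\<ge>0. \<forall>ta ka g. small_perturbation ta ka --> in_L2 g -->
  (\<integral>\<^sup>+ i. (L2_norm (filter_commutator ta g i))^2 \<partial>count_space I) <= ennreal (ka^2 * K) * (H_norm (1 - \<beta>) g)^2"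
proof -
 obtain C where C: "1 <= C" and K: "\<And>j. 1 <= j ==> kernel_family (J j) \<psi> (2 powr (- \<beta> * j)) C (%k r i om. (\<i> / of_real (2 * pi)) ^ r * (partial_deriv k ^^ r) (fourier (\<psi> i)) om)"
  using level_kernels by blast
 obtain c where c: "0 <= c" "\<And>r N. 0 <= r ==> (\<Sum>j\<in>{1..N}. level_weight \<beta> j r) <= c * (1 + r^2) powr (1 - \<beta>)"
  using level_weight_sum[OF assms \<beta>1] by blast
 define E where "E = 4 * (40000 * C)^2 + 40000"
 have E0: "0 <= E" by (simp add: E_def)
 have w0: "0 <= level_weight \<beta> j r" for j r by (simp add: level_weight_def)
 have "(\<integral>\<^sup>+ i. (L2_norm (filter_commutator ta g i))^2 \<partial>count_space I) <= ennreal (ka^2 * (E * c)) * (H_norm (1 - \<beta>) g)^2"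
  if ta: "small_perturbation ta ka" and g: "in_L2 g" for ta ka g
 proof (rule count_space_le)
  fix F assume F: "finite F" "F \<subseteq> I"
  obtain h where h: "ft g h" using ft_exists[OF g] by blast
  note [measurable] = ft_meas[OF h]
  have [measurable]: "(%om. level_weight \<beta> j (norm (om::real^2))) \<in> bm" for j
  unfolding level_weight_def by measurable
  define N where "N = Max (insert 1 (fst ` F))"
  let ?G = "%j om. ka^2 * E * level_weight \<beta> j (norm om) * (cmod (h om))^2"
  have "F \<subseteq> (\<Union>j\<in>{1..N}. J j)"
  proof
  fix i assume i: "i \<in> F"
  then have "fst i <= N" using F by (auto simp: N_def)
  moreover have "1 <= fst i" "i \<in> J (fst i)" using i F by (auto simp: I_level_def I_star_def)
  ultimately show "i \<in> (\<Union>j\<in>{1..N}. J j)" by auto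
  qed
  then have "(\<Sum>i\<in>F. (L2_norm (filter_commutator ta g i))^2) <= (\<Sum>i\<in>(\<Union>j\<in>{1..N}. J j). (L2_norm (filter_commutator ta g i))^2)"
  by (intro sum_mono2) auto
  also have "... = (\<Sum>j\<in>{1..N}. \<Sum>i\<in>J j. (L2_norm (filter_commutator ta g i))^2)"
  by (rule sum.UNION_disjoint) (simp, simp, auto simp: I_level_def)
  also have "... <= (\<Sum>j\<in>{1..N}. (NN om. ennreal (?G j om)))"
  unfolding E_def by (intro sum_mono level_commutator[OF _ K ta h]) auto
  also have "... = (NN om. (\<Sum>j\<in>{1..N}. ennreal (?G j om)))"
  by (rule nn_integral_sum[symmetric]) measurable
  also have "... <= (NN om. ennreal (ka^2 * (E * c)) * ennreal ((1 + (norm om)^2) powr (1 - \<beta>) * (cmod (h om))^2))"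
  proof (rule nn_integral_mono)
  fix om
  have "(\<Sum>j\<in>{1..N}. ennreal (?G j om)) = ennreal (\<Sum>j\<in>{1..N}. ?G j om)" using E0 w0 by (intro sum_ennreal) simp
  also have "(\<Sum>j\<in>{1..N}. ?G j om) = ka^2 * E * (\<Sum>j\<in>{1..N}. level_weight \<beta> j (norm om)) * (cmod (h om))^2"
  by (simp only: sum_distrib_left sum_distrib_right)
  also have "... <= ka^2 * E * (c * (1 + (norm om)^2) powr (1 - \<beta>)) * (cmod (h om))^2"
  using E0 c(2)[of "norm om" N] by (intro mult_right_mono mult_left_mono) auto
  also have "... = ka^2 * (E * c) * ((1 + (norm om)^2) powr (1 - \<beta>) * (cmod (h om))^2)" by (simp only: mult_ac)
  finally show "(\<Sum>j\<in>{1..N}. ennreal (?G j om)) <= ennreal (ka^2 * (E * c)) * ennreal ((1 + (norm om)^2) powr (1 - \<beta>) * (cmod (h om))^2)"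
  using E0 c(1) by (simp add: ennreal_leI flip: ennreal_mult)
  qed
  also have "... = ennreal (ka^2 * (E * c)) * (H_norm (1 - \<beta>) g)^2"
  unfolding H_norm_sq[OF h] by (rule nn_integral_cmult) measurable
  finally show "(\<Sum>i\<in>F. (L2_norm (filter_commutator ta g i))^2) <= ennreal (ka^2 * (E * c)) * (H_norm (1 - \<beta>) g)^2" .
 qed
 then show ?thesis using E0 c(1) by (intro exI[of _ "E * c"]) auto
qed

text \<open>For \<open>\<beta> = 0\<close> the full gradient is controlled, so both terms of the commutator may
  be compared with the undeformed convolution; the gradients of the filtered functions add up by
  Bessel's identity.\<close>

lemma commutator_zero:
 assumes "\<beta> = 0" and ta: "small_perturbation ta ka" and T: "\<And>x. norm (ta x) <= T" and g: "in_L2 g"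
 shows "(\<integral>\<^sup>+ i. (L2_norm (filter_commutator ta g i))^2 \<partial>count_space I) <= ennreal (128 * (8 * T)^2) * (H_norm (1 - \<beta>) g)^2"
proof -
 interpret small_perturbation ta ka by (rule ta)
 obtain h where h: "ft g h" using ft_exists[OF g] by blast
 note [measurable] = ft_meas[OF h]
 have T0: "0 <= T" by (rule order_trans[OF norm_ge_zero T])
 define d where "d x = g (Ph x) - g x" for x
 have dL: "in_L2 d" unfolding d_def[abs_def] by (intro in_L2_diff in_L2_Ph g)
 note [measurable] = in_L2_measurable'[OF dL]
 define c where "c = ennreal (4 * T)"
 define D where "D i = gnorm (%om. h om * fourier (\<psi> i) om)" for i
 have i: "(L2_norm (filter_commutator ta g i))^2 <= 4 * (L2_norm (convolution d (\<psi> i)))^2 + 4 * (c^2 * (D i)^2)" if i: "i \<in> I" for i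
 proof -
  note [measurable] = \<psi>_L2[OF i, THEN in_L2_measurable']
  let ?v = "convolution g (\<psi> i)"
  have "filter_commutator ta g i x = convolution d (\<psi> i) x - (?v (Ph x) - ?v x)" for x
  using conv_diff[OF in_L2_Ph[OF g] g \<psi>_L2[OF i], of x] by (simp add: filter_commutator_def d_def[abs_def] Ph_def)
  then have "L2_norm (filter_commutator ta g i) = L2_norm (%x. convolution d (\<psi> i) x - (?v (Ph x) - ?v x))" by presburger
  also have "... <= L2_norm (convolution d (\<psi> i)) + L2_norm (%x. ?v (Ph x) - ?v x)" by (rule L2_norm_diff) auto
  also have "... <= L2_norm (convolution d (\<psi> i)) + c * D i"
  unfolding c_def D_def by (intro add_left_mono displacement_le_gradient ft_filter[OF h i] T)
  finally have "(L2_norm (filter_commutator ta g i))^2 <= (L2_norm (convolution d (\<psi> i)) + c * D i)^2" by (simp only: ennreal_sq_le_iff)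
  also have "... <= 4 * (L2_norm (convolution d (\<psi> i)))^2 + 4 * (c * D i)^2" by (rule ennreal_add_sq_le)
  finally show ?thesis by (simp only: power_mult_distrib)
 qed
 have "(\<integral>\<^sup>+ i. (L2_norm (filter_commutator ta g i))^2 \<partial>count_space I)
  <= (\<integral>\<^sup>+ i. 4 * (L2_norm (convolution d (\<psi> i)))^2 + 4 * (c^2 * (D i)^2) \<partial>count_space I)"
  by (rule nn_integral_mono) (simp add: i)
 also have "... = 4 * (\<integral>\<^sup>+ i. (L2_norm (convolution d (\<psi> i)))^2 \<partial>count_space I) + 4 * (c^2 * (\<integral>\<^sup>+ i. (D i)^2 \<partial>count_space I))"
  by (simp add: nn_integral_add nn_integral_cmult)
 also have "... <= 4 * (L2_norm d)^2 + 4 * (c^2 * (gnorm h)^2)"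
 proof (intro add_mono mult_left_mono)
  show "(\<integral>\<^sup>+ i. (L2_norm (convolution d (\<psi> i)))^2 \<partial>count_space I) <= (L2_norm d)^2"
  unfolding bessel[OF dL, symmetric] by simp
  have D: "D i = L2_norm (%om. (of_real (2 * pi * norm om) * h om) * fourier (\<psi> i) om)" for i
  by (simp only: D_def gnorm_def mult.assoc)
  have le: "Y <= Z" if "X + Y = Z" for X Y Z :: ennreal using that by auto
  show "(\<integral>\<^sup>+ i. (D i)^2 \<partial>count_space I) <= (gnorm h)^2"
  unfolding D gnorm_def by (rule le[OF bessel_multiplier]) measurable
 qed auto
 also have "... <= 4 * (c^2 * (gnorm h)^2) + 4 * (c^2 * (gnorm h)^2)"
 proof -
  have "L2_norm d <= c * gnorm h" unfolding d_def[abs_def] c_def by (rule displacement_le_gradient[OF h T])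
  then have "(L2_norm d)^2 <= c^2 * (gnorm h)^2" by (simp only: ennreal_sq_le_iff flip: power_mult_distrib)
  then show ?thesis by (intro add_right_mono mult_left_mono) auto
 qed
 also have "... = 8 * (c^2 * (gnorm h)^2)" by (simp flip: distrib_right)
 also have "... <= 8 * (c^2 * (64 * (H_norm (1 - \<beta>) g)^2))"
 proof (intro mult_left_mono)
  have "(gnorm h)^2 <= (NN om. 64 * ennreal ((1 + (norm om)^2) powr (1 - \<beta>) * (cmod (h om))^2))"
  unfolding gnorm_sq genergy_def
  proof (rule nn_integral_mono)
  fix om :: "real^2"
  have "(2 * pi * norm om)^2 <= (8 * norm om)^2" using pi_less_4 by (intro power_mono mult_right_mono) auto
  also have "... <= 64 * (1 + (norm om)^2)" by (simp add: power_mult_distrib)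
  finally have "(2 * pi * norm om)^2 * (cmod (h om))^2 <= 64 * (1 + (norm om)^2) * (cmod (h om))^2" by (rule mult_right_mono) simp
  then have "ennreal ((2 * pi * norm om)^2 * (cmod (h om))^2) <= ennreal (64 * ((1 + (norm om)^2) * (cmod (h om))^2))"
  by (intro ennreal_leI) (simp only: mult.assoc)
  also have "... = 64 * ennreal ((1 + (norm om)^2) powr (1 - \<beta>) * (cmod (h om))^2)"
  using assms(1) by (simp add: ennreal_mult' add_nonneg_nonneg)
  finally show "ennreal ((2 * pi * norm om)^2 * (cmod (h om))^2) <= 64 * ennreal ((1 + (norm om)^2) powr (1 - \<beta>) * (cmod (h om))^2)" .
  qed
  also have "... = 64 * (H_norm (1 - \<beta>) g)^2" unfolding H_norm_sq[OF h] by (rule nn_integral_cmult) measurable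
  finally show "(gnorm h)^2 <= 64 * (H_norm (1 - \<beta>) g)^2" .
 qed auto
 also have "... = ennreal (128 * (8 * T)^2) * (H_norm (1 - \<beta>) g)^2"
 proof -
  have c2: "c^2 = ennreal (16 * T^2)" using T0 by (simp add: c_def ennreal_power power_mult_distrib)
  have e: "(8 * 64 :: ennreal) = ennreal 512" by simp
  have "8 * (c^2 * 64) = (8 * 64) * c^2" by (simp only: mult_ac)
  also have "... = ennreal 512 * c^2" unfolding e ..
  also have "... = ennreal (512 * (16 * T^2))" unfolding c2 by (rule ennreal_mult[symmetric]) simp_all
  finally have "8 * (c^2 * 64) = ennreal (128 * (8 * T)^2)" by (simp add: power_mult_distrib)
  then show ?thesis by (simp flip: mult.assoc)
 qed
 finally show ?thesis .
qed

lemma commutator_bound: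
 "\<exists>K\<ge>0. \<forall>ta ka T g. small_perturbation ta ka --> (\<forall>x. norm (ta x) <= T) --> in_L2 g -->
  l2n (count_space I) (%i. L2_norm (filter_commutator ta g i)) <= ennreal (K * (ka + T)) * H_norm (1 - \<beta>) g"
proof -
 have root: "l2n (count_space I) (%i. L2_norm (F i)) <= ennreal (b * z) * H"
  if "(\<integral>\<^sup>+ i. (L2_norm (F i))^2 \<partial>count_space I) <= ennreal ((b * a)^2) * H^2" "0 <= a" "a <= z" "0 <= b" for F a b z H
 proof -
  have "(l2n (count_space I) (%i. L2_norm (F i)))^2 <= (ennreal (b * a) * H)^2"
  unfolding l2n_sq power_mult_distrib using that by (simp add: ennreal_power)
  then have "l2n (count_space I) (%i. L2_norm (F i)) <= ennreal (b * a) * H" by (simp only: ennreal_sq_le_iff)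
  also have "... <= ennreal (b * z) * H" using that by (intro mult_right_mono ennreal_leI mult_left_mono) auto
  finally show ?thesis .
 qed
 show ?thesis
 proof (cases "\<beta> = 0")
  case True
  have "l2n (count_space I) (%i. L2_norm (filter_commutator ta g i)) <= ennreal (sqrt 128 * 8 * (ka + T)) * H_norm (1 - \<beta>) g"
  if "small_perturbation ta ka" "\<forall>x. norm (ta x) <= T" "in_L2 g" for ta ka T g
  proof (rule root[where a=T])
  show "0 <= T" using order_trans[OF norm_ge_zero that(2)[rule_format]] .
  show "T <= ka + T" using small_perturbation.ka0[OF that(1)] by simp
  show "(\<integral>\<^sup>+ i. (L2_norm (filter_commutator ta g i))^2 \<partial>count_space I) <= ennreal ((sqrt 128 * 8 * T)^2) * (H_norm (1 - \<beta>) g)^2"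
  using commutator_zero[OF True that(1) _ that(3), of T] that(2) by (simp add: power_mult_distrib)
  qed simp
  then show ?thesis by (intro exI[of _ "sqrt 128 * 8"]) auto
 next
  case False
  then obtain K where K: "0 <= K" "\<And>ta ka g. small_perturbation ta ka ==> in_L2 g ==>
  (\<integral>\<^sup>+ i. (L2_norm (filter_commutator ta g i))^2 \<partial>count_space I) <= ennreal (ka^2 * K) * (H_norm (1 - \<beta>) g)^2"
  using commutator_positive \<beta>0 by force
  have "l2n (count_space I) (%i. L2_norm (filter_commutator ta g i)) <= ennreal (sqrt K * (ka + T)) * H_norm (1 - \<beta>) g"
  if "small_perturbation ta ka" "\<forall>x. norm (ta x) <= T" "in_L2 g" for ta ka T g
  proof (rule root[where a=ka])
  show "0 <= ka" by (rule small_perturbation.ka0[OF that(1)])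
  show "ka <= ka + T" using order_trans[OF norm_ge_zero that(2)[rule_format]] by simp
  show "(\<integral>\<^sup>+ i. (L2_norm (filter_commutator ta g i))^2 \<partial>count_space I) <= ennreal ((sqrt K * ka)^2) * (H_norm (1 - \<beta>) g)^2"
  using K(2)[OF that(1,3)] K(1) by (simp add: power_mult_distrib mult.commute)
  qed (use K in simp)
  then show ?thesis using K(1) by (intro exI[of _ "sqrt K"]) auto
 qed
qed

end

section \<open>Scattering paths\<close>

lemma count_space_image_Cons:
 fixes F :: "'a :: countable list => ennreal"
 shows "(\<integral>\<^sup>+ p. F p \<partial>count_space ((%(i, p). i # p) ` (A \<times> B))) = (\<integral>\<^sup>+ i. \<integral>\<^sup>+ p. F (i # p) \<partial>count_space B \<partial>count_space A)"
proof -
 have "(\<integral>\<^sup>+ p. F p \<partial>count_space ((%(i, p). i # p) ` (A \<times> B))) = (\<integral>\<^sup>+ z. F ((%(i, p). i # p) z) \<partial>count_space (A \<times> B))"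
  by (rule nn_integral_bij_count_space[symmetric]) (auto simp: bij_betw_def inj_on_def)
 also have "... = (\<integral>\<^sup>+ z. F ((%(i, p). i # p) z) * indicator (A \<times> B) z \<partial>count_space UNIV)"
  by (rule nn_integral_count_space_indicator) simp
 also have "... = (\<integral>\<^sup>+ i. \<integral>\<^sup>+ p. F (i # p) * indicator (A \<times> B) (i, p) \<partial>count_space UNIV \<partial>count_space UNIV)"
  by (subst nn_integral_fst_count_space[symmetric]) simp
 also have "... = (\<integral>\<^sup>+ i. (\<integral>\<^sup>+ p. F (i # p) * indicator B p \<partial>count_space UNIV) * indicator A i \<partial>count_space UNIV)"
  by (intro nn_integral_cong) (auto split: split_indicator simp: indicator_times)
 also have "... = (\<integral>\<^sup>+ i. \<integral>\<^sup>+ p. F (i # p) \<partial>count_space B \<partial>count_space A)"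
  by (simp add: nn_integral_count_space_indicator)
 finally show ?thesis .
qed

lemma count_space_insert:
 fixes F :: "'a :: countable => ennreal"
 assumes "a \<notin> A"
 shows "(\<integral>\<^sup>+ p. F p \<partial>count_space (insert a A)) = F a + (\<integral>\<^sup>+ p. F p \<partial>count_space A)"
proof -
 have "(\<integral>\<^sup>+ p. F p \<partial>count_space (insert a A)) = (\<integral>\<^sup>+ p. F p * indicator {a} p + F p * indicator A p \<partial>count_space UNIV)"
  using assms by (subst nn_integral_count_space_indicator) (auto intro!: nn_integral_cong split: split_indicator)
 also have "... = (\<integral>\<^sup>+ p. F p * indicator {a} p \<partial>count_space UNIV) + (\<integral>\<^sup>+ p. F p * indicator A p \<partial>count_space UNIV)"
  by (rule nn_integral_add) auto
 also have "(\<integral>\<^sup>+ p. F p * indicator {a} p \<partial>count_space UNIV) = F a" by simp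
 finally show ?thesis by (subst (2) nn_integral_count_space_indicator) auto
qed

lemma ennreal_sq_sum_le: "a^2 + b^2 <= (a + b :: ennreal)^2"
 by (simp add: power2_eq_square distrib_left distrib_right add_mono add_increasing2)

lemma ell2_norm_l2n: "ell2_norm N P q = l2n (count_space P) (%p. N (q p))" for P :: "'p :: countable set"
 by (simp add: ell2_norm_def l2n_def infsum_count_space)

lemma L2_norm_le_H_norm:
 assumes "in_L2 f" "0 <= s" shows "L2_norm f <= H_norm s f"
proof -
 obtain h where h: "ft f h" using ft_exists[OF assms(1)] by blast
 show ?thesis unfolding H_norm_eq[OF h] ft_isometry[OF h, symmetric]
 proof (rule L2_norm_mono)
  fix om :: "real^2"
  have "1 <= (1 + (norm om)^2) powr (s / 2)" using assms(2) by (intro ge_one_powr_ge_zero) auto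
  then have "1 * cmod (h om) <= (1 + (norm om)^2) powr (s / 2) * cmod (h om)" by (rule mult_right_mono) simp
  then show "cmod (h om) <= cmod (((1 + (norm om)^2) powr (s / 2)) *\<^sub>R h om)" by simp
 qed
qed

context filter_bank
begin

definition Ustep :: "nat \<times> nat \<times> nat => (real^2 => complex) => real^2 => complex" where
 "Ustep i g x = of_real (cmod (convolution g (\<psi> i) x))"

lemma scat_U_simps [simp]: "scat_U \<psi> [] f = f" "scat_U \<psi> (i # p) f = scat_U \<psi> p (Ustep i f)"
 by (simp_all add: scat_U_def Ustep_def[abs_def])

lemma Ustep_L2:
 assumes f: "in_L2 f" and i: "i \<in> I" shows "in_L2 (Ustep i f)"
proof -
 have c: "in_L2 (convolution f (\<psi> i))" by (rule conv_L2[OF f \<psi>_int[OF i]])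
 note [measurable] = in_L2_measurable'[OF c]
 show ?thesis by (rule in_L2_bound(1)[OF c, of _ 1]) (auto simp: Ustep_def[abs_def])
qed

lemma Ustep_diff: "cmod (Ustep i f x - Ustep i g y) <= cmod (convolution f (\<psi> i) x - convolution g (\<psi> i) y)"
 unfolding Ustep_def of_real_diff[symmetric] norm_of_real by (rule norm_triangle_ineq3)

definition short_paths :: "nat => (nat \<times> nat \<times> nat) list set" where
 "short_paths N = {p \<in> lists I. length p < N}"

lemma short_paths_Suc: "short_paths (Suc N) = insert [] ((%(i, p). i # p) ` (I \<times> short_paths N))"
proof (intro equalityI subsetI)
 fix p assume "p \<in> short_paths (Suc N)"
 then show "p \<in> insert [] ((%(i, p). i # p) ` (I \<times> short_paths N))"
  by (cases p) (auto simp: short_paths_def)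
qed (auto simp: short_paths_def)

definition scat_dist :: "nat => (real^2 => complex) => (real^2 => complex) => ennreal" where
 "scat_dist N f g = l2n (count_space (short_paths N)) (%p. L2_norm (%x. scat_S chi \<psi> f p x - scat_S chi \<psi> g p x))"

lemma scat_dist_0: "scat_dist 0 f g = 0"
 by (simp add: scat_dist_def short_paths_def l2n_def ennreal_sqrt_def nn_integral_empty)

lemma scat_dist_Suc:
 "(scat_dist (Suc N) f g)^2 = (L2_norm (%x. convolution f chi x - convolution g chi x))^2
  + (\<integral>\<^sup>+ i. (scat_dist N (Ustep i f) (Ustep i g))^2 \<partial>count_space I)"
proof -
 have "[] \<notin> (%(i, p). i # p) ` (I \<times> short_paths N)" by auto
 then show ?thesis unfolding scat_dist_def l2n_sq short_paths_Suc
  by (simp add: count_space_insert count_space_image_Cons scat_S_def)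
qed

lemma scat_U_L2: "in_L2 f ==> p \<in> lists I ==> in_L2 (scat_U \<psi> p f)"
 by (induction p arbitrary: f) (auto intro: Ustep_L2)

lemma scat_dist_triangle:
 assumes "in_L2 f" "in_L2 g" "in_L2 h"
 shows "scat_dist N f h <= scat_dist N f g + scat_dist N g h"
proof -
 have m: "scat_S chi \<psi> u p \<in> borel_measurable lborel" if "in_L2 u" "p \<in> short_paths N" for u p
 proof -
  have "p \<in> lists I" using that(2) by (simp add: short_paths_def)
  then have "scat_U \<psi> p u \<in> bm" using scat_U_L2[OF that(1)] in_L2_measurable' by blast
  then have "convolution (scat_U \<psi> p u) chi \<in> bm" using in_L2_measurable'[OF chi_L2] by (rule conv_measurable)
  then show ?thesis by (simp add: scat_S_def[abs_def])
 qed
 have "scat_dist N f h <= l2n (count_space (short_paths N)) (%p. L2_norm (%x. scat_S chi \<psi> f p x - scat_S chi \<psi> g p x)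
  + L2_norm (%x. scat_S chi \<psi> g p x - scat_S chi \<psi> h p x))"
  unfolding scat_dist_def by (intro l2n_mono L2_norm_diff_trans m assms) auto
 also have "... <= scat_dist N f g + scat_dist N g h" unfolding scat_dist_def by (rule l2n_triangle) auto
 finally show ?thesis .
qed

text \<open>The scattering transform is nonexpansive, because the modulus is and by Bessel's identity.\<close>

lemma scat_dist_nonexpansive:
 "in_L2 f ==> in_L2 g ==> scat_dist N f g <= L2_norm (%x. f x - g x)"
proof (induction N arbitrary: f g)
 case (Suc N)
 have d: "in_L2 (%x. f x - g x)" by (rule in_L2_diff) fact+
 have "(scat_dist (Suc N) f g)^2 <= (L2_norm (convolution (%x. f x - g x) chi))^2
  + (\<integral>\<^sup>+ i. (L2_norm (convolution (%x. f x - g x) (\<psi> i)))^2 \<partial>count_space I)"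
  unfolding scat_dist_Suc
 proof (intro add_mono nn_integral_mono)
  show "(L2_norm (%x. convolution f chi x - convolution g chi x))^2 <= (L2_norm (convolution (%x. f x - g x) chi))^2"
  proof -
  have "convolution (%x. f x - g x) chi = (%x. convolution f chi x - convolution g chi x)"
  by (rule ext) (rule conv_diff[OF Suc.prems chi_L2])
  then show ?thesis by simp
  qed
  fix i assume "i \<in> space (count_space I)"
  then have i: "i \<in> I" by simp
  have "scat_dist N (Ustep i f) (Ustep i g) <= L2_norm (%x. Ustep i f x - Ustep i g x)"
  using Suc i by (intro Suc.IH Ustep_L2)
  also have "... <= L2_norm (convolution (%x. f x - g x) (\<psi> i))"
  by (rule L2_norm_mono) (simp add: conv_diff[OF Suc.prems \<psi>_L2[OF i]] Ustep_diff)
  finally show "(scat_dist N (Ustep i f) (Ustep i g))^2 <= (L2_norm (convolution (%x. f x - g x) (\<psi> i)))^2"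
  by (simp only: ennreal_sq_le_iff)
 qed
 also have "... = (L2_norm (%x. f x - g x))^2" by (rule bessel[OF d])
 finally show ?case by (simp only: ennreal_sq_le_iff)
qed (simp add: scat_dist_0)

definition level_energy :: "nat => (real^2 => complex) => ennreal" where
 "level_energy n f = l2n (count_space {p \<in> lists I. length p = n}) (%p. H_norm (1 - \<beta>) (scat_U \<psi> p f))"

lemma level_energy_0: "level_energy 0 f = H_norm (1 - \<beta>) f"
proof -
 have "{p \<in> lists I. length p = 0} = {[]}" by auto
 then have "(level_energy 0 f)^2 = (H_norm (1 - \<beta>) f)^2"
  unfolding level_energy_def l2n_sq by (simp add: nn_integral_count_space_finite)
 then show ?thesis by (simp only: ennreal_sq_eq_iff)
qed

lemma level_energy_Suc: "level_energy (Suc n) f = l2n (count_space I) (%i. level_energy n (Ustep i f))"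
proof -
 have e: "{p \<in> lists I. length p = Suc n} = (%(i, p). i # p) ` (I \<times> {p \<in> lists I. length p = n})"
 proof (intro equalityI subsetI)
  fix p assume "p \<in> {p \<in> lists I. length p = Suc n}"
  then show "p \<in> (%(i, p). i # p) ` (I \<times> {p \<in> lists I. length p = n})" by (cases p) auto
 qed auto
 have "(level_energy (Suc n) f)^2 = (l2n (count_space I) (%i. level_energy n (Ustep i f)))^2"
  unfolding level_energy_def l2n_sq e by (simp add: count_space_image_Cons)
 then show ?thesis by (simp only: ennreal_sq_eq_iff)
qed

lemma scat_energy_eq: "scat_energy I \<psi> (1 - \<beta>) f = (\<Sum>n. level_energy n f)"
 by (simp add: scat_energy_def level_energy_def ell2_norm_l2n)

text \<open>A finite set of paths has bounded length, and the infinite sum is the supremum of the finite ones.\<close>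

lemma scat_dist_complete:
 assumes "\<And>N. scat_dist N f g <= b"
 shows "ell2_norm L2_norm (lists I) (%p x. scat_S chi \<psi> f p x - scat_S chi \<psi> g p x) <= b"
 unfolding ell2_norm_def ennreal_sqrt_le_iff infsum_count_space
proof (rule count_space_le)
 fix F assume F: "finite F" "F \<subseteq> lists I"
 define N where "N = Suc (Max (insert 0 (length ` F)))"
 have "F \<subseteq> short_paths N" using F by (auto simp: short_paths_def N_def less_Suc_eq_le)
 then have "(\<Sum>p\<in>F. (L2_norm (%x. scat_S chi \<psi> f p x - scat_S chi \<psi> g p x))^2) <= (scat_dist N f g)^2"
  unfolding scat_dist_def l2n_sq by (intro finite_sum_le_count_space F)
 also have "... <= b^2" unfolding ennreal_sq_le_iff by (rule assms)
 finally show "(\<Sum>p\<in>F. (L2_norm (%x. scat_S chi \<psi> f p x - scat_S chi \<psi> g p x))^2) <= b^2" .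
qed

text \<open>The output filter only sees frequencies below 4, where the deformation acts almost trivially.\<close>

lemma output_displacement:
 assumes ta: "small_perturbation ta ka" and T: "\<And>x. norm (ta x) <= T" and f: "in_L2 f"
 shows "L2_norm (%x. convolution (%x. f (x - ta x)) chi x - convolution f chi x) <= ennreal (200 * (ka + T)) * L2_norm f"
proof -
 interpret small_perturbation ta ka by (rule ta)
 have T0: "0 <= T" by (rule order_trans[OF norm_ge_zero T])
 have Ph: "(%x. f (x - ta x)) = (%x. f (Ph x))" by (simp add: Ph_def)
 have d: "in_L2 (%x. f (Ph x) - f x)" by (intro in_L2_diff in_L2_Ph f)
 obtain g where g: "ft (%x. f (Ph x) - f x) g" using ft_exists[OF d] by blast
 have gL: "in_L2 (lowpass 4 g)" using bandlim_lowpass[OF ft_L2(2)[OF g]] by (rule bandlim_L2)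
 have "L2_norm (%x. convolution (%x. f (Ph x)) chi x - convolution f chi x) = L2_norm (convolution (%x. f (Ph x) - f x) chi)"
  using conv_diff[OF in_L2_Ph[OF f] f chi_L2] by presburger
 also have "... = L2_norm (%om. g om * fourier chi om)" by (rule ft_isometry[OF ft_conv[OF g chi_int chi_L2], symmetric])
 also have "... = L2_norm (%om. lowpass 4 g om * fourier chi om)"
 proof -
  have "fourier chi om = 0" if "4 <= norm om" for om
  proof (rule ccontr)
  assume "fourier chi om \<noteq> 0"
  then have "om \<in> {om. fourier chi om \<noteq> 0}" by simp
  then have "om \<in> closure {om. fourier chi om \<noteq> 0}" by (rule closure_subset[THEN subsetD])
  then have "om \<in> ball 0 4" using bank unfolding wave_packet_bank_def Q_zero_def by blast
  then show False using that by simp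
  qed
  then have "g om * fourier chi om = lowpass 4 g om * fourier chi om" for om
  by (cases "norm om < 4") (auto simp: lowpass_def)
  then show ?thesis by presburger
 qed
 also have "... <= L2_norm (lowpass 4 g)"
 proof -
  have "(L2_norm (%om. lowpass 4 g om * fourier chi om))^2 <= (L2_norm (lowpass 4 g))^2"
  unfolding bessel_multiplier[OF in_L2_measurable'[OF gL], symmetric] by simp
  then show ?thesis by (simp only: ennreal_sq_le_iff)
 qed
 also have "... <= ennreal (200 * (ka + T) * nrm f)"
 proof -
  have "nrm (lowpass 4 g) <= (80 * ka + 8 * pi * 4 * T) * nrm f" by (rule lowpass_displacement[OF f _ T g]) simp
  also have "... <= 200 * (ka + T) * nrm f"
  proof (rule mult_right_mono)
  have "pi * T <= 4 * T" using pi_less_4 T0 by (intro mult_right_mono) auto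
  then show "80 * ka + 8 * pi * 4 * T <= 200 * (ka + T)" using ka0 T0 by simp
  qed simp
  finally show ?thesis using ka0 T0 by (subst nrm_le_iff[OF gL, symmetric]) auto
 qed
 also have "... = ennreal (200 * (ka + T)) * L2_norm f"
  unfolding L2_norm_eq_nrm[OF f] using ka0 T0 by (intro ennreal_mult) auto
 finally show ?thesis unfolding Ph .
qed

text \<open>Moving the deformation through the network one layer at a time: each layer costs one
 commutator, and what has been moved through later layers is not amplified.\<close>

lemma scat_dist_deform:
 assumes K: "0 <= K" "\<And>g. in_L2 g ==> l2n (count_space I) (%i. L2_norm (filter_commutator ta g i)) <= ennreal (K * (ka + T)) * H_norm (1 - \<beta>) g"
  and ta: "small_perturbation ta ka" and T: "\<And>x. norm (ta x) <= T"
 shows "in_L2 f ==> scat_dist N (%x. f (x - ta x)) f <= ennreal ((200 + K) * (ka + T)) * (\<Sum>n<N. level_energy n f)"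
proof (induction N arbitrary: f)
 case 0
 then show ?case by (simp add: scat_dist_0)
next
 case (Suc N)
 interpret small_perturbation ta ka by (rule ta)
 have T0: "0 <= T" by (rule order_trans[OF norm_ge_zero T])
 define A where "A = ennreal ((200 + K) * (ka + T))"
 define L where "L g x = g (x - ta x)" for g :: "real^2 => complex" and x
 have LL: "in_L2 (L g)" if "in_L2 g" for g using in_L2_Ph[OF that] by (simp add: L_def[abs_def] Ph_def)
 define c where "c = L2_norm (%x. convolution (L f) chi x - convolution f chi x)"
 note U = Ustep_L2[OF Suc.prems] Ustep_L2[OF LL[OF Suc.prems]]
 have "(scat_dist (Suc N) (L f) f)^2 = c^2 + (l2n (count_space I) (%i. scat_dist N (Ustep i (L f)) (Ustep i f)))^2"
  unfolding scat_dist_Suc l2n_sq c_def ..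
 also have "... <= (c + l2n (count_space I) (%i. scat_dist N (Ustep i (L f)) (Ustep i f)))^2" by (rule ennreal_sq_sum_le)
 finally have m1: "scat_dist (Suc N) (L f) f <= c + l2n (count_space I) (%i. scat_dist N (Ustep i (L f)) (Ustep i f))"
  by (simp only: ennreal_sq_le_iff)
 have m2: "l2n (count_space I) (%i. scat_dist N (Ustep i (L f)) (Ustep i f))
  <= l2n (count_space I) (%i. L2_norm (filter_commutator ta f i) + A * (\<Sum>n<N. level_energy n (Ustep i f)))"
 proof (rule l2n_mono)
  fix i assume "i \<in> space (count_space I)"
  then have i: "i \<in> I" by simp
  have tri: "scat_dist N (Ustep i (L f)) (Ustep i f) <= scat_dist N (Ustep i (L f)) (L (Ustep i f)) + scat_dist N (L (Ustep i f)) (Ustep i f)"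
  by (intro scat_dist_triangle LL U i)
  have s1: "scat_dist N (Ustep i (L f)) (L (Ustep i f)) <= L2_norm (filter_commutator ta f i)"
  proof -
  have "scat_dist N (Ustep i (L f)) (L (Ustep i f)) <= L2_norm (%x. Ustep i (L f) x - L (Ustep i f) x)"
  by (intro scat_dist_nonexpansive LL U i)
  also have "... <= L2_norm (filter_commutator ta f i)"
  by (rule L2_norm_mono) (use Ustep_diff[of i "L f" _ f] in \<open>simp add: L_def[abs_def] filter_commutator_def\<close>)
  finally show ?thesis .
  qed
  have s2: "scat_dist N (L (Ustep i f)) (Ustep i f) <= A * (\<Sum>n<N. level_energy n (Ustep i f))"
  unfolding A_def L_def[abs_def] by (intro Suc.IH U i)
  show "scat_dist N (Ustep i (L f)) (Ustep i f) <= L2_norm (filter_commutator ta f i) + A * (\<Sum>n<N. level_energy n (Ustep i f))"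
  by (rule order_trans[OF tri add_mono[OF s1 s2]])
 qed
 have m3: "l2n (count_space I) (%i. L2_norm (filter_commutator ta f i) + A * (\<Sum>n<N. level_energy n (Ustep i f)))
  <= l2n (count_space I) (%i. L2_norm (filter_commutator ta f i)) + l2n (count_space I) (%i. A * (\<Sum>n<N. level_energy n (Ustep i f)))"
  by (rule l2n_triangle) auto
 have m4: "l2n (count_space I) (%i. A * (\<Sum>n<N. level_energy n (Ustep i f))) <= A * (\<Sum>n<N. level_energy (Suc n) f)"
 proof -
  have "l2n (count_space I) (%i. \<Sum>n<N. level_energy n (Ustep i f)) <= (\<Sum>n<N. l2n (count_space I) (%i. level_energy n (Ustep i f)))"
  by (rule l2n_sum) auto
  then show ?thesis unfolding level_energy_Suc by (subst l2n_cmult) (auto intro: mult_left_mono)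
 qed
 have main: "scat_dist (Suc N) (L f) f <= c + (l2n (count_space I) (%i. L2_norm (filter_commutator ta f i)) + A * (\<Sum>n<N. level_energy (Suc n) f))"
  by (rule order_trans[OF m1 add_left_mono[OF order_trans[OF m2 order_trans[OF m3 add_left_mono[OF m4]]]]])
 have "c <= ennreal (200 * (ka + T)) * L2_norm f"
  unfolding c_def L_def[abs_def] by (rule output_displacement[OF ta T Suc.prems])
 also have "... <= ennreal (200 * (ka + T)) * H_norm (1 - \<beta>) f"
  using \<beta>1 by (intro mult_left_mono L2_norm_le_H_norm Suc.prems) auto
 finally have "c + l2n (count_space I) (%i. L2_norm (filter_commutator ta f i)) <= ennreal (200 * (ka + T)) * H_norm (1 - \<beta>) f + ennreal (K * (ka + T)) * H_norm (1 - \<beta>) f"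
  by (intro add_mono K(2) Suc.prems)
 also have "... = A * level_energy 0 f"
 proof -
  have e: "ennreal ((200 + K) * (ka + T)) = ennreal (200 * (ka + T)) + ennreal (K * (ka + T))"
  using K(1) ka0 T0 by (subst ennreal_plus[symmetric]) (auto simp: distrib_right)
  show ?thesis unfolding A_def level_energy_0 e by (rule distrib_right[symmetric])
 qed
 finally have first: "c + l2n (count_space I) (%i. L2_norm (filter_commutator ta f i)) <= A * level_energy 0 f" .
 from main have "scat_dist (Suc N) (L f) f <= (c + l2n (count_space I) (%i. L2_norm (filter_commutator ta f i))) + A * (\<Sum>n<N. level_energy (Suc n) f)"
  by (simp only: add.assoc)
 also have "... <= A * level_energy 0 f + A * (\<Sum>n<N. level_energy (Suc n) f)" by (rule add_right_mono[OF first])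
 also have "... = A * (\<Sum>n<Suc N. level_energy n f)" unfolding sum.lessThan_Suc_shift by (simp only: distrib_left)
 finally show ?case unfolding A_def L_def[abs_def] .
qed

subsection \<open>The stability estimate\<close>

lemma expansive_L2:
 assumes lip: "\<And>x y. norm (ta x - ta y) <= ka * norm (x - y)" and ka: "0 <= ka" "ka < 1" and f: "in_L2 f"
 shows "L2_norm (%x. f (x - ta x)) <= ennreal (2 / (1 - ka)) * L2_norm f" "(%x. f (x - ta x)) \<in> bm"
proof -
 have "ka-lipschitz_on UNIV ta" using lip ka by (auto simp: lipschitz_on_def dist_norm)
 then have [measurable]: "ta \<in> bm" by (intro borel_measurable_continuous_onI lipschitz_on_continuous_on)
 note [measurable] = in_L2_measurable'[OF f]
 show "(%x. f (x - ta x)) \<in> bm" by measurable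
 have "(NN x. indicator UNIV x * ennreal ((cmod (f (x - ta x)))^2)) <= ennreal ((2 * (1 / (1 - ka)))^2) * (NN x. ennreal ((cmod (f x))^2))"
 proof (rule nn_integral_expansive[where Ph="%x. x - ta x"])
  fix x y
  have "norm (x - y) <= norm ((x - ta x) - (y - ta y)) + norm (ta x - ta y)"
  using norm_triangle_ineq[of "(x - ta x) - (y - ta y)" "ta x - ta y"] by (simp add: algebra_simps)
  then have "norm (x - y) * (1 - ka) <= norm ((x - ta x) - (y - ta y))" using lip[of x y] by (simp add: algebra_simps)
  then show "norm (x - y) <= 1 / (1 - ka) * norm ((x - ta x) - (y - ta y))" using ka by (simp add: pos_le_divide_eq)
 qed (use ka in auto)
 moreover have e: "(ennreal (2 / (1 - ka)))^2 = ennreal ((2 * (1 / (1 - ka)))^2)"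
  unfolding times_divide_eq_right mult_1_right by (rule ennreal_power) (use ka in simp)
 ultimately have "(L2_norm (%x. f (x - ta x)))^2 <= (ennreal (2 / (1 - ka)) * L2_norm f)^2"
  unfolding power_mult_distrib[of "ennreal (2 / (1 - ka))"] e L2_norm_sq by simp
 then show "L2_norm (%x. f (x - ta x)) <= ennreal (2 / (1 - ka)) * L2_norm f" by (simp only: ennreal_sq_le_iff)
qed

lemma scat_S_cong_AE:
 assumes "f \<in> bm" "g \<in> bm" "AEL x. f x = g x" "p \<in> lists I"
 shows "scat_S chi \<psi> f p = scat_S chi \<psi> g p"
proof -
 have c: "convolution f h = convolution g h" if [measurable]: "h \<in> bm" for h
 proof
  fix x
  note [measurable] = assms(1,2)
  show "convolution f h x = convolution g h x" unfolding convolution_def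
  by (rule integral_cong_AE) (auto intro: eventually_mono[OF assms(3)])
 qed
 have "chi \<in> bm" "i \<in> I ==> \<psi> i \<in> bm" for i by measurable
 then show ?thesis using assms(4) by (cases p) (auto simp: scat_S_def[abs_def] Ustep_def[abs_def] c)
qed

text \<open>Replacing the displacement by its Lipschitz representative does not change the transforms. For
  \<open>k > 1/8\<close> the constant may absorb the factor \<open>8 * k \<ge> 1\<close>, and
  nonexpansiveness together with the boundedness of the deformation suffices.\<close>

theorem stability:
 assumes ka: "0 < ka" "ka < 1"
 shows "\<exists>C>0. \<forall>ta D f. W1inf ta D --> Linf_opnorm D <= ennreal ka --> in_L2 f -->
  ell2_norm L2_norm (lists I) (%p x. scat_S chi \<psi> (deform ta f) p x - scat_S chi \<psi> f p x)
  <= ennreal C * (Linf_norm ta + Linf_opnorm D) * scat_energy I \<psi> (1 - \<beta>) f"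
proof -
 obtain K where K0: "0 <= K" and K: "\<And>ta ka T g. small_perturbation ta ka ==> (\<forall>x. norm (ta x) <= T) ==> in_L2 g ==>
  l2n (count_space I) (%i. L2_norm (filter_commutator ta g i)) <= ennreal (K * (ka + T)) * H_norm (1 - \<beta>) g"
  using commutator_bound by blast
 define M where "M = 2 / (1 - ka) + 1"
 have M: "0 < M" using ka by (simp add: M_def add_pos_pos)
 define C where "C = 200 + K + 8 * M"
 have C: "0 < C" using K0 M by (simp add: C_def)
 have "ell2_norm L2_norm (lists I) (%p x. scat_S chi \<psi> (deform ta f) p x - scat_S chi \<psi> f p x)
  <= ennreal C * (Linf_norm ta + Linf_opnorm D) * scat_energy I \<psi> (1 - \<beta>) f"
  if W: "W1inf ta D" and D: "Linf_opnorm D <= ennreal ka" and f: "in_L2 f" for ta D f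
 proof -
  define k where "k = enn2real (Linf_opnorm D)"
  define T where "T = enn2real (Linf_norm ta)"
  have fin: "Linf_opnorm D < \<infinity>" "Linf_norm ta < \<infinity>" and [measurable]: "ta \<in> bm" using W by (auto simp: W1inf_def)
  have kT: "Linf_opnorm D = ennreal k" "Linf_norm ta = ennreal T" "0 <= k" "0 <= T" using fin by (simp_all add: k_def T_def)
  have kka: "k <= ka" using D ka unfolding kT by simp
  obtain ta' where lip: "\<And>x y. norm (ta' x - ta' y) <= k * norm (x - y)" and T: "\<And>x. norm (ta' x) <= T" and ae: "AEL x. ta x = ta' x"
  using W1inf_lipschitz[OF W] unfolding k_def T_def by blast
  note [measurable] = in_L2_measurable'[OF f]
  define Lf where "Lf x = f (x - ta' x)" for x
  have k1: "k < 1" using kka ka by simp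
  have Lm[measurable]: "Lf \<in> bm" unfolding Lf_def[abs_def] by (rule expansive_L2(2)[OF lip kT(3) k1 f])
  have Lb: "L2_norm Lf <= ennreal (2 / (1 - k)) * L2_norm f" unfolding Lf_def[abs_def] by (rule expansive_L2(1)[OF lip kT(3) k1 f])
  have LL: "in_L2 Lf" by (rule in_L2_of_nn[OF Lm Lb]) (use f in \<open>auto simp: in_L2_def ennreal_mult_less_top\<close>)
  have "deform ta f \<in> bm" unfolding deform_def[abs_def] by measurable
  moreover have "AEL x. deform ta f x = Lf x" using ae by eventually_elim (simp add: deform_def Lf_def)
  ultimately have S: "scat_S chi \<psi> (deform ta f) p = scat_S chi \<psi> Lf p" if "p \<in> lists I" for p
  using that Lm by (intro scat_S_cong_AE) auto
  have "ell2_norm L2_norm (lists I) (%p x. scat_S chi \<psi> (deform ta f) p x - scat_S chi \<psi> f p x)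
  = ell2_norm L2_norm (lists I) (%p x. scat_S chi \<psi> Lf p x - scat_S chi \<psi> f p x)"
  unfolding ell2_norm_def using S by (intro arg_cong[where f=ennreal_sqrt] infsum_cong) simp
  also have "... <= ennreal (C * (T + k)) * scat_energy I \<psi> (1 - \<beta>) f"
  proof (rule scat_dist_complete)
  fix N
  show "scat_dist N Lf f <= ennreal (C * (T + k)) * scat_energy I \<psi> (1 - \<beta>) f"
  proof (cases "k <= 1/8")
  case True
  have ta': "small_perturbation ta' k" by standard (use lip kT True in auto)
  have KK: "l2n (count_space I) (%i. L2_norm (filter_commutator ta' g i)) <= ennreal (K * (k + T)) * H_norm (1 - \<beta>) g" if "in_L2 g" for g
  using K[OF ta' _ that] T by blast
  have "scat_dist N Lf f <= ennreal ((200 + K) * (k + T)) * (\<Sum>n<N. level_energy n f)"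
  unfolding Lf_def[abs_def] by (rule scat_dist_deform[OF K0 KK ta' T f])
  also have "... <= ennreal (C * (T + k)) * (\<Sum>n. level_energy n f)"
  proof (rule mult_mono, rule ennreal_leI)
  show "(200 + K) * (k + T) <= C * (T + k)" using M kT unfolding add.commute[of T k] by (intro mult_right_mono) (auto simp: C_def)
  show "(\<Sum>n<N. level_energy n f) <= (\<Sum>n. level_energy n f)" by (intro sum_le_suminf summableI) auto
  qed simp_all
  finally show ?thesis by (simp only: scat_energy_eq)
  next
  case False
  have "scat_dist N Lf f <= L2_norm (%x. Lf x - f x)" by (rule scat_dist_nonexpansive[OF LL f])
  also have "... <= L2_norm Lf + L2_norm f" by (rule L2_norm_diff) auto
  also have "... <= ennreal (2 / (1 - ka)) * L2_norm f + ennreal 1 * L2_norm f"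
  proof (rule add_mono)
  have "2 / (1 - k) <= 2 / (1 - ka)" using kka ka by (intro divide_left_mono mult_pos_pos) auto
  then show "L2_norm Lf <= ennreal (2 / (1 - ka)) * L2_norm f"
  by (intro order_trans[OF Lb] mult_right_mono ennreal_leI) auto
  qed simp
  also have "... = ennreal M * L2_norm f"
  unfolding distrib_right[symmetric] M_def using ka by (subst ennreal_plus[symmetric]) auto
  also have "... <= ennreal (C * (T + k)) * (\<Sum>n. level_energy n f)"
  proof (rule mult_mono, rule ennreal_leI)
  have "M * 1 <= M * (8 * (T + k))" using False M kT by (intro mult_left_mono) auto
  also have "... = (8 * M) * (T + k)" by simp
  also have "... <= C * (T + k)" using K0 kT by (intro mult_right_mono) (auto simp: C_def)
  finally show "M <= C * (T + k)" by simp
  have "L2_norm f <= level_energy 0 f" unfolding level_energy_0 using \<beta>1 by (intro L2_norm_le_H_norm f) simp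
  also have "... = (\<Sum>n<1. level_energy n f)" by simp
  also have "... <= (\<Sum>n. level_energy n f)" by (intro sum_le_suminf summableI) auto
  finally show "L2_norm f <= (\<Sum>n. level_energy n f)" .
  qed simp_all
  finally show ?thesis by (simp only: scat_energy_eq)
  qed
  qed
  also have "ennreal (C * (T + k)) = ennreal C * (Linf_norm ta + Linf_opnorm D)"
  unfolding kT using C kT by (simp add: ennreal_mult)
  finally show ?thesis .
 qed
 then show ?thesis using C by blast
qed

end

theorem theorem1p3:
  fixes \<alpha> \<beta> \<epsilon> :: real
    and chi :: "real^2 \<Rightarrow> complex"
    and \<psi> :: "nat \<times> nat \<times> nat \<Rightarrow> real^2 \<Rightarrow> complex"
  assumes "0 \<le> \<beta>" "\<beta> \<le> \<alpha>" "\<alpha> \<le> 1" "\<beta> < 1"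
    and "0 < \<epsilon>" "\<epsilon> < 1 / 32"
    and "wave_packet_bank \<alpha> \<beta> \<epsilon> chi \<psi>"
    and "multiplier_regularity \<alpha> \<beta> \<psi>"
  shows "\<forall>\<kappa>::real. 0 < \<kappa> \<and> \<kappa> < 1 \<longrightarrow>
    (\<exists>C::real. C > 0 \<and>
      (\<forall>\<tau> D. W1inf \<tau> D \<and> Linf_opnorm D \<le> ennreal \<kappa> \<longrightarrow>
        (\<forall>f. in_H (1 - \<beta>) f \<longrightarrow>
          scat_energy (I_star \<alpha> \<beta>) \<psi> (1 - \<beta>) f < \<infinity> \<longrightarrow>
          ell2_norm L2_norm (lists (I_star \<alpha> \<beta>))
              (\<lambda>p x. scat_S chi \<psi> (deform \<tau> f) p x - scat_S chi \<psi> f p x)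
            \<le> ennreal C * (Linf_norm \<tau> + Linf_opnorm D)
                * scat_energy (I_star \<alpha> \<beta>) \<psi> (1 - \<beta>) f)))"
proof (intro allI impI)
  fix \<kappa> :: real assume "0 < \<kappa> \<and> \<kappa> < 1"
  moreover have "filter_bank \<alpha> \<beta> \<epsilon> chi \<psi>" by (rule filter_bank.intro[OF assms])
  ultimately obtain C where "C > 0" "\<And>\<tau> D f. W1inf \<tau> D \<Longrightarrow> Linf_opnorm D \<le> ennreal \<kappa> \<Longrightarrow> in_L2 f \<Longrightarrow>
     ell2_norm L2_norm (lists (I_star \<alpha> \<beta>)) (\<lambda>p x. scat_S chi \<psi> (deform \<tau> f) p x - scat_S chi \<psi> f p x)
       \<le> ennreal C * (Linf_norm \<tau> + Linf_opnorm D) * scat_energy (I_star \<alpha> \<beta>) \<psi> (1 - \<beta>) f"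
    using filter_bank.stability[of \<alpha> \<beta> \<epsilon> chi \<psi> \<kappa>] by blast
  then show "\<exists>C::real. C > 0 \<and>
      (\<forall>\<tau> D. W1inf \<tau> D \<and> Linf_opnorm D \<le> ennreal \<kappa> \<longrightarrow>
        (\<forall>f. in_H (1 - \<beta>) f \<longrightarrow>
          scat_energy (I_star \<alpha> \<beta>) \<psi> (1 - \<beta>) f < \<infinity> \<longrightarrow>
          ell2_norm L2_norm (lists (I_star \<alpha> \<beta>))
              (\<lambda>p x. scat_S chi \<psi> (deform \<tau> f) p x - scat_S chi \<psi> f p x)
            \<le> ennreal C * (Linf_norm \<tau> + Linf_opnorm D)
                * scat_energy (I_star \<alpha> \<beta>) \<psi> (1 - \<beta>) f))"
    by (intro exI[of _ C]) (auto simp: in_H_def)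
qed

end
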